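(* Let $n\ge1$ and let $M$ be a finite-dimensional $\mathbb{C}S_n$-module. For a strict partition $\lambda$ of $n$, let $m_\lambda$ be the multiplicity of $D^\lambda$ in the $\mathcal{H}_n$-module $\mathcal{C}_n\otimes M$, and let $m_\lambda^-$ be the multiplicity of $D^\lambda_-$ in the $\mathbb{C}S_n^-$-module $\mathcal{B}_n\otimes M$. Then $$m_\lambda^-=\begin{cases} m_\lambda, & \text{if } n \text{ is even},\\ m_\lambda, & \text{if } n \text{ is odd and } \ell(\lambda)\text{ is odd},\\ \tfrac12 m_\lambda, & \text{if } n\text{ is odd and }\ell(\lambda)\text{ is even}.\end{cases}$$
   Context: Ground field $\mathbb{C}$. All algebras and modules are $\mathbb{Z}_2$-graded (super); homomorphisms $f$ satisfy $f(av)=(-1)^{\bar f\bar a}af(v)$ and need not be even; $\Pi$ denotes parity shift ($a\in\mathcal A$ acts on $\Pi V$ by $a\cdot v=(-1)^{\bar a}av$). $S_n$-modules $M$ are regarded as purely even. Multiplicities count a simple module and its parity shift together. For a strict partition $\lambda=(\lambda_1>\cdots>\lambda_\ell>0)$ of $n$, $\ell(\lambda)=\ell$, and $\delta(\lambda)=0$ if $\ell(\lambda)$ is even and $1$ if odd. Hecke–Clifford algebra. $\mathcal{C}_n$ is the Clifford superalgebra generated by odd $c_1,\dots,c_n$ with $c_i^2=1$, $c_ic_j=-c_jc_i$ ($i\ne j$). $\mathcal{H}_n=\mathcal{C}_n\rtimes\mathbb{C}S_n$ is generated by $\mathcal{C}_n$ and $\mathbb{C}S_n$ (even, with simple transpositions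 $s_i$), with $s_ic_i=c_{i+1}s_i$ and $s_ic_j=c_js_i$ for $j\ne i,i+1$. $\mathcal{C}_n$ is an $\mathcal{H}_n$-module via $\mathcal{C}_n\cong\mathrm{ind}_{\mathbb{C}S_n}^{\mathcal{H}_n}\mathbf 1$ ($c_i$ acts by left multiplication, $S_n$ permutes the $c_i$). For an $\mathcal{H}_n$-module $F$ and an $S_n$-module $M$, $F\otimes M$ is an $\mathcal{H}_n$-module via $c_i(u\otimes x)=c_iu\otimes x$, $s_j(u\otimes x)=s_ju\otimes s_jx$. Irreducible $\mathcal{H}_n$-modules. Let $q_r$ be defined by $\sum_{r\ge0}q_r(z)u^r=\prod_i\frac{1+z_iu}{1-z_iu}$, $q_\nu=q_{\nu_1}q_{\nu_2}\cdots$, $\Gamma_{\mathbb{C}}=\mathbb{C}[q_1,q_2,\dots]$, and let $Q_\lambda$ be the Schur $Q$-function, i.e. the $m\to\infty$ limit of $2^{\ell}\sum_{w\in S_m/S_{m-\ell}}w\big(z_1^{\lambda_1}\cdots z_\ell^{\lambda_\ell}\prod_{1\le i\le\ell}\prod_{i<j\le m}\frac{z_i+z_j}{z_i-z_j}\big)$. The irreducible $\mathcal{H}_n$-modules up to (not necessarily even) isomorphism are $D^\lambda$, $\lambda$ a strict partition of $n$, with labelling characterized by: the linear isomorphism $\mathrm{ch}:\bigoplus_nK(\mathcal{H}_n\text{-smod})\to\Gamma_{\mathbb{C}}$ (complexified Grothendieck groups of finite-dimensional modules, $[\Pi N]=[N]$) with $\mathrm{ch}(\mathrm{ind}_{\mathbb{C}S_\nu}^{\mathcal{H}_n}\mathbf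 1)=q_\nu$ for all compositions $\nu$ of $n$ sends $D^\lambda$ to $2^{-\frac{\ell(\lambda)-\delta(\lambda)}{2}}Q_\lambda$. In particular $D^{(n)}\cong\mathcal{C}_n$. Spin symmetric group algebra. $\mathbb{C}S_n^-$ is the superalgebra generated by odd $t_1,\dots,t_{n-1}$ with $t_i^2=1$, $t_it_{i+1}t_i=t_{i+1}t_it_{i+1}$, $t_it_j=-t_jt_i$ for $|i-j|>1$. There is a superalgebra isomorphism $\mathbb{C}S_n^-\otimes\mathcal{C}_n\to\mathcal{H}_n$ with $c_i\mapsto c_i$, $t_j\mapsto\frac{1}{\sqrt{-2}}s_j(c_j-c_{j+1})$. Let $U_n$ be the unique (up to isomorphism) irreducible $\mathcal{C}_n$-module and $\mathfrak{G}_n=\mathrm{Hom}_{\mathcal{C}_n}(U_n,-)$, a functor from $\mathcal{H}_n$-modules to $\mathbb{C}S_n^-$-modules, with $(t_j*f)(u)=\frac{1}{\sqrt{-2}}s_j(c_j-c_{j+1})f(u)$. The irreducible $\mathbb{C}S_n^-$-modules up to isomorphism are $D^\lambda_-$, $\lambda$ a strict partition of $n$, determined by $\mathfrak{G}_n(D^\lambda)\cong D^\lambda_-$ if $n$ or $\ell(\lambda)$ is even, and $\mathfrak{G}_n(D^\lambda)\cong D^\lambda_-\oplus\Pi D^\lambda_-$ otherwise. $\mathcal{B}_n:=D^{(n)}_-$ is the basic spin module. For a $\mathbb{C}S_n^-$-module $E$ and an $S_n$-module $M$, $E\otimes M$ is a $\mathbb{C}S_n^-$-module via $t_j(u\otimes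 x)=t_ju\otimes s_jx$. *)

theory Defs
  imports
    Complex_Main
    "HOL-Library.Function_Algebras"
    "HOL-Library.Poly_Mapping"
    "HOL-Library.Z2"
    "HOL-Combinatorics.Permutations"
    "HOL-Computational_Algebra.Formal_Power_Series"
begin

section \<open>Complex vector spaces\<close>

text \<open>
  All complex vector spaces are carried by subspaces of a function space
  \<^typ>\<open>'x \<Rightarrow> complex\<close>, with \<^typ>\<open>'x\<close> an arbitrary type and pointwise operations.
\<close>

definition cscale :: "complex \<Rightarrow> ('x \<Rightarrow> complex) \<Rightarrow> 'x \<Rightarrow> complex"  (infixr "*c" 75) where
  "a *c v = (\<lambda>x. a * v x)"

global_interpretation cfun: vector_space "cscale :: complex \<Rightarrow> ('x \<Rightarrow> complex) \<Rightarrow> _"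
  by unfold_locales (auto simp: cscale_def fun_eq_iff algebra_simps)

definition lin_on :: "('x \<Rightarrow> complex) set \<Rightarrow> (('x \<Rightarrow> complex) \<Rightarrow> 'y \<Rightarrow> complex) \<Rightarrow> bool" where
  "lin_on S f \<longleftrightarrow> (\<forall>u\<in>S. \<forall>v\<in>S. f (u + v) = f u + f v) \<and> (\<forall>a. \<forall>u\<in>S. f (a *c u) = a *c f u)"

section \<open>Superalgebras and their modules\<close>

text \<open>
  A superalgebra given by generators and relations enters through its homogeneous generators
  and their parities. A module is a graded vector space with operators for the generators
  that satisfy the relations; the relations are part of the module predicates
  \<open>cliff_module\<close>, \<open>sym_module\<close>, \<open>hc_module\<close> and \<open>spin_module\<close> below.
  Submodules and homomorphisms need only be tested on generators.
\<close>

record 'g sgens =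
  gens :: "'g set"
  gpar :: "'g \<Rightarrow> bit"

record ('g, 'x) smod =
  hpart :: "bit \<Rightarrow> ('x \<Rightarrow> complex) set"
  act :: "'g \<Rightarrow> ('x \<Rightarrow> complex) \<Rightarrow> 'x \<Rightarrow> complex"

definition carr :: "('g, 'x) smod \<Rightarrow> ('x \<Rightarrow> complex) set" where
  "carr V = {u + v | u v. u \<in> hpart V 0 \<and> v \<in> hpart V 1}"

text \<open>The sign $(-1)^{pq}$.\<close>

definition ssign :: "bit \<Rightarrow> bit \<Rightarrow> complex" where
  "ssign p q = (if p = 1 \<and> q = 1 then -1 else 1)"

text \<open>Finite-dimensional graded space on which each generator acts linearly, with its parity.\<close>

definition smodule :: "'g sgens \<Rightarrow> ('g, 'x) smod \<Rightarrow> bool" where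
  "smodule A V \<longleftrightarrow>
     (\<forall>p. cfun.subspace (hpart V p)) \<and> hpart V 0 \<inter> hpart V 1 = {0} \<and>
     (\<exists>X. finite X \<and> carr V = cfun.span X) \<and>
     (\<forall>g\<in>gens A. lin_on (carr V) (act V g) \<and>
        (\<forall>p. act V g ` hpart V p \<subseteq> hpart V (p + gpar A g)))"

definition ssubmodule :: "'g sgens \<Rightarrow> ('g, 'x) smod \<Rightarrow> ('x \<Rightarrow> complex) set \<Rightarrow> bool" where
  "ssubmodule A V W \<longleftrightarrow>
     cfun.subspace W \<and>
     W = {u + v | u v. u \<in> W \<inter> hpart V 0 \<and> v \<in> W \<inter> hpart V 1} \<and>
     (\<forall>g\<in>gens A. act V g ` W \<subseteq> W)"

definition sub_smod :: "('g, 'x) smod \<Rightarrow> ('x \<Rightarrow> complex) set \<Rightarrow> ('g, 'x) smod" where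
  "sub_smod V W = V\<lparr>hpart := \<lambda>p. hpart V p \<inter> W\<rparr>"

definition sirreducible :: "'g sgens \<Rightarrow> ('g, 'x) smod \<Rightarrow> bool" where
  "sirreducible A V \<longleftrightarrow> carr V \<noteq> {0} \<and> (\<forall>W. ssubmodule A V W \<longrightarrow> W = {0} \<or> W = carr V)"

text \<open>Homogeneous homomorphisms of parity \<open>p\<close>, and arbitrary ones.\<close>

definition shom ::
  "'g sgens \<Rightarrow> bit \<Rightarrow> ('g, 'x) smod \<Rightarrow> ('g, 'y) smod \<Rightarrow> (('x \<Rightarrow> complex) \<Rightarrow> 'y \<Rightarrow> complex) \<Rightarrow> bool" where
  "shom A p V W f \<longleftrightarrow>
     lin_on (carr V) f \<and> (\<forall>q. f ` hpart V q \<subseteq> hpart W (q + p)) \<and>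
     (\<forall>g\<in>gens A. \<forall>v\<in>carr V. f (act V g v) = ssign p (gpar A g) *c act W g (f v))"

definition hom_smod ::
  "'g sgens \<Rightarrow> ('g, 'x) smod \<Rightarrow> ('g, 'y) smod \<Rightarrow> (('x \<Rightarrow> complex) \<Rightarrow> 'y \<Rightarrow> complex) \<Rightarrow> bool" where
  "hom_smod A V W f \<longleftrightarrow>
     (\<exists>f0 f1. shom A 0 V W f0 \<and> shom A 1 V W f1 \<and> (\<forall>v\<in>carr V. f v = f0 v + f1 v))"

text \<open>Not necessarily even isomorphism.\<close>

definition iso_smod :: "'g sgens \<Rightarrow> ('g, 'x) smod \<Rightarrow> ('g, 'y) smod \<Rightarrow> bool" where
  "iso_smod A V W \<longleftrightarrow> (\<exists>f. hom_smod A V W f \<and> bij_betw f (carr V) (carr W))"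

definition Pi_smod :: "'g sgens \<Rightarrow> ('g, 'x) smod \<Rightarrow> ('g, 'x) smod" where
  "Pi_smod A V = \<lparr>hpart = \<lambda>p. hpart V (p + 1), act = \<lambda>g v. ssign 1 (gpar A g) *c act V g v\<rparr>"

definition dsum_smod :: "('g, 'x) smod \<Rightarrow> ('g, 'y) smod \<Rightarrow> ('g, 'x + 'y) smod" where
  "dsum_smod V W =
     \<lparr>hpart = \<lambda>p. {case_sum u v | u v. u \<in> hpart V p \<and> v \<in> hpart W p},
      act = \<lambda>g z. case_sum (act V g (z \<circ> Inl)) (act W g (z \<circ> Inr))\<rparr>"

subsection \<open>Composition multiplicities\<close>

definition composition_series ::
  "'g sgens \<Rightarrow> ('g, 'x) smod \<Rightarrow> ('x \<Rightarrow> complex) set list \<Rightarrow> bool" where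
  "composition_series A V Ws \<longleftrightarrow>
     Ws \<noteq> [] \<and> hd Ws = {0} \<and> last Ws = carr V \<and> (\<forall>W\<in>set Ws. ssubmodule A V W) \<and>
     (\<forall>i. Suc i < length Ws \<longrightarrow> Ws ! i \<subset> Ws ! Suc i \<and>
        \<not> (\<exists>W. ssubmodule A V W \<and> Ws ! i \<subset> W \<and> W \<subset> Ws ! Suc i))"

text \<open>
  The subquotient \<open>W' / W\<close> of \<open>V\<close> is isomorphic to \<open>D\<close>; the isomorphism is given as a
  homomorphism from \<open>W'\<close> onto \<open>D\<close> with kernel \<open>W\<close>. Since it need not be even, \<open>D\<close> and its
  parity shift are not distinguished.
\<close>

definition factor_iso ::
  "'g sgens \<Rightarrow> ('g, 'x) smod \<Rightarrow> ('x \<Rightarrow> complex) set \<Rightarrow> ('x \<Rightarrow> complex) set \<Rightarrow> ('g, 'y) smod \<Rightarrow> bool" where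
  "factor_iso A V W W' D \<longleftrightarrow>
     (\<exists>f. hom_smod A (sub_smod V W') D f \<and> f ` W' = carr D \<and> (\<forall>v\<in>W'. f v = 0 \<longleftrightarrow> v \<in> W))"

definition has_multiplicity ::
  "'g sgens \<Rightarrow> ('g, 'x) smod \<Rightarrow> ('g, 'y) smod \<Rightarrow> nat \<Rightarrow> bool" where
  "has_multiplicity A V D m \<longleftrightarrow>
     (\<exists>Ws. composition_series A V Ws \<and>
        m = card {i. Suc i < length Ws \<and> factor_iso A V (Ws ! i) (Ws ! Suc i) D})"

definition smult :: "'g sgens \<Rightarrow> ('g, 'x) smod \<Rightarrow> ('g, 'y) smod \<Rightarrow> nat" where
  "smult A V D = (THE m. has_multiplicity A V D m)"

section \<open>The algebras\<close>

subsection \<open>Clifford superalgebra\<close>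

definition cliff_alg :: "nat \<Rightarrow> nat sgens" where
  "cliff_alg n = \<lparr>gens = {1..n}, gpar = \<lambda>_. 1\<rparr>"

definition cliff_module :: "nat \<Rightarrow> (nat, 'x) smod \<Rightarrow> bool" where
  "cliff_module n V \<longleftrightarrow> smodule (cliff_alg n) V \<and>
     (\<forall>i\<in>{1..n}. \<forall>v\<in>carr V. act V i (act V i v) = v) \<and>
     (\<forall>i\<in>{1..n}. \<forall>j\<in>{1..n}. i \<noteq> j \<longrightarrow> (\<forall>v\<in>carr V. act V i (act V j v) = - act V j (act V i v)))"

subsection \<open>Symmetric group\<close>

text \<open>The elements of $S_n$ are the permutations of \<open>{1..n}\<close>; $s_i$ is \<open>transpose i (Suc i)\<close>.\<close>

definition Sn :: "nat \<Rightarrow> (nat \<Rightarrow> nat) set" where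
  "Sn n = {w. w permutes {1..n}}"

definition sym_alg :: "nat \<Rightarrow> (nat \<Rightarrow> nat) sgens" where
  "sym_alg n = \<lparr>gens = Sn n, gpar = \<lambda>_. 0\<rparr>"

definition sym_module :: "nat \<Rightarrow> (nat \<Rightarrow> nat, 'x) smod \<Rightarrow> bool" where
  "sym_module n M \<longleftrightarrow> smodule (sym_alg n) M \<and> hpart M 1 = {0} \<and>
     (\<forall>v\<in>carr M. act M id v = v) \<and>
     (\<forall>w\<in>Sn n. \<forall>w'\<in>Sn n. \<forall>v\<in>carr M. act M (w \<circ> w') v = act M w (act M w' v))"

subsection \<open>Hecke--Clifford superalgebra\<close>

datatype hcgen = Cl nat | Sy "nat \<Rightarrow> nat"

definition hc_alg :: "nat \<Rightarrow> hcgen sgens" where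
  "hc_alg n = \<lparr>gens = Cl ` {1..n} \<union> Sy ` Sn n, gpar = \<lambda>g. case g of Cl _ \<Rightarrow> 1 | Sy _ \<Rightarrow> 0\<rparr>"

definition hc_module :: "nat \<Rightarrow> (hcgen, 'x) smod \<Rightarrow> bool" where
  "hc_module n V \<longleftrightarrow> smodule (hc_alg n) V \<and>
     (\<forall>i\<in>{1..n}. \<forall>v\<in>carr V. act V (Cl i) (act V (Cl i) v) = v) \<and>
     (\<forall>i\<in>{1..n}. \<forall>j\<in>{1..n}. i \<noteq> j \<longrightarrow>
        (\<forall>v\<in>carr V. act V (Cl i) (act V (Cl j) v) = - act V (Cl j) (act V (Cl i) v))) \<and>
     (\<forall>v\<in>carr V. act V (Sy id) v = v) \<and>
     (\<forall>w\<in>Sn n. \<forall>w'\<in>Sn n. \<forall>v\<in>carr V. act V (Sy (w \<circ> w')) v = act V (Sy w) (act V (Sy w') v)) \<and>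
     (\<forall>i\<in>{1..<n}. \<forall>v\<in>carr V.
        act V (Sy (transpose i (Suc i))) (act V (Cl i) v) =
        act V (Cl (Suc i)) (act V (Sy (transpose i (Suc i))) v)) \<and>
     (\<forall>i\<in>{1..<n}. \<forall>j\<in>{1..n} - {i, Suc i}. \<forall>v\<in>carr V.
        act V (Sy (transpose i (Suc i))) (act V (Cl j) v) =
        act V (Cl j) (act V (Sy (transpose i (Suc i))) v))"

text \<open>
  The \<open>hc_alg n\<close>-module $\mathcal{C}_n$, in coordinates with respect to the basis
  $c_A = c_{a_1} \cdots c_{a_k}$, $A = \{a_1 < \dots < a_k\} \subseteq \{1,\dots,n\}$. Here
  $c_i c_A = (-1)^{|\{a \in A : a < i\}|} c_{A \triangle \{i\}}$ and
  $w c_A = c_{w(a_1)} \cdots c_{w(a_k)} = (-1)^{\mathrm{inv}_A(w)} c_{w(A)}$.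
\<close>

definition inversions_on :: "(nat \<Rightarrow> nat) \<Rightarrow> nat set \<Rightarrow> nat" where
  "inversions_on w A = card {(a, b). a \<in> A \<and> b \<in> A \<and> a < b \<and> w b < w a}"

definition cliff_hc :: "nat \<Rightarrow> (hcgen, nat set) smod" where
  "cliff_hc n =
     \<lparr>hpart = \<lambda>p. {f. \<forall>A. f A \<noteq> 0 \<longrightarrow> A \<subseteq> {1..n} \<and> of_nat (card A) = p},
      act = \<lambda>g f B. (case g of
          Cl i \<Rightarrow> (-1) ^ card {a \<in> B. a < i} * f (sym_diff B {i})
        | Sy w \<Rightarrow> (-1) ^ inversions_on w (w -` B) * f (w -` B))\<rparr>"

subsection \<open>Spin symmetric group algebra\<close>

definition spin_alg :: "nat \<Rightarrow> nat sgens" where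
  "spin_alg n = \<lparr>gens = {1..<n}, gpar = \<lambda>_. 1\<rparr>"

definition spin_module :: "nat \<Rightarrow> (nat, 'x) smod \<Rightarrow> bool" where
  "spin_module n V \<longleftrightarrow> smodule (spin_alg n) V \<and>
     (\<forall>i\<in>{1..<n}. \<forall>v\<in>carr V. act V i (act V i v) = v) \<and>
     (\<forall>i. 1 \<le> i \<and> Suc i < n \<longrightarrow> (\<forall>v\<in>carr V.
        act V i (act V (Suc i) (act V i v)) = act V (Suc i) (act V i (act V (Suc i) v)))) \<and>
     (\<forall>i\<in>{1..<n}. \<forall>j\<in>{1..<n}. Suc i < j \<or> Suc j < i \<longrightarrow>
        (\<forall>v\<in>carr V. act V i (act V j v) = - act V j (act V i v)))"

subsection \<open>Tensor products with modules over the symmetric group\<close>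

definition tens :: "('x \<Rightarrow> complex) \<Rightarrow> ('y \<Rightarrow> complex) \<Rightarrow> 'x \<times> 'y \<Rightarrow> complex" where
  "tens u x = (\<lambda>(a, b). u a * x b)"

definition tens_space ::
  "('x \<Rightarrow> complex) set \<Rightarrow> ('y \<Rightarrow> complex) set \<Rightarrow> ('x \<times> 'y \<Rightarrow> complex) set" where
  "tens_space S T = cfun.span {tens u x | u x. u \<in> S \<and> x \<in> T}"

text \<open>
  $F \otimes G$, obtained by applying \<open>G\<close> to the second argument and then \<open>F\<close> to the first;
  for linear operators this is the linear extension of $u \otimes x \mapsto F u \otimes G x$.
\<close>

definition tens_op ::
  "(('x \<Rightarrow> complex) \<Rightarrow> 'x \<Rightarrow> complex) \<Rightarrow> (('y \<Rightarrow> complex) \<Rightarrow> 'y \<Rightarrow> complex) \<Rightarrow>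
   ('x \<times> 'y \<Rightarrow> complex) \<Rightarrow> 'x \<times> 'y \<Rightarrow> complex" where
  "tens_op F G z = (\<lambda>(a, b). F (\<lambda>a'. G (\<lambda>b'. z (a', b')) b) a)"

lemma tens_op_tens:
  assumes "lin_on S F" "u \<in> S" "lin_on T G" "x \<in> T"
  shows "tens_op F G (tens u x) = tens (F u) (G x)"
proof -
  have "(\<lambda>b'. tens u x (a, b')) = u a *c x" for a
    by (simp add: tens_def cscale_def)
  then have 1: "G (\<lambda>b'. tens u x (a, b')) = u a *c G x" for a
    using assms(3,4) by (simp add: lin_on_def)
  have "(\<lambda>a'. G (\<lambda>b'. tens u x (a', b')) b) = G x b *c u" for b
    by (simp add: 1) (simp add: cscale_def mult.commute)
  then show ?thesis
    using assms(1,2) by (simp add: tens_op_def fun_eq_iff lin_on_def)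
       (simp add: tens_def cscale_def mult.commute)
qed

definition hc_tensor ::
  "(hcgen, 'x) smod \<Rightarrow> (nat \<Rightarrow> nat, 'y) smod \<Rightarrow> (hcgen, 'x \<times> 'y) smod" where
  "hc_tensor F M =
     \<lparr>hpart = \<lambda>p. tens_space (hpart F p) (carr M),
      act = \<lambda>g. case g of
          Cl i \<Rightarrow> tens_op (act F (Cl i)) id
        | Sy w \<Rightarrow> tens_op (act F (Sy w)) (act M w)\<rparr>"

definition spin_tensor ::
  "(nat, 'x) smod \<Rightarrow> (nat \<Rightarrow> nat, 'y) smod \<Rightarrow> (nat, 'x \<times> 'y) smod" where
  "spin_tensor E M =
     \<lparr>hpart = \<lambda>p. tens_space (hpart E p) (carr M),
      act = \<lambda>j. tens_op (act E j) (act M (transpose j (Suc j)))\<rparr>"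

section \<open>Labelling of the irreducible modules\<close>

subsection \<open>Symmetric functions\<close>

text \<open>
  A symmetric function in $z_0, z_1, \dots$ is represented by its values at finitely supported
  sequences of complex numbers, with the pointwise ring structure.
\<close>

type_synonym symfun = "(nat \<Rightarrow>\<^sub>0 complex) \<Rightarrow> complex"

definition q_fun :: "nat \<Rightarrow> symfun" where
  "q_fun r z =
     fps_nth (\<Prod>i\<in>Poly_Mapping.keys z. (1 + fps_const (Poly_Mapping.lookup z i) * fps_X) /
                           (1 - fps_const (Poly_Mapping.lookup z i) * fps_X)) r"

definition q_comp :: "nat list \<Rightarrow> symfun" where
  "q_comp nu = prod_list (map q_fun nu)"

inductive_set Gamma :: "symfun set" where
  const: "(\<lambda>_. a) \<in> Gamma"
| q: "r \<ge> 1 \<Longrightarrow> q_fun r \<in> Gamma"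
| add: "f \<in> Gamma \<Longrightarrow> g \<in> Gamma \<Longrightarrow> f + g \<in> Gamma"
| mult: "f \<in> Gamma \<Longrightarrow> g \<in> Gamma \<Longrightarrow> f * g \<in> Gamma"

definition strict_partition :: "nat \<Rightarrow> nat list \<Rightarrow> bool" where
  "strict_partition n lam \<longleftrightarrow> sorted_wrt (>) lam \<and> 0 \<notin> set lam \<and> sum_list lam = n"

text \<open>
  The defining sum for $Q_\lambda$ in the variables $z_0, \dots, z_{m-1}$, at a point where they
  are pairwise distinct. The cosets in $S_m / S_{m-\ell}$ are represented by the permutations
  of \<open>{..<m}\<close> that are increasing on \<open>{\<ell>..<m}\<close>.
\<close>

definition schurQ_vars :: "nat list \<Rightarrow> nat \<Rightarrow> (nat \<Rightarrow> complex) \<Rightarrow> complex" where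
  "schurQ_vars lam m z =
     2 ^ length lam *
     (\<Sum>w | w permutes {..<m} \<and> strict_mono_on {length lam..<m} w.
        (\<Prod>i<length lam. z (w i) ^ (lam ! i)) *
        (\<Prod>i<length lam. \<Prod>j\<in>{i<..<m}. (z (w i) + z (w j)) / (z (w i) - z (w j))))"

text \<open>
  \<open>schurQ_vars\<close> is stable under $m \to m + 1$, $z_m = 0$, for $m \geq \ell$; its limit is the element of
  $\Gamma_{\mathbb{C}}$ that restricts to it for all such \<open>m\<close>.
\<close>

definition schurQ :: "nat list \<Rightarrow> symfun" where
  "schurQ lam =
     (THE f. f \<in> Gamma \<and>
        (\<forall>m\<ge>length lam. \<forall>z. Poly_Mapping.keys z \<subseteq> {..<m} \<and> inj_on (Poly_Mapping.lookup z) {..<m} \<longrightarrow>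
           f z = schurQ_vars lam m (Poly_Mapping.lookup z)))"

subsection \<open>The characteristic map\<close>

text \<open>
  Every finite-dimensional module is isomorphic to one on a subspace of
  \<^typ>\<open>nat \<Rightarrow> complex\<close>, so these suffice to form the Grothendieck groups.
\<close>

type_synonym hcmod = "(hcgen, nat) smod"

definition composition_of :: "nat \<Rightarrow> nat list \<Rightarrow> bool" where
  "composition_of n nu \<longleftrightarrow> 0 \<notin> set nu \<and> sum_list nu = n"

definition young :: "nat \<Rightarrow> nat list \<Rightarrow> (nat \<Rightarrow> nat) set" where
  "young n nu =
     {w \<in> Sn n. \<forall>k<length nu.
        w ` {sum_list (take k nu)<..sum_list (take (Suc k) nu)} =
          {sum_list (take k nu)<..sum_list (take (Suc k) nu)}}"

text \<open>
  \<open>I\<close> is $\mathrm{ind}_{\mathbb{C}S_\nu}^{\mathcal{H}_n} \mathbf{1} =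
  \mathcal{H}_n \otimes_{\mathbb{C}S_\nu} \mathbf{1}$: it has an even $S_\nu$-invariant vector
  \<open>v0\<close> (namely $1 \otimes 1$) that is universal among such vectors in $\mathcal{H}_n$-modules.
\<close>

definition is_induced_triv :: "nat \<Rightarrow> nat list \<Rightarrow> hcmod \<Rightarrow> bool" where
  "is_induced_triv n nu I \<longleftrightarrow> hc_module n I \<and>
     (\<exists>v0\<in>hpart I 0. (\<forall>w\<in>young n nu. act I (Sy w) v0 = v0) \<and>
        (\<forall>N :: hcmod. hc_module n N \<longrightarrow>
           (\<forall>x\<in>hpart N 0. (\<forall>w\<in>young n nu. act N (Sy w) x = x) \<longrightarrow>
              (\<exists>f. shom (hc_alg n) 0 I N f \<and> f v0 = x \<and>
                 (\<forall>g. shom (hc_alg n) 0 I N g \<and> g v0 = x \<longrightarrow> (\<forall>v\<in>carr I. g v = f v))))))"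

text \<open>
  $\bigoplus_n K(\mathcal{H}_n\text{-smod})$, complexified, is \<open>K_free\<close> modulo \<open>K_rel\<close>; a linear map
  out of \<open>K_free\<close> is determined by its values \<open>ch n V\<close> on the basis.
\<close>

definition delta :: "'x \<Rightarrow> 'x \<Rightarrow> complex" where
  "delta x = (\<lambda>y. if y = x then 1 else 0)"

definition short_exact :: "'g sgens \<Rightarrow> ('g, 'x) smod \<Rightarrow> ('g, 'y) smod \<Rightarrow> ('g, 'z) smod \<Rightarrow> bool" where
  "short_exact A V1 V2 V3 \<longleftrightarrow>
     (\<exists>f g. shom A 0 V1 V2 f \<and> shom A 0 V2 V3 g \<and> inj_on f (carr V1) \<and>
        f ` carr V1 = {v \<in> carr V2. g v = 0} \<and> g ` carr V2 = carr V3)"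

definition K_free :: "(nat \<times> hcmod \<Rightarrow> complex) set" where
  "K_free = cfun.span {delta (n, V) | n V. hc_module n V}"

definition K_rel :: "(nat \<times> hcmod \<Rightarrow> complex) set" where
  "K_rel = cfun.span
     ({delta (n, V2) - delta (n, V1) - delta (n, V3) | n V1 V2 V3.
         hc_module n V1 \<and> hc_module n V2 \<and> hc_module n V3 \<and> short_exact (hc_alg n) V1 V2 V3} \<union>
      {delta (n, Pi_smod (hc_alg n) V) - delta (n, V) | n V. hc_module n V})"

definition ch_ext :: "(nat \<Rightarrow> hcmod \<Rightarrow> symfun) \<Rightarrow> (nat \<times> hcmod \<Rightarrow> complex) \<Rightarrow> symfun" where
  "ch_ext ch x = (\<Sum>(n, V)\<in>{y. x y \<noteq> 0}. x (n, V) *c ch n V)"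

text \<open>
  \<open>ch\<close> induces a linear isomorphism from \<open>K_free / K_rel\<close> onto \<open>Gamma\<close> that has the prescribed
  values on the induced modules.
\<close>

definition characteristic_map :: "(nat \<Rightarrow> hcmod \<Rightarrow> symfun) \<Rightarrow> bool" where
  "characteristic_map ch \<longleftrightarrow>
     ch_ext ch ` K_free = Gamma \<and>
     (\<forall>x\<in>K_free. ch_ext ch x = 0 \<longleftrightarrow> x \<in> K_rel) \<and>
     (\<forall>n nu I. composition_of n nu \<and> is_induced_triv n nu I \<longrightarrow> ch n I = q_comp nu)"

subsection \<open>Irreducible modules\<close>

definition delta_len :: "nat list \<Rightarrow> nat" where
  "delta_len lam = (if even (length lam) then 0 else 1)"

text \<open>\<open>D\<close> is (isomorphic to) $D^\lambda$.\<close>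

definition is_D :: "(nat \<Rightarrow> hcmod \<Rightarrow> symfun) \<Rightarrow> nat \<Rightarrow> nat list \<Rightarrow> hcmod \<Rightarrow> bool" where
  "is_D ch n lam D \<longleftrightarrow> hc_module n D \<and> sirreducible (hc_alg n) D \<and>
     ch n D = (1 / 2 ^ ((length lam - delta_len lam) div 2)) *c schurQ lam"

definition res_cliff :: "(hcgen, 'x) smod \<Rightarrow> (nat, 'x) smod" where
  "res_cliff V = \<lparr>hpart = hpart V, act = \<lambda>i. act V (Cl i)\<rparr>"

text \<open>
  $\mathfrak{G}_n(V) = \mathrm{Hom}_{\mathcal{C}_n}(U, V)$; a homomorphism \<open>f\<close> is encoded as the
  function \<open>(u, x) \<mapsto> f u x\<close>, extended by zero to \<open>u\<close> outside \<open>U\<close>.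
\<close>

definition G_functor ::
  "nat \<Rightarrow> (nat, 'u) smod \<Rightarrow> (hcgen, 'x) smod \<Rightarrow> (nat, ('u \<Rightarrow> complex) \<times> 'x) smod" where
  "G_functor n U V =
     \<lparr>hpart = \<lambda>p. {\<lambda>(u, x). if u \<in> carr U then f u x else 0 | f.
                     shom (cliff_alg n) p U (res_cliff V) f},
      act = \<lambda>j F (u, x).
        (let v = (\<lambda>y. F (u, y)) in
          1 / csqrt (-2) *
          act V (Sy (transpose j (Suc j))) (act V (Cl j) v - act V (Cl (Suc j)) v) x)\<rparr>"

text \<open>\<open>E\<close> is (isomorphic to) $D^\lambda_-$; \<open>U\<close> is $U_n$.\<close>

definition is_D_spin ::
  "(nat \<Rightarrow> hcmod \<Rightarrow> symfun) \<Rightarrow> nat \<Rightarrow> nat list \<Rightarrow> (nat, 'e) smod \<Rightarrow> bool" where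
  "is_D_spin ch n lam E \<longleftrightarrow> spin_module n E \<and> sirreducible (spin_alg n) E \<and>
     (\<exists>(U :: (nat, nat) smod) D.
        cliff_module n U \<and> sirreducible (cliff_alg n) U \<and> is_D ch n lam D \<and>
        (if even n \<or> even (length lam)
         then iso_smod (spin_alg n) (G_functor n U D) E
         else iso_smod (spin_alg n) (G_functor n U D) (dsum_smod E (Pi_smod (spin_alg n) E))))"

end

theory Submission
  imports "HOL-Library.Nat_Bijection" "HOL-Computational_Algebra.Polynomial_FPS" Defs
begin

text \<open>
  The proof compares dimensions of homomorphism spaces. For a finite-dimensional semisimple
  module \<open>V\<close> and an irreducible \<open>D\<close>, with homomorphisms of both parities allowed, the
  multiplicity of \<open>D\<close> in \<open>V\<close> is $\dim \mathrm{Hom}(D, V) / \dim \mathrm{End}(D)$ (\<open>smult_hdim\<close>);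
  semisimplicity comes from invariant Hermitian forms (\<open>hc_unitarizable\<close>, \<open>spin_unitarizable\<close>).

  The functor $\mathfrak{G}_n$ is made concrete as $V \mapsto eV$ with \<open>e\<close> a primitive even
  idempotent of the Clifford algebra: $eV$ is the joint eigenspace \<open>eD n V\<close> of the commuting
  operators $c_1c_2, c_3c_4, \dots$, on which the $t_j$ act because they supercommute with the
  Clifford generators (\<open>G_iso\<close>). Passing from $\mathrm{Hom}_{\mathcal{H}_n}(V, W)$ to
  $\mathrm{Hom}_{\mathbb{C}S_n^-}(eV, eW)$ multiplies the dimension by
  $\varepsilon = \dim \mathrm{End}_{\mathcal{C}_n}(U_n)$, which is $1$ for even and $2$ for odd \<open>n\<close>
  (\<open>hdim_eD\<close>): intertwiners of eigenspaces extend uniquely along pairs of Clifford generators, and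
  for odd \<open>n\<close> the remaining generator doubles the dimension. Moreover
  $e(V \otimes M) = eV \otimes M$ (\<open>eD_tensor\<close>).

  Let $eD^\lambda$ be a sum of \<open>a\<close> copies of $D^\lambda_-$ and $eD^{(n)}$ a sum of \<open>b\<close> copies of
  $\mathcal{B}_n$. Then
  $ab \dim \mathrm{Hom}(D^\lambda_-, \mathcal{B}_n \otimes M) =
  \varepsilon \dim \mathrm{Hom}(D^\lambda, D^{(n)} \otimes M)$ and
  $a^2 \dim \mathrm{End}(D^\lambda_-) = \varepsilon \dim \mathrm{End}(D^\lambda)$, whence
  $b\, m^-_\lambda = a\, m_\lambda$. The three cases are the values of \<open>a\<close> and \<open>b\<close>.

  It remains to identify $D^{(n)}$ with $\mathcal{C}_n$ from the characteristic map. Partial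
  fractions show $Q_{(n)} = q_n$ (\<open>schurQ_single\<close>), and $\mathcal{C}_n$ has the universal property of
  $\mathrm{ind}\,\mathbf{1}$ (\<open>cliff_universal\<close>), so both modules have the same characteristic. Modules
  with the same characteristic have the same class in the Grothendieck group, hence equal
  dimensions and equal dimensions of homomorphism spaces (\<open>additive_eq_if_ch_eq\<close>); Schur's lemma
  gives the isomorphism (\<open>is_D_single\<close>). The same argument shows that $D^\lambda$ is determined up to
  isomorphism (\<open>is_D_unique\<close>).
\<close>

section \<open>Linear algebra on subspaces\<close>

type_synonym 'x vec = "'x \<Rightarrow> complex"

declare plus_fun_apply [simp del] zero_fun_apply [simp del] minus_apply [simp del] uminus_apply [simp del]

global_interpretation cpair: vector_space_pair
  "cscale :: complex \<Rightarrow> 'x vec \<Rightarrow> _" "cscale :: complex \<Rightarrow> 'y vec \<Rightarrow> _" ..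

lemmas pointwise = plus_fun_apply zero_fun_apply minus_apply uminus_apply cscale_def

abbreviation clinear :: "('x vec \<Rightarrow> 'y vec) \<Rightarrow> bool" where
  "clinear \<equiv> Vector_Spaces.linear cscale cscale"

lemma clinear_lin_on: "clinear f \<Longrightarrow> lin_on S f"
  unfolding lin_on_def Vector_Spaces.linear_iff by blast

lemma lin_on_add: "lin_on S f \<Longrightarrow> u \<in> S \<Longrightarrow> v \<in> S \<Longrightarrow> f (u + v) = f u + f v"
  and lin_on_scale: "lin_on S f \<Longrightarrow> u \<in> S \<Longrightarrow> f (a *c u) = a *c f u"
  by (auto simp: lin_on_def)

lemma lin_on_subset: "lin_on S f \<Longrightarrow> T \<subseteq> S \<Longrightarrow> lin_on T f"
  by (auto simp: lin_on_def subset_iff)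

lemma neg_eq_cscale: "- v = (- 1) *c v"
  by (simp add: cscale_def fun_eq_iff uminus_apply)

lemma lin_on_zero: "lin_on S f \<Longrightarrow> cfun.subspace S \<Longrightarrow> f 0 = 0"
  by (metis cfun.scale_zero_left cfun.subspace_0 lin_on_scale)

lemma lin_on_uminus: "lin_on S f \<Longrightarrow> u \<in> S \<Longrightarrow> f (- u) = - f u"
  by (metis neg_eq_cscale lin_on_scale)

lemma lin_on_diff:
  assumes "lin_on S f" "cfun.subspace S" "u \<in> S" "v \<in> S"
  shows "f (u - v) = f u - f v"
  using lin_on_add[OF assms(1) assms(3) cfun.subspace_neg[OF assms(2,4)]]
    lin_on_uminus[OF assms(1,4)] by simp

lemma lin_on_sum:
  assumes "lin_on S f" "cfun.subspace S" "finite A" "\<And>i. i \<in> A \<Longrightarrow> g i \<in> S"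
  shows "f (\<Sum>i\<in>A. g i) = (\<Sum>i\<in>A. f (g i))"
  using assms(3,4)
proof (induction A rule: finite_induct)
  case empty
  then show ?case using lin_on_zero[OF assms(1,2)] unfolding sum.empty by metis
next
  case (insert i A)
  then show ?case
    using lin_on_add[OF assms(1), of "g i" "sum g A"] cfun.subspace_sum[OF assms(2), of A g]
    by simp
qed

lemma lin_on_comp: "lin_on S f \<Longrightarrow> f ` S \<subseteq> T \<Longrightarrow> lin_on T g \<Longrightarrow> lin_on S (\<lambda>v. g (f v))"
  unfolding lin_on_def image_subset_iff by simp

lemma lin_on_cong: "lin_on S f \<Longrightarrow> (\<And>v. v \<in> S \<Longrightarrow> g v = f v) \<Longrightarrow> cfun.subspace S \<Longrightarrow> lin_on S g"
  by (simp add: lin_on_def cfun.subspace_add cfun.subspace_scale)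

lemma lin_on_add_fun: "lin_on S f \<Longrightarrow> lin_on S g \<Longrightarrow> lin_on S (\<lambda>v. f v + g v)"
  by (simp add: lin_on_def cfun.scale_right_distrib)

lemma lin_on_diff_fun: "lin_on S f \<Longrightarrow> lin_on S g \<Longrightarrow> lin_on S (\<lambda>v. f v - g v)"
  by (simp add: lin_on_def cfun.scale_right_diff_distrib)

lemma lin_on_scale_fun: "lin_on S f \<Longrightarrow> lin_on S (\<lambda>v. a *c f v)"
  by (simp add: lin_on_def cfun.scale_right_distrib mult.commute)

lemma lin_on_id: "lin_on S (\<lambda>v. v)"
  by (simp add: lin_on_def)

lemma lin_on_const_zero: "lin_on S (\<lambda>v. 0)"
  by (simp add: lin_on_def)

lemma subspace_lin_image:
  assumes "cfun.subspace S" "lin_on S f" shows "cfun.subspace (f ` S)"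
proof (rule cfun.subspaceI)
  show "0 \<in> f ` S"
    using lin_on_zero[OF assms(2,1)] cfun.subspace_0[OF assms(1)] by force
next
  fix x y assume "x \<in> f ` S" "y \<in> f ` S"
  then obtain u v where "u \<in> S" "v \<in> S" "x = f u" "y = f v" by auto
  then show "x + y \<in> f ` S"
    using lin_on_add[OF assms(2)] cfun.subspace_add[OF assms(1)] by (metis imageI)
next
  fix c x assume "x \<in> f ` S"
  then show "c *c x \<in> f ` S"
    using lin_on_scale[OF assms(2)] cfun.subspace_scale[OF assms(1)] by (metis (no_types, lifting) imageE imageI)
qed

lemma subspace_lin_kernel:
  assumes "cfun.subspace S" "lin_on S f" shows "cfun.subspace {v \<in> S. f v = 0}"
  using assms lin_on_zero[OF assms(2,1)]
  by (auto intro!: cfun.subspaceI simp: lin_on_add lin_on_scale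
      cfun.subspace_0 cfun.subspace_add cfun.subspace_scale)

lemma subspace_lin_eq:
  assumes "cfun.subspace S" "lin_on S f" "lin_on S g" shows "cfun.subspace {v \<in> S. f v = g v}"
proof -
  have "{v \<in> S. f v = g v} = {v \<in> S. f v - g v = 0}" by simp
  then show ?thesis using subspace_lin_kernel[OF assms(1) lin_on_diff_fun[OF assms(2,3)]] by simp
qed

lemma lin_on_eq_span:
  assumes "lin_on (cfun.span X) f" "lin_on (cfun.span X) g" "\<And>x. x \<in> X \<Longrightarrow> f x = g x"
    and "v \<in> cfun.span X"
  shows "f v = g v"
proof -
  have "cfun.span X \<subseteq> {v \<in> cfun.span X. f v = g v}"
    by (rule cfun.span_minimal) (auto intro: subspace_lin_eq assms cfun.span_base)
  then show ?thesis using assms(4) by auto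
qed

lemma lin_on_inj_iff:
  assumes "lin_on S f" "cfun.subspace S"
  shows "inj_on f S \<longleftrightarrow> (\<forall>v\<in>S. f v = 0 \<longrightarrow> v = 0)"
proof
  assume "inj_on f S"
  then show "\<forall>v\<in>S. f v = 0 \<longrightarrow> v = 0"
    using lin_on_zero[OF assms] cfun.subspace_0[OF assms(2)] by (metis inj_onD)
next
  assume *: "\<forall>v\<in>S. f v = 0 \<longrightarrow> v = 0"
  show "inj_on f S"
  proof (rule inj_onI)
    fix x y assume "x \<in> S" "y \<in> S" "f x = f y"
    then have "x - y = 0"
      using * lin_on_diff[OF assms] cfun.subspace_diff[OF assms(2)] by (metis diff_self)
    then show "x = y" by simp
  qed
qed

lemma subspace_basis:
  assumes "cfun.subspace S"
  obtains B where "B \<subseteq> S" "cfun.independent B" "cfun.span B = S" "card B = cfun.dim S"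
  by (metis assms cfun.basis_exists cfun.span_subspace)

lemma lin_on_extend:
  fixes f :: "'x vec \<Rightarrow> 'y vec"
  assumes "cfun.subspace S" "lin_on S f"
  obtains g where "clinear g" "\<And>v. v \<in> S \<Longrightarrow> g v = f v"
proof -
  obtain B where B: "cfun.independent B" "cfun.span B = S"
    using subspace_basis[OF assms(1)] by metis
  obtain g where g: "clinear g" "\<forall>x\<in>B. g x = f x"
    using cpair.linear_independent_extend[OF B(1)] by blast
  have "g v = f v" if "v \<in> S" for v
    using lin_on_eq_span[of B g f v] g clinear_lin_on assms(2) B(2) that by auto
  then show ?thesis using that g by blast
qed

text \<open>A linear projection onto an arbitrary subspace; it serves to retract a tensor product
  onto the tensor product of a smaller space.\<close>

lemma linear_projection:
  assumes "cfun.subspace S"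
  obtains p :: "'x vec \<Rightarrow> 'x vec"
  where "clinear p" "\<And>v. v \<in> S \<Longrightarrow> p v = v" "\<And>v. p v \<in> S"
proof -
  obtain B where B: "cfun.independent B" "cfun.span B = S"
    using subspace_basis[OF assms(1)] by metis
  obtain p :: "'x vec \<Rightarrow> 'x vec"
    where p: "clinear p" "\<forall>x\<in>B. p x = x" "range p = cfun.span ((\<lambda>x. x) ` B)"
    using cpair.linear_independent_extend_subspace[OF B(1), of "\<lambda>x. x"] by blast
  have "p v = v" if "v \<in> S" for v
    using lin_on_eq_span[of B p "\<lambda>x. x" v, OF clinear_lin_on[OF p(1)] lin_on_id] p(2) B(2) that by blast
  moreover have "p v \<in> S" for v using p(3) B(2) by auto
  ultimately show ?thesis using that p by blast
qed

text \<open>Finite-dimensional subspaces, in the form used for modules.\<close>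

definition fd :: "'x vec set \<Rightarrow> bool" where
  "fd S \<longleftrightarrow> (\<exists>X. finite X \<and> S = cfun.span X)"

lemma fd_subspace: "fd S \<Longrightarrow> cfun.subspace S"
  by (auto simp: fd_def)

lemma fd_basis:
  assumes "fd S"
  obtains B where "finite B" "B \<subseteq> S" "cfun.independent B" "cfun.span B = S" "card B = cfun.dim S"
proof -
  obtain X where X: "finite X" "S = cfun.span X" using assms by (auto simp: fd_def)
  obtain B where B: "B \<subseteq> S" "cfun.independent B" "cfun.span B = S" "card B = cfun.dim S"
    using subspace_basis fd_subspace assms by metis
  then have "finite B" using cfun.independent_span_bound[OF X(1) B(2)] X(2) by auto
  with B that show ?thesis by blast
qed

lemma fd_mono:
  assumes "fd S" "W \<subseteq> S" "cfun.subspace W" shows "fd W"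
proof -
  obtain X where X: "finite X" "S = cfun.span X" using assms by (auto simp: fd_def)
  obtain B where B: "B \<subseteq> W" "cfun.independent B" "cfun.span B = W"
    using subspace_basis assms(3) by metis
  then have "finite B" using cfun.independent_span_bound[OF X(1) B(2)] X(2) assms(2) by auto
  with B show ?thesis by (auto simp: fd_def)
qed

lemma fd_lin_image:
  assumes "fd S" "lin_on S f" shows "fd (f ` S)"
proof -
  obtain X where X: "finite X" "S = cfun.span X" using assms by (auto simp: fd_def)
  obtain g where g: "clinear g" "\<And>v. v \<in> S \<Longrightarrow> g v = f v"
    using lin_on_extend fd_subspace assms by metis
  have "f ` S = g ` cfun.span X" using g X by force
  also have "\<dots> = cfun.span (g ` X)" by (rule cpair.linear_span_image[OF g(1), symmetric])
  finally show ?thesis using X by (auto simp: fd_def)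
qed

lemma dim_lin_image:
  fixes f :: "'x vec \<Rightarrow> 'y vec"
  assumes "cfun.subspace S" "lin_on S f" "inj_on f S"
  shows "cfun.dim (f ` S) = cfun.dim S"
proof -
  obtain g where g: "clinear g" "\<And>v. v \<in> S \<Longrightarrow> g v = f v"
    using lin_on_extend assms by metis
  obtain B where B: "B \<subseteq> S" "cfun.independent B" "cfun.span B = S" "card B = cfun.dim S"
    using subspace_basis assms(1) by metis
  have inj: "inj_on g S" using assms(3) g(2) by (simp add: inj_on_def)
  have ind: "cfun.independent (g ` B)"
    using cpair.linear_independent_injective_image[OF g(1) B(2)] inj B(3) by simp
  have "f ` S = g ` cfun.span B" using g B by force
  also have "\<dots> = cfun.span (g ` B)" by (rule cpair.linear_span_image[OF g(1), symmetric])
  finally have "cfun.dim (f ` S) = card (g ` B)"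
    using cfun.dim_span_eq_card_independent[OF ind] by simp
  also have "\<dots> = card B" using inj B(1) by (meson card_image inj_on_subset)
  finally show ?thesis using B by simp
qed

lemma dim_less:
  assumes "fd S" "W \<subset> S" "cfun.subspace W"
  shows "cfun.dim W < cfun.dim S"
proof -
  obtain X where X: "finite X" "S = cfun.span X" using assms by (auto simp: fd_def)
  obtain B where B: "B \<subseteq> W" "cfun.independent B" "cfun.span B = W" "card B = cfun.dim W"
    using subspace_basis assms(3) by metis
  have "B \<subseteq> S" using B assms by auto
  then obtain C where C: "B \<subseteq> C" "C \<subseteq> S" "cfun.independent C" "S \<subseteq> cfun.span C"
    using cfun.maximal_independent_subset_extend B by metis
  have finC: "finite C" using cfun.independent_span_bound[OF X(1) C(3)] X(2) C(2) by auto
  have "B \<noteq> C" using B C assms by auto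
  then have "card B < card C" using C finC by (simp add: psubset_card_mono psubsetI)
  moreover have "card C = cfun.dim S" using C cfun.basis_card_eq_dim by blast
  ultimately show ?thesis using B by simp
qed

lemma fd_dim_eq:
  assumes "fd S" "W \<subseteq> S" "cfun.subspace W" "cfun.dim W = cfun.dim S"
  shows "W = S"
  using dim_less[OF assms(1) _ assms(3)] assms(2,4) by auto

subsection \<open>Internal direct sums\<close>

definition splits :: "'x vec set \<Rightarrow> 'x vec set \<Rightarrow> 'x vec set \<Rightarrow> bool" where
  "splits T X Y \<longleftrightarrow> cfun.subspace X \<and> cfun.subspace Y \<and> X \<inter> Y = {0} \<and>
     T = {x + y | x y. x \<in> X \<and> y \<in> Y}"

definition comp1 :: "'x vec set \<Rightarrow> 'x vec set \<Rightarrow> 'x vec \<Rightarrow> 'x vec" where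
  "comp1 X Y t = (SOME x. x \<in> X \<and> t - x \<in> Y)"

lemma splits_subspace: "splits T X Y \<Longrightarrow> cfun.subspace T"
  unfolding splits_def using cfun.subspace_sums[of X Y] by simp

lemma splits_sub: "splits T X Y \<Longrightarrow> X \<subseteq> T \<and> Y \<subseteq> T"
proof -
  assume a: "splits T X Y"
  then have "0 \<in> X" "0 \<in> Y" by (auto simp: splits_def cfun.subspace_0)
  then have "x \<in> T" if "x \<in> X \<union> Y" for x
    using a that unfolding splits_def
    by (metis (mono_tags, lifting) Un_iff add.left_neutral add.right_neutral mem_Collect_eq)
  then show ?thesis by auto
qed

lemma splits_swap: "splits T X Y \<Longrightarrow> splits T Y X"
  unfolding splits_def by (auto simp: Int_commute) (metis add.commute)+

lemma splits_unique:
  assumes "splits T X Y" "x \<in> X" "y \<in> Y" "x' \<in> X" "y' \<in> Y" "x + y = x' + y'"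
  shows "x = x' \<and> y = y'"
proof -
  have e: "x - x' = y' - y" using assms(6) by (simp add: algebra_simps)
  have "x - x' \<in> X" "y' - y \<in> Y"
    using assms by (auto simp: splits_def cfun.subspace_diff)
  then have "x - x' \<in> X \<inter> Y" using e by simp
  then have "x - x' = 0" using assms(1) unfolding splits_def by blast
  then show ?thesis using e by simp
qed

lemma comp1_add:
  assumes "splits T X Y" "x \<in> X" "y \<in> Y" shows "comp1 X Y (x + y) = x"
proof -
  have ex: "\<exists>z. z \<in> X \<and> x + y - z \<in> Y" using assms by (intro exI[of _ x]) simp
  from someI_ex[OF ex] have "comp1 X Y (x + y) \<in> X" "x + y - comp1 X Y (x + y) \<in> Y"
    by (auto simp: comp1_def)
  then show ?thesis using splits_unique[OF assms] by (metis add.commute diff_add_cancel)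
qed

lemma comp1:
  assumes "splits T X Y" "t \<in> T"
  shows "comp1 X Y t \<in> X" "t - comp1 X Y t \<in> Y"
  using assms comp1_add[OF assms(1)] unfolding splits_def by auto

lemma comp1_lin: assumes s: "splits T X Y" shows "lin_on T (comp1 X Y)"
  unfolding lin_on_def
proof (intro conjI ballI allI)
  have X: "cfun.subspace X" and Y: "cfun.subspace Y" using s by (auto simp: splits_def)
  fix u assume u: "u \<in> T"
  note cu = comp1[OF s u]
  show "comp1 X Y (a *c u) = a *c comp1 X Y u" for a
  proof -
    have "a *c u = a *c comp1 X Y u + a *c (u - comp1 X Y u)"
      by (simp flip: cfun.scale_right_distrib)
    then show ?thesis
      using comp1_add[OF s] cu cfun.subspace_scale[OF X] cfun.subspace_scale[OF Y] by metis
  qed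
  fix v assume v: "v \<in> T"
  note cv = comp1[OF s v]
  have "u + v = (comp1 X Y u + comp1 X Y v) + ((u - comp1 X Y u) + (v - comp1 X Y v))" by simp
  then show "comp1 X Y (u + v) = comp1 X Y u + comp1 X Y v"
    using comp1_add[OF s] cu cv cfun.subspace_add[OF X] cfun.subspace_add[OF Y] by metis
qed

lemma dim_splits:
  assumes s: "splits T X Y" and "fd T"
  shows "cfun.dim T = cfun.dim X + cfun.dim Y"
proof -
  have X: "cfun.subspace X" and Y: "cfun.subspace Y" using s by (auto simp: splits_def)
  have "fd X" "fd Y" using fd_mono[OF assms(2)] splits_sub[OF s] X Y by auto
  then obtain A B where A: "finite A" "A \<subseteq> X" "cfun.independent A" "cfun.span A = X" "card A = cfun.dim X"
    and B: "finite B" "B \<subseteq> Y" "cfun.independent B" "cfun.span B = Y" "card B = cfun.dim Y"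
    using fd_basis by metis
  have "A \<inter> B \<subseteq> {0}" using A B s by (auto simp: splits_def)
  moreover have "0 \<notin> A" using A(3) cfun.dependent_zero by blast
  ultimately have disj: "A \<inter> B = {}" by auto
  have "cfun.independent (A \<union> B)"
  proof (rule cfun.independent_if_scalars_zero)
    show "finite (A \<union> B)" using A B by simp
    fix f x assume 0: "(\<Sum>x\<in>A \<union> B. f x *c x) = 0" and x: "x \<in> A \<union> B"
    have "(\<Sum>x\<in>A. f x *c x) + (\<Sum>x\<in>B. f x *c x) = 0 + 0"
      using 0 by (simp add: sum.union_disjoint A B disj)
    moreover have "(\<Sum>x\<in>A. f x *c x) \<in> X" "(\<Sum>x\<in>B. f x *c x) \<in> Y"
      using A B X Y by (auto intro!: cfun.subspace_sum cfun.subspace_scale)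
    ultimately have "(\<Sum>x\<in>A. f x *c x) = 0" "(\<Sum>x\<in>B. f x *c x) = 0"
      using splits_unique[OF s] cfun.subspace_0[OF X] cfun.subspace_0[OF Y] by blast+
    then show "f x = 0" using x cfun.independentD A B by blast
  qed
  moreover have "T = cfun.span (A \<union> B)" using s A B by (simp add: splits_def cfun.span_Un)
  ultimately have "cfun.dim T = card (A \<union> B)" by (simp add: cfun.dim_eq_card)
  then show ?thesis using A B disj by (simp add: card_Un_disjoint)
qed

section \<open>Spaces of intertwining operators and their dimensions\<close>

definition homs ::
  "'i set \<Rightarrow> 'x vec set \<Rightarrow> ('i \<Rightarrow> 'x vec \<Rightarrow> 'x vec) \<Rightarrow>
   'y vec set \<Rightarrow> ('i \<Rightarrow> 'y vec \<Rightarrow> 'y vec) \<Rightarrow>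
   ('x vec \<Rightarrow> 'y vec) set" where
  "homs I S a T b = {f. lin_on S f \<and> f ` S \<subseteq> T \<and> (\<forall>i\<in>I. \<forall>v\<in>S. f (a i v) = b i (f v))}"

text \<open>An operator out of \<open>S\<close> as a vector: the same encoding as in \<open>G_functor\<close>.\<close>

definition enc :: "'x vec set \<Rightarrow> ('x vec \<Rightarrow> 'y vec) \<Rightarrow>
    'x vec \<times> 'y \<Rightarrow> complex" where
  "enc S f = (\<lambda>(u, y). if u \<in> S then f u y else 0)"

definition fdim :: "'x vec set \<Rightarrow> ('x vec \<Rightarrow> 'y vec) set \<Rightarrow> nat" where
  "fdim S F = cfun.dim (enc S ` F)"

abbreviation hdim where "hdim I S a T b \<equiv> fdim S (homs I S a T b)"

lemma homsI:
  "lin_on S f \<Longrightarrow> (\<And>v. v \<in> S \<Longrightarrow> f v \<in> T) \<Longrightarrow> (\<And>i v. i \<in> I \<Longrightarrow> v \<in> S \<Longrightarrow> f (a i v) = b i (f v)) \<Longrightarrow>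
    f \<in> homs I S a T b"
  by (auto simp: homs_def)

lemma homsD:
  assumes "f \<in> homs I S a T b"
  shows "lin_on S f" "v \<in> S \<Longrightarrow> f v \<in> T" "i \<in> I \<Longrightarrow> v \<in> S \<Longrightarrow> f (a i v) = b i (f v)"
  using assms by (auto simp: homs_def)

lemma enc_add: "enc S (\<lambda>v. f v + g v) = enc S f + enc S g"
  by (auto simp: enc_def fun_eq_iff pointwise)

lemma enc_scale: "enc S (\<lambda>v. a *c f v) = a *c enc S f"
  by (auto simp: enc_def fun_eq_iff pointwise)

lemma enc_zero: "enc S (\<lambda>v. 0) = 0"
  by (auto simp: enc_def fun_eq_iff pointwise)

lemma enc_eq_iff: "enc S f = enc S g \<longleftrightarrow> (\<forall>v\<in>S. f v = g v)"
  unfolding enc_def fun_eq_iff by auto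

lemma enc_eq_0_iff: "enc S f = 0 \<longleftrightarrow> (\<forall>v\<in>S. f v = 0)"
  using enc_eq_iff[of S f "\<lambda>v. 0"] by (simp add: enc_zero)

definition fspace :: "('x vec \<Rightarrow> 'y vec) set \<Rightarrow> bool" where
  "fspace F \<longleftrightarrow> (\<lambda>v. 0) \<in> F \<and> (\<forall>f\<in>F. \<forall>g\<in>F. (\<lambda>v. f v + g v) \<in> F) \<and> (\<forall>a. \<forall>f\<in>F. (\<lambda>v. a *c f v) \<in> F)"

lemma fspace_add: "fspace F \<Longrightarrow> f \<in> F \<Longrightarrow> g \<in> F \<Longrightarrow> (\<lambda>v. f v + g v) \<in> F"
  and fspace_scale: "fspace F \<Longrightarrow> f \<in> F \<Longrightarrow> (\<lambda>v. a *c f v) \<in> F"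
  by (auto simp: fspace_def)

lemma fspace_subspace:
  assumes "fspace F" shows "cfun.subspace (enc S ` F)"
proof (rule cfun.subspaceI)
  show "0 \<in> enc S ` F" using assms unfolding fspace_def by (metis enc_zero imageI)
  show "x + y \<in> enc S ` F" if "x \<in> enc S ` F" "y \<in> enc S ` F" for x y
    using that assms unfolding fspace_def by (auto simp flip: enc_add)
  show "c *c x \<in> enc S ` F" if "x \<in> enc S ` F" for x c
    using that assms unfolding fspace_def by (auto simp flip: enc_scale)
qed

lemma homs_fspace:
  assumes "cfun.subspace T" "\<And>i. i \<in> I \<Longrightarrow> lin_on T (b i)"
  shows "fspace (homs I S a T b)"
  unfolding fspace_def
proof (intro conjI ballI allI)
  show "(\<lambda>v. 0) \<in> homs I S a T b"
    using assms lin_on_zero by (force intro!: homsI lin_on_const_zero simp: cfun.subspace_0)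
  fix f assume f: "f \<in> homs I S a T b"
  show "(\<lambda>v. c *c f v) \<in> homs I S a T b" for c
    using homsD[OF f] assms
    by (intro homsI lin_on_scale_fun) (auto simp: cfun.subspace_scale lin_on_scale[of T])
  fix g assume g: "g \<in> homs I S a T b"
  show "(\<lambda>v. f v + g v) \<in> homs I S a T b"
    using homsD[OF f] homsD[OF g] assms
    by (intro homsI lin_on_add_fun) (auto simp: cfun.subspace_add lin_on_add[of T])
qed

text \<open>All identifications of operator spaces below have the form \<open>f \<mapsto> \<beta> \<circ> f \<circ> \<alpha>\<close>.\<close>

lemma fdim_eqI:
  fixes \<beta> :: "'y vec \<Rightarrow> 'z vec" and \<alpha> :: "'w vec \<Rightarrow> 'x vec"
  assumes F: "fspace F" and T: "\<And>f v. f \<in> F \<Longrightarrow> v \<in> S \<Longrightarrow> f v \<in> T"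
    and \<alpha>: "\<And>v. v \<in> S' \<Longrightarrow> \<alpha> v \<in> S" and \<beta>: "lin_on T \<beta>"
    and into: "\<And>f. f \<in> F \<Longrightarrow> (\<lambda>v. \<beta> (f (\<alpha> v))) \<in> G"
    and inj: "\<And>f v. f \<in> F \<Longrightarrow> (\<And>v. v \<in> S' \<Longrightarrow> \<beta> (f (\<alpha> v)) = 0) \<Longrightarrow> v \<in> S \<Longrightarrow> f v = 0"
    and surj: "\<And>g. g \<in> G \<Longrightarrow> \<exists>f\<in>F. \<forall>v\<in>S'. \<beta> (f (\<alpha> v)) = g v"
  shows "fdim S F = fdim S' G"
proof -
  define \<Phi> :: "('x vec \<times> 'y \<Rightarrow> complex) \<Rightarrow> 'w vec \<times> 'z \<Rightarrow> complex"
    where "\<Phi> H = enc S' (\<lambda>v. \<beta> (\<lambda>y. H (\<alpha> v, y)))" for H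
  have \<Phi>: "\<Phi> (enc S f) = enc S' (\<lambda>v. \<beta> (f (\<alpha> v)))" for f
    unfolding \<Phi>_def enc_eq_iff by (auto simp: enc_def \<alpha>)
  have sub: "cfun.subspace (enc S ` F)" by (rule fspace_subspace[OF F])
  have "lin_on (enc S ` F) \<Phi>"
    unfolding lin_on_def
  proof (intro conjI ballI allI)
    fix H a assume "H \<in> enc S ` F"
    then obtain f where f: "f \<in> F" "H = enc S f" by auto
    have "enc S' (\<lambda>v. \<beta> (a *c f (\<alpha> v))) = enc S' (\<lambda>v. a *c \<beta> (f (\<alpha> v)))"
      unfolding enc_eq_iff using lin_on_scale[OF \<beta>] T f \<alpha> by auto
    then show "\<Phi> (a *c H) = a *c \<Phi> H" by (simp add: f \<Phi> flip: enc_scale)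
    fix K assume "K \<in> enc S ` F"
    then obtain g where g: "g \<in> F" "K = enc S g" by auto
    have "enc S' (\<lambda>v. \<beta> (f (\<alpha> v) + g (\<alpha> v))) = enc S' (\<lambda>v. \<beta> (f (\<alpha> v)) + \<beta> (g (\<alpha> v)))"
      unfolding enc_eq_iff using lin_on_add[OF \<beta>] T f g \<alpha> by auto
    then show "\<Phi> (H + K) = \<Phi> H + \<Phi> K" by (simp add: f g \<Phi> flip: enc_add)
  qed
  moreover from this have "inj_on \<Phi> (enc S ` F)"
    using inj by (auto simp: lin_on_inj_iff[OF _ sub] \<Phi> enc_eq_0_iff)
  ultimately have "cfun.dim (\<Phi> ` enc S ` F) = fdim S F"
    unfolding fdim_def using dim_lin_image sub by blast
  moreover have "\<Phi> ` enc S ` F = enc S' ` G"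
  proof
    show "\<Phi> ` enc S ` F \<subseteq> enc S' ` G" using into by (auto simp: \<Phi>)
    show "enc S' ` G \<subseteq> \<Phi> ` enc S ` F"
    proof
      fix H assume "H \<in> enc S' ` G"
      then obtain g where g: "g \<in> G" "H = enc S' g" by auto
      then obtain f where f: "f \<in> F" "\<forall>v\<in>S'. \<beta> (f (\<alpha> v)) = g v" using surj by blast
      then have "\<Phi> (enc S f) = H" unfolding \<Phi> g(2) enc_eq_iff by simp
      then show "H \<in> \<Phi> ` enc S ` F" using f by auto
    qed
  qed
  ultimately show ?thesis by (simp add: fdim_def)
qed

lemma homs_inverse:
  assumes \<phi>: "\<phi> \<in> homs I S a T b" and bij: "bij_betw \<phi> S T"
    and S: "cfun.subspace S" "\<And>i v. i \<in> I \<Longrightarrow> v \<in> S \<Longrightarrow> a i v \<in> S"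
  shows "inv_into S \<phi> \<in> homs I T b S a" "bij_betw (inv_into S \<phi>) T S"
proof -
  note \<phi> = homsD[OF \<phi>]
  have inj: "inj_on \<phi> S" and img: "\<phi> ` S = T" using bij by (auto simp: bij_betw_def)
  let ?f = "inv_into S \<phi>"
  have f: "?f v \<in> S" "\<phi> (?f v) = v" if "v \<in> T" for v
    using that img inv_into_into[of v \<phi> S] f_inv_into_f[of v \<phi> S] by blast+
  have img': "\<exists>u\<in>S. v = \<phi> u" if "v \<in> T" for v using that img by auto
  have fe: "?f (\<phi> u) = u" if "u \<in> S" for u using inj that by simp
  show "?f \<in> homs I T b S a"
  proof (rule homsI)
    show "?f v \<in> S" if "v \<in> T" for v using f that by simp
    show "?f (b i v) = a i (?f v)" if "i \<in> I" "v \<in> T" for i v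
      using img'[OF that(2)] fe S(2)[OF that(1)] \<phi>(3)[OF that(1)] by (metis)
    show "lin_on T ?f" unfolding lin_on_def
    proof (intro conjI ballI allI)
      show "?f (u + v) = ?f u + ?f v" if "u \<in> T" "v \<in> T" for u v
        using img'[OF that(1)] img'[OF that(2)] fe lin_on_add[OF \<phi>(1)] cfun.subspace_add[OF S(1)] by metis
      show "?f (c *c u) = c *c ?f u" if "u \<in> T" for u c
        using img'[OF that] fe lin_on_scale[OF \<phi>(1)] cfun.subspace_scale[OF S(1)] by metis
    qed
  qed
  show "bij_betw ?f T S" using bij by (rule bij_betw_inv_into)
qed

lemma homs_comp:
  "f \<in> homs I S a T b \<Longrightarrow> g \<in> homs I T b R c \<Longrightarrow> (\<lambda>v. g (f v)) \<in> homs I S a R c"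
  by (rule homsI) (auto simp: homsD intro!: lin_on_comp[of S f T g] dest: homsD)

lemma hdim_iso_right:
  assumes "cfun.subspace T" "\<And>i. i \<in> I \<Longrightarrow> lin_on T (b i)" "\<And>i v. i \<in> I \<Longrightarrow> v \<in> T \<Longrightarrow> b i v \<in> T"
    and "\<phi> \<in> homs I T b T' b'" "bij_betw \<phi> T T'"
    and S: "cfun.subspace S" "\<And>i v. i \<in> I \<Longrightarrow> v \<in> S \<Longrightarrow> a i v \<in> S"
  shows "hdim I S a T b = hdim I S a T' b'"
proof (rule fdim_eqI[where \<alpha>="\<lambda>v. v" and \<beta>=\<phi> and T=T])
  note \<phi> = homsD[OF assms(4)]
  have inj: "inj_on \<phi> T" and img: "\<phi> ` T = T'" using assms(5) by (auto simp: bij_betw_def)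
  show "fspace (homs I S a T b)" by (rule homs_fspace) (use assms in auto)
  show "lin_on T \<phi>" by (rule \<phi>)
  show "f v \<in> T" if "f \<in> homs I S a T b" "v \<in> S" for f v using homsD[OF that(1)] that by auto
  show "(\<lambda>v. \<phi> (f v)) \<in> homs I S a T' b'" if "f \<in> homs I S a T b" for f
    using homsD[OF that] \<phi> by (auto intro!: homsI intro: lin_on_comp)
  show "f v = 0" if "f \<in> homs I S a T b" "\<And>v. v \<in> S \<Longrightarrow> \<phi> (f v) = 0" "v \<in> S" for f v
    using that homsD[OF that(1)] inj lin_on_inj_iff[OF \<phi>(1) assms(1)] by auto
  show "\<exists>f\<in>homs I S a T b. \<forall>v\<in>S. \<phi> (f v) = g v" if g: "g \<in> homs I S a T' b'" for g
  proof (rule bexI[OF _ homs_comp[OF g homs_inverse(1)[OF assms(4,5,1,3)]]])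
    show "\<forall>v\<in>S. \<phi> (inv_into T \<phi> (g v)) = g v"
      using homsD(2)[OF g] img f_inv_into_f[of _ \<phi> T] by blast
  qed
qed auto

lemma hdim_iso_left:
  assumes \<phi>: "\<phi> \<in> homs I S a S' a'" and bij: "bij_betw \<phi> S S'"
    and S: "cfun.subspace S" "\<And>i v. i \<in> I \<Longrightarrow> v \<in> S \<Longrightarrow> a i v \<in> S"
    and T: "cfun.subspace T" "\<And>i. i \<in> I \<Longrightarrow> lin_on T (b i)"
  shows "hdim I S a T b = hdim I S' a' T b"
proof (rule sym, rule fdim_eqI[where \<alpha>=\<phi> and \<beta>="\<lambda>v. v" and T=T])
  note p = homsD[OF \<phi>]
  have img: "\<phi> ` S = S'" and inj: "inj_on \<phi> S" using bij by (auto simp: bij_betw_def)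
  show "fspace (homs I S' a' T b)" by (rule homs_fspace) (use T in auto)
  show "f v \<in> T" if "f \<in> homs I S' a' T b" "v \<in> S'" for f v using homsD[OF that(1)] that by auto
  show "\<phi> v \<in> S'" if "v \<in> S" for v using p that by auto
  show "lin_on T (\<lambda>v. v)" by (rule lin_on_id)
  show "(\<lambda>v. f (\<phi> v)) \<in> homs I S a T b" if "f \<in> homs I S' a' T b" for f
    using homs_comp[OF \<phi> that] .
  show "f v = 0" if "\<And>v. v \<in> S \<Longrightarrow> f (\<phi> v) = 0" "v \<in> S'" for f v
    using that img by auto
  show "\<exists>f\<in>homs I S' a' T b. \<forall>v\<in>S. f (\<phi> v) = g v" if "g \<in> homs I S a T b" for g
    using homs_comp[OF homs_inverse(1)[OF \<phi> bij S] that] inj by (intro bexI) auto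
qed

lemma fd_enc:
  assumes "fd S" "fd T" "fspace F" "\<And>f. f \<in> F \<Longrightarrow> lin_on S f" "\<And>f v. f \<in> F \<Longrightarrow> v \<in> S \<Longrightarrow> f v \<in> T"
  shows "fd (enc S ` F)"
proof -
  obtain B where B: "finite B" "B \<subseteq> S" "cfun.independent B" "cfun.span B = S" using fd_basis[OF assms(1)] .
  obtain C where C: "finite C" "C \<subseteq> T" "cfun.independent C" "cfun.span C = T" using fd_basis[OF assms(2)] .
  define X where "X = (\<lambda>(b, w). enc S (\<lambda>v. cfun.representation B v b *c w)) ` (B \<times> C)"
  have "enc S f \<in> cfun.span X" if "f \<in> F" for f
  proof -
    have "f v = (\<Sum>b\<in>B. \<Sum>w\<in>C. cfun.representation C (f b) w *c cfun.representation B v b *c w)"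
      if v: "v \<in> S" for v
    proof -
      have "v = (\<Sum>b\<in>B. cfun.representation B v b *c b)"
        using cfun.sum_representation_eq[OF B(3)] v B by auto
      then have "f v = f (\<Sum>b\<in>B. cfun.representation B v b *c b)" by simp
      also have "\<dots> = (\<Sum>b\<in>B. f (cfun.representation B v b *c b))"
        using assms(4)[OF \<open>f \<in> F\<close>] fd_subspace[OF assms(1)] B
        by (intro lin_on_sum) (auto intro: cfun.subspace_scale)
      also have "\<dots> = (\<Sum>b\<in>B. cfun.representation B v b *c f b)"
        using assms(4)[OF \<open>f \<in> F\<close>] B by (intro sum.cong) (auto intro: lin_on_scale)
      also have "\<dots> = (\<Sum>b\<in>B. cfun.representation B v b *c (\<Sum>w\<in>C. cfun.representation C (f b) w *c w))"
      proof (rule sum.cong[OF refl])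
        fix b assume "b \<in> B"
        then have "f b \<in> T" using assms(5) \<open>f \<in> F\<close> B by auto
        then have "(\<Sum>w\<in>C. cfun.representation C (f b) w *c w) = f b"
          using cfun.sum_representation_eq[OF C(3)] C by auto
        then show "cfun.representation B v b *c f b =
          cfun.representation B v b *c (\<Sum>w\<in>C. cfun.representation C (f b) w *c w)" by simp
      qed
      finally show ?thesis
        by (simp only: cfun.scale_sum_right cfun.scale_left_commute)
    qed
    then have "enc S f = enc S (\<lambda>v. \<Sum>b\<in>B. \<Sum>w\<in>C. cfun.representation C (f b) w *c cfun.representation B v b *c w)"
      unfolding enc_eq_iff by simp
    also have "\<dots> = (\<Sum>b\<in>B. \<Sum>w\<in>C. cfun.representation C (f b) w *c enc S (\<lambda>v. cfun.representation B v b *c w))"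
    proof -
      have es: "enc S (\<lambda>v. \<Sum>i\<in>K. h i v) = (\<Sum>i\<in>K. enc S (h i))" if "finite K"
        for K :: "'u vec set" and h :: "'u vec \<Rightarrow> 'a vec \<Rightarrow> 'b vec"
        using that by (induction K rule: finite_induct) (auto simp: enc_zero enc_add)
      show ?thesis by (simp only: es[OF B(1)] es[OF C(1)] enc_scale)
    qed
    also have "\<dots> \<in> cfun.span X"
      by (intro cfun.span_sum cfun.span_scale cfun.span_base) (auto simp: X_def)
    finally show ?thesis .
  qed
  moreover have "finite X" using B C by (simp add: X_def)
  ultimately show ?thesis
    using fd_mono[of "cfun.span X" "enc S ` F"] fspace_subspace[OF assms(3)] by (auto simp: fd_def)
qed

text \<open>
  If the operator space is the sum of two subspaces that meet only in operators vanishing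
  on \<open>S\<close>, dimensions add up.
\<close>

lemma fdim_split:
  assumes "fd (enc S ` F)" "fspace F1" "fspace F2"
    and "F1 \<subseteq> F" "F2 \<subseteq> F" "fspace F"
    and "\<And>f g v. f \<in> F1 \<Longrightarrow> g \<in> F2 \<Longrightarrow> (\<And>v. v \<in> S \<Longrightarrow> f v = g v) \<Longrightarrow> v \<in> S \<Longrightarrow> f v = 0"
    and "\<And>f. f \<in> F \<Longrightarrow> \<exists>f1\<in>F1. \<exists>f2\<in>F2. \<forall>v\<in>S. f v = f1 v + f2 v"
  shows "fdim S F = fdim S F1 + fdim S F2"
proof -
  have "splits (enc S ` F) (enc S ` F1) (enc S ` F2)"
    unfolding splits_def
  proof (intro conjI)
    show s1: "cfun.subspace (enc S ` F1)" and s2: "cfun.subspace (enc S ` F2)"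
      using fspace_subspace assms(2,3) by auto
    have "x = 0" if "x \<in> enc S ` F1" "x \<in> enc S ` F2" for x
    proof -
      obtain f g where "f \<in> F1" "g \<in> F2" "x = enc S f" "enc S f = enc S g" using \<open>x \<in> enc S ` F1\<close> \<open>x \<in> enc S ` F2\<close> by auto
      then have "\<forall>v\<in>S. f v = 0" using assms(7)[of f g] unfolding enc_eq_iff by blast
      then show "x = 0" using \<open>x = enc S f\<close> enc_eq_0_iff by metis
    qed
    then show "enc S ` F1 \<inter> enc S ` F2 = {0}"
      using cfun.subspace_0[OF s1] cfun.subspace_0[OF s2] by auto
    show "enc S ` F = {x + y |x y. x \<in> enc S ` F1 \<and> y \<in> enc S ` F2}"
    proof (intro subset_antisym subsetI)
      fix x assume "x \<in> enc S ` F"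
      then obtain f where "f \<in> F" "x = enc S f" by auto
      moreover then obtain f1 f2 where "f1 \<in> F1" "f2 \<in> F2" "\<forall>v\<in>S. f v = f1 v + f2 v"
        using assms(8) by blast
      ultimately have "x = enc S f1 + enc S f2" unfolding enc_add[symmetric] by (simp add: enc_eq_iff)
      then show "x \<in> {x + y |x y. x \<in> enc S ` F1 \<and> y \<in> enc S ` F2}" using \<open>f1 \<in> F1\<close> \<open>f2 \<in> F2\<close> by blast
    next
      fix x assume "x \<in> {x + y |x y. x \<in> enc S ` F1 \<and> y \<in> enc S ` F2}"
      then obtain f1 f2 where "f1 \<in> F1" "f2 \<in> F2" and x: "x = enc S f1 + enc S f2" by auto
      then show "x \<in> enc S ` F" unfolding x
        using assms(4-6) unfolding fspace_def enc_add[symmetric] by blast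
    qed
  qed
  then show ?thesis using dim_splits assms(1) unfolding fdim_def by blast
qed

lemma hdim_sum_right:
  assumes T: "splits T X Y" and fdS: "fd S" and fdT: "fd T"
    and lin: "\<And>i. i \<in> I \<Longrightarrow> lin_on T (b i)"
    and bX: "\<And>i v. i \<in> I \<Longrightarrow> v \<in> X \<Longrightarrow> b i v \<in> X" and bY: "\<And>i v. i \<in> I \<Longrightarrow> v \<in> Y \<Longrightarrow> b i v \<in> Y"
    and aS: "\<And>i v. i \<in> I \<Longrightarrow> v \<in> S \<Longrightarrow> a i v \<in> S"
  shows "hdim I S a T b = hdim I S a X b + hdim I S a Y b"
proof (rule fdim_split)
  have X: "cfun.subspace X" "X \<subseteq> T" and Y: "cfun.subspace Y" "Y \<subseteq> T"
    using splits_sub[OF T] T by (auto simp: splits_def)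
  show sp: "fspace (homs I S a T b)" by (rule homs_fspace) (use lin fd_subspace fdT in auto)
  show "fspace (homs I S a X b)" "fspace (homs I S a Y b)"
    using lin X Y by (auto intro!: homs_fspace intro: lin_on_subset[of T])
  show "homs I S a X b \<subseteq> homs I S a T b" "homs I S a Y b \<subseteq> homs I S a T b"
    using X Y by (auto simp: homs_def)
  show "fd (enc S ` homs I S a T b)"
    by (rule fd_enc[OF fdS fdT sp]) (auto simp: homs_def)
  show "f v = 0" if "f \<in> homs I S a X b" "g \<in> homs I S a Y b" "\<And>v. v \<in> S \<Longrightarrow> f v = g v" "v \<in> S" for f g v
  proof -
    have "f v \<in> X \<inter> Y" using homsD(2)[OF that(1,4)] homsD(2)[OF that(2,4)] that(3)[OF that(4)] by simp
    then show ?thesis using T unfolding splits_def by blast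
  qed
  fix f assume f: "f \<in> homs I S a T b"
  note f = homsD[OF f]
  let ?p = "comp1 X Y" 
  have pe: "?p (b i t) = b i (?p t)" "b i (t - ?p t) = b i t - b i (?p t)" if i: "i \<in> I" and t: "t \<in> T" for i t
  proof -
    note c = comp1[OF T t]
    show e: "b i (t - ?p t) = b i t - b i (?p t)"
      using lin_on_diff[OF lin[OF i] fd_subspace[OF fdT] t] c X by auto
    have "b i (?p t) + b i (t - ?p t) = b i t" by (simp add: e)
    then show "?p (b i t) = b i (?p t)" using comp1_add[OF T bX[OF i c(1)] bY[OF i c(2)]] by simp
  qed
  have 1: "(\<lambda>v. ?p (f v)) \<in> homs I S a X b"
  proof (rule homsI)
    show "lin_on S (\<lambda>v. ?p (f v))" by (rule lin_on_comp[OF f(1) _ comp1_lin[OF T]]) (use f in auto)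
    show "?p (f v) \<in> X" if "v \<in> S" for v using comp1[OF T f(2)[OF that]] by simp
    show "?p (f (a i v)) = b i (?p (f v))" if "i \<in> I" "v \<in> S" for i v
      using f(3)[OF that] pe(1)[OF that(1) f(2)[OF that(2)]] by simp
  qed
  have 2: "(\<lambda>v. f v - ?p (f v)) \<in> homs I S a Y b"
  proof (rule homsI)
    show "lin_on S (\<lambda>v. f v - ?p (f v))" by (rule lin_on_diff_fun[OF f(1) homsD(1)[OF 1]])
    show "f v - ?p (f v) \<in> Y" if "v \<in> S" for v using comp1[OF T f(2)[OF that]] by simp
    show "f (a i v) - ?p (f (a i v)) = b i (f v - ?p (f v))" if "i \<in> I" "v \<in> S" for i v
      using f(3)[OF that] pe[OF that(1) f(2)[OF that(2)]] by simp
  qed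
  show "\<exists>f1\<in>homs I S a X b. \<exists>f2\<in>homs I S a Y b. \<forall>v\<in>S. f v = f1 v + f2 v"
    by (rule bexI[OF _ 1], rule bexI[OF _ 2]) auto
qed

lemma hdim_sum_left:
  assumes S: "splits S X Y" and fdS: "fd S" and fdT: "fd T"
    and lin: "\<And>i. i \<in> I \<Longrightarrow> lin_on T (b i)" and lina: "\<And>i. i \<in> I \<Longrightarrow> lin_on S (a i)"
    and aX: "\<And>i v. i \<in> I \<Longrightarrow> v \<in> X \<Longrightarrow> a i v \<in> X" and aY: "\<And>i v. i \<in> I \<Longrightarrow> v \<in> Y \<Longrightarrow> a i v \<in> Y"
  shows "hdim I S a T b = hdim I X a T b + hdim I Y a T b"
proof -
  define F where "F Z = {f \<in> homs I S a T b. \<forall>v\<in>Z. f v = 0}" for Z :: "'a vec set"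
  have subT: "cfun.subspace T" using fd_subspace fdT by auto
  have sp: "fspace (homs I S a T b)" by (rule homs_fspace) (use lin subT in auto)
  have spF: "fspace (F Z)" for Z
    using sp unfolding F_def fspace_def by simp
  have half: "fdim S (F Y) = hdim I X a T b"
    if s: "splits S X Y" and aX: "\<And>i v. i \<in> I \<Longrightarrow> v \<in> X \<Longrightarrow> a i v \<in> X"
      and aY: "\<And>i v. i \<in> I \<Longrightarrow> v \<in> Y \<Longrightarrow> a i v \<in> Y" for X Y
  proof (rule fdim_eqI[where \<alpha>="\<lambda>v. v" and \<beta>="\<lambda>v. v" and T=T])
    have XY: "X \<subseteq> S" "Y \<subseteq> S" "cfun.subspace X" "cfun.subspace Y" "cfun.subspace S"
      using splits_sub[OF s] splits_subspace[OF s] s by (auto simp: splits_def)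
    show "fspace (F Y)" by (rule spF)
    show "f v \<in> T" if "f \<in> F Y" "v \<in> S" for f v using that by (auto simp: F_def homs_def)
    show "v \<in> S" if "v \<in> X" for v using that XY by auto
    show "lin_on T (\<lambda>v. v)" by (rule lin_on_id)
    show "(\<lambda>v. f v) \<in> homs I X a T b" if "f \<in> F Y" for f
      using that XY by (auto simp: F_def homs_def intro: lin_on_subset[of S])
    show "f v = 0" if f: "f \<in> F Y" "\<And>v. v \<in> X \<Longrightarrow> f v = 0" "v \<in> S" for f v
    proof -
      obtain x y where "x \<in> X" "y \<in> Y" "v = x + y" using f(3) s by (auto simp: splits_def)
      moreover have "lin_on S f" using f(1) by (auto simp: F_def homs_def)
      ultimately show ?thesis using f XY by (auto simp: lin_on_add[of S] F_def subset_iff)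
    qed
    fix g assume g: "g \<in> homs I X a T b"
    note gD = homsD[OF g]
    have "(\<lambda>v. g (comp1 X Y v)) \<in> homs I S a T b"
    proof (rule homsI)
      show "lin_on S (\<lambda>v. g (comp1 X Y v))"
        using lin_on_comp[OF comp1_lin[OF s] _ gD(1)] comp1[OF s] by auto
      show "g (comp1 X Y v) \<in> T" if "v \<in> S" for v using gD comp1[OF s that] by auto
      fix i v assume i: "i \<in> I" and v: "v \<in> S"
      note c = comp1[OF s v]
      have "a i (v - comp1 X Y v) = a i v - a i (comp1 X Y v)"
        using lin_on_diff[OF lina[OF i] XY(5) v] c XY by auto
      then have "a i (comp1 X Y v) + a i (v - comp1 X Y v) = a i v" by simp
      then have "comp1 X Y (a i v) = a i (comp1 X Y v)"
        using comp1_add[OF s aX[OF i c(1)] aY[OF i c(2)]] by simp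
      then show "g (comp1 X Y (a i v)) = b i (g (comp1 X Y v))" using gD(3)[OF i c(1)] by simp
    qed
    moreover have "g (comp1 X Y v) = 0" if "v \<in> Y" for v
      using comp1_add[OF s, of 0 v] that XY lin_on_zero[OF gD(1)] by (auto simp: cfun.subspace_0)
    moreover have "g (comp1 X Y v) = g v" if "v \<in> X" for v
      using comp1_add[OF s, of v 0] that XY by (auto simp: cfun.subspace_0)
    ultimately show "\<exists>f\<in>F Y. \<forall>v\<in>X. f v = g v"
      by (intro bexI[of _ "\<lambda>v. g (comp1 X Y v)"]) (auto simp: F_def)
  qed
  have "hdim I S a T b = fdim S (F Y) + fdim S (F X)"
  proof (rule fdim_split)
    have XY: "X \<subseteq> S" "Y \<subseteq> S" "cfun.subspace S"
      using splits_sub[OF S] splits_subspace[OF S] by auto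
    show "fspace (F Y)" "fspace (F X)" "fspace (homs I S a T b)" using sp spF by auto
    show "F Y \<subseteq> homs I S a T b" "F X \<subseteq> homs I S a T b" by (auto simp: F_def)
    show "fd (enc S ` homs I S a T b)"
      by (rule fd_enc[OF fdS fdT sp]) (auto simp: homs_def)
    show "f v = 0" if "f \<in> F Y" "g \<in> F X" "\<And>v. v \<in> S \<Longrightarrow> f v = g v" and v: "v \<in> S" for f g v
    proof -
      obtain x y where xy: "x \<in> X" "y \<in> Y" "v = x + y" using v S by (auto simp: splits_def)
      have "lin_on S f" using that by (auto simp: F_def homs_def)
      then have "f v = f x + f y" using xy XY by (auto simp: lin_on_add[of S] subset_iff)
      moreover have "f y = 0" using that xy by (auto simp: F_def)
      moreover have "f x = 0" using that xy XY by (auto simp: F_def)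
      ultimately show ?thesis by simp
    qed
    fix f assume f: "f \<in> homs I S a T b"
    have "\<exists>g\<in>F Y. \<forall>v\<in>X. g v = f v"
      if s: "splits S X Y" and aX: "\<And>i v. i \<in> I \<Longrightarrow> v \<in> X \<Longrightarrow> a i v \<in> X"
        and aY: "\<And>i v. i \<in> I \<Longrightarrow> v \<in> Y \<Longrightarrow> a i v \<in> Y" for X Y
    proof (intro bexI ballI)
      have XY: "X \<subseteq> S" "Y \<subseteq> S" "cfun.subspace X" "cfun.subspace Y" "cfun.subspace S"
        using splits_sub[OF s] splits_subspace[OF s] s by (auto simp: splits_def)
      note fD = homsD[OF f]
      show "f (comp1 X Y v) = f v" if "v \<in> X" for v
        using comp1_add[OF s, of v 0] that XY by (auto simp: cfun.subspace_0)
      have "(\<lambda>v. f (comp1 X Y v)) \<in> homs I S a T b"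
      proof (rule homsI)
        show "lin_on S (\<lambda>v. f (comp1 X Y v))"
          using lin_on_comp[OF comp1_lin[OF s] _ fD(1)] comp1[OF s] XY by auto
        show "f (comp1 X Y v) \<in> T" if "v \<in> S" for v using fD comp1[OF s that] XY by auto
        fix i v assume i: "i \<in> I" and v: "v \<in> S"
        note c = comp1[OF s v]
        have "a i (v - comp1 X Y v) = a i v - a i (comp1 X Y v)"
          using lin_on_diff[OF lina[OF i] XY(5) v] c XY by auto
        then have "a i (comp1 X Y v) + a i (v - comp1 X Y v) = a i v" by simp
        then have "comp1 X Y (a i v) = a i (comp1 X Y v)"
          using comp1_add[OF s aX[OF i c(1)] aY[OF i c(2)]] by simp
        then show "f (comp1 X Y (a i v)) = b i (f (comp1 X Y v))" using fD(3)[OF i] c XY by auto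
      qed
      moreover have "f (comp1 X Y v) = 0" if "v \<in> Y" for v
        using comp1_add[OF s, of 0 v] that XY lin_on_zero[OF fD(1)] by (auto simp: cfun.subspace_0)
      ultimately show "(\<lambda>v. f (comp1 X Y v)) \<in> F Y" by (auto simp: F_def)
    qed
    from this[OF S aX aY] this[OF splits_swap[OF S] aY aX]
    obtain g h where gh: "g \<in> F Y" "\<forall>v\<in>X. g v = f v" "h \<in> F X" "\<forall>v\<in>Y. h v = f v" by auto
    have "f v = g v + h v" if v: "v \<in> S" for v
    proof -
      obtain x y where xy: "x \<in> X" "y \<in> Y" "v = x + y" using v S by (auto simp: splits_def)
      have "lin_on S g" "lin_on S h" "lin_on S f" "g y = 0" "h x = 0"
        using gh xy f by (auto simp: F_def homs_def)
      then show ?thesis using xy gh XY by (auto simp: lin_on_add[of S] subset_iff)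
    qed
    then show "\<exists>f1\<in>F Y. \<exists>f2\<in>F X. \<forall>v\<in>S. f v = f1 v + f2 v" using gh by blast
  qed
  then show ?thesis using half[OF S aX aY] half[OF splits_swap[OF S] aY aX] by simp
qed

section \<open>Supermodules through the parity involution\<close>

definition sg :: "('g, 'x) smod \<Rightarrow> 'x vec \<Rightarrow> 'x vec" where
  "sg V v = comp1 (hpart V 0) (hpart V 1) v - (v - comp1 (hpart V 0) (hpart V 1) v)"

text \<open>
  A homomorphism $f = f_0 + f_1$ satisfies $f_p(av) = (-1)^{p\bar a} a f_p(v)$, with a sign that
  depends on the component. Composing the odd generators with the parity involution absorbs this
  sign: homomorphisms of both parities become the linear maps that commute with the operators
  below, and parity shift leaves these operators unchanged.
\<close>

definition tact :: "'g sgens \<Rightarrow> ('g, 'x) smod \<Rightarrow> 'g \<Rightarrow> 'x vec \<Rightarrow> 'x vec" where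
  "tact A V g v = (if gpar A g = 0 then act V g v else act V g (sg V v))"

abbreviation graded :: "('g, 'x) smod \<Rightarrow> bool" where
  "graded V \<equiv> splits (carr V) (hpart V 0) (hpart V 1)"

definition gmod :: "'g sgens \<Rightarrow> ('g, 'x) smod \<Rightarrow> bool" where
  "gmod A V \<longleftrightarrow> graded V \<and> (\<forall>g\<in>gens A. lin_on (carr V) (act V g) \<and>
        (\<forall>p. act V g ` hpart V p \<subseteq> hpart V (p + gpar A g)))"

lemma bit_01: "(p::bit) = 0 \<or> p = 1"
  by (cases p) auto

lemma all_bit: "(\<forall>p::bit. P p) \<longleftrightarrow> P 0 \<and> P 1"
  using bit_01 by metis

lemma ssign_simps [simp]: "ssign 0 p = 1" "ssign p 0 = 1" "ssign 1 1 = -1"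
  by (auto simp: ssign_def)

lemma ssign_commute: "ssign p q = ssign q p"
  by (auto simp: ssign_def)

lemma ssign_mult_self [simp]: "ssign p q * ssign p q = 1"
  by (auto simp: ssign_def)

lemma ssign_add: "ssign 1 (p + q) = ssign 1 p * ssign 1 q"
  using bit_01[of p] bit_01[of q] by (auto simp: ssign_def)

lemma smodule_iff: "smodule A V \<longleftrightarrow> gmod A V \<and> fd (carr V)"
proof -
  have "graded V \<longleftrightarrow> (\<forall>p. cfun.subspace (hpart V p)) \<and> hpart V 0 \<inter> hpart V 1 = {0}"
    unfolding splits_def all_bit carr_def[symmetric] by (simp add: carr_def conj_assoc)
  then show ?thesis unfolding smodule_def gmod_def fd_def by (simp only: ball_conj_distrib) meson
qed

lemma smoduleD:
  assumes "smodule A V"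
  shows "gmod A V" "fd (carr V)" "cfun.subspace (carr V)"
  using assms by (auto simp: smodule_iff fd_subspace)

context
  fixes V :: "('g, 'x) smod"
  assumes gr: "graded V"
begin

lemma carr_subspace: "cfun.subspace (carr V)"
  by (rule splits_subspace[OF gr])

lemma hpart_subspace: "cfun.subspace (hpart V p)"
  using gr bit_01[of p] by (auto simp: splits_def)

lemma hpart_carr: "hpart V p \<subseteq> carr V"
  using splits_sub[OF gr] bit_01[of p] by auto

lemma hpart_in_carr: "v \<in> hpart V p \<Longrightarrow> v \<in> carr V"
  using hpart_carr by auto

lemma carr_cases:
  assumes "v \<in> carr V" obtains v0 v1 where "v0 \<in> hpart V 0" "v1 \<in> hpart V 1" "v = v0 + v1"
  using assms unfolding carr_def by blast

lemma sg_add_parts: "v0 \<in> hpart V 0 \<Longrightarrow> v1 \<in> hpart V 1 \<Longrightarrow> sg V (v0 + v1) = v0 - v1"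
  by (simp add: sg_def comp1_add[OF gr])

lemma sg_hpart: assumes "v \<in> hpart V p" shows "sg V v = ssign 1 p *c v"
proof -
  have "0 \<in> hpart V 0" "0 \<in> hpart V 1" by (simp_all add: cfun.subspace_0 hpart_subspace)
  then show ?thesis using bit_01[of p] sg_add_parts[of v 0] sg_add_parts[of 0 v] assms
    by auto
qed

lemma sg_carr: "v \<in> carr V \<Longrightarrow> sg V v \<in> carr V"
  by (metis carr_cases sg_add_parts cfun.subspace_diff[OF carr_subspace] hpart_in_carr)

lemma sg_sg: assumes "v \<in> carr V" shows "sg V (sg V v) = v"
proof -
  obtain v0 v1 where v: "v0 \<in> hpart V 0" "v1 \<in> hpart V 1" "v = v0 + v1" using carr_cases[OF assms] .
  have "sg V (v0 - v1) = v0 + v1"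
    using sg_add_parts[OF v(1) cfun.subspace_neg[OF hpart_subspace v(2)]] by simp
  then show ?thesis using sg_add_parts v by simp
qed

lemma sg_lin: "lin_on (carr V) (sg V)"
  unfolding sg_def
  by (intro lin_on_diff_fun comp1_lin[OF gr] lin_on_id)

lemma hpart_iff: "v \<in> hpart V p \<longleftrightarrow> v \<in> carr V \<and> sg V v = ssign 1 p *c v"
proof
  assume "v \<in> hpart V p" then show "v \<in> carr V \<and> sg V v = ssign 1 p *c v"
    using sg_hpart hpart_carr by auto
next
  assume a: "v \<in> carr V \<and> sg V v = ssign 1 p *c v"
  obtain v0 v1 where v: "v0 \<in> hpart V 0" "v1 \<in> hpart V 1" "v = v0 + v1"
    using carr_cases a by blast
  have e: "v0 - v1 = ssign 1 p *c (v0 + v1)" using a v sg_add_parts by simp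
  have z: "0 \<in> hpart V 0" "0 \<in> hpart V 1" by (simp_all add: cfun.subspace_0 hpart_subspace)
  show "v \<in> hpart V p"
  proof (cases "p = 0")
    case True
    then have "2 *c v1 = 0" using e by (simp add: fun_eq_iff pointwise)
    then show ?thesis using v True by simp
  next
    case False
    then have p: "p = 1" using bit_01 by auto
    then have "2 *c v0 = 0" using e by (simp add: fun_eq_iff pointwise)
    then show ?thesis using v p by simp
  qed
qed

end

context
  fixes A :: "'g sgens" and V :: "('g, 'x) smod"
  assumes gm: "gmod A V"
begin

lemma gmod_graded: "graded V" using gm by (simp add: gmod_def)

lemma gmod_carr_subspace: "cfun.subspace (carr V)"
  by (rule carr_subspace[OF gmod_graded])

lemma act_lin: "g \<in> gens A \<Longrightarrow> lin_on (carr V) (act V g)"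
  and act_hpart: "g \<in> gens A \<Longrightarrow> v \<in> hpart V p \<Longrightarrow> act V g v \<in> hpart V (p + gpar A g)"
  using gm unfolding gmod_def by blast+

lemma act_carr: assumes "g \<in> gens A" "v \<in> carr V" shows "act V g v \<in> carr V"
proof -
  obtain v0 v1 where v: "v0 \<in> hpart V 0" "v1 \<in> hpart V 1" "v = v0 + v1"
    using carr_cases[OF gmod_graded assms(2)] .
  then have "act V g v = act V g v0 + act V g v1"
    using lin_on_add[OF act_lin[OF assms(1)]] hpart_in_carr[OF gmod_graded] by auto
  then show ?thesis
    using act_hpart[OF assms(1)] v hpart_in_carr[OF gmod_graded] gmod_carr_subspace
    by (metis cfun.subspace_add)
qed

lemma sg_act:
  assumes g: "g \<in> gens A" and v: "v \<in> carr V"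
  shows "sg V (act V g v) = ssign 1 (gpar A g) *c act V g (sg V v)"
proof -
  note gr = gmod_graded
  obtain v0 v1 where v: "v0 \<in> hpart V 0" "v1 \<in> hpart V 1" "v = v0 + v1"
    using carr_cases[OF gr v] .
  have c: "v0 \<in> carr V" "v1 \<in> carr V" using v hpart_in_carr[OF gr] by auto
  have "act V g v = act V g v0 + act V g v1"
    using lin_on_add[OF act_lin[OF g] c] v by simp
  then have "sg V (act V g v) = sg V (act V g v0) + sg V (act V g v1)"
    using lin_on_add[OF sg_lin[OF gr]] act_carr[OF g] c by simp
  also have "\<dots> = ssign 1 (gpar A g) *c act V g v0 - ssign 1 (gpar A g) *c act V g v1"
    using sg_hpart[OF gr act_hpart[OF g v(1)]] sg_hpart[OF gr act_hpart[OF g v(2)]]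
    by (simp add: ssign_add)
  also have "\<dots> = ssign 1 (gpar A g) *c act V g (v0 - v1)"
    using lin_on_diff[OF act_lin[OF g] gmod_carr_subspace c] by (simp add: cfun.scale_right_diff_distrib)
  finally show ?thesis using sg_add_parts[OF gr v(1,2)] v by simp
qed

lemma tact_lin: assumes "g \<in> gens A" shows "lin_on (carr V) (tact A V g)"
proof -
  have "lin_on (carr V) (\<lambda>v. act V g (sg V v))"
    by (rule lin_on_comp[OF sg_lin[OF gmod_graded] _ act_lin[OF assms]])
      (auto intro: sg_carr[OF gmod_graded])
  then show ?thesis using act_lin[OF assms] unfolding tact_def by (cases "gpar A g = 0") auto
qed

lemma tact_carr: "g \<in> gens A \<Longrightarrow> v \<in> carr V \<Longrightarrow> tact A V g v \<in> carr V"
  by (simp add: tact_def act_carr sg_carr[OF gmod_graded])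

lemma sg_tact:
  "g \<in> gens A \<Longrightarrow> v \<in> carr V \<Longrightarrow> sg V (tact A V g v) = ssign 1 (gpar A g) *c tact A V g (sg V v)"
  by (simp add: tact_def sg_act sg_carr[OF gmod_graded])

text \<open>
  A subspace stable under the parity involution is the sum of its intersections with the two
  eigenspaces, so gradedness is one more stability condition.
\<close>

lemma ssubmodule_iff:
  "ssubmodule A V W \<longleftrightarrow> cfun.subspace W \<and> W \<subseteq> carr V \<and> (\<forall>v\<in>W. sg V v \<in> W) \<and>
     (\<forall>g\<in>gens A. \<forall>v\<in>W. tact A V g v \<in> W)"
proof -
  note gr = gmod_graded
  have "(W = {u + v | u v. u \<in> W \<inter> hpart V 0 \<and> v \<in> W \<inter> hpart V 1}) \<longleftrightarrow>
      W \<subseteq> carr V \<and> (\<forall>v\<in>W. sg V v \<in> W)" (is "?L = ?R") if sub: "cfun.subspace W"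
  proof
    assume L: ?L
    have "w \<in> carr V \<and> sg V w \<in> W" if "w \<in> W" for w
    proof -
      have "w \<in> {u + v | u v. u \<in> W \<inter> hpart V 0 \<and> v \<in> W \<inter> hpart V 1}" using that L by blast
      then obtain u v where uv: "u \<in> W" "u \<in> hpart V 0" "v \<in> W" "v \<in> hpart V 1" "w = u + v"
        by blast
      then have "w \<in> carr V" by (auto simp: carr_def)
      then show ?thesis using uv sg_add_parts[OF gr uv(2,4)] cfun.subspace_diff[OF sub] by auto
    qed
    then show ?R by auto
  next
    assume R: ?R
    show ?L
    proof (intro subset_antisym subsetI)
      fix w assume w: "w \<in> W"
      then have wc: "w \<in> carr V" using R by auto
      obtain u v where uv: "u \<in> hpart V 0" "v \<in> hpart V 1" "w = u + v" using carr_cases[OF gr wc] .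
      have h: "(1/2) *c ((u + v) + (u - v)) = u" "(1/2) *c ((u + v) - (u - v)) = v"
        by (rule ext, simp add: pointwise)+
      have "(1/2) *c (w + sg V w) = u" "(1/2) *c (w - sg V w) = v"
        unfolding uv(3) sg_add_parts[OF gr uv(1,2)] by (fact h)+
      moreover have "(1/2) *c (w + sg V w) \<in> W" "(1/2) *c (w - sg V w) \<in> W"
        using w R sub by (auto intro!: cfun.subspace_scale cfun.subspace_add cfun.subspace_diff)
      ultimately have "u \<in> W" "v \<in> W" by simp_all
      then show "w \<in> {u + v | u v. u \<in> W \<inter> hpart V 0 \<and> v \<in> W \<inter> hpart V 1}"
        using uv by auto
    next
      fix w assume "w \<in> {u + v | u v. u \<in> W \<inter> hpart V 0 \<and> v \<in> W \<inter> hpart V 1}"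
      then show "w \<in> W" using cfun.subspace_add[OF sub] by blast
    qed
  qed
  note graded_iff = this
  have act_iff: "(act V g ` W \<subseteq> W) \<longleftrightarrow> (\<forall>v\<in>W. tact A V g v \<in> W)"
    if "W \<subseteq> carr V" "\<forall>v\<in>W. sg V v \<in> W" for g
  proof (cases "gpar A g = 0")
    case True then show ?thesis by (auto simp: tact_def)
  next
    case False
    have "\<forall>v\<in>W. act V g v \<in> W" if a: "\<forall>v\<in>W. act V g (sg V v) \<in> W"
    proof
      fix v assume "v \<in> W"
      then show "act V g v \<in> W" using a that sg_sg[OF gr, of v] \<open>W \<subseteq> carr V\<close> \<open>\<forall>v\<in>W. sg V v \<in> W\<close>
        by (metis subsetD)
    qed
    then show ?thesis using that False by (auto simp: tact_def image_subset_iff)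
  qed
  show ?thesis
  proof
    assume a: "ssubmodule A V W"
    note d = a[unfolded ssubmodule_def]
    note sub = conjunct1[OF d] and g = conjunct1[OF conjunct2[OF d]]
    have act: "act V g ` W \<subseteq> W" if "g \<in> gens A" for g
      using conjunct2[OF conjunct2[OF d]] that by (rule bspec)
    from graded_iff[OF sub] g have R: "W \<subseteq> carr V \<and> (\<forall>v\<in>W. sg V v \<in> W)" by (rule iffD1)
    with sub act act_iff show "cfun.subspace W \<and> W \<subseteq> carr V \<and> (\<forall>v\<in>W. sg V v \<in> W) \<and>
     (\<forall>g\<in>gens A. \<forall>v\<in>W. tact A V g v \<in> W)" by simp
  next
    assume a: "cfun.subspace W \<and> W \<subseteq> carr V \<and> (\<forall>v\<in>W. sg V v \<in> W) \<and>
     (\<forall>g\<in>gens A. \<forall>v\<in>W. tact A V g v \<in> W)"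
    then have sub: "cfun.subspace W" and R: "W \<subseteq> carr V" "\<forall>v\<in>W. sg V v \<in> W"
      and t: "\<And>g. g \<in> gens A \<Longrightarrow> \<forall>v\<in>W. tact A V g v \<in> W" by auto
    show "ssubmodule A V W"
      unfolding ssubmodule_def
      using sub iffD2[OF graded_iff[OF sub] conjI[OF R]] iffD2[OF act_iff[OF R] t]
      by (intro conjI ballI)
  qed
qed

lemma ssubmodule_zero: "ssubmodule A V {0}"
  using lin_on_zero[OF sg_lin[OF gmod_graded] gmod_carr_subspace] lin_on_zero[OF tact_lin gmod_carr_subspace]
    cfun.subspace_0[OF gmod_carr_subspace]
  by (auto simp: ssubmodule_iff)

lemma ssubmodule_carr: "ssubmodule A V (carr V)"
  by (simp add: ssubmodule_iff gmod_carr_subspace sg_carr[OF gmod_graded] tact_carr)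

end

abbreviation shoms where
  "shoms A V W \<equiv> homs (gens A) (carr V) (tact A V) (carr W) (tact A W)"

abbreviation shdim where
  "shdim A V W \<equiv> hdim (gens A) (carr V) (tact A V) (carr W) (tact A W)"

lemma shom_iff:
  assumes V: "gmod A V" and W: "gmod A W"
  shows "shom A p V W f \<longleftrightarrow> f \<in> shoms A V W \<and> (\<forall>v\<in>carr V. f (sg V v) = ssign 1 p *c sg W (f v))"
proof -
  note grV = gmod_graded[OF V] note grW = gmod_graded[OF W]
  have par: "(\<forall>q. f ` hpart V q \<subseteq> hpart W (q + p)) \<longleftrightarrow>
      f ` carr V \<subseteq> carr W \<and> (\<forall>v\<in>carr V. f (sg V v) = ssign 1 p *c sg W (f v))" (is "?L \<longleftrightarrow> ?R")
    if lin: "lin_on (carr V) f"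
  proof
    assume L: ?L
    have "f v \<in> carr W \<and> f (sg V v) = ssign 1 p *c sg W (f v)" if v: "v \<in> carr V" for v
    proof -
      obtain v0 v1 where v: "v0 \<in> hpart V 0" "v1 \<in> hpart V 1" "v = v0 + v1"
        using carr_cases[OF grV v] .
      have c: "v0 \<in> carr V" "v1 \<in> carr V" using v hpart_in_carr[OF grV] by auto
      have f01: "f v0 \<in> hpart W (0 + p)" "f v1 \<in> hpart W (1 + p)" using L v by blast+
      have fc: "f v0 \<in> carr W" "f v1 \<in> carr W" using f01 hpart_in_carr[OF grW] by auto
      have fv: "f v = f v0 + f v1" "f (sg V v) = f v0 - f v1"
        using lin_on_add[OF lin c] lin_on_diff[OF lin carr_subspace[OF grV] c] v sg_add_parts[OF grV v(1,2)]
        by auto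
      have "sg W (f v) = ssign 1 (0 + p) *c f v0 + ssign 1 (1 + p) *c f v1"
        using fv(1) lin_on_add[OF sg_lin[OF grW] fc] sg_hpart[OF grW f01(1)] sg_hpart[OF grW f01(2)] by simp
      then have "ssign 1 p *c sg W (f v) = f v0 - f v1"
        by (simp add: ssign_add cfun.scale_right_distrib cfun.scale_right_diff_distrib)
      then show ?thesis using fv fc cfun.subspace_add[OF carr_subspace[OF grW]] by auto
    qed
    then show ?R by auto
  next
    assume R: ?R
    show ?L
    proof (intro allI subsetI)
      fix q x assume "x \<in> f ` hpart V q"
      then obtain v where v: "v \<in> hpart V q" "x = f v" by auto
      then have vc: "v \<in> carr V" using hpart_in_carr[OF grV] by auto
      have "ssign 1 p *c sg W (f v) = ssign 1 q *c f v"
        using R vc sg_hpart[OF grV v(1)] lin_on_scale[OF lin vc] by auto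
      then have "ssign 1 p *c (ssign 1 p *c sg W (f v)) = ssign 1 p *c (ssign 1 q *c f v)" by simp
      then have "sg W (f v) = ssign 1 (q + p) *c f v" unfolding ssign_add by (simp add: mult.commute)
      then show "x \<in> hpart W (q + p)" using R vc v hpart_iff[OF grW] by auto
    qed
  qed
  have com: "(\<forall>v\<in>carr V. f (act V g v) = ssign p (gpar A g) *c act W g (f v)) \<longleftrightarrow>
      (\<forall>v\<in>carr V. f (tact A V g v) = tact A W g (f v))"
    if lin: "lin_on (carr V) f" and im: "f ` carr V \<subseteq> carr W"
      and s: "\<forall>v\<in>carr V. f (sg V v) = ssign 1 p *c sg W (f v)" and g: "g \<in> gens A" for g
  proof (cases "gpar A g = 0")
    case True then show ?thesis by (simp add: tact_def)
  next
    case False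
    then have g1: "gpar A g = 1" using bit_01 by auto
    have eq: "tact A W g (f v) = ssign p 1 *c act W g (f (sg V v))" if "v \<in> carr V" for v
    proof -
      have fc: "f v \<in> carr W" using im that by auto
      have "act W g (f (sg V v)) = ssign 1 p *c act W g (sg W (f v))"
        using s that lin_on_scale[OF act_lin[OF W g] sg_carr[OF grW fc]] by simp
      then show ?thesis using False by (simp add: tact_def ssign_commute[of p])
    qed
    have "(\<forall>v\<in>carr V. f (tact A V g v) = tact A W g (f v)) \<longleftrightarrow>
       (\<forall>v\<in>carr V. f (act V g (sg V v)) = ssign p 1 *c act W g (f (sg V v)))"
      using eq False by (simp add: tact_def)
    also have "\<dots> \<longleftrightarrow> (\<forall>v\<in>carr V. f (act V g v) = ssign p 1 *c act W g (f v))"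
      using sg_sg[OF grV] sg_carr[OF grV] by metis
    finally show ?thesis using g1 by simp
  qed
  let ?s = "\<forall>v\<in>carr V. f (sg V v) = ssign 1 p *c sg W (f v)"
  show ?thesis
  proof
    assume a: "shom A p V W f"
    then have lin: "lin_on (carr V) f" by (simp add: shom_def)
    note aD = a[unfolded shom_def]
    have R: "f ` carr V \<subseteq> carr W \<and> ?s" by (rule iffD1[OF par[OF lin] conjunct1[OF conjunct2[OF aD]]])
    have "f (tact A V g v) = tact A W g (f v)" if "g \<in> gens A" "v \<in> carr V" for g v
      using iffD1[OF com[OF lin conjunct1[OF R] conjunct2[OF R] that(1)]
          bspec[OF conjunct2[OF conjunct2[OF aD]] that(1)]] that(2) by (rule bspec)
    then show "f \<in> shoms A V W \<and> ?s" using lin R unfolding homs_def by simp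
  next
    assume a: "f \<in> shoms A V W \<and> ?s"
    then have lin: "lin_on (carr V) f" and R: "f ` carr V \<subseteq> carr W \<and> ?s" by (simp_all add: homs_def)
    have "\<forall>v\<in>carr V. f (act V g v) = ssign p (gpar A g) *c act W g (f v)" if "g \<in> gens A" for g
      by (rule iffD2[OF com[OF lin conjunct1[OF R] conjunct2[OF R] that]]) (use a that in "simp add: homs_def")
    then show "shom A p V W f" unfolding shom_def using lin iffD2[OF par[OF lin] R] by simp
  qed
qed

definition hcomp :: "('g, 'x) smod \<Rightarrow> ('g, 'y) smod \<Rightarrow> bit \<Rightarrow> ('x vec \<Rightarrow> 'y vec) \<Rightarrow>
    'x vec \<Rightarrow> 'y vec" where
  "hcomp V W p f v = (1/2) *c (f v + ssign 1 p *c sg W (f (sg V v)))"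

lemma half_sum: "x = (1/2) *c (x + 1 *c y) + (1/2) *c (x + (- 1) *c y)"
  by (rule ext) (simp add: pointwise add_divide_distrib diff_divide_distrib)

lemma hcomp_sum: "f v = hcomp V W 0 f v + hcomp V W 1 f v"
  unfolding hcomp_def ssign_simps by (rule half_sum)

lemma hcomp_shom:
  assumes V: "gmod A V" and W: "gmod A W" and f: "f \<in> shoms A V W"
  shows "shom A p V W (hcomp V W p f)"
proof -
  note grV = gmod_graded[OF V] note grW = gmod_graded[OF W]
  note subW = gmod_carr_subspace[OF W]
  note fD = homsD[OF f]
  have "(\<lambda>v. sg W (f (sg V v))) \<in> shoms A V W"
  proof (rule homsI)
    show "lin_on (carr V) (\<lambda>v. sg W (f (sg V v)))"
      by (rule lin_on_comp[OF lin_on_comp[OF sg_lin[OF grV] _ fD(1)] _ sg_lin[OF grW]])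
        (auto intro: fD(2) sg_carr[OF grV])
    show "sg W (f (sg V v)) \<in> carr W" if "v \<in> carr V" for v
      by (rule sg_carr[OF grW fD(2)[OF sg_carr[OF grV that]]])
    fix g v assume g: "g \<in> gens A" and v: "v \<in> carr V"
    have sv: "sg V v \<in> carr V" and fsv: "f (sg V v) \<in> carr W"
      by (fact sg_carr[OF grV v] fD(2)[OF sg_carr[OF grV v]])+
    have "sg W (f (sg V (tact A V g v))) = sg W (ssign 1 (gpar A g) *c tact A W g (f (sg V v)))"
      using sg_tact[OF V g v] lin_on_scale[OF fD(1) tact_carr[OF V g sv]] fD(3)[OF g sv] by simp
    also have "\<dots> = tact A W g (sg W (f (sg V v)))"
      using lin_on_scale[OF sg_lin[OF grW] tact_carr[OF W g fsv]] sg_tact[OF W g fsv] by simp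
    finally show "sg W (f (sg V (tact A V g v))) = tact A W g (sg W (f (sg V v)))" .
  qed
  note h = this
  have sp: "fspace (shoms A V W)" by (rule homs_fspace[OF subW tact_lin[OF W]])
  have 1: "hcomp V W p f \<in> shoms A V W"
    using fspace_scale[OF sp fspace_add[OF sp f fspace_scale[OF sp h]]] by (simp only: hcomp_def[abs_def])
  have "hcomp V W p f (sg V v) = ssign 1 p *c sg W (hcomp V W p f v)" if v: "v \<in> carr V" for v
  proof -
    have sv: "sg V v \<in> carr V" and fv: "f v \<in> carr W" and fsv: "f (sg V v) \<in> carr W"
      by (fact sg_carr[OF grV v] fD(2)[OF v] fD(2)[OF sg_carr[OF grV v]])+
    have s: "sg W (f (sg V v)) \<in> carr W" using sg_carr[OF grW fsv] .
    have es: "ssign 1 p *c sg W (f (sg V v)) \<in> carr W" by (rule cfun.subspace_scale[OF subW s])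
    have "sg W (hcomp V W p f v) = (1/2) *c (sg W (f v) + ssign 1 p *c f (sg V v))"
      unfolding hcomp_def
      by (simp only: lin_on_scale[OF sg_lin[OF grW] cfun.subspace_add[OF subW fv es]]
          lin_on_add[OF sg_lin[OF grW] fv es] lin_on_scale[OF sg_lin[OF grW] s] sg_sg[OF grW fsv])
    then have "ssign 1 p *c sg W (hcomp V W p f v) =
        ssign 1 p *c ((1/2) *c (sg W (f v) + ssign 1 p *c f (sg V v)))" by (simp only:)
    also have "\<dots> = (1/2) *c (f (sg V v) + ssign 1 p *c sg W (f v))"
      using bit_01[of p] by (auto simp: fun_eq_iff pointwise field_simps)
    also have "\<dots> = hcomp V W p f (sg V v)"
      unfolding hcomp_def sg_sg[OF grV v] ..
    finally show ?thesis by (rule sym)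
  qed
  then show ?thesis using 1 shom_iff[OF V W] by auto
qed

text \<open>
  Replacing an odd generator \<open>g\<close> by \<open>g \<circ> \<sigma>\<close>, with \<open>\<sigma>\<close> the parity involution, absorbs the
  sign $(-1)^{\bar f\bar a}$: all supermodule homomorphisms, of either parity or mixed, become the
  plain intertwiners of the twisted operators.
\<close>

lemma hom_smod_iff:
  assumes V: "gmod A V" and W: "gmod A W"
  shows "hom_smod A V W f \<longleftrightarrow> f \<in> shoms A V W"
proof
  assume "hom_smod A V W f"
  then obtain f0 f1 where f: "shom A 0 V W f0" "shom A 1 V W f1" "\<forall>v\<in>carr V. f v = f0 v + f1 v"
    unfolding hom_smod_def by blast
  then have "f0 \<in> shoms A V W" "f1 \<in> shoms A V W" using shom_iff[OF V W] by auto
  then have s: "(\<lambda>v. f0 v + f1 v) \<in> shoms A V W"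
    by (intro fspace_add[OF homs_fspace[OF gmod_carr_subspace[OF W] tact_lin[OF W]]])
  show "f \<in> shoms A V W"
  proof (rule homsI)
    show "lin_on (carr V) f"
      by (rule lin_on_cong[OF homsD(1)[OF s]]) (use f gmod_carr_subspace[OF V] in auto)
  qed (use f homsD[OF s] tact_carr[OF V] in auto)
next
  assume "f \<in> shoms A V W"
  then show "hom_smod A V W f"
    unfolding hom_smod_def using hcomp_shom[OF V W] hcomp_sum by blast
qed

text \<open>Schur's lemma.\<close>

lemma shom_kernel:
  assumes V: "gmod A V" and W: "gmod A W" and f: "shom A p V W f"
  shows "ssubmodule A V {v \<in> carr V. f v = 0}"
proof -
  have f': "f \<in> shoms A V W" "\<forall>v\<in>carr V. f (sg V v) = ssign 1 p *c sg W (f v)"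
    using f shom_iff[OF V W] by auto
  note fD = homsD[OF f'(1)]
  have z: "sg W 0 = 0" "\<And>g. g \<in> gens A \<Longrightarrow> tact A W g 0 = 0"
    using lin_on_zero[OF sg_lin[OF gmod_graded[OF W]] gmod_carr_subspace[OF W]]
      lin_on_zero[OF tact_lin[OF W] gmod_carr_subspace[OF W]] by auto
  show ?thesis
    unfolding ssubmodule_iff[OF V]
    using subspace_lin_kernel[OF gmod_carr_subspace[OF V] fD(1)] f'(2) fD(3) z
      sg_carr[OF gmod_graded[OF V]] tact_carr[OF V] by auto
qed

lemma shom_image:
  assumes V: "gmod A V" and W: "gmod A W" and f: "shom A p V W f"
  shows "ssubmodule A W (f ` carr V)"
proof -
  have f': "f \<in> shoms A V W" "\<forall>v\<in>carr V. f (sg V v) = ssign 1 p *c sg W (f v)"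
    using f shom_iff[OF V W] by auto
  note fD = homsD[OF f'(1)]
  have "sg W (f v) \<in> f ` carr V" if v: "v \<in> carr V" for v
  proof -
    have "f (ssign 1 p *c sg V v) = sg W (f v)"
      using f'(2) v lin_on_scale[OF fD(1) sg_carr[OF gmod_graded[OF V] v]] by simp
    then show ?thesis
      using v cfun.subspace_scale[OF gmod_carr_subspace[OF V]] sg_carr[OF gmod_graded[OF V]] by (metis imageI)
  qed
  moreover have "tact A W g (f v) \<in> f ` carr V" if "g \<in> gens A" "v \<in> carr V" for g v
    using fD(3)[OF that] tact_carr[OF V that] by (metis imageI)
  ultimately show ?thesis
    unfolding ssubmodule_iff[OF W]
    using subspace_lin_image[OF gmod_carr_subspace[OF V] fD(1)] fD(2) by auto
qed

lemma schur_inj: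
  assumes V: "gmod A V" and W: "gmod A W" and f: "shom A p V W f" and irr: "sirreducible A V"
    and v: "v \<in> carr V" "f v \<noteq> 0"
  shows "inj_on f (carr V)"
proof -
  have "{v \<in> carr V. f v = 0} = {0} \<or> {v \<in> carr V. f v = 0} = carr V"
    using irr shom_kernel[OF V W f] by (auto simp: sirreducible_def)
  then have "{v \<in> carr V. f v = 0} = {0}" using v by blast
  moreover have "lin_on (carr V) f" using f by (simp add: shom_def)
  ultimately show ?thesis
    using lin_on_inj_iff[OF _ gmod_carr_subspace[OF V]] by blast
qed

lemma schur_surj:
  assumes V: "gmod A V" and W: "gmod A W" and f: "shom A p V W f" and irr: "sirreducible A W"
    and v: "v \<in> carr V" "f v \<noteq> 0"
  shows "f ` carr V = carr W"
  using irr shom_image[OF V W f] v by (auto simp: sirreducible_def)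

lemma schur_iso:
  assumes V: "gmod A V" and W: "gmod A W" and f: "f \<in> shoms A V W"
    and irr: "sirreducible A V" "sirreducible A W"
    and v: "v \<in> carr V" "f v \<noteq> 0"
  obtains h p where "shom A p V W h" "h \<in> shoms A V W" "bij_betw h (carr V) (carr W)"
proof -
  have "hcomp V W 0 f v \<noteq> 0 \<or> hcomp V W 1 f v \<noteq> 0"
  proof (rule ccontr)
    assume "\<not> ?thesis"
    then have "hcomp V W 0 f v + hcomp V W 1 f v = 0" by simp
    then show False using v(2) unfolding hcomp_sum[of f v V W, symmetric] by simp
  qed
  then obtain p where p: "hcomp V W p f v \<noteq> 0" by blast
  note s = hcomp_shom[OF V W f, of p]
  have "bij_betw (hcomp V W p f) (carr V) (carr W)"
    using schur_inj[where f="hcomp V W p f" and v=v, OF V W s irr(1) v(1) p]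
      schur_surj[where f="hcomp V W p f" and v=v, OF V W s irr(2) v(1) p] by (simp add: bij_betw_def)
  then show ?thesis by (rule that[OF s conjunct1[OF iffD1[OF shom_iff[OF V W] s]]])
qed

subsection \<open>Submodules\<close>

lemma sub_smod_simps [simp]: "hpart (sub_smod V W) p = hpart V p \<inter> W" "act (sub_smod V W) = act V"
  by (simp_all add: sub_smod_def)

lemma sub_smod:
  assumes V: "gmod A V" and W: "ssubmodule A V W"
  shows "gmod A (sub_smod V W)" "carr (sub_smod V W) = W"
    "v \<in> W \<Longrightarrow> sg (sub_smod V W) v = sg V v" "v \<in> W \<Longrightarrow> tact A (sub_smod V W) g v = tact A V g v"
proof -
  note gr = gmod_graded[OF V]
  have W': "cfun.subspace W" "W \<subseteq> carr V" "\<And>v. v \<in> W \<Longrightarrow> sg V v \<in> W" using W ssubmodule_iff[OF V] by auto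
  have eqW: "W = {u + v | u v. u \<in> W \<inter> hpart V 0 \<and> v \<in> W \<inter> hpart V 1}"
    using W unfolding ssubmodule_def by blast
  show c: "carr (sub_smod V W) = W"
    unfolding carr_def by (subst eqW) (auto simp: Int_commute)
  have gr': "graded (sub_smod V W)"
    unfolding splits_def using W' hpart_subspace[OF gr] gr eqW
    by (auto simp: cfun.subspace_inter carr_def cfun.subspace_0 splits_def)
  show "gmod A (sub_smod V W)"
    unfolding gmod_def sub_smod_simps
  proof (intro conjI ballI allI)
    show "splits (carr (sub_smod V W)) (hpart V 0 \<inter> W) (hpart V 1 \<inter> W)" using gr' by simp
    fix g assume g: "g \<in> gens A"
    show "lin_on (carr (sub_smod V W)) (act V g)"
      unfolding c by (rule lin_on_subset[OF act_lin[OF V g] W'(2)])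
    have "act V g ` W \<subseteq> W" using W g unfolding ssubmodule_def by blast
    then show "act V g ` (hpart V p \<inter> W) \<subseteq> hpart V (p + gpar A g) \<inter> W" for p
      using act_hpart[OF V g] by blast
  qed
  show s: "sg (sub_smod V W) v = sg V v" if "v \<in> W" for v
  proof -
    have "v \<in> carr (sub_smod V W)" using that c by simp
    from carr_cases[OF gr' this] obtain v0 v1
      where v: "v0 \<in> hpart (sub_smod V W) 0" "v1 \<in> hpart (sub_smod V W) 1" "v = v0 + v1" .
    then show ?thesis using sg_add_parts[OF gr' v(1,2)] sg_add_parts[OF gr, of v0 v1] by simp
  qed
  show "tact A (sub_smod V W) g v = tact A V g v" if "v \<in> W"
    using s[OF that] by (simp add: tact_def)
qed

section \<open>Invariant Hermitian forms and multiplicities\<close>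

definition herm_form :: "'x vec set \<Rightarrow> ('x vec \<Rightarrow> 'x vec \<Rightarrow> complex) \<Rightarrow> bool" where
  "herm_form S h \<longleftrightarrow>
     (\<forall>u\<in>S. \<forall>v\<in>S. \<forall>w\<in>S. h (u + v) w = h u w + h v w) \<and>
     (\<forall>a. \<forall>u\<in>S. \<forall>w\<in>S. h (a *c u) w = a * h u w) \<and>
     (\<forall>u\<in>S. \<forall>w\<in>S. h w u = cnj (h u w)) \<and>
     (\<forall>u\<in>S. u \<noteq> 0 \<longrightarrow> 0 < Re (h u u))"

text \<open>
  The adjoint of each twisted generator is a multiple of another one, which makes the orthogonal
  complement of a submodule a submodule.
\<close>

definition unitarizable :: "'g sgens \<Rightarrow> ('g, 'x) smod \<Rightarrow> bool" where
  "unitarizable A V \<longleftrightarrow> (\<exists>h. herm_form (carr V) h \<and>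
     (\<forall>u\<in>carr V. \<forall>v\<in>carr V. h (sg V u) v = h u (sg V v)) \<and>
     (\<forall>g\<in>gens A. \<exists>g'\<in>gens A. \<exists>a. \<forall>u\<in>carr V. \<forall>v\<in>carr V.
        h (tact A V g u) v = a * h u (tact A V g' v)))"

context
  fixes S :: "'x vec set" and h
  assumes H: "herm_form S h" and S: "cfun.subspace S"
begin

lemma herm_add: "u \<in> S \<Longrightarrow> v \<in> S \<Longrightarrow> w \<in> S \<Longrightarrow> h (u + v) w = h u w + h v w"
  and herm_scale: "u \<in> S \<Longrightarrow> w \<in> S \<Longrightarrow> h (a *c u) w = a * h u w"
  and herm_cnj: "u \<in> S \<Longrightarrow> w \<in> S \<Longrightarrow> h w u = cnj (h u w)"
  and herm_pos: "u \<in> S \<Longrightarrow> u \<noteq> 0 \<Longrightarrow> 0 < Re (h u u)"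
  using H unfolding herm_form_def by blast+

lemma herm_add_right: assumes "u \<in> S" "v \<in> S" "w \<in> S" shows "h w (u + v) = h w u + h w v"
proof -
  have "h w (u + v) = cnj (h (u + v) w)" by (rule herm_cnj[OF cfun.subspace_add[OF S assms(1,2)] assms(3)])
  also have "\<dots> = cnj (h u w) + cnj (h v w)" using herm_add[OF assms] by simp
  also have "\<dots> = h w u + h w v" using herm_cnj[OF assms(1,3)] herm_cnj[OF assms(2,3)] by simp
  finally show ?thesis .
qed

lemma herm_scale_right: assumes "u \<in> S" "w \<in> S" shows "h w (a *c u) = cnj a * h w u"
proof -
  have "h w (a *c u) = cnj (h (a *c u) w)" by (rule herm_cnj[OF cfun.subspace_scale[OF S assms(1)] assms(2)])
  also have "\<dots> = cnj a * h w u" using herm_scale[OF assms] herm_cnj[OF assms] by simp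
  finally show ?thesis .
qed

lemma herm_diff: assumes "u \<in> S" "v \<in> S" "w \<in> S" shows "h (u - v) w = h u w - h v w"
proof -
  have "h (u + (- 1) *c v) w = h u w + (- 1) * h v w"
    using herm_add[OF assms(1) cfun.subspace_scale[OF S assms(2)] assms(3)] herm_scale[OF assms(2,3)] by metis
  then show ?thesis by simp
qed

lemma herm_zero: "w \<in> S \<Longrightarrow> h 0 w = 0"
  using herm_scale[of 0 w 0] cfun.subspace_0[OF S] by simp

lemma orth_proj_span:
  assumes "finite B" "B \<subseteq> S"
  shows "\<forall>v\<in>S. \<exists>w\<in>cfun.span B. \<forall>u\<in>cfun.span B. h (v - w) u = 0"
  using assms
proof (induction B rule: finite_induct)
  case empty
  show ?case
  proof
    fix v assume v: "v \<in> S"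
    have "h v 0 = 0" using herm_cnj[OF cfun.subspace_0[OF S] v] herm_zero[OF v] by simp
    then show "\<exists>w\<in>cfun.span {}. \<forall>u\<in>cfun.span {}. h (v - w) u = 0" by simp
  qed
next
  case (insert b B)
  have bS: "b \<in> S" and BS: "cfun.span B \<subseteq> S" and bBS: "cfun.span (insert b B) \<subseteq> S"
    using insert.prems cfun.span_minimal[OF _ S] by auto
  have spm: "cfun.span B \<subseteq> cfun.span (insert b B)" by (rule cfun.span_mono) auto
  obtain wb where wb: "wb \<in> cfun.span B" "\<forall>u\<in>cfun.span B. h (b - wb) u = 0"
    using insert bS by blast
  let ?b = "b - wb"
  have b'S: "?b \<in> S" using bS wb BS cfun.subspace_diff[OF S] by auto
  show ?case
  proof
    fix v assume v: "v \<in> S"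
    obtain wv where wv: "wv \<in> cfun.span B" "\<forall>u\<in>cfun.span B. h (v - wv) u = 0"
      using insert v by blast
    have v'S: "v - wv \<in> S" using v wv BS cfun.subspace_diff[OF S] by auto
    define c where "c = (if ?b = 0 then 0 else h (v - wv) ?b / h ?b ?b)"
    have c0: "h (v - wv) ?b - c * h ?b ?b = 0"
    proof (cases "?b = 0")
      case True
      have "h (v - wv) 0 = 0" using herm_cnj[OF cfun.subspace_0[OF S] v'S] herm_zero[OF v'S] by simp
      then show ?thesis using True herm_zero[OF cfun.subspace_0[OF S]] by simp
    next
      case False
      then have "h ?b ?b \<noteq> 0" using herm_pos[OF b'S False] by auto
      then show ?thesis using False by (simp add: c_def)
    qed
    have cb: "c *c ?b \<in> S" by (rule cfun.subspace_scale[OF S b'S])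
    have "wv + c *c ?b \<in> cfun.span (insert b B)"
      using subsetD[OF spm wv(1)] subsetD[OF spm wb(1)] cfun.span_base[of b "insert b B"]
      by (intro cfun.span_add cfun.span_scale cfun.span_diff) auto
    moreover have "h (v - (wv + c *c ?b)) u = 0" if u: "u \<in> cfun.span (insert b B)" for u
    proof -
      obtain k where k: "u - k *c b \<in> cfun.span B" using u cfun.span_breakdown_eq by blast
      define y where "y = (u - k *c b) + k *c wb"
      have y: "y \<in> cfun.span B" unfolding y_def by (intro cfun.span_add k cfun.span_scale wb)
      have yS: "y \<in> S" using y BS by auto
      have ue: "u = y + k *c ?b" unfolding y_def by (simp add: cfun.scale_right_diff_distrib)
      have kb: "k *c ?b \<in> S" by (rule cfun.subspace_scale[OF S b'S])
      have uS: "u \<in> S" using u bBS by auto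
      have "v - (wv + c *c ?b) = (v - wv) - c *c ?b" by (rule diff_diff_eq[symmetric])
      then have "h (v - (wv + c *c ?b)) u = h (v - wv) u - c * h ?b u"
        using herm_diff[OF v'S cb uS] herm_scale[OF b'S uS, of c] by (simp only:)
      also have "h (v - wv) u = cnj k * h (v - wv) ?b"
        using herm_add_right[OF yS kb v'S] herm_scale_right[OF b'S v'S] wv(2) y ue by simp
      also have "h ?b u = cnj k * h ?b ?b"
        using herm_add_right[OF yS kb b'S] herm_scale_right[OF b'S b'S] wb(2) y ue by simp
      also have "cnj k * h (v - wv) ?b - c * (cnj k * h ?b ?b) = cnj k * (h (v - wv) ?b - c * h ?b ?b)"
        by (simp add: algebra_simps)
      finally show ?thesis using c0 by simp
    qed
    ultimately show "\<exists>w\<in>cfun.span (insert b B). \<forall>u\<in>cfun.span (insert b B). h (v - w) u = 0" by blast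
  qed
qed

end

lemma invariant_complement:
  assumes V: "smodule A V" and uni: "unitarizable A V"
    and W: "ssubmodule A V W" and W': "ssubmodule A V W'" and sub: "W \<subseteq> W'"
  obtains X where "ssubmodule A V X" "splits W' W X"
proof -
  note gm = smoduleD(1)[OF V]
  obtain h where h: "herm_form (carr V) h"
    and hs: "\<forall>u\<in>carr V. \<forall>v\<in>carr V. h (sg V u) v = h u (sg V v)"
    and hg: "\<forall>g\<in>gens A. \<exists>g'\<in>gens A. \<exists>a. \<forall>u\<in>carr V. \<forall>v\<in>carr V.
        h (tact A V g u) v = a * h u (tact A V g' v)"
    using uni unfolding unitarizable_def by blast
  note S = smoduleD(3)[OF V]
  have Wd: "cfun.subspace W" "W \<subseteq> carr V" "\<And>v. v \<in> W \<Longrightarrow> sg V v \<in> W"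
    "\<And>g v. g \<in> gens A \<Longrightarrow> v \<in> W \<Longrightarrow> tact A V g v \<in> W"
    using W unfolding ssubmodule_iff[OF gm] by auto
  have W'd: "cfun.subspace W'" "W' \<subseteq> carr V" "\<And>v. v \<in> W' \<Longrightarrow> sg V v \<in> W'"
    "\<And>g v. g \<in> gens A \<Longrightarrow> v \<in> W' \<Longrightarrow> tact A V g v \<in> W'"
    using W' unfolding ssubmodule_iff[OF gm] by auto
  define X where "X = {x \<in> W'. \<forall>w\<in>W. h x w = 0}"
  have XW: "X \<subseteq> W'" by (auto simp: X_def)
  have subX: "cfun.subspace X"
  proof (rule cfun.subspaceI)
    show "0 \<in> X" using cfun.subspace_0[OF W'd(1)] herm_zero[OF h S] Wd(2) by (auto simp: X_def)
    show "x + y \<in> X" if "x \<in> X" "y \<in> X" for x y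
    proof -
      have xy: "x \<in> W'" "y \<in> W'" "\<And>w. w \<in> W \<Longrightarrow> h x w = 0" "\<And>w. w \<in> W \<Longrightarrow> h y w = 0"
        using that by (auto simp: X_def)
      have "h (x + y) w = 0" if "w \<in> W" for w
        using herm_add[OF h S, of x y w] xy that W'd(2) Wd(2) by auto
      then show ?thesis using xy cfun.subspace_add[OF W'd(1)] by (auto simp: X_def)
    qed
    show "c *c x \<in> X" if "x \<in> X" for c x
    proof -
      have xy: "x \<in> W'" "\<And>w. w \<in> W \<Longrightarrow> h x w = 0" using that by (auto simp: X_def)
      have "h (c *c x) w = 0" if "w \<in> W" for w
        using herm_scale[OF h S, of x w c] xy that W'd(2) Wd(2) by auto
      then show ?thesis using xy cfun.subspace_scale[OF W'd(1)] by (auto simp: X_def)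
    qed
  qed
  have "ssubmodule A V X"
    unfolding ssubmodule_iff[OF gm]
  proof (intro conjI ballI)
    show "cfun.subspace X" by (rule subX)
    show "X \<subseteq> carr V" using XW W'd by auto
    fix x assume x: "x \<in> X"
    then have x': "x \<in> W'" "x \<in> carr V" "\<And>w. w \<in> W \<Longrightarrow> h x w = 0" using XW W'd(2) by (auto simp: X_def)
    have "h (sg V x) w = 0" if "w \<in> W" for w
      using hs x' Wd(3)[OF that] that Wd(2) by auto
    then show "sg V x \<in> X" using W'd(3)[OF x'(1)] by (simp add: X_def)
    fix g assume g: "g \<in> gens A"
    then obtain g' a where g': "g' \<in> gens A"
      "\<forall>u\<in>carr V. \<forall>v\<in>carr V. h (tact A V g u) v = a * h u (tact A V g' v)" using hg by blast
    have "h (tact A V g x) w = 0" if "w \<in> W" for w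
      using g'(2) x' Wd(4)[OF g'(1) that] that Wd(2) by auto
    then show "tact A V g x \<in> X" using W'd(4)[OF g x'(1)] by (simp add: X_def)
  qed
  moreover have "splits W' W X"
    unfolding splits_def
  proof (intro conjI)
    show "cfun.subspace W" "cfun.subspace X" by (fact Wd(1) subX)+
    have "x = 0" if "x \<in> W" "x \<in> X" for x
    proof (rule ccontr)
      assume "x \<noteq> 0"
      then have "0 < Re (h x x)" using herm_pos[OF h S] that Wd(2) by auto
      moreover have "h x x = 0" using that by (auto simp: X_def)
      ultimately show False by simp
    qed
    then show "W \<inter> X = {0}" using cfun.subspace_0[OF Wd(1)] cfun.subspace_0[OF subX] by auto
    obtain B where B: "finite B" "B \<subseteq> W" "cfun.span B = W"
      using fd_basis[OF fd_mono[OF smoduleD(2)[OF V] Wd(2,1)]] by metis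
    show "W' = {x + y |x y. x \<in> W \<and> y \<in> X}"
    proof (intro subset_antisym subsetI)
      fix v assume v: "v \<in> W'"
      have "\<exists>w\<in>W. \<forall>u\<in>W. h (v - w) u = 0"
        using bspec[OF orth_proj_span[OF h S B(1)], of v] B Wd(2) W'd(2) v by auto
      then obtain w where w: "w \<in> W" "\<forall>u\<in>W. h (v - w) u = 0" by blast
      then have "v - w \<in> X" using v sub cfun.subspace_diff[OF W'd(1)] by (auto simp: X_def)
      moreover have "v = w + (v - w)" by simp
      ultimately show "v \<in> {x + y |x y. x \<in> W \<and> y \<in> X}" using w by blast
    next
      fix v assume "v \<in> {x + y |x y. x \<in> W \<and> y \<in> X}"
      then show "v \<in> W'" using XW sub cfun.subspace_add[OF W'd(1)] by blast
    qed
  qed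
  ultimately show ?thesis using that by blast
qed

lemma dim_pos: "fd S \<Longrightarrow> v \<in> S \<Longrightarrow> v \<noteq> 0 \<Longrightarrow> 0 < cfun.dim S"
proof -
  assume a: "fd S" "v \<in> S" "v \<noteq> 0"
  have "{0} \<subset> S" using a cfun.subspace_0[OF fd_subspace[OF a(1)]] by auto
  from dim_less[OF a(1) this cfun.subspace_single_0] show ?thesis by simp
qed

lemma shdim_pos:
  assumes D: "smodule A D" and nz: "carr D \<noteq> {0}"
  shows "0 < shdim A D D"
proof -
  note gm = smoduleD(1)[OF D]
  have sp: "fspace (shoms A D D)" by (rule homs_fspace[OF smoduleD(3)[OF D] tact_lin[OF gm]])
  have fde: "fd (enc (carr D) ` shoms A D D)"
    by (rule fd_enc[OF smoduleD(2)[OF D] smoduleD(2)[OF D] sp]) (auto simp: homs_def)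
  obtain v where v: "v \<in> carr D" "v \<noteq> 0"
    using nz cfun.subspace_0[OF smoduleD(3)[OF D]] by auto
  have "(\<lambda>v. v) \<in> shoms A D D" by (rule homsI) (auto intro: lin_on_id)
  moreover have "enc (carr D) (\<lambda>v. v) \<noteq> 0" using v by (auto simp: enc_eq_0_iff)
  ultimately show ?thesis unfolding fdim_def using dim_pos[OF fde] by blast
qed

lemma hdim_eq_0:
  assumes "\<And>f v. f \<in> homs I S a T b \<Longrightarrow> v \<in> S \<Longrightarrow> f v = 0"
  shows "hdim I S a T b = 0"
proof -
  have "enc S ` homs I S a T b \<subseteq> cfun.span {}" using assms by (auto simp: enc_eq_0_iff)
  then show ?thesis unfolding fdim_def using cfun.dim_le_card[of _ "{}"] by auto
qed

abbreviation hdim_into :: "'g sgens \<Rightarrow> ('g, 'y) smod \<Rightarrow> ('g, 'x) smod \<Rightarrow> 'x vec set \<Rightarrow> nat" where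
  "hdim_into A D V W \<equiv> hdim (gens A) (carr D) (tact A D) W (tact A V)"

lemma complement_irreducible:
  assumes V: "smodule A V" and W: "ssubmodule A V W" and W': "ssubmodule A V W'"
    and X: "ssubmodule A V X" and s: "splits W' W X"
    and lt: "W \<subset> W'" and nb: "\<not> (\<exists>Y. ssubmodule A V Y \<and> W \<subset> Y \<and> Y \<subset> W')"
  shows "sirreducible A (sub_smod V X)"
  unfolding sirreducible_def
proof (intro conjI allI impI)
  note gm = smoduleD(1)[OF V]
  note cX = sub_smod(2)[OF gm X]
  note gX = sub_smod(1)[OF gm X]
  have Xd: "cfun.subspace X" "X \<subseteq> carr V" using X unfolding ssubmodule_iff[OF gm] by auto
  have Wd: "cfun.subspace W" "W \<subseteq> carr V" "\<And>v. v \<in> W \<Longrightarrow> sg V v \<in> W"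
    "\<And>g v. g \<in> gens A \<Longrightarrow> v \<in> W \<Longrightarrow> tact A V g v \<in> W"
    using W unfolding ssubmodule_iff[OF gm] by auto
  have e: "W' = {x + y | x y. x \<in> W \<and> y \<in> X}" and i: "W \<inter> X = {0}" using s unfolding splits_def by blast+
  show "carr (sub_smod V X) \<noteq> {0}"
  proof
    assume "carr (sub_smod V X) = {0}"
    then have "W' = W" using e cX by simp
    then show False using lt by simp
  qed
  fix Y assume Y: "ssubmodule A (sub_smod V X) Y"
  have Yd: "cfun.subspace Y" "Y \<subseteq> X" "\<And>v. v \<in> Y \<Longrightarrow> sg (sub_smod V X) v \<in> Y"
    "\<And>g v. g \<in> gens A \<Longrightarrow> v \<in> Y \<Longrightarrow> tact A (sub_smod V X) g v \<in> Y"
    using Y unfolding ssubmodule_iff[OF gX] cX by auto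
  have Ys: "sg V v \<in> Y" "g \<in> gens A \<Longrightarrow> tact A V g v \<in> Y" if "v \<in> Y" for v g
    using Yd(3)[OF that] Yd(4)[OF _ that, of g] sub_smod(3)[OF gm X, of v] sub_smod(4)[OF gm X, of v g]
      subsetD[OF Yd(2) that] by auto
  define Z where "Z = {x + y | x y. x \<in> W \<and> y \<in> Y}"
  have ZW: "W \<subseteq> Z" unfolding Z_def using cfun.subspace_0[OF Yd(1)] by force
  have YZ: "Y \<subseteq> Z" unfolding Z_def using cfun.subspace_0[OF Wd(1)] by force
  have ZW': "Z \<subseteq> W'" unfolding Z_def e using Yd(2) by blast
  have W'c: "W' \<subseteq> carr V" using W' unfolding ssubmodule_iff[OF gm] by auto
  have "ssubmodule A V Z"
    unfolding ssubmodule_iff[OF gm]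
  proof (intro conjI ballI)
    show "cfun.subspace Z" unfolding Z_def by (rule cfun.subspace_sums[OF Wd(1) Yd(1)])
    show "Z \<subseteq> carr V" using ZW' W'c by auto
    fix z assume "z \<in> Z"
    then obtain x y where z: "x \<in> W" "y \<in> Y" "z = x + y" unfolding Z_def by blast
    have c: "x \<in> carr V" "y \<in> carr V" using z Wd Yd Xd by auto
    show "sg V z \<in> Z"
      unfolding Z_def z(3) lin_on_add[OF sg_lin[OF gmod_graded[OF gm]] c]
      using Wd(3)[OF z(1)] Ys(1)[OF z(2)] by blast
    fix g assume g: "g \<in> gens A"
    show "tact A V g z \<in> Z"
      unfolding Z_def z(3) lin_on_add[OF tact_lin[OF gm g] c]
      using Wd(4)[OF g z(1)] Ys(2)[OF z(2) g] by blast
  qed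
  then have "Z = W \<or> Z = W'" using nb ZW ZW' by blast
  then show "Y = {0} \<or> Y = carr (sub_smod V X)"
  proof
    assume "Z = W"
    then have "Y \<subseteq> {0}" using YZ Yd(2) i by blast
    then show ?thesis using cfun.subspace_0[OF Yd(1)] by auto
  next
    assume ZW': "Z = W'"
    have "x \<in> Y" if x: "x \<in> X" for x
    proof -
      have "x \<in> Z" using ZW' splits_sub[OF s] x by auto
      then obtain w y where wy: "w \<in> W" "y \<in> Y" "x = w + y" unfolding Z_def by blast
      then have "w = x - y" by simp
      then have "w \<in> X" using x wy(2) Yd(2) cfun.subspace_diff[OF Xd(1)] by auto
      then have "w = 0" using wy(1) i by blast
      then show ?thesis using wy by simp
    qed
    then show ?thesis using Yd(2) cX by auto
  qed
qed

text \<open>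
  A complement of \<open>W\<close> in \<open>W'\<close> is irreducible, so it contributes $\dim \mathrm{End}(D)$ if it is
  isomorphic to \<open>D\<close>, and nothing otherwise.
\<close>

lemma hdim_step:
  assumes V: "smodule A V" and uni: "unitarizable A V"
    and D: "smodule A D" and irr: "sirreducible A D"
    and W: "ssubmodule A V W" and W': "ssubmodule A V W'"
    and lt: "W \<subset> W'" and nb: "\<not> (\<exists>Y. ssubmodule A V Y \<and> W \<subset> Y \<and> Y \<subset> W')"
  shows "hdim_into A D V W' = hdim_into A D V W + (if factor_iso A V W W' D then shdim A D D else 0)"
proof -
  note gm = smoduleD(1)[OF V] note gD = smoduleD(1)[OF D]
  obtain X where X: "ssubmodule A V X" and s: "splits W' W X"
    using invariant_complement[OF V uni W W'] lt by blast
  have Wd: "cfun.subspace W" "W \<subseteq> carr V" "\<And>g v. g \<in> gens A \<Longrightarrow> v \<in> W \<Longrightarrow> tact A V g v \<in> W"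
    using W unfolding ssubmodule_iff[OF gm] by auto
  have W'd: "cfun.subspace W'" "W' \<subseteq> carr V" using W' unfolding ssubmodule_iff[OF gm] by auto
  have Xd: "cfun.subspace X" "X \<subseteq> carr V" "\<And>g v. g \<in> gens A \<Longrightarrow> v \<in> X \<Longrightarrow> tact A V g v \<in> X"
    using X unfolding ssubmodule_iff[OF gm] by auto
  note cX = sub_smod(2)[OF gm X] note gX = sub_smod(1)[OF gm X] note tX = sub_smod(4)[OF gm X]
  note cW' = sub_smod(2)[OF gm W'] note gW' = sub_smod(1)[OF gm W'] note tW' = sub_smod(4)[OF gm W']
  have XW': "X \<subseteq> W'" "W \<subseteq> W'" using splits_sub[OF s] by auto
  have i: "W \<inter> X = {0}" and e: "W' = {x + y | x y. x \<in> W \<and> y \<in> X}" using s unfolding splits_def by blast+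
  have "hdim_into A D V W' = hdim_into A D V W + hdim_into A D V X"
    by (rule hdim_sum_right[OF s smoduleD(2)[OF D] fd_mono[OF smoduleD(2)[OF V] W'd(2,1)]])
      (auto intro: lin_on_subset[OF tact_lin[OF gm] W'd(2)] Wd(3) Xd(3) tact_carr[OF gD])
  moreover have "hdim_into A D V X = (if factor_iso A V W W' D then shdim A D D else 0)"
  proof (cases "factor_iso A V W W' D")
    case True
    then obtain f where f: "hom_smod A (sub_smod V W') D f" "f ` W' = carr D" "\<forall>v\<in>W'. f v = 0 \<longleftrightarrow> v \<in> W"
      unfolding factor_iso_def by blast
    have f': "f \<in> shoms A (sub_smod V W') D" using hom_smod_iff[OF gW' gD] f(1) by blast
    note fD = homsD[OF f', unfolded cW']
    have fX: "f \<in> homs (gens A) X (tact A V) (carr D) (tact A D)"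
    proof (rule homsI)
      show "lin_on X f" by (rule lin_on_subset[OF fD(1) XW'(1)])
      show "f v \<in> carr D" if "v \<in> X" for v using fD(2) that XW' by blast
      show "f (tact A V g v) = tact A D g (f v)" if "g \<in> gens A" "v \<in> X" for g v
      proof -
        have "v \<in> W'" using that XW' by auto
        then show ?thesis using fD(3)[OF that(1), of v] tW'[of v g] by simp
      qed
    qed
    have "inj_on f X"
      unfolding lin_on_inj_iff[OF homsD(1)[OF fX] Xd(1)] using f(3) XW' i by blast
    moreover have "f ` X = carr D"
    proof -
      have "y \<in> f ` X" if "y \<in> f ` W'" for y
      proof -
        obtain w x where wx: "w \<in> W" "x \<in> X" "y = f (w + x)" using \<open>y \<in> f ` W'\<close> e by blast
        then have "f (w + x) = f w + f x" using lin_on_add[OF fD(1), of w x] XW' by auto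
        moreover have "f w = 0" using f(3) wx XW' by auto
        ultimately show ?thesis using wx by simp
      qed
      then show ?thesis using f(2) XW' by blast
    qed
    ultimately have bij: "bij_betw f X (carr D)" by (simp add: bij_betw_def)
    have "hdim_into A D V X = shdim A D D"
      by (rule hdim_iso_right[OF Xd(1) _ _ fX bij smoduleD(3)[OF D]])
        (auto intro: lin_on_subset[OF tact_lin[OF gm] Xd(2)] Xd(3) tact_carr[OF gD])
    then show ?thesis using True by simp
  next
    case False
    have "hdim_into A D V X = 0"
    proof (rule hdim_eq_0, rule ccontr)
      fix f v assume f: "f \<in> homs (gens A) (carr D) (tact A D) X (tact A V)" and v: "v \<in> carr D" "f v \<noteq> 0"
      note fD = homsD[OF f]
      have f': "f \<in> shoms A D (sub_smod V X)"
        unfolding cX by (rule homsI) (use fD tX in auto)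
      obtain p :: bit and h where h: "h \<in> shoms A D (sub_smod V X)" "bij_betw h (carr D) X"
        using schur_iso[OF gD gX f' irr complement_irreducible[OF V W W' X s lt nb] v] cX by metis
      have "h \<in> homs (gens A) (carr D) (tact A D) X (tact A V)"
        by (rule homsI) (use homsD[OF h(1), unfolded cX] tX in auto)
      from homs_inverse[OF this h(2) smoduleD(3)[OF D]] tact_carr[OF gD]
      have k: "inv_into (carr D) h \<in> homs (gens A) X (tact A V) (carr D) (tact A D)"
        "bij_betw (inv_into (carr D) h) X (carr D)" by blast+
      let ?k = "inv_into (carr D) h" let ?F = "\<lambda>v. ?k (comp1 X W v)"
      note kD = homsD[OF k(1)]
      note s' = splits_swap[OF s]
      have c1: "comp1 X W v \<in> X" "v - comp1 X W v \<in> W" if "v \<in> W'" for v using comp1[OF s' that] .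
      have "?F \<in> shoms A (sub_smod V W') D"
        unfolding cW'
      proof (rule homsI)
        show "lin_on W' ?F" by (rule lin_on_comp[OF comp1_lin[OF s'] _ kD(1)]) (use c1 in auto)
        show "?F v \<in> carr D" if "v \<in> W'" for v by (rule kD(2)[OF c1(1)[OF that]])
        fix g v assume g: "g \<in> gens A" and v: "v \<in> W'"
        note c = c1[OF v]
        have vc: "v \<in> carr V" "comp1 X W v \<in> carr V" using v c W'd Xd by auto
        have "tact A V g v = tact A V g (comp1 X W v) + tact A V g (v - comp1 X W v)"
          using lin_on_diff[OF tact_lin[OF gm g] smoduleD(3)[OF V] vc] by simp
        then have "comp1 X W (tact A V g v) = tact A V g (comp1 X W v)"
          using comp1_add[OF s' Xd(3)[OF g c(1)] Wd(3)[OF g c(2)]] by simp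
        then show "?F (tact A (sub_smod V W') g v) = tact A D g (?F v)"
          using tW'[OF v] kD(3)[OF g c(1)] by simp
      qed
      then have "hom_smod A (sub_smod V W') D ?F" using hom_smod_iff[OF gW' gD] by blast
      moreover have "?F ` W' = carr D"
      proof -
        have "?k x \<in> ?F ` W'" if "x \<in> X" for x
          using comp1_add[OF s' that cfun.subspace_0[OF Wd(1)]] subsetD[OF XW'(1) that]
          by (intro image_eqI[of _ _ x]) simp_all
        then have "?k ` X \<subseteq> ?F ` W'" by (rule image_subsetI)
        moreover have "?k ` X = carr D" using k(2) by (simp add: bij_betw_def)
        moreover have "?F ` W' \<subseteq> carr D" using kD(2) c1 by blast
        ultimately show ?thesis by blast
      qed
      moreover have "?F v = 0 \<longleftrightarrow> v \<in> W" if v: "v \<in> W'" for v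
      proof -
        have inj: "inj_on ?k X" using k(2) by (simp add: bij_betw_def)
        have "?F v = 0 \<longleftrightarrow> comp1 X W v = 0"
          using inj lin_on_inj_iff[OF kD(1) Xd(1)] c1(1)[OF v] lin_on_zero[OF kD(1) Xd(1)] by metis
        also have "\<dots> \<longleftrightarrow> v \<in> W"
          using c1(2)[OF v] comp1_add[OF s' cfun.subspace_0[OF Xd(1)], of v] by auto
        finally show ?thesis .
      qed
      ultimately have "factor_iso A V W W' D" unfolding factor_iso_def by blast
      then show False using False by simp
    qed
    then show ?thesis using False by simp
  qed
  ultimately show ?thesis by simp
qed

lemma composition_series_exists:
  assumes V: "smodule A V" shows "\<exists>Ws. composition_series A V Ws"
proof -
  note gm = smoduleD(1)[OF V]
  define P where "P W Ws \<longleftrightarrow> Ws \<noteq> [] \<and> hd Ws = {0} \<and> last Ws = W \<and> (\<forall>W\<in>set Ws. ssubmodule A V W) \<and>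
     (\<forall>i. Suc i < length Ws \<longrightarrow> Ws ! i \<subset> Ws ! Suc i \<and>
        \<not> (\<exists>W. ssubmodule A V W \<and> Ws ! i \<subset> W \<and> W \<subset> Ws ! Suc i))" for W Ws
  have fdW: "fd W" if "ssubmodule A V W" for W
    using that fd_mono[OF smoduleD(2)[OF V]] unfolding ssubmodule_iff[OF gm] by blast
  have subW: "cfun.subspace W" if "ssubmodule A V W" for W
    using that unfolding ssubmodule_iff[OF gm] by blast
  have "\<exists>Ws. P W Ws" if "ssubmodule A V W" for W
    using that
  proof (induction "cfun.dim W" arbitrary: W rule: less_induct)
    case less
    show ?case
    proof (cases "W = {0}")
      case True
      then have "P W [{0}]" using less.prems by (simp add: P_def)
      then show ?thesis by blast
    next
      case False
      define N where "N = {cfun.dim Y | Y. ssubmodule A V Y \<and> Y \<subset> W}"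
      have N0: "cfun.dim {0 :: 'b vec} \<in> N"
        unfolding N_def using False ssubmodule_zero[OF gm] cfun.subspace_0[OF subW[OF less.prems]] by blast
      have Nlt: "k < cfun.dim W" if "k \<in> N" for k
        using that dim_less[OF fdW[OF less.prems]] subW unfolding N_def by blast
      then have fN: "finite N" by (meson finite_nat_set_iff_bounded)
      then have M: "Max N \<in> N" "\<And>k. k \<in> N \<Longrightarrow> k \<le> Max N"
        using N0 by (auto intro: Max_in)
      from M(1) obtain Y where Y: "ssubmodule A V Y" "Y \<subset> W" "cfun.dim Y = Max N"
        unfolding N_def mem_Collect_eq by metis
      have "cfun.dim Y < cfun.dim W" by (rule dim_less[OF fdW[OF less.prems] Y(2) subW[OF Y(1)]])
      then obtain Ws where Ws: "P Y Ws" using less.hyps Y(1) by blast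
      have nb: "\<not> (\<exists>Z. ssubmodule A V Z \<and> Y \<subset> Z \<and> Z \<subset> W)"
      proof
        assume "\<exists>Z. ssubmodule A V Z \<and> Y \<subset> Z \<and> Z \<subset> W"
        then obtain Z where Z: "ssubmodule A V Z" "Y \<subset> Z" "Z \<subset> W" by blast
        have "cfun.dim Y < cfun.dim Z" by (rule dim_less[OF fdW[OF Z(1)] Z(2) subW[OF Y(1)]])
        moreover have "cfun.dim Z \<le> Max N" using M(2) Z unfolding N_def by blast
        ultimately show False using Y(3) by simp
      qed
      have lastY: "Ws ! (length Ws - 1) = Y" "Ws \<noteq> []" using Ws by (auto simp: P_def last_conv_nth)
      have "P W (Ws @ [W])"
        unfolding P_def
      proof (intro conjI allI impI)
        show "hd (Ws @ [W]) = {0}" using Ws by (simp add: P_def)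
        show "\<forall>W\<in>set (Ws @ [W]). ssubmodule A V W" using Ws less.prems by (auto simp: P_def)
        fix i assume i: "Suc i < length (Ws @ [W])"
        have c: "Suc i < length Ws \<or> (i = length Ws - 1 \<and> Suc i = length Ws)" using i lastY(2) by auto
        show "(Ws @ [W]) ! i \<subset> (Ws @ [W]) ! Suc i"
          using c Ws Y(2) lastY by (auto simp: P_def nth_append)
        show "\<not> (\<exists>Wa. ssubmodule A V Wa \<and> (Ws @ [W]) ! i \<subset> Wa \<and> Wa \<subset> (Ws @ [W]) ! Suc i)"
        proof (cases "Suc i < length Ws")
          case True
          then show ?thesis using Ws unfolding P_def by (simp add: nth_append)
        next
          case False
          then have "i = length Ws - 1" "Suc i = length Ws" using c by auto
          then have "(Ws @ [W]) ! i = Y" "(Ws @ [W]) ! Suc i = W"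
            using lastY by (simp_all add: nth_append)
          then show ?thesis using nb by simp
        qed
      qed auto
      then show ?thesis by blast
    qed
  qed
  from this[OF ssubmodule_carr[OF gm]] show ?thesis unfolding P_def composition_series_def by blast
qed

lemma hdim_composition_series:
  assumes V: "smodule A V" and uni: "unitarizable A V"
    and D: "smodule A D" and irr: "sirreducible A D" and Ws: "composition_series A V Ws"
  shows "card {i. Suc i < length Ws \<and> factor_iso A V (Ws ! i) (Ws ! Suc i) D} * shdim A D D = shdim A D V"
proof -
  note c = Ws[unfolded composition_series_def]
  have ssub: "ssubmodule A V (Ws ! i)" if "i < length Ws" for i using c that by auto
  have "hdim_into A D V (Ws ! k) =
      card {i. Suc i \<le> k \<and> factor_iso A V (Ws ! i) (Ws ! Suc i) D} * shdim A D D" if "k < length Ws" for k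
    using that
  proof (induction k)
    case 0
    have "Ws ! 0 = {0}" using c hd_conv_nth[of Ws] by metis
    then have "hdim_into A D V (Ws ! 0) = 0" by (intro hdim_eq_0) (auto simp: homs_def)
    then show ?case by simp
  next
    case (Suc k)
    let ?f = "factor_iso A V (Ws ! k) (Ws ! Suc k) D"
    have step: "hdim_into A D V (Ws ! Suc k) = hdim_into A D V (Ws ! k) + (if ?f then shdim A D D else 0)"
      using c Suc.prems ssub[of k] ssub[of "Suc k"]
      by (intro hdim_step[OF V uni D irr]) auto
    have "{i. Suc i \<le> Suc k \<and> factor_iso A V (Ws ! i) (Ws ! Suc i) D} =
        (if ?f then insert k else id) {i. Suc i \<le> k \<and> factor_iso A V (Ws ! i) (Ws ! Suc i) D}"
      by (auto simp: le_Suc_eq)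
    moreover have "finite {i. Suc i \<le> k \<and> factor_iso A V (Ws ! i) (Ws ! Suc i) D}"
      by (rule finite_subset[of _ "{..k}"]) auto
    ultimately have "card {i. Suc i \<le> Suc k \<and> factor_iso A V (Ws ! i) (Ws ! Suc i) D} =
        card {i. Suc i \<le> k \<and> factor_iso A V (Ws ! i) (Ws ! Suc i) D} + (if ?f then 1 else 0)"
      by simp
    then show ?case using step Suc.IH Suc.prems by (simp add: algebra_simps)
  qed
  note step = this
  have l: "length Ws - 1 < length Ws" "Ws ! (length Ws - 1) = carr V" using c last_conv_nth[of Ws] by auto
  have "{i. Suc i \<le> length Ws - 1 \<and> factor_iso A V (Ws ! i) (Ws ! Suc i) D} =
     {i. Suc i < length Ws \<and> factor_iso A V (Ws ! i) (Ws ! Suc i) D}" by auto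
  then show ?thesis using step[OF l(1)] unfolding l(2) by simp
qed

text \<open>
  For a module with an invariant form the composition multiplicity is the ratio of the dimensions
  of two spaces of homomorphisms, because every step of a composition series splits. In
  particular it does not depend on the series, so that \<open>smult\<close> is meaningful.
\<close>

lemma smult_hdim:
  assumes V: "smodule A V" and uni: "unitarizable A V"
    and D: "smodule A D" and irr: "sirreducible A D"
  shows "smult A V D * shdim A D D = shdim A D V"
proof -
  have pos: "0 < shdim A D D" using shdim_pos[OF D] irr by (simp add: sirreducible_def)
  have *: "m * shdim A D D = shdim A D V" if m: "has_multiplicity A V D m" for m
  proof -
    obtain Ws where "composition_series A V Ws"
      "m = card {i. Suc i < length Ws \<and> factor_iso A V (Ws ! i) (Ws ! Suc i) D}"
      using m unfolding has_multiplicity_def by blast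
    then show ?thesis using hdim_composition_series[OF V uni D irr] by simp
  qed
  obtain Ws where Ws: "composition_series A V Ws" using composition_series_exists[OF V] by blast
  have "has_multiplicity A V D (smult A V D)"
    unfolding smult_def
  proof (rule theI')
    show "\<exists>!m. has_multiplicity A V D m"
    proof (rule ex_ex1I)
      show "\<exists>m. has_multiplicity A V D m" unfolding has_multiplicity_def using Ws by blast
      fix m m' assume "has_multiplicity A V D m" "has_multiplicity A V D m'"
      then have "m * shdim A D D = m' * shdim A D D" using *[of m] *[of m'] by (simp only:)
      then show "m = m'" using pos by simp
    qed
  qed
  then show ?thesis by (rule *)
qed

section \<open>Tensor products\<close>

text \<open>\<open>tens_op\<close> for operators between different spaces.\<close>

definition tmap ::
  "('x vec \<Rightarrow> 'u vec) \<Rightarrow> ('y vec \<Rightarrow> 'y vec) \<Rightarrow>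
   ('x \<times> 'y \<Rightarrow> complex) \<Rightarrow> 'u \<times> 'y \<Rightarrow> complex" where
  "tmap F G z = (\<lambda>(a, b). F (\<lambda>a'. G (\<lambda>b'. z (a', b')) b) a)"

lemma tens_op_tmap: "tens_op F G = tmap F G"
  by (simp add: tens_op_def tmap_def fun_eq_iff)

lemma tens_in: "u \<in> S \<Longrightarrow> x \<in> T \<Longrightarrow> tens u x \<in> tens_space S T"
  unfolding tens_space_def by (rule cfun.span_base) blast

lemma tens_space_subspace: "cfun.subspace (tens_space S T)"
  unfolding tens_space_def by simp

lemma tens_space_zero: "0 \<in> tens_space S T"
  by (rule cfun.subspace_0[OF tens_space_subspace])

lemma tens_space_induct:
  assumes "z \<in> tens_space S T" "cfun.subspace P" "\<And>u x. u \<in> S \<Longrightarrow> x \<in> T \<Longrightarrow> tens u x \<in> P"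
  shows "z \<in> P"
proof -
  have "cfun.span {tens u x | u x. u \<in> S \<and> x \<in> T} \<subseteq> P"
    by (rule cfun.span_minimal) (use assms in auto)
  then show ?thesis using assms(1) unfolding tens_space_def by auto
qed

lemma tens_space_mono: "S \<subseteq> S' \<Longrightarrow> tens_space S T \<subseteq> tens_space S' T"
  unfolding tens_space_def by (rule cfun.span_mono) blast

lemma tens_bilinear:
  "tens (u + v) x = tens u x + tens v x" "tens (a *c u) x = a *c tens u x"
  "tens u (x + y) = tens u x + tens u y" "tens u (a *c x) = a *c tens u x"
  by (auto simp: tens_def fun_eq_iff pointwise algebra_simps)

lemma tens_zero: "tens 0 x = 0" "tens u 0 = 0"
  by (auto simp: tens_def fun_eq_iff pointwise)

lemma tens_slice_left:
  assumes z: "z \<in> tens_space S T" and S: "cfun.subspace S"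
  shows "(\<lambda>a. z (a, b)) \<in> S"
proof -
  let ?P = "{z. (\<lambda>a. z (a, b)) \<in> S}"
  have "cfun.subspace ?P"
  proof (rule cfun.subspaceI)
    show "0 \<in> ?P" using cfun.subspace_0[OF S] by (simp add: zero_fun_def)
    show "x + y \<in> ?P" if "x \<in> ?P" "y \<in> ?P" for x y
      using cfun.subspace_add[OF S, of "\<lambda>a. x (a, b)" "\<lambda>a. y (a, b)"] that
      by (simp add: plus_fun_def)
    show "c *c x \<in> ?P" if "x \<in> ?P" for c x
      using cfun.subspace_scale[OF S, of "\<lambda>a. x (a, b)" c] that by (simp add: cscale_def)
  qed
  moreover have "tens u x \<in> ?P" if "u \<in> S" for u :: "'a vec" and x :: "'b vec"
  proof -
    have "(\<lambda>a. tens u x (a, b)) = x b *c u" by (simp add: tens_def fun_eq_iff cscale_def)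
    then show ?thesis using cfun.subspace_scale[OF S that] by simp
  qed
  ultimately show ?thesis using tens_space_induct[OF z] by blast
qed

lemma tens_slice_right:
  assumes z: "z \<in> tens_space S T" and T: "cfun.subspace T"
  shows "(\<lambda>b. z (a, b)) \<in> T"
proof -
  let ?P = "{z. (\<lambda>b. z (a, b)) \<in> T}"
  have "cfun.subspace ?P"
  proof (rule cfun.subspaceI)
    show "0 \<in> ?P" using cfun.subspace_0[OF T] by (simp add: zero_fun_def)
    show "x + y \<in> ?P" if "x \<in> ?P" "y \<in> ?P" for x y
      using cfun.subspace_add[OF T, of "\<lambda>b. x (a, b)" "\<lambda>b. y (a, b)"] that
      by (simp add: plus_fun_def)
    show "c *c x \<in> ?P" if "x \<in> ?P" for c x
      using cfun.subspace_scale[OF T, of "\<lambda>b. x (a, b)" c] that by (simp add: cscale_def)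
  qed
  moreover have "tens u x \<in> ?P" if "x \<in> T" for u :: "'a vec" and x :: "'b vec"
  proof -
    have "(\<lambda>b. tens u x (a, b)) = u a *c x" by (simp add: tens_def fun_eq_iff cscale_def)
    then show ?thesis using cfun.subspace_scale[OF T that] by simp
  qed
  ultimately show ?thesis using tens_space_induct[OF z] by blast
qed

lemma fd_tens:
  assumes "fd S" "fd T" shows "fd (tens_space S T)"
proof -
  obtain X Y where X: "finite X" "S = cfun.span X" and Y: "finite Y" "T = cfun.span Y"
    using assms by (auto simp: fd_def)
  let ?Z = "(\<lambda>(u, x). tens u x) ` (X \<times> Y)"
  have gen: "tens u x \<in> cfun.span ?Z" if "u \<in> X" "x \<in> Y" for u x
    by (rule cfun.span_base, rule image_eqI[of _ _ "(u, x)"]) (use that in auto)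
  have a: "tens u x \<in> cfun.span ?Z" if "u \<in> S" "x \<in> T" for u x
  proof -
    have "S \<subseteq> {u. \<forall>x\<in>Y. tens u x \<in> cfun.span ?Z}" unfolding X(2)
    proof (rule cfun.span_minimal)
      show "X \<subseteq> {u. \<forall>x\<in>Y. tens u x \<in> cfun.span ?Z}" using gen by auto
      show "cfun.subspace {u. \<forall>x\<in>Y. tens u x \<in> cfun.span ?Z}"
      proof (rule cfun.subspaceI)
        show "0 \<in> {u. \<forall>x\<in>Y. tens u x \<in> cfun.span ?Z}" by (simp add: tens_zero cfun.span_zero)
      qed (simp_all add: tens_bilinear cfun.span_add cfun.span_scale)
    qed
    then have u: "\<forall>x\<in>Y. tens u x \<in> cfun.span ?Z" using that by blast
    have "T \<subseteq> {x. tens u x \<in> cfun.span ?Z}" unfolding Y(2)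
    proof (rule cfun.span_minimal)
      show "Y \<subseteq> {x. tens u x \<in> cfun.span ?Z}" using u by auto
      show "cfun.subspace {x. tens u x \<in> cfun.span ?Z}"
      proof (rule cfun.subspaceI)
        show "0 \<in> {x. tens u x \<in> cfun.span ?Z}" by (simp add: tens_zero cfun.span_zero)
      qed (simp_all add: tens_bilinear cfun.span_add cfun.span_scale)
    qed
    then show ?thesis using that by blast
  qed
  have "tens_space S T \<subseteq> cfun.span ?Z"
    by (rule subsetI, rule tens_space_induct) (use a in auto)
  moreover have "fd (cfun.span ?Z)" unfolding fd_def using X(1) Y(1) by (intro exI[of _ ?Z]) simp
  ultimately show ?thesis using fd_mono[OF _ _ tens_space_subspace] by metis
qed

context
  fixes S :: "'x vec set" and T :: "'y vec set"
    and F :: "'x vec \<Rightarrow> 'u vec" and G :: "'y vec \<Rightarrow> 'y vec"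
  assumes S: "cfun.subspace S" and T: "cfun.subspace T" and F: "lin_on S F" and G: "lin_on T G"
begin

lemma tmap_tens: assumes "u \<in> S" "x \<in> T" shows "tmap F G (tens u x) = tens (F u) (G x)"
proof -
  have "(\<lambda>b'. tens u x (a, b')) = u a *c x" for a
    by (simp add: tens_def cscale_def)
  then have 1: "G (\<lambda>b'. tens u x (a, b')) = u a *c G x" for a
    using lin_on_scale[OF G assms(2)] by simp
  have 2: "(\<lambda>a'. G (\<lambda>b'. tens u x (a', b')) b) = G x b *c u" for b
    unfolding 1 by (simp add: cscale_def mult.commute)
  show ?thesis
    unfolding tmap_def 2 lin_on_scale[OF F assms(1)]
    by (simp add: tens_def cscale_def fun_eq_iff)
qed

lemma tmap_inner: assumes z: "z \<in> tens_space S T"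
  shows "(\<lambda>a'. G (\<lambda>b'. z (a', b')) b) \<in> S"
proof -
  let ?P = "{z \<in> tens_space S T. (\<lambda>a'. G (\<lambda>b'. z (a', b')) b) \<in> S}"
  note sl = tens_slice_right[OF _ T]
  have "cfun.subspace ?P"
  proof (rule cfun.subspaceI)
    have "G (\<lambda>b'. 0) b = 0"
      using lin_on_zero[OF G T] by (simp add: zero_fun_def)
    then show "0 \<in> ?P"
      using cfun.subspace_0[OF S] tens_space_zero[of S T] by (simp add: zero_fun_def)
    show "x + y \<in> ?P" if xy: "x \<in> ?P" "y \<in> ?P" for x y
    proof -
      have x: "x \<in> tens_space S T" and y: "y \<in> tens_space S T" using xy by auto
      have "G (\<lambda>b'. (x + y) (a', b')) = G (\<lambda>b'. x (a', b')) + G (\<lambda>b'. y (a', b'))" for a'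
        using lin_on_add[OF G sl[OF x, of a'] sl[OF y, of a']] by (simp add: plus_fun_def)
      then show ?thesis
        using xy cfun.subspace_add[OF tens_space_subspace x y]
          cfun.subspace_add[OF S, of "\<lambda>a'. G (\<lambda>b'. x (a', b')) b" "\<lambda>a'. G (\<lambda>b'. y (a', b')) b"]
        by (simp add: plus_fun_def)
    qed
    show "c *c x \<in> ?P" if xy: "x \<in> ?P" for c x
    proof -
      have x: "x \<in> tens_space S T" using xy by auto
      have "G (\<lambda>b'. (c *c x) (a', b')) = c *c G (\<lambda>b'. x (a', b'))" for a'
        using lin_on_scale[OF G sl[OF x, of a'], of c] by (simp add: cscale_def)
      then show ?thesis
        using xy cfun.subspace_scale[OF tens_space_subspace x]
          cfun.subspace_scale[OF S, of "\<lambda>a'. G (\<lambda>b'. x (a', b')) b" c]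
        by (simp add: cscale_def)
    qed
  qed
  moreover have "tens u x \<in> ?P" if "u \<in> S" "x \<in> T" for u x
  proof -
    have "(\<lambda>b'. tens u x (a, b')) = u a *c x" for a
      by (simp add: tens_def cscale_def)
    then have 1: "G (\<lambda>b'. tens u x (a, b')) = u a *c G x" for a
      using lin_on_scale[OF G that(2)] by simp
    have "(\<lambda>a'. G (\<lambda>b'. tens u x (a', b')) b) = G x b *c u"
      unfolding 1 by (simp add: cscale_def mult.commute)
    then show ?thesis using cfun.subspace_scale[OF S that(1)] tens_in[OF that] by simp
  qed
  ultimately have "z \<in> ?P" by (rule tens_space_induct[OF z])
  then show ?thesis by simp
qed

lemma tmap_lin: "lin_on (tens_space S T) (tmap F G)"
  unfolding lin_on_def
proof (intro conjI ballI allI)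
  note sl = tens_slice_right[OF _ T]
  fix x assume x: "x \<in> tens_space S T"
  show "tmap F G (c *c x) = c *c tmap F G x" for c
  proof -
    have 1: "G (\<lambda>b'. (c *c x) (a', b')) = c *c G (\<lambda>b'. x (a', b'))" for a'
      using lin_on_scale[OF G sl[OF x, of a'], of c] by (simp add: cscale_def)
    have "F (\<lambda>a'. (c *c G (\<lambda>b'. x (a', b'))) b) = c *c F (\<lambda>a'. G (\<lambda>b'. x (a', b')) b)" for b
      using lin_on_scale[OF F tmap_inner[OF x, of b], of c] by (simp add: cscale_def)
    then show ?thesis unfolding tmap_def 1 by (simp add: fun_eq_iff cscale_def)
  qed
  fix y assume y: "y \<in> tens_space S T"
  have 1: "G (\<lambda>b'. (x + y) (a', b')) = G (\<lambda>b'. x (a', b')) + G (\<lambda>b'. y (a', b'))" for a'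
    using lin_on_add[OF G sl[OF x, of a'] sl[OF y, of a']] by (simp add: plus_fun_def)
  have "F (\<lambda>a'. (G (\<lambda>b'. x (a', b')) + G (\<lambda>b'. y (a', b'))) b) =
      F (\<lambda>a'. G (\<lambda>b'. x (a', b')) b) + F (\<lambda>a'. G (\<lambda>b'. y (a', b')) b)" for b
    using lin_on_add[OF F tmap_inner[OF x, of b] tmap_inner[OF y, of b]] by (simp add: plus_fun_def)
  then show "tmap F G (x + y) = tmap F G x + tmap F G y"
    unfolding tmap_def 1 by (simp add: fun_eq_iff plus_fun_apply)
qed

lemma tmap_in:
  assumes "\<And>u. u \<in> S \<Longrightarrow> F u \<in> S'" "\<And>x. x \<in> T \<Longrightarrow> G x \<in> T'" "z \<in> tens_space S T"
  shows "tmap F G z \<in> tens_space S' T'"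
proof -
  have "z \<in> {z \<in> tens_space S T. tmap F G z \<in> tens_space S' T'}"
  proof (rule tens_space_induct[OF assms(3)])
    show "cfun.subspace {z \<in> tens_space S T. tmap F G z \<in> tens_space S' T'}"
    proof (rule cfun.subspaceI)
      show "0 \<in> {z \<in> tens_space S T. tmap F G z \<in> tens_space S' T'}"
        using lin_on_zero[OF tmap_lin tens_space_subspace] tens_space_zero[of S T] tens_space_zero[of S' T'] by simp
    qed (auto simp: lin_on_add[OF tmap_lin] lin_on_scale[OF tmap_lin]
        cfun.subspace_add[OF tens_space_subspace] cfun.subspace_scale[OF tens_space_subspace])
    show "tens u x \<in> {z \<in> tens_space S T. tmap F G z \<in> tens_space S' T'}" if "u \<in> S" "x \<in> T" for u x
      using tens_in[OF that] tmap_tens[OF that] tens_in[OF assms(1)[OF that(1)] assms(2)[OF that(2)]] by simp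
  qed
  then show ?thesis by simp
qed

end

lemma lin_eq_on_tens:
  assumes "lin_on (tens_space S T) f" "lin_on (tens_space S T) g"
    and "\<And>u x. u \<in> S \<Longrightarrow> x \<in> T \<Longrightarrow> f (tens u x) = g (tens u x)" and "z \<in> tens_space S T"
  shows "f z = g z"
proof -
  have "z \<in> {z \<in> tens_space S T. f z = g z}"
    by (rule tens_space_induct[OF assms(4) subspace_lin_eq[OF tens_space_subspace assms(1,2)]])
      (use assms(3) tens_in in auto)
  then show ?thesis by simp
qed

lemma tmap_cong:
  assumes "cfun.subspace S" "cfun.subspace T" "lin_on S F" "lin_on T G" "lin_on S F'" "lin_on T G'"
    and "\<And>u. u \<in> S \<Longrightarrow> F u = F' u" "\<And>x. x \<in> T \<Longrightarrow> G x = G' x" and "z \<in> tens_space S T"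
  shows "tmap F G z = tmap F' G' z"
  by (rule lin_eq_on_tens[OF tmap_lin tmap_lin _ assms(9)])
    (use assms tmap_tens[of S T F G] tmap_tens[of S T F' G'] in auto)

lemma tmap_comp:
  assumes "cfun.subspace S" "cfun.subspace T" "lin_on S F" "lin_on T G"
    and "cfun.subspace S'" "lin_on S' F'" "lin_on T G'"
    and FS: "\<And>u. u \<in> S \<Longrightarrow> F u \<in> S'" and GT: "\<And>x. x \<in> T \<Longrightarrow> G x \<in> T"
    and z: "z \<in> tens_space S T"
  shows "tmap F' G' (tmap F G z) = tmap (\<lambda>v. F' (F v)) (\<lambda>x. G' (G x)) z"
proof -
  have F'F: "lin_on S (\<lambda>v. F' (F v))" by (rule lin_on_comp[OF assms(3) _ assms(6)]) (use FS in auto)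
  have G'G: "lin_on T (\<lambda>x. G' (G x))" by (rule lin_on_comp[OF assms(4) _ assms(7)]) (use GT in auto)
  note l1 = tmap_lin[OF assms(1-4)]
  note l2 = tmap_lin[OF assms(5,2,6,7)]
  have l: "lin_on (tens_space S T) (\<lambda>z. tmap F' G' (tmap F G z))"
    by (rule lin_on_comp[OF l1 _ l2]) (use tmap_in[OF assms(1-4) FS GT] in auto)
  show ?thesis
    by (rule lin_eq_on_tens[OF l tmap_lin[OF assms(1,2) F'F G'G] _ z])
      (use tmap_tens[OF assms(1-4)] tmap_tens[OF assms(5,2,6,7)] tmap_tens[OF assms(1,2) F'F G'G] FS GT in auto)
qed

lemma tmap_id: "tmap (\<lambda>v. v) (\<lambda>x. x) z = z"
  by (simp add: tmap_def)

lemma tmap_slice: "(\<lambda>a. tmap F (\<lambda>x. x) z (a, b)) = F (\<lambda>a. z (a, b))"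
  by (simp add: tmap_def)

lemma tmap_bij:
  assumes S: "cfun.subspace S" and T: "cfun.subspace T" and F: "lin_on S F" and bij: "bij_betw F S S'"
  shows "bij_betw (tmap F (\<lambda>x. x)) (tens_space S T) (tens_space S' T)"
proof -
  note lin = tmap_lin[OF S T F lin_on_id]
  have img: "F ` S = S'" and inj: "inj_on F S" using bij by (auto simp: bij_betw_def)
  have "z = 0" if z: "z \<in> tens_space S T" "tmap F (\<lambda>x. x) z = 0" for z
  proof -
    have "F (\<lambda>a. z (a, b)) = 0" for b
      unfolding tmap_slice[symmetric] that(2) by (simp add: zero_fun_def)
    then have "(\<lambda>a. z (a, b)) = 0" for b
      using inj tens_slice_left[OF z(1) S] unfolding lin_on_inj_iff[OF F S] by blast
    then have "z (a, b) = 0" for a b using fun_cong[of "\<lambda>a. z (a, b)" 0 a] by (simp add: zero_fun_apply)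
    then show ?thesis by (simp add: fun_eq_iff zero_fun_apply)
  qed
  then have "inj_on (tmap F (\<lambda>x. x)) (tens_space S T)"
    unfolding lin_on_inj_iff[OF lin tens_space_subspace] by blast
  moreover have "tmap F (\<lambda>x. x) ` tens_space S T = tens_space S' T"
  proof (intro subset_antisym subsetI)
    fix y assume "y \<in> tmap F (\<lambda>x. x) ` tens_space S T"
    then show "y \<in> tens_space S' T" using tmap_in[OF S T F lin_on_id, of S' T] img by auto
  next
    fix y assume y: "y \<in> tens_space S' T"
    show "y \<in> tmap F (\<lambda>x. x) ` tens_space S T"
    proof (rule tens_space_induct[OF y subspace_lin_image[OF tens_space_subspace lin]])
      fix u' x assume u': "u' \<in> S'" and x: "x \<in> T"
      obtain u where u: "u \<in> S" "u' = F u" using u' img by blast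
      show "tens u' x \<in> tmap F (\<lambda>x. x) ` tens_space S T"
        by (rule image_eqI[OF _ tens_in[OF u(1) x]]) (simp add: tmap_tens[OF S T F lin_on_id u(1) x] u(2))
    qed
  qed
  ultimately show ?thesis by (simp add: bij_betw_def)
qed

lemma tmap_homs:
  assumes S: "cfun.subspace S" and T: "cfun.subspace T" and S': "cfun.subspace S'"
    and F: "F \<in> homs I S a S' a'"
    and a: "\<And>i. i \<in> I \<Longrightarrow> lin_on S (a i)" "\<And>i v. i \<in> I \<Longrightarrow> v \<in> S \<Longrightarrow> a i v \<in> S"
    and a': "\<And>i. i \<in> I \<Longrightarrow> lin_on S' (a' i)"
    and m: "\<And>i. i \<in> I \<Longrightarrow> lin_on T (m i)" "\<And>i x. i \<in> I \<Longrightarrow> x \<in> T \<Longrightarrow> m i x \<in> T"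
  shows "tmap F (\<lambda>x. x) \<in> homs I (tens_space S T) (\<lambda>i. tmap (a i) (m i)) (tens_space S' T) (\<lambda>i. tmap (a' i) (m i))"
proof (rule homsI)
  note FD = homsD[OF F]
  show "lin_on (tens_space S T) (tmap F (\<lambda>x. x))" by (rule tmap_lin[OF S T FD(1) lin_on_id])
  show "tmap F (\<lambda>x. x) z \<in> tens_space S' T" if "z \<in> tens_space S T" for z
    by (rule tmap_in[OF S T FD(1) lin_on_id FD(2) _ that])
  fix i z assume i: "i \<in> I" and z: "z \<in> tens_space S T"
  have "tmap F (\<lambda>x. x) (tmap (a i) (m i) z) = tmap (\<lambda>v. F (a i v)) (\<lambda>x. m i x) z"
    by (rule tmap_comp[OF S T a(1)[OF i] m(1)[OF i] S FD(1) lin_on_id a(2)[OF i] m(2)[OF i] z])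
  also have "\<dots> = tmap (\<lambda>v. a' i (F v)) (\<lambda>x. m i x) z"
  proof (rule tmap_cong[OF S T _ m(1)[OF i] _ m(1)[OF i] FD(3)[OF i] refl z])
    show "lin_on S (\<lambda>v. F (a i v))" by (rule lin_on_comp[OF a(1)[OF i] _ FD(1)]) (use a(2)[OF i] in auto)
    show "lin_on S (\<lambda>v. a' i (F v))" by (rule lin_on_comp[OF FD(1) _ a'[OF i]]) (use FD(2) in auto)
  qed
  also have "\<dots> = tmap (a' i) (m i) (tmap F (\<lambda>x. x) z)"
    by (rule tmap_comp[OF S T FD(1) lin_on_id S' a'[OF i] m(1)[OF i] FD(2) _ z, symmetric])
  finally show "tmap F (\<lambda>x. x) (tmap (a i) (m i) z) = tmap (a' i) (m i) (tmap F (\<lambda>x. x) z)" .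
qed

text \<open>
  A tensor whose slices lie in \<open>S'\<close> is fixed by a projection onto \<open>S'\<close> in the first factor.
\<close>

lemma tens_retract:
  assumes S: "cfun.subspace S" and T: "cfun.subspace T" and S': "cfun.subspace S'"
    and z: "z \<in> tens_space S T" and sl: "\<And>b. (\<lambda>a. z (a, b)) \<in> S'"
  shows "z \<in> tens_space S' T"
proof -
  obtain p :: "'a vec \<Rightarrow> 'a vec"
    where p: "clinear p" "\<And>v. v \<in> S' \<Longrightarrow> p v = v" "\<And>v. p v \<in> S'"
    using linear_projection[OF S'] by blast
  have "(\<lambda>a. tmap p (\<lambda>x. x) z (a, b)) = (\<lambda>a. z (a, b))" for b
    unfolding tmap_slice by (rule p(2)[OF sl])
  then have "tmap p (\<lambda>x. x) z (a, b) = z (a, b)" for a b by meson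
  then have "tmap p (\<lambda>x. x) z = z" by (simp add: fun_eq_iff)
  then show ?thesis
    using tmap_in[OF S T clinear_lin_on[OF p(1)] lin_on_id p(3) _ z, of T] by simp
qed

lemma tens_splits:
  assumes s: "splits S X Y" and T: "cfun.subspace T"
  shows "splits (tens_space S T) (tens_space X T) (tens_space Y T)"
proof -
  have X: "cfun.subspace X" and Y: "cfun.subspace Y" and i: "X \<inter> Y = {0}"
    and e: "S = {x + y | x y. x \<in> X \<and> y \<in> Y}" using s unfolding splits_def by blast+
  have sub: "X \<subseteq> S" "Y \<subseteq> S" using splits_sub[OF s] by auto
  have z0: "z = 0" if "z \<in> tens_space X T" "z \<in> tens_space Y T" for z
  proof -
    have "(\<lambda>a. z (a, b)) \<in> X \<inter> Y" for b
      by (rule IntI[OF tens_slice_left[OF that(1) X] tens_slice_left[OF that(2) Y]])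
    then have "(\<lambda>a. z (a, b)) = 0" for b unfolding i by (rule singletonD)
    then have "z (a, b) = 0" for a b using fun_cong[of "\<lambda>a. z (a, b)" 0 a] by (simp add: zero_fun_apply)
    then show ?thesis by (simp add: fun_eq_iff zero_fun_apply)
  qed
  have R: "tens_space S T = {x + y |x y. x \<in> tens_space X T \<and> y \<in> tens_space Y T}" (is "_ = ?R")
  proof (intro subset_antisym subsetI)
    have R: "cfun.subspace ?R" by (rule cfun.subspace_sums[OF tens_space_subspace tens_space_subspace])
    fix z assume z: "z \<in> tens_space S T"
    show "z \<in> ?R"
    proof (rule tens_space_induct[OF z R])
      fix u x assume "u \<in> S" and x: "x \<in> T"
      then obtain u1 u2 where u: "u1 \<in> X" "u2 \<in> Y" "u = u1 + u2" using e by blast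
      show "tens u x \<in> ?R" unfolding u(3) tens_bilinear using tens_in[OF u(1) x] tens_in[OF u(2) x] by blast
    qed
  next
    fix z assume "z \<in> ?R"
    then show "z \<in> tens_space S T"
      using cfun.subspace_add[OF tens_space_subspace] tens_space_mono[OF sub(1)] tens_space_mono[OF sub(2)] by blast
  qed
  have "tens_space X T \<inter> tens_space Y T = {0}"
  proof (intro subset_antisym subsetI)
    show "z \<in> {0}" if "z \<in> tens_space X T \<inter> tens_space Y T" for z
      using z0[of z] that by simp
  qed (use tens_space_zero in auto)
  then show ?thesis unfolding splits_def by (intro conjI tens_space_subspace R)
qed

subsection \<open>Tensor modules\<close>

text \<open>The common form of \<open>hc_tensor\<close> and \<open>spin_tensor\<close>: \<open>m g\<close> is the even operator by which
  the generator \<open>g\<close> acts on the second factor.\<close>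

definition tens_mod :: "('g, 'x) smod \<Rightarrow> 'y vec set \<Rightarrow> ('g \<Rightarrow> 'y vec \<Rightarrow> 'y vec) \<Rightarrow>
    ('g, 'x \<times> 'y) smod" where
  "tens_mod V T m = \<lparr>hpart = \<lambda>p. tens_space (hpart V p) T, act = \<lambda>g. tens_op (act V g) (m g)\<rparr>"

lemma spin_tensor_tens_mod:
  "spin_tensor B M = tens_mod B (carr M) (\<lambda>j. act M (transpose j (Suc j)))"
  by (simp add: spin_tensor_def tens_mod_def)

lemma hc_tensor_tens_mod:
  "hc_tensor F M = tens_mod F (carr M) (\<lambda>g. case g of Cl i \<Rightarrow> (\<lambda>x. x) | Sy w \<Rightarrow> act M w)"
  unfolding hc_tensor_def tens_mod_def by (auto simp: fun_eq_iff id_def split: hcgen.splits)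

lemma tens_mod:
  assumes V: "gmod A V" and T: "cfun.subspace T"
    and m: "\<And>g. g \<in> gens A \<Longrightarrow> lin_on T (m g)" "\<And>g x. g \<in> gens A \<Longrightarrow> x \<in> T \<Longrightarrow> m g x \<in> T"
  shows "carr (tens_mod V T m) = tens_space (carr V) T"
    and "gmod A (tens_mod V T m)"
    and "z \<in> tens_space (carr V) T \<Longrightarrow> sg (tens_mod V T m) z = tmap (sg V) (\<lambda>x. x) z"
    and "g \<in> gens A \<Longrightarrow> z \<in> tens_space (carr V) T \<Longrightarrow> act (tens_mod V T m) g z = tmap (act V g) (m g) z"
    and "g \<in> gens A \<Longrightarrow> z \<in> tens_space (carr V) T \<Longrightarrow> tact A (tens_mod V T m) g z = tmap (tact A V g) (m g) z"
proof -
  let ?V = "tens_mod V T m"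
  note gr = gmod_graded[OF V] note S = gmod_carr_subspace[OF V]
  have hp: "hpart ?V p = tens_space (hpart V p) T" for p by (simp add: tens_mod_def)
  have ac: "act ?V g = tmap (act V g) (m g)" for g by (simp add: tens_mod_def tens_op_tmap)
  note ts = tens_splits[OF gr T]
  show c: "carr ?V = tens_space (carr V) T"
    unfolding carr_def[of ?V] hp using ts unfolding splits_def by blast
  have gr': "graded ?V" unfolding hp c by (rule ts)
  show "gmod A ?V"
    unfolding gmod_def
  proof (intro conjI ballI allI)
    show "graded ?V" by (rule gr')
    fix g assume g: "g \<in> gens A"
    show "lin_on (carr ?V) (act ?V g)"
      unfolding c ac by (rule tmap_lin[OF S T act_lin[OF V g] m(1)[OF g]])
    fix p
    show "act ?V g ` hpart ?V p \<subseteq> hpart ?V (p + gpar A g)"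
      unfolding hp ac
      by (rule image_subsetI, rule tmap_in[OF hpart_subspace[OF gr] T
            lin_on_subset[OF act_lin[OF V g] hpart_carr[OF gr]] m(1)[OF g] act_hpart[OF V g] m(2)[OF g]])
  qed
  show s: "sg ?V z = tmap (sg V) (\<lambda>x. x) z" if z: "z \<in> tens_space (carr V) T" for z
  proof (rule lin_eq_on_tens[OF _ tmap_lin[OF S T sg_lin[OF gr] lin_on_id] _ z])
    show "lin_on (tens_space (carr V) T) (sg ?V)" using sg_lin[OF gr'] c by simp
    fix u x assume "u \<in> carr V" and x: "x \<in> T"
    from carr_cases[OF gr this(1)] obtain v0 v1
      where v: "v0 \<in> hpart V 0" "v1 \<in> hpart V 1" "u = v0 + v1" .
    have "tens v0 x \<in> hpart ?V 0" "tens v1 x \<in> hpart ?V 1" unfolding hp using tens_in v x by blast+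
    from sg_add_parts[OF gr' this] have "sg ?V (tens u x) = tens v0 x - tens v1 x"
      unfolding v(3) tens_bilinear .
    also have "\<dots> = tens (v0 - v1) x" by (simp add: tens_def fun_eq_iff pointwise algebra_simps)
    also have "\<dots> = tmap (sg V) (\<lambda>x. x) (tens u x)"
      using tmap_tens[OF S T sg_lin[OF gr] lin_on_id \<open>u \<in> carr V\<close> x] sg_add_parts[OF gr v(1,2)] v(3) by simp
    finally show "sg ?V (tens u x) = tmap (sg V) (\<lambda>x. x) (tens u x)" .
  qed
  show a: "act ?V g z = tmap (act V g) (m g) z" for g z by (simp add: ac)
  show "tact A ?V g z = tmap (tact A V g) (m g) z" if g: "g \<in> gens A" and z: "z \<in> tens_space (carr V) T"
  proof (cases "gpar A g = 0")
    case True then show ?thesis by (simp add: tact_def[abs_def] ac)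
  next
    case False
    then have "tact A ?V g z = tmap (act V g) (m g) (tmap (sg V) (\<lambda>x. x) z)"
      by (simp add: tact_def ac s[OF z])
    also have "\<dots> = tmap (\<lambda>v. act V g (sg V v)) (\<lambda>x. m g x) z"
      by (rule tmap_comp[OF S T sg_lin[OF gr] lin_on_id S act_lin[OF V g] m(1)[OF g] sg_carr[OF gr] _ z])
    finally show ?thesis using False by (simp add: tact_def[abs_def])
  qed
qed

lemma tens_mod_smodule:
  assumes V: "smodule A V" and T: "fd T"
    and m: "\<And>g. g \<in> gens A \<Longrightarrow> lin_on T (m g)" "\<And>g x. g \<in> gens A \<Longrightarrow> x \<in> T \<Longrightarrow> m g x \<in> T"
  shows "smodule A (tens_mod V T m)"
  using tens_mod(1,2)[OF smoduleD(1)[OF V] fd_subspace[OF T] m] fd_tens[OF smoduleD(2)[OF V] T]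
  by (simp add: smodule_iff)

section \<open>Clifford operators and their joint eigenspaces\<close>

text \<open>
  Operators $d_1, \dots, d_{2m}$ that anticommute and have square $-1$, together with further
  operators \<open>x i\<close> that anticommute with all of them.
\<close>

definition cfam :: "nat \<Rightarrow> 'i set \<Rightarrow> 'x vec set \<Rightarrow> (nat \<Rightarrow> 'x vec \<Rightarrow> 'x vec) \<Rightarrow>
    ('i \<Rightarrow> 'x vec \<Rightarrow> 'x vec) \<Rightarrow> bool" where
  "cfam m I S d x \<longleftrightarrow> cfun.subspace S \<and>
     (\<forall>j\<in>{1..2*m}. lin_on S (d j) \<and> (\<forall>v\<in>S. d j v \<in> S \<and> d j (d j v) = - v)) \<and>
     (\<forall>j\<in>{1..2*m}. \<forall>k\<in>{1..2*m}. j \<noteq> k \<longrightarrow> (\<forall>v\<in>S. d j (d k v) = - d k (d j v))) \<and>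
     (\<forall>i\<in>I. lin_on S (x i) \<and> (\<forall>v\<in>S. x i v \<in> S) \<and> (\<forall>j\<in>{1..2*m}. \<forall>v\<in>S. x i (d j v) = - d j (x i v)))"

text \<open>
  The products $d_{2j-1}d_{2j}$ commute and have square $-1$; this is one of their joint
  eigenspaces, the image of a primitive idempotent.
\<close>

definition eig :: "nat \<Rightarrow> 'x vec set \<Rightarrow> (nat \<Rightarrow> 'x vec \<Rightarrow> 'x vec) \<Rightarrow> 'x vec set" where
  "eig m S d = {v \<in> S. \<forall>j\<in>{1..m}. d (2 * j - 1) (d (2 * j) v) = \<i> *c v}"

lemma eig_0 [simp]: "eig 0 S d = S"
  by (simp add: eig_def)

lemma eig_sub: "eig m S d \<subseteq> S"
  by (auto simp: eig_def)

lemma cfam_mono: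
  assumes "cfam m I S d x" "k \<le> m" shows "cfam k I S d x"
proof -
  have s: "\<And>j. j \<in> {1..2*k} \<Longrightarrow> j \<in> {1..2*m}" using assms(2) by auto
  note c = assms(1)[unfolded cfam_def]
  note c1 = conjunct1[OF c] and c2 = conjunct1[OF conjunct2[OF c]]
    and c3 = conjunct1[OF conjunct2[OF conjunct2[OF c]]] and c4 = conjunct2[OF conjunct2[OF conjunct2[OF c]]]
  show ?thesis
    unfolding cfam_def
  proof (intro conjI[OF c1] conjI ballI impI)
    show "lin_on S (d j)" "v \<in> S \<Longrightarrow> d j v \<in> S" "v \<in> S \<Longrightarrow> d j (d j v) = - v" if "j \<in> {1..2*k}" for j v
      using bspec[OF c2 s[OF that]] by auto
    show "d j (d l v) = - d l (d j v)" if "j \<in> {1..2*k}" "l \<in> {1..2*k}" "j \<noteq> l" "v \<in> S" for j l v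
      using bspec[OF bspec[OF c3 s[OF that(1)]] s[OF that(2)]] that(3,4) by blast
    show "lin_on S (x i)" "v \<in> S \<Longrightarrow> x i v \<in> S"
      "j \<in> {1..2*k} \<Longrightarrow> v \<in> S \<Longrightarrow> x i (d j v) = - d j (x i v)" if "i \<in> I" for i j v
      using bspec[OF c4 that] s[of j] by blast+
  qed
qed

lemma lin_rules:
  assumes "lin_on S f" "cfun.subspace S"
  shows "u \<in> S \<Longrightarrow> v \<in> S \<Longrightarrow> f (u + v) = f u + f v" "u \<in> S \<Longrightarrow> v \<in> S \<Longrightarrow> f (u - v) = f u - f v"
    "u \<in> S \<Longrightarrow> f (a *c u) = a *c f u" "u \<in> S \<Longrightarrow> f (- u) = - f u"
  using lin_on_add[OF assms(1)] lin_on_diff[OF assms] lin_on_scale[OF assms(1)] lin_on_uminus[OF assms(1)]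
  by auto

context
  fixes m and I :: "'i set" and S :: "'x vec set" and d and x :: "'i \<Rightarrow> 'x vec \<Rightarrow> 'x vec"
  assumes C: "cfam m I S d x"
begin

lemma cfam_subspace: "cfun.subspace S"
  using C by (simp add: cfam_def)

lemma cfam_d:
  assumes "1 \<le> j" "j \<le> 2 * m"
  shows "lin_on S (d j)" "v \<in> S \<Longrightarrow> d j v \<in> S" "v \<in> S \<Longrightarrow> d j (d j v) = - v"
    "1 \<le> k \<Longrightarrow> k \<le> 2 * m \<Longrightarrow> j \<noteq> k \<Longrightarrow> v \<in> S \<Longrightarrow> d j (d k v) = - d k (d j v)"
proof -
  note c = C[unfolded cfam_def]
  note c2 = conjunct1[OF conjunct2[OF c]] and c3 = conjunct1[OF conjunct2[OF conjunct2[OF c]]]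
  have j: "j \<in> {1..2 * m}" using assms by simp
  show "lin_on S (d j)" "v \<in> S \<Longrightarrow> d j v \<in> S" "v \<in> S \<Longrightarrow> d j (d j v) = - v"
    using bspec[OF c2 j] by blast+
  show "d j (d k v) = - d k (d j v)" if "1 \<le> k" "k \<le> 2 * m" "j \<noteq> k" "v \<in> S"
    using bspec[OF bspec[OF c3 j], of k] that by simp
qed

lemma cfam_x:
  assumes "i \<in> I"
  shows "lin_on S (x i)" "v \<in> S \<Longrightarrow> x i v \<in> S"
    "1 \<le> j \<Longrightarrow> j \<le> 2 * m \<Longrightarrow> v \<in> S \<Longrightarrow> x i (d j v) = - d j (x i v)"
proof -
  note c = C[unfolded cfam_def]
  note c4 = bspec[OF conjunct2[OF conjunct2[OF conjunct2[OF c]]] assms]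
  show "lin_on S (x i)" "v \<in> S \<Longrightarrow> x i v \<in> S" using c4 by blast+
  show "x i (d j v) = - d j (x i v)" if "1 \<le> j" "j \<le> 2 * m" "v \<in> S"
    using bspec[OF bspec[OF conjunct2[OF conjunct2[OF c4]], of j], of v] that by simp
qed

lemma eig_subspace: assumes "k \<le> m" shows "cfun.subspace (eig k S d)"
proof (rule cfun.subspaceI)
  have lin: "lin_on S (\<lambda>v. d (2 * j - 1) (d (2 * j) v))" if "j \<in> {1..k}" for j
    by (rule lin_on_comp[OF cfam_d(1) _ cfam_d(1)]) (use that assms cfam_d(2)[of "2*j"] in auto)
  note sub = cfam_subspace
  show "0 \<in> eig k S d"
    using cfun.subspace_0[OF sub] lin_on_zero[OF lin sub] by (simp add: eig_def)
  show "u + v \<in> eig k S d" if "u \<in> eig k S d" "v \<in> eig k S d" for u v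
    using that cfun.subspace_add[OF sub] lin_on_add[OF lin]
    by (simp add: eig_def cfun.scale_right_distrib)
  show "c *c v \<in> eig k S d" if "v \<in> eig k S d" for c v
    using that cfun.subspace_scale[OF sub] lin_on_scale[OF lin]
    by (simp add: eig_def mult.commute)
qed

text \<open>An operator anticommuting with all \<open>d j\<close> commutes with the products that define \<open>eig\<close>.\<close>

lemma eig_stable:
  assumes "k \<le> m" and y: "lin_on S y" "\<And>v. v \<in> S \<Longrightarrow> y v \<in> S"
    and yd: "\<And>j v. 1 \<le> j \<Longrightarrow> j \<le> 2 * k \<Longrightarrow> v \<in> S \<Longrightarrow> y (d j v) = - d j (y v)"
    and v: "v \<in> eig k S d"
  shows "y v \<in> eig k S d"
proof -
  have vS: "v \<in> S" using v by (simp add: eig_def)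
  have "d (2 * j - 1) (d (2 * j) (y v)) = \<i> *c y v" if j: "j \<in> {1..k}" for j
  proof -
    have r: "1 \<le> 2 * j - 1" "2 * j - 1 \<le> 2 * m" "1 \<le> 2 * j" "2 * j \<le> 2 * m"
      "2 * j - 1 \<le> 2 * k" "2 * j \<le> 2 * k" using j assms(1) by auto
    have 1: "d (2 * j) (y v) = - y (d (2 * j) v)" using yd[OF r(3,6) vS] by simp
    have "d (2 * j - 1) (d (2 * j) (y v)) = - d (2 * j - 1) (y (d (2 * j) v))"
      unfolding 1 by (rule lin_on_uminus[OF cfam_d(1)[OF r(1,2)] y(2)[OF cfam_d(2)[OF r(3,4) vS]]])
    also have "\<dots> = y (d (2 * j - 1) (d (2 * j) v))"
      using yd[OF r(1,5) cfam_d(2)[OF r(3,4) vS]] by simp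
    also have "\<dots> = y (\<i> *c v)" using v j by (simp add: eig_def)
    finally show ?thesis using lin_on_scale[OF y(1) vS] by simp
  qed
  then show ?thesis using y(2)[OF vS] by (simp add: eig_def)
qed

end

text \<open>One step: the involution \<open>\<kappa> = - \<i> d\<^sub>p d\<^sub>q\<close> for the pair \<open>p = 2k+1\<close>, \<open>q = 2k+2\<close> anticommutes
  with \<open>d\<^sub>p\<close>, so that \<open>eig k\<close> is the direct sum of \<open>eig (k+1)\<close> and its image under \<open>d\<^sub>p\<close>; \<open>prA\<close> and \<open>prB\<close>
  are the two coordinates.\<close>

definition kap :: "nat \<Rightarrow> (nat \<Rightarrow> 'x vec \<Rightarrow> 'x vec) \<Rightarrow> 'x vec \<Rightarrow> 'x vec" where
  "kap k d v = (- \<i>) *c d (2 * k + 1) (d (2 * k + 2) v)"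

definition prA :: "nat \<Rightarrow> (nat \<Rightarrow> 'x vec \<Rightarrow> 'x vec) \<Rightarrow> 'x vec \<Rightarrow> 'x vec" where
  "prA k d v = (1/2) *c (v + kap k d v)"

definition prB :: "nat \<Rightarrow> (nat \<Rightarrow> 'x vec \<Rightarrow> 'x vec) \<Rightarrow> 'x vec \<Rightarrow> 'x vec" where
  "prB k d v = - d (2 * k + 1) ((1/2) *c (v - kap k d v))"

lemma half_add: "(1/2) *c ((a::'x vec) + b) + (1/2) *c (a - b) = a"
  by (rule ext) (simp add: pointwise add_divide_distrib diff_divide_distrib)

lemma half_double: "(1/2) *c ((a::'x vec) + a) = a"
  by (rule ext) (simp add: pointwise)

context
  fixes k and I :: "'i set" and S :: "'x vec set" and d and x :: "'i \<Rightarrow> 'x vec \<Rightarrow> 'x vec"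
  assumes C: "cfam (Suc k) I S d x"
begin

private lemma sub: "cfun.subspace S" by (rule cfam_subspace[OF C])

private lemma
  p: "lin_on S (d (2 * k + 1))" "v \<in> S \<Longrightarrow> d (2 * k + 1) v \<in> S" "v \<in> S \<Longrightarrow> d (2 * k + 1) (d (2 * k + 1) v) = - v"
  and q: "lin_on S (d (2 * k + 2))" "v \<in> S \<Longrightarrow> d (2 * k + 2) v \<in> S" "v \<in> S \<Longrightarrow> d (2 * k + 2) (d (2 * k + 2) v) = - v"
  and qp: "v \<in> S \<Longrightarrow> d (2 * k + 2) (d (2 * k + 1) v) = - d (2 * k + 1) (d (2 * k + 2) v)"
proof -
  have r: "1 \<le> 2 * k + 1" "2 * k + 1 \<le> 2 * Suc k" "1 \<le> 2 * k + 2" "2 * k + 2 \<le> 2 * Suc k"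
    and ne: "2 * k + 2 \<noteq> 2 * k + 1" by auto
  show "lin_on S (d (2 * k + 1))" by (rule cfam_d(1)[OF C r(1,2)])
  show "d (2 * k + 1) v \<in> S" "d (2 * k + 1) (d (2 * k + 1) v) = - v" if "v \<in> S"
    by (fact cfam_d(2,3)[OF C r(1,2) that])+
  show "lin_on S (d (2 * k + 2))" by (rule cfam_d(1)[OF C r(3,4)])
  show "d (2 * k + 2) v \<in> S" "d (2 * k + 2) (d (2 * k + 2) v) = - v" if "v \<in> S"
    by (fact cfam_d(2,3)[OF C r(3,4) that])+
  show "d (2 * k + 2) (d (2 * k + 1) v) = - d (2 * k + 1) (d (2 * k + 2) v)" if "v \<in> S"
    by (rule cfam_d(4)[OF C r(3,4) r(1,2) ne that])
qed

private lemmas pl = lin_rules[OF p(1) sub]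
private lemmas ql = lin_rules[OF q(1) sub]
private lemmas cl = cfun.subspace_add[OF sub] cfun.subspace_diff[OF sub] cfun.subspace_scale[OF sub] cfun.subspace_neg[OF sub]

lemma kap_lin: "lin_on S (kap k d)"
  unfolding kap_def by (rule lin_on_scale_fun, rule lin_on_comp[OF q(1) _ p(1)]) (use q(2) in auto)

lemma kap_in: "v \<in> S \<Longrightarrow> kap k d v \<in> S"
  unfolding kap_def by (intro cl p(2) q(2))

lemma kap_kap: assumes v: "v \<in> S" shows "kap k d (kap k d v) = v"
proof -
  note qv = q(2)[OF v] note pqv = p(2)[OF qv]
  have "d (2 * k + 2) (kap k d v) = (- \<i>) *c d (2 * k + 2) (d (2 * k + 1) (d (2 * k + 2) v))"
    unfolding kap_def by (rule ql(3)[OF pqv])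
  also have "d (2 * k + 2) (d (2 * k + 1) (d (2 * k + 2) v)) = d (2 * k + 1) v"
    unfolding qp[OF qv] q(3)[OF v] pl(4)[OF v] by simp
  finally have e: "d (2 * k + 1) (d (2 * k + 2) (kap k d v)) = (- \<i>) *c (- v)"
    by (simp only: pl(3)[OF p(2)[OF v]] p(3)[OF v])
  show ?thesis unfolding kap_def[of k d "kap k d v"] e by simp
qed

lemma kap_p: assumes v: "v \<in> S" shows "kap k d (d (2 * k + 1) v) = - d (2 * k + 1) (kap k d v)"
proof -
  note qv = q(2)[OF v]
  have "kap k d (d (2 * k + 1) v) = (- \<i>) *c (- d (2 * k + 1) (d (2 * k + 1) (d (2 * k + 2) v)))"
    unfolding kap_def qp[OF v] pl(4)[OF p(2)[OF qv]] ..
  moreover have "d (2 * k + 1) (kap k d v) = (- \<i>) *c d (2 * k + 1) (d (2 * k + 1) (d (2 * k + 2) v))"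
    unfolding kap_def by (rule pl(3)[OF p(2)[OF qv]])
  ultimately show ?thesis by simp
qed

lemma q_via_kap: assumes v: "v \<in> S" shows "d (2 * k + 2) v = (- \<i>) *c d (2 * k + 1) (kap k d v)"
proof -
  note qv = q(2)[OF v]
  have "d (2 * k + 1) (kap k d v) = (- \<i>) *c (- d (2 * k + 2) v)"
    unfolding kap_def pl(3)[OF p(2)[OF qv]] p(3)[OF qv] ..
  then show ?thesis by simp
qed

lemma kap_eig: assumes "v \<in> eig (Suc k) S d" shows "kap k d v = v"
proof -
  have n: "2 * Suc k - 1 = 2 * k + 1" "2 * Suc k = 2 * k + 2" by auto
  have "\<forall>j\<in>{1..Suc k}. d (2 * j - 1) (d (2 * j) v) = \<i> *c v" using assms unfolding eig_def by blast
  from bspec[OF this, of "Suc k"] have "d (2 * k + 1) (d (2 * k + 2) v) = \<i> *c v" unfolding n by auto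
  then show ?thesis unfolding kap_def by simp
qed

lemma eig_Suc: "v \<in> eig (Suc k) S d \<longleftrightarrow> v \<in> eig k S d \<and> kap k d v = v"
proof -
  have "d (2 * Suc k - 1) (d (2 * Suc k) v) = \<i> *c v \<longleftrightarrow> kap k d v = v" (is "?w = _ \<longleftrightarrow> _")
  proof
    assume "?w = \<i> *c v" then show "kap k d v = v" unfolding kap_def by simp
  next
    assume "kap k d v = v"
    then have "\<i> *c kap k d v = \<i> *c v" by simp
    then show "?w = \<i> *c v" unfolding kap_def by simp
  qed
  then show ?thesis unfolding eig_def by (auto simp: atLeastAtMostSuc_conv)
qed

lemma kap_y:
  assumes y: "lin_on S y" "\<And>v. v \<in> S \<Longrightarrow> y v \<in> S"
    and yp: "\<And>v. v \<in> S \<Longrightarrow> y (d (2 * k + 1) v) = - d (2 * k + 1) (y v)"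
    and yq: "\<And>v. v \<in> S \<Longrightarrow> y (d (2 * k + 2) v) = - d (2 * k + 2) (y v)" and v: "v \<in> S"
  shows "kap k d (y v) = y (kap k d v)"
    and "prA k d (y v) = y (prA k d v)" and "prB k d (y v) = - y (prB k d v)"
proof -
  note qv = q(2)[OF v] note yl = lin_rules[OF y(1) sub]
  have "d (2 * k + 2) (y v) = - y (d (2 * k + 2) v)" using yq[OF v] by simp
  then have "d (2 * k + 1) (d (2 * k + 2) (y v)) = - d (2 * k + 1) (y (d (2 * k + 2) v))"
    using pl(4)[OF y(2)[OF qv]] by simp
  then have "d (2 * k + 1) (d (2 * k + 2) (y v)) = y (d (2 * k + 1) (d (2 * k + 2) v))" using yp[OF qv] by simp
  then show kap: "kap k d (y v) = y (kap k d v)"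
    unfolding kap_def yl(3)[OF p(2)[OF qv]] by (simp only:)
  show "prA k d (y v) = y (prA k d v)"
    unfolding prA_def kap yl(3)[OF cl(1)[OF v kap_in[OF v]]] yl(1)[OF v kap_in[OF v]] ..
  let ?w = "(1/2) *c (v - kap k d v)"
  have w: "?w \<in> S" by (intro cl v kap_in)
  have "y ?w = (1/2) *c (y v - y (kap k d v))"
    unfolding yl(3)[OF cl(2)[OF v kap_in[OF v]]] yl(2)[OF v kap_in[OF v]] ..
  then have "prB k d (y v) = - d (2 * k + 1) (y ?w)" unfolding prB_def kap by simp
  also have "\<dots> = y (d (2 * k + 1) ?w)" using yp[OF w] by simp
  also have "\<dots> = - y (prB k d v)" unfolding prB_def using yl(4)[OF p(2)[OF w]] by simp
  finally show "prB k d (y v) = - y (prB k d v)" .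
qed

lemma prAB_lin: "lin_on S (prA k d)" "lin_on S (prB k d)"
proof -
  show "lin_on S (prA k d)" unfolding prA_def by (intro lin_on_scale_fun lin_on_add_fun lin_on_id kap_lin)
  have "lin_on S (\<lambda>v. d (2 * k + 1) ((1/2) *c (v - kap k d v)))"
    by (rule lin_on_comp[OF _ _ p(1)], intro lin_on_scale_fun lin_on_diff_fun lin_on_id kap_lin)
      (auto intro: cl kap_in)
  then have "lin_on S (\<lambda>v. (-1) *c d (2 * k + 1) ((1/2) *c (v - kap k d v)))" by (rule lin_on_scale_fun)
  then show "lin_on S (prB k d)" unfolding prB_def by simp
qed

lemma prAB_sum: assumes v: "v \<in> S" shows "v = prA k d v + d (2 * k + 1) (prB k d v)"
proof -
  have w: "(1/2) *c (v - kap k d v) \<in> S" by (intro cl v kap_in)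
  have "d (2 * k + 1) (prB k d v) = (1/2) *c (v - kap k d v)"
    unfolding prB_def pl(4)[OF p(2)[OF w]] p(3)[OF w] by simp
  then show ?thesis unfolding prA_def by (simp only: half_add)
qed

lemma kap_prAB: assumes v: "v \<in> S" shows "kap k d (prA k d v) = prA k d v" "kap k d (prB k d v) = prB k d v"
proof -
  note kl = lin_rules[OF kap_lin sub] note kv = kap_in[OF v]
  show "kap k d (prA k d v) = prA k d v"
    unfolding prA_def kl(3)[OF cl(1)[OF v kv]] kl(1)[OF v kv] kap_kap[OF v] by (simp add: add.commute)
  let ?w = "(1/2) *c (v - kap k d v)"
  have w: "?w \<in> S" by (intro cl v kap_in)
  have "kap k d ?w = (1/2) *c (kap k d v - v)"
    unfolding kl(3)[OF cl(2)[OF v kv]] kl(2)[OF v kv] kap_kap[OF v] ..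
  also have "\<dots> = - ?w" by (simp add: cfun.scale_right_diff_distrib)
  finally have "d (2 * k + 1) (kap k d ?w) = - d (2 * k + 1) ?w" using pl(4)[OF w] by simp
  then have "kap k d (d (2 * k + 1) ?w) = d (2 * k + 1) ?w" using kap_p[OF w] by simp
  then show "kap k d (prB k d v) = prB k d v"
    unfolding prB_def kl(4)[OF p(2)[OF w]] by simp
qed

lemma prAB_p: assumes v: "v \<in> S"
  shows "prA k d (d (2 * k + 1) v) = - prB k d v" "prB k d (d (2 * k + 1) v) = prA k d v"
proof -
  note kv = kap_in[OF v]
  have 1: "d (2 * k + 1) v + kap k d (d (2 * k + 1) v) = d (2 * k + 1) (v - kap k d v)"
    unfolding kap_p[OF v] pl(2)[OF v kv] by simp
  show "prA k d (d (2 * k + 1) v) = - prB k d v"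
    unfolding prA_def prB_def 1 pl(3)[OF cl(2)[OF v kv]] by simp
  have s: "v + kap k d v \<in> S" by (intro cl v kv)
  have 2: "d (2 * k + 1) v - kap k d (d (2 * k + 1) v) = d (2 * k + 1) (v + kap k d v)"
    unfolding kap_p[OF v] pl(1)[OF v kv] by simp
  show "prB k d (d (2 * k + 1) v) = prA k d v"
    unfolding prA_def prB_def 2 pl(3)[OF p(2)[OF s]] p(3)[OF s]
    by (simp only: cfun.scale_minus_right minus_minus)
qed

lemma prAB_kap: assumes v: "v \<in> S"
  shows "prA k d (kap k d v) = prA k d v" "prB k d (kap k d v) = - prB k d v"
proof -
  note kv = kap_in[OF v]
  show "prA k d (kap k d v) = prA k d v" unfolding prA_def kap_kap[OF v] by (simp add: add.commute)
  have e: "(1/2) *c (kap k d v - v) = - ((1/2) *c (v - kap k d v))"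
    by (simp add: cfun.scale_right_diff_distrib)
  have w: "(1/2) *c (v - kap k d v) \<in> S" by (intro cl v kap_in)
  show "prB k d (kap k d v) = - prB k d v" unfolding prB_def kap_kap[OF v] e pl(4)[OF w] ..
qed

lemma prAB_eig: assumes v: "v \<in> eig (Suc k) S d" shows "prA k d v = v" "prB k d v = 0"
  unfolding prA_def prB_def kap_eig[OF v]
  by (simp_all only: half_double diff_self cfun.scale_zero_right lin_on_zero[OF p(1) sub] minus_zero)

lemma p_eig: assumes "v \<in> eig k S d" shows "d (2 * k + 1) v \<in> eig k S d"
  by (rule eig_stable[where y="d (2 * k + 1)", OF C _ p(1) _ _ assms])
    (use p(2) cfam_d(4)[OF C, of "2 * k + 1"] in auto)

lemma q_eig: assumes "v \<in> eig k S d" shows "d (2 * k + 2) v \<in> eig k S d"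
  by (rule eig_stable[where y="d (2 * k + 2)", OF C _ q(1) _ _ assms])
    (use q(2) cfam_d(4)[OF C, of "2 * k + 2"] in auto)

lemma prAB_in: assumes v: "v \<in> eig k S d" shows "prA k d v \<in> eig (Suc k) S d" "prB k d v \<in> eig (Suc k) S d"
proof -
  have s: "cfun.subspace (eig k S d)" by (rule eig_subspace[OF C]) simp
  have vS: "v \<in> S" using v eig_sub by blast
  have kv: "kap k d v \<in> eig k S d" unfolding kap_def by (intro cfun.subspace_scale[OF s] p_eig q_eig v)
  have "prA k d v \<in> eig k S d"
    unfolding prA_def by (intro cfun.subspace_scale[OF s] cfun.subspace_add[OF s] v kv)
  then show "prA k d v \<in> eig (Suc k) S d" unfolding eig_Suc using kap_prAB[OF vS] by simp
  have "prB k d v \<in> eig k S d"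
    unfolding prB_def by (intro cfun.subspace_neg[OF s] cfun.subspace_scale[OF s] cfun.subspace_diff[OF s] p_eig v kv)
  then show "prB k d v \<in> eig (Suc k) S d" unfolding eig_Suc using kap_prAB[OF vS] by simp
qed

end

lemma eig_generates:
  assumes "cfam m I S d x" and K: "cfun.subspace K" and st: "\<And>j v. 1 \<le> j \<Longrightarrow> j \<le> 2 * m \<Longrightarrow> v \<in> K \<Longrightarrow> d j v \<in> K"
    and "eig m S d \<subseteq> K"
  shows "S \<subseteq> K"
  using assms(1,3,4)
proof (induction m)
  case 0 then show ?case by simp
next
  case (Suc k)
  note C = Suc.prems(1)
  have "eig k S d \<subseteq> K"
  proof
    fix v assume v: "v \<in> eig k S d"
    have a: "prA k d v \<in> K" "prB k d v \<in> K" using prAB_in[OF C v] Suc.prems(3) by blast+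
    have "d (2 * k + 1) (prB k d v) \<in> K" by (rule Suc.prems(2)[OF _ _ a(2)]) auto
    then have "prA k d v + d (2 * k + 1) (prB k d v) \<in> K" by (rule cfun.subspace_add[OF K a(1)])
    moreover have "v \<in> S" using v eig_sub by blast
    ultimately show "v \<in> K" using prAB_sum[OF C] by metis
  qed
  with Suc.IH[OF cfam_mono[OF C]] Suc.prems(2) show ?case by simp
qed

text \<open>An intertwiner of the eigenspaces is extended one pair of Clifford operators at a time by
  \<open>F (a + d\<^sub>p b) = F a + d\<^sub>p (F b)\<close>.\<close>

lemma eig_extend_step:
  assumes C: "cfam (Suc k) I S d x" and C': "cfam (Suc k) I S' d' x'"
    and f: "f \<in> homs I (eig (Suc k) S d) x (eig (Suc k) S' d') x'"
  obtains g where "g \<in> homs I (eig k S d) x (eig k S' d') x'"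
    "\<And>v. v \<in> eig k S d \<Longrightarrow> g (d (2 * k + 1) v) = d' (2 * k + 1) (g v)"
    "\<And>v. v \<in> eig k S d \<Longrightarrow> g (d (2 * k + 2) v) = d' (2 * k + 2) (g v)"
    "\<And>v. v \<in> eig (Suc k) S d \<Longrightarrow> g v = f v"
proof -
  note f = homsD[OF f]
  let ?p = "2 * k + 1" and ?q = "2 * k + 2"
  let ?E = "eig k S d" and ?E1 = "eig (Suc k) S d" and ?E' = "eig k S' d'" and ?E1' = "eig (Suc k) S' d'"
  have ES: "?E \<subseteq> S" "?E1 \<subseteq> S" "?E1 \<subseteq> ?E" and ES': "?E' \<subseteq> S'" "?E1' \<subseteq> S'" "?E1' \<subseteq> ?E'"
    using eig_sub[of k S d] eig_sub[of k S' d'] eig_Suc[OF C] eig_Suc[OF C'] eig_sub[of "Suc k" S d]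
      eig_sub[of "Suc k" S' d'] by blast+
  have sE1: "cfun.subspace ?E1" and sE: "cfun.subspace ?E" and sE': "cfun.subspace ?E'"
    using eig_subspace[OF C, of "Suc k"] eig_subspace[OF C, of k] eig_subspace[OF C', of k] by auto
  note sub' = cfam_subspace[OF C']
  have p': "lin_on S' (d' ?p)" "\<And>v. v \<in> S' \<Longrightarrow> d' ?p v \<in> S'" "\<And>v. v \<in> S' \<Longrightarrow> d' ?p (d' ?p v) = - v"
    using cfam_d[OF C', of ?p] by auto
  note pl' = lin_rules[OF p'(1) sub'] note fl = lin_rules[OF f(1) sE1]
  define g where "g v = f (prA k d v) + d' ?p (f (prB k d v))" for v
  have ab: "prA k d v \<in> ?E1" "prB k d v \<in> ?E1" if "v \<in> ?E" for v using prAB_in[OF C that] .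
  have fab: "f (prA k d v) \<in> ?E1'" "f (prB k d v) \<in> ?E1'" if "v \<in> ?E" for v
    using f(2) ab[OF that] by auto
  have fabS: "f (prA k d v) \<in> S'" "f (prB k d v) \<in> S'" if "v \<in> ?E" for v
    using fab[OF that] ES' by auto
  have anti: "g (y v) = y' (g v)"
    if v: "v \<in> ?E" and y: "lin_on S y" "\<And>v. v \<in> S \<Longrightarrow> y v \<in> S"
      "\<And>v. v \<in> S \<Longrightarrow> y (d ?p v) = - d ?p (y v)" "\<And>v. v \<in> S \<Longrightarrow> y (d ?q v) = - d ?q (y v)"
      and y': "lin_on S' y'" "\<And>v. v \<in> S' \<Longrightarrow> y' v \<in> S'" "\<And>v. v \<in> S' \<Longrightarrow> y' (d' ?p v) = - d' ?p (y' v)"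
      and fy: "\<And>v. v \<in> ?E1 \<Longrightarrow> f (y v) = y' (f v)" and yE: "\<And>v. v \<in> ?E1 \<Longrightarrow> y v \<in> ?E1" for y y' v
  proof -
    have vS: "v \<in> S" using v ES by auto
    have ky: "prA k d (y v) = y (prA k d v)" "prB k d (y v) = - y (prB k d v)"
      using kap_y(2,3)[where y=y, OF C y(1) _ _ _ vS] y(2-4) by blast+
    note F = fabS[OF v]
    have "f (- y (prB k d v)) = - y' (f (prB k d v))"
      using fl(4)[OF yE[OF ab(2)[OF v]]] fy[OF ab(2)[OF v]] by simp
    then have "g (y v) = y' (f (prA k d v)) + d' ?p (- y' (f (prB k d v)))"
      unfolding g_def ky fy[OF ab(1)[OF v]] by simp
    also have "d' ?p (- y' (f (prB k d v))) = y' (d' ?p (f (prB k d v)))"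
      using pl'(4)[OF y'(2)[OF F(2)]] y'(3)[OF F(2)] by simp
    finally show ?thesis unfolding g_def using lin_on_add[OF y'(1) F(1) p'(2)[OF F(2)]] by simp
  qed
  have linE: "lin_on ?E (prA k d)" "lin_on ?E (prB k d)"
    using lin_on_subset[OF prAB_lin(1)[OF C] ES(1)] lin_on_subset[OF prAB_lin(2)[OF C] ES(1)] by auto
  have fA: "lin_on ?E (\<lambda>v. f (prA k d v))" by (rule lin_on_comp[OF linE(1) _ f(1)]) (use ab in auto)
  have fB: "lin_on ?E (\<lambda>v. f (prB k d v))" by (rule lin_on_comp[OF linE(2) _ f(1)]) (use ab in auto)
  have glin: "lin_on ?E g"
    unfolding g_def by (rule lin_on_add_fun[OF fA], rule lin_on_comp[OF fB _ p'(1)]) (use fabS in auto)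
  have gin: "g v \<in> ?E'" if v: "v \<in> ?E" for v
    unfolding g_def using fab[OF v] ES' p_eig[OF C'] by (intro cfun.subspace_add[OF sE']) auto
  have gx: "g (x i v) = x' i (g v)" if i: "i \<in> I" and v: "v \<in> ?E" for i v
  proof (rule anti[where y="x i" and y'="x' i", OF v cfam_x(1)[OF C i] cfam_x(2)[OF C i] _ _ cfam_x(1)[OF C' i] cfam_x(2)[OF C' i] _ f(3)[OF i]])
    show "x i v \<in> ?E1" if "v \<in> ?E1" for v
      by (rule eig_stable[where y="x i", OF C _ cfam_x(1)[OF C i] _ _ that]) (use cfam_x(2,3)[OF C i] in auto)
  qed (use cfam_x(3)[OF C i] cfam_x(3)[OF C' i] in auto)
  have gp: "g (d ?p v) = d' ?p (g v)" if v: "v \<in> ?E" for v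
  proof -
    have vS: "v \<in> S" using v ES by auto
    note F = fabS[OF v]
    have "g (d ?p v) = - f (prB k d v) + d' ?p (f (prA k d v))"
      unfolding g_def prAB_p[OF C vS] fl(4)[OF ab(2)[OF v]] ..
    then show ?thesis
      unfolding g_def pl'(1)[OF F(1) p'(2)[OF F(2)]] p'(3)[OF F(2)] by (simp add: add.commute)
  qed
  have gk: "g (kap k d v) = kap k d' (g v)" if v: "v \<in> ?E" for v
  proof -
    have vS: "v \<in> S" using v ES by auto
    note F = fabS[OF v]
    have 1: "g (kap k d v) = f (prA k d v) - d' ?p (f (prB k d v))"
      unfolding g_def prAB_kap[OF C vS] fl(4)[OF ab(2)[OF v]] pl'(4)[OF F(2)] by simp
    have "kap k d' (g v) = kap k d' (f (prA k d v)) + kap k d' (d' ?p (f (prB k d v)))"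
      unfolding g_def by (rule lin_on_add[OF kap_lin[OF C'] F(1) p'(2)[OF F(2)]])
    then show ?thesis
      unfolding 1 kap_p[OF C' F(2)] kap_eig[OF C' fab(1)[OF v]] kap_eig[OF C' fab(2)[OF v]] by simp
  qed
  have gq: "g (d ?q v) = d' ?q (g v)" if v: "v \<in> ?E" for v
  proof -
    have vS: "v \<in> S" using v ES by auto
    have gS: "g v \<in> S'" using gin[OF v] ES' by auto
    have kE: "kap k d v \<in> ?E"
      unfolding kap_def by (intro cfun.subspace_scale[OF sE] p_eig[OF C] q_eig[OF C] v)
    have "g (d ?q v) = (- \<i>) *c g (d ?p (kap k d v))"
      unfolding q_via_kap[OF C vS] by (rule lin_on_scale[OF glin p_eig[OF C kE]])
    also have "\<dots> = (- \<i>) *c d' ?p (kap k d' (g v))" unfolding gp[OF kE] gk[OF v] ..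
    also have "\<dots> = d' ?q (g v)" by (rule q_via_kap[OF C' gS, symmetric])
    finally show ?thesis .
  qed
  have gf: "g v = f v" if v: "v \<in> ?E1" for v
    unfolding g_def prAB_eig[OF C v] lin_on_zero[OF f(1) sE1] lin_on_zero[OF p'(1) sub'] by simp
  have g: "g \<in> homs I ?E x ?E' x'" by (rule homsI) (fact glin gin gx)+
  show ?thesis by (rule that[OF g gp gq gf])
qed

lemma eig_extend:
  fixes I :: "'i set"
  assumes C: "cfam m I S d x" and C': "cfam m I S' d' x'"
    and f: "f \<in> homs I (eig m S d) x (eig m S' d') x'"
  shows "\<exists>F \<in> homs (Inl ` {1..2*m} \<union> Inr ` I) S (case_sum d x) S' (case_sum d' x').
     \<forall>v\<in>eig m S d. F v = f v"
proof -
  let ?J = "\<lambda>k. Inl ` {2*k+1..2*m} \<union> Inr ` I"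
  have CJ: "cfam (Suc k) (?J (Suc k)) S d (case_sum d x)" if k: "Suc k \<le> m" and C: "cfam m I S d x"
    for S :: "'z vec set" and d x k
    unfolding cfam_def
  proof (intro conjI ballI impI)
    show "cfun.subspace S" by (rule cfam_subspace[OF C])
    fix i assume i: "i \<in> ?J (Suc k)"
    then consider j where "j \<in> I" "i = Inr j" | j where "i = Inl j" "2 * Suc k + 1 \<le> j" "j \<le> 2 * m" by auto
    note cases = this
    show "lin_on S (case_sum d x i)"
      using cases by cases (use cfam_x(1)[OF C] cfam_d(1)[OF C] in auto)
    fix v assume v: "v \<in> S"
    show "case_sum d x i v \<in> S"
      using cases by cases (use cfam_x(2)[OF C] cfam_d(2)[OF C] v in auto)
    fix j assume j: "j \<in> {1..2 * Suc k}"
    show "case_sum d x i (d j v) = - d j (case_sum d x i v)"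
      using cases
    proof cases
      case 1 then show ?thesis using cfam_x(3)[OF C 1(1)] v j k by auto
    next
      case (2 j')
      then show ?thesis using cfam_d(4)[OF C, of j' j v] v j k by auto
    qed
  next
    fix j assume j: "j \<in> {1..2 * Suc k}"
    then have j': "1 \<le> j" "j \<le> 2 * m" using k by auto
    show "lin_on S (d j)" by (rule cfam_d(1)[OF C j'])
    show "d j v \<in> S" "d j (d j v) = - v" if "v \<in> S" for v using cfam_d(2,3)[OF C j' that] by auto
    show "d j (d l v) = - d l (d j v)" if "l \<in> {1..2 * Suc k}" "j \<noteq> l" "v \<in> S" for l v
      using cfam_d(4)[OF C j' _ _ that(2,3)] that(1) k by auto
  qed
  have main: "\<exists>F \<in> homs (?J k) (eig k S d) (case_sum d x) (eig k S' d') (case_sum d' x').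
     \<forall>v\<in>eig m S d. F v = f v" if "k \<le> m" for k
    using that
  proof (induction rule: inc_induct)
    case base
    have "f \<in> homs (?J m) (eig m S d) (case_sum d x) (eig m S' d') (case_sum d' x')"
      using homsD[OF f] by (intro homsI) auto
    then show ?case by blast
  next
    case (step k)
    then obtain F where F: "F \<in> homs (?J (Suc k)) (eig (Suc k) S d) (case_sum d x) (eig (Suc k) S' d') (case_sum d' x')"
      "\<forall>v\<in>eig m S d. F v = f v" by blast
    have k: "Suc k \<le> m" using step by simp
    obtain g where g: "g \<in> homs (?J (Suc k)) (eig k S d) (case_sum d x) (eig k S' d') (case_sum d' x')"
      "\<And>v. v \<in> eig k S d \<Longrightarrow> g (d (2 * k + 1) v) = d' (2 * k + 1) (g v)"
      "\<And>v. v \<in> eig k S d \<Longrightarrow> g (d (2 * k + 2) v) = d' (2 * k + 2) (g v)"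
      "\<And>v. v \<in> eig (Suc k) S d \<Longrightarrow> g v = F v"
      using eig_extend_step[OF CJ[OF k C] CJ[OF k C'] F(1)] by blast
    have J: "?J k \<subseteq> insert (Inl (2*k+1)) (insert (Inl (2*k+2)) (?J (Suc k)))"
    proof
      fix i :: "nat + 'i" assume "i \<in> ?J k"
      then consider j where "i = Inl j" "2*k+1 \<le> j" "j \<le> 2*m" | j where "i = Inr j" "j \<in> I" by auto
      then show "i \<in> insert (Inl (2*k+1)) (insert (Inl (2*k+2)) (?J (Suc k)))"
      proof cases
        case 1
        then have "j = 2*k+1 \<or> j = 2*k+2 \<or> 2 * Suc k + 1 \<le> j" by arith
        then show ?thesis using 1 by auto
      qed auto
    qed
    have "g \<in> homs (?J k) (eig k S d) (case_sum d x) (eig k S' d') (case_sum d' x')"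
    proof (rule homsI[OF homsD(1,2)[OF g(1)]])
      fix i v assume "i \<in> ?J k" and v: "v \<in> eig k S d"
      then consider "i = Inl (2*k+1)" | "i = Inl (2*k+2)" | "i \<in> ?J (Suc k)" using J by blast
      then show "g (case_sum d x i v) = case_sum d' x' i (g v)"
        by cases (use g(2,3)[OF v] homsD(3)[OF g(1) _ v] in auto)
    qed
    moreover have "eig m S d \<subseteq> eig (Suc k) S d" using k by (auto simp: eig_def)
    ultimately show ?case using g(4) F(2) by (metis subsetD)
  qed
  from main[of 0] show ?thesis by simp
qed

text \<open>Restriction to the joint eigenspace identifies the Clifford-linear intertwiners.\<close>

lemma hdim_eig:
  assumes C: "cfam m I S d x" and C': "cfam m I S' d' x'"
  shows "hdim (Inl ` {1..2*m} \<union> Inr ` I) S (case_sum d x) S' (case_sum d' x') =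
    hdim I (eig m S d) x (eig m S' d') x'"
proof (rule fdim_eqI[where \<alpha>="\<lambda>v. v" and \<beta>="\<lambda>v. v" and T=S'])
  let ?H = "homs (Inl ` {1..2*m} \<union> Inr ` I) S (case_sum d x) S' (case_sum d' x')"
  note sub' = cfam_subspace[OF C']
  have lin: "lin_on S' (case_sum d' x' i)" if "i \<in> Inl ` {1..2*m} \<union> Inr ` I" for i
    using that cfam_x(1)[OF C'] cfam_d(1)[OF C'] by auto
  show "fspace ?H" by (rule homs_fspace[OF sub' lin])
  show "f v \<in> S'" if "f \<in> ?H" "v \<in> S" for f v by (rule homsD(2)[OF that])
  show "v \<in> S" if "v \<in> eig m S d" for v using that eig_sub by blast
  show "lin_on S' (\<lambda>v. v)" by (rule lin_on_id)
  have fd: "f (d j v) = d' j (f v)" if "f \<in> ?H" "1 \<le> j" "j \<le> 2*m" "v \<in> S" for f j v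
    using homsD(3)[OF that(1), of "Inl j" v] that by simp
  have fx: "f (x i v) = x' i (f v)" if "f \<in> ?H" "i \<in> I" "v \<in> S" for f i v
    using homsD(3)[OF that(1), of "Inr i" v] that by simp
  show "(\<lambda>v. f v) \<in> homs I (eig m S d) x (eig m S' d') x'" if f: "f \<in> ?H" for f
  proof (rule homsI)
    show "lin_on (eig m S d) f" by (rule lin_on_subset[OF homsD(1)[OF f] eig_sub])
    show "f (x i v) = x' i (f v)" if "i \<in> I" "v \<in> eig m S d" for i v
      using fx[OF f that(1)] that(2) eig_sub by blast
    fix v assume v: "v \<in> eig m S d"
    then have vS: "v \<in> S" using eig_sub by blast
    have "d' (2 * j - 1) (d' (2 * j) (f v)) = \<i> *c f v" if j: "j \<in> {1..m}" for j
    proof -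
      have r: "1 \<le> 2 * j - 1" "2 * j - 1 \<le> 2 * m" "1 \<le> 2 * j" "2 * j \<le> 2 * m" using j by auto
      have "d' (2 * j - 1) (d' (2 * j) (f v)) = f (d (2 * j - 1) (d (2 * j) v))"
        using fd[OF f r(1,2) cfam_d(2)[OF C r(3,4) vS]] fd[OF f r(3,4) vS] by simp
      also have "\<dots> = f (\<i> *c v)" using v j by (simp add: eig_def)
      finally show ?thesis using lin_on_scale[OF homsD(1)[OF f] vS] by simp
    qed
    then show "f v \<in> eig m S' d'" using homsD(2)[OF f vS] by (simp add: eig_def)
  qed
  show "f v = 0" if f: "f \<in> ?H" and z: "\<And>v. v \<in> eig m S d \<Longrightarrow> f v = 0" and v: "v \<in> S" for f v
  proof -
    have "S \<subseteq> {v \<in> S. f v = 0}"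
    proof (rule eig_generates[OF C])
      show "cfun.subspace {v \<in> S. f v = 0}" by (rule subspace_lin_kernel[OF cfam_subspace[OF C] homsD(1)[OF f]])
      show "eig m S d \<subseteq> {v \<in> S. f v = 0}" using z eig_sub by blast
      fix j v assume j: "1 \<le> j" "j \<le> 2 * m" and v: "v \<in> {v \<in> S. f v = 0}"
      then show "d j v \<in> {v \<in> S. f v = 0}"
        using fd[OF f j] cfam_d(2)[OF C j] lin_on_zero[OF cfam_d(1)[OF C' j] sub'] by simp
    qed
    then show ?thesis using v by blast
  qed
  show "\<exists>f\<in>?H. \<forall>v\<in>eig m S d. f v = g v" if "g \<in> homs I (eig m S d) x (eig m S' d') x'" for g
    by (rule eig_extend[OF C C' that])
qed

text \<open>For odd \<open>n\<close> one Clifford operator is left over. Composing with \<open>\<sigma> c\<close>, which commutes with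
  the remaining operators and anticommutes with \<open>c\<close>, exchanges the intertwiners that commute with
  \<open>c\<close> and those that anticommute with it; the two kinds span all of them.\<close>

lemma hdim_double:
  fixes x :: "'i \<Rightarrow> 'x vec \<Rightarrow> 'x vec" and x' :: "'i \<Rightarrow> 'y vec \<Rightarrow> 'y vec"
  assumes E: "fd E" and E': "fd E'"
    and x: "\<And>i. i \<in> I \<Longrightarrow> lin_on E (x i)" "\<And>i v. i \<in> I \<Longrightarrow> v \<in> E \<Longrightarrow> x i v \<in> E"
    and x': "\<And>i. i \<in> I \<Longrightarrow> lin_on E' (x' i)" "\<And>i v. i \<in> I \<Longrightarrow> v \<in> E' \<Longrightarrow> x' i v \<in> E'"
    and c: "lin_on E c" "\<And>v. v \<in> E \<Longrightarrow> c v \<in> E" "\<And>v. v \<in> E \<Longrightarrow> c (c v) = - v"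
      "\<And>i v. i \<in> I \<Longrightarrow> v \<in> E \<Longrightarrow> c (x i v) = - x i (c v)"
    and c': "lin_on E' c'" "\<And>v. v \<in> E' \<Longrightarrow> c' v \<in> E'" "\<And>v. v \<in> E' \<Longrightarrow> c' (c' v) = - v"
      "\<And>i v. i \<in> I \<Longrightarrow> v \<in> E' \<Longrightarrow> c' (x' i v) = - x' i (c' v)"
    and s: "lin_on E s" "\<And>v. v \<in> E \<Longrightarrow> s v \<in> E" "\<And>v. v \<in> E \<Longrightarrow> s (s v) = v"
      "\<And>i v. i \<in> I \<Longrightarrow> v \<in> E \<Longrightarrow> s (x i v) = - x i (s v)" "\<And>v. v \<in> E \<Longrightarrow> s (c v) = - c (s v)"
  shows "hdim I E x E' x' = 2 * hdim (insert None (Some ` I)) E (case_option c x) E' (case_option c' x')"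
proof -
  let ?H = "homs I E x E' x'"
  let ?P = "{f \<in> ?H. \<forall>v\<in>E. f (c v) = c' (f v)}" and ?N = "{f \<in> ?H. \<forall>v\<in>E. f (c v) = - c' (f v)}"
  note sE = fd_subspace[OF E] and sE' = fd_subspace[OF E']
  note cl = lin_rules[OF c(1) sE] and cl' = lin_rules[OF c'(1) sE'] and sl = lin_rules[OF s(1) sE]
  have P: "homs (insert None (Some ` I)) E (case_option c x) E' (case_option c' x') = ?P"
    unfolding homs_def by auto
  have spH: "fspace ?H" by (rule homs_fspace[OF sE' x'(1)])
  have HE: "f v \<in> E'" if "f \<in> ?H" "v \<in> E" for f v by (rule homsD(2)[OF that])
  have spP: "fspace ?P" unfolding fspace_def
    using fspace_add[OF spH] fspace_scale[OF spH] spH cl' HE lin_on_zero[OF c'(1) sE']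
    by (auto simp: fspace_def)
  have spN: "fspace ?N" unfolding fspace_def
    using fspace_add[OF spH] fspace_scale[OF spH] spH cl' HE lin_on_zero[OF c'(1) sE']
    by (auto simp: fspace_def)
  have "fdim E ?H = fdim E ?P + fdim E ?N"
  proof (rule fdim_split[OF _ spP spN _ _ spH])
    show "fd (enc E ` ?H)" by (rule fd_enc[OF E E' spH]) (auto simp: homs_def)
    show "f v = 0" if f: "f \<in> ?P" and g: "g \<in> ?N" and fg: "\<And>v. v \<in> E \<Longrightarrow> f v = g v" and v: "v \<in> E" for f g v
    proof -
      have "c' (f v) = - c' (f v)" using f g fg[OF v] fg[OF c(2)[OF v]] v by auto
      then have "2 *c c' (f v) = 0" by (simp add: fun_eq_iff pointwise)
      then have z: "c' (f v) = 0" by simp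
      have "f v \<in> E'" using f v homsD(2) by blast
      then have "- f v = c' 0" using c'(3)[of "f v"] z by simp
      then show ?thesis using lin_on_zero[OF c'(1) sE'] by simp
    qed
    fix f assume f: "f \<in> ?H"
    note fD = homsD[OF f]
    define h where "h v = c' (f (c v))" for v
    have hH: "h \<in> ?H"
    proof (rule homsI)
      show "lin_on E h" unfolding h_def
        by (rule lin_on_comp[OF lin_on_comp[OF c(1) _ fD(1)] _ c'(1)]) (use c fD in auto)
      show "h v \<in> E'" if "v \<in> E" for v unfolding h_def by (intro c'(2) fD(2) c(2) that)
      fix i v assume i: "i \<in> I" and v: "v \<in> E"
      have "f (c (x i v)) = - x' i (f (c v))"
        unfolding c(4)[OF i v] lin_on_uminus[OF fD(1) x(2)[OF i c(2)[OF v]]] fD(3)[OF i c(2)[OF v]] ..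
      then have "h (x i v) = - c' (x' i (f (c v)))"
        unfolding h_def using cl'(4)[OF x'(2)[OF i fD(2)[OF c(2)[OF v]]]] by simp
      then show "h (x i v) = x' i (h v)" unfolding h_def using c'(4)[OF i fD(2)[OF c(2)[OF v]]] by simp
    qed
    have hc: "h (c v) = - c' (f v)" "c' (h v) = - f (c v)" if v: "v \<in> E" for v
    proof -
      show "h (c v) = - c' (f v)"
        unfolding h_def c(3)[OF v] lin_on_uminus[OF fD(1) v] cl'(4)[OF fD(2)[OF v]] ..
      show "c' (h v) = - f (c v)" unfolding h_def by (rule c'(3)[OF fD(2)[OF c(2)[OF v]]])
    qed
    have P1: "(\<lambda>v. (1/2) *c (f v + (-1) *c h v)) \<in> ?H" and N1: "(\<lambda>v. (1/2) *c (f v + h v)) \<in> ?H"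
      using fspace_scale[OF spH fspace_add[OF spH f fspace_scale[OF spH hH]]]
        fspace_scale[OF spH fspace_add[OF spH f hH]] by blast+
    have "(1/2) *c (f (c v) + (-1) *c h (c v)) = c' ((1/2) *c (f v + (-1) *c h v))"
      "(1/2) *c (f (c v) + h (c v)) = - c' ((1/2) *c (f v + h v))" if v: "v \<in> E" for v
    proof -
      note m = fD(2)[OF v] homsD(2)[OF hH v]
      show "(1/2) *c (f (c v) + (-1) *c h (c v)) = c' ((1/2) *c (f v + (-1) *c h v))"
        unfolding hc[OF v] cl'(3)[OF cfun.subspace_add[OF sE' m(1) cfun.subspace_scale[OF sE' m(2)]]]
          cl'(1)[OF m(1) cfun.subspace_scale[OF sE' m(2)]] cl'(3)[OF m(2)] hc[OF v]
        by (simp add: add.commute)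
      show "(1/2) *c (f (c v) + h (c v)) = - c' ((1/2) *c (f v + h v))"
        unfolding hc[OF v] cl'(3)[OF cfun.subspace_add[OF sE' m]] cl'(1)[OF m] hc[OF v]
        by (simp add: cfun.scale_right_diff_distrib)
    qed
    then have PN: "(\<lambda>v. (1/2) *c (f v + (-1) *c h v)) \<in> ?P" "(\<lambda>v. (1/2) *c (f v + h v)) \<in> ?N"
      using P1 N1 by simp_all
    have "f v = (1/2) *c (f v + (-1) *c h v) + (1/2) *c (f v + h v)" for v
      by (rule ext) (simp add: pointwise add_divide_distrib diff_divide_distrib)
    then show "\<exists>f1\<in>?P. \<exists>f2\<in>?N. \<forall>v\<in>E. f v = f1 v + f2 v"
      using PN by (intro bexI[OF _ PN(1)] bexI[OF _ PN(2)] ballI)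
  qed auto
  moreover have "fdim E ?N = fdim E ?P"
  proof (rule fdim_eqI[where \<alpha>="\<lambda>v. s (c v)" and \<beta>="\<lambda>v. v" and T=E'])
    show "fspace ?N" by (rule spN)
    show "f v \<in> E'" if "f \<in> ?N" "v \<in> E" for f v using that homsD(2) by blast
    show sc: "s (c v) \<in> E" if "v \<in> E" for v by (intro s c that)
    show "lin_on E' (\<lambda>v. v)" by (rule lin_on_id)
    have scsc: "s (c (s (c v))) = v" if v: "v \<in> E" for v
    proof -
      have "s (c (s (c v))) = - c (s (s (c v)))" by (rule s(5)[OF sc[OF v]])
      then show ?thesis using s(3)[OF c(2)[OF v]] c(3)[OF v] by simp
    qed
    have scc: "s (c (c v)) = - s v" "c (s (c v)) = s v" if v: "v \<in> E" for v
    proof -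
      show "s (c (c v)) = - s v" unfolding c(3)[OF v] by (rule sl(4)[OF v])
      have "s (c v) = - c (s v)" by (rule s(5)[OF v])
      then have "c (s (c v)) = - c (c (s v))" using cl(4)[OF c(2)[OF s(2)[OF v]]] by simp
      then show "c (s (c v)) = s v" using c(3)[OF s(2)[OF v]] by simp
    qed
    have scx: "s (c (x i v)) = x i (s (c v))" if "i \<in> I" "v \<in> E" for i v
      unfolding c(4)[OF that] sl(4)[OF x(2)[OF that(1) c(2)[OF that(2)]]] s(4)[OF that(1) c(2)[OF that(2)]] by simp
    have H: "(\<lambda>v. f (s (c v))) \<in> ?H" if f: "f \<in> ?H" for f
    proof (rule homsI)
      note fD = homsD[OF f]
      show "lin_on E (\<lambda>v. f (s (c v)))"
        by (rule lin_on_comp[OF lin_on_comp[OF c(1) _ s(1)] _ fD(1)]) (use c(2) sc in blast)+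
      show "f (s (c v)) \<in> E'" if "v \<in> E" for v by (rule fD(2)[OF sc[OF that]])
      show "f (s (c (x i v))) = x' i (f (s (c v)))" if "i \<in> I" "v \<in> E" for i v
        unfolding scx[OF that] by (rule fD(3)[OF that(1) sc[OF that(2)]])
    qed
    have fm: "f (- s v) = - f (s v)" if "f \<in> ?H" "v \<in> E" for f v
      by (rule lin_on_uminus[OF homsD(1)[OF that(1)] s(2)[OF that(2)]])
    show "(\<lambda>v. f (s (c v))) \<in> ?P" if f: "f \<in> ?N" for f
    proof -
      have fH: "f \<in> ?H" and fc: "\<And>v. v \<in> E \<Longrightarrow> f (c v) = - c' (f v)" using f by auto
      have "f (s (c (c v))) = c' (f (s (c v)))" if v: "v \<in> E" for v
      proof -
        have "c' (f (s (c v))) = - f (c (s (c v)))" using fc[OF sc[OF v]] by simp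
        then show ?thesis unfolding scc[OF v] fm[OF fH v] by simp
      qed
      then show ?thesis using H[OF fH] by simp
    qed
    show "f v = 0" if "f \<in> ?N" "\<And>v. v \<in> E \<Longrightarrow> f (s (c v)) = 0" "v \<in> E" for f v
      using that(2)[OF sc[OF that(3)]] scsc[OF that(3)] by simp
    show "\<exists>f\<in>?N. \<forall>v\<in>E. f (s (c v)) = g v" if g: "g \<in> ?P" for g
    proof
      have gH: "g \<in> ?H" and gc: "\<And>v. v \<in> E \<Longrightarrow> g (c v) = c' (g v)" using g by auto
      have "g (s (c (c v))) = - c' (g (s (c v)))" if v: "v \<in> E" for v
        using gc[OF sc[OF v]] unfolding scc[OF v] fm[OF gH v] by simp
      then show "(\<lambda>v. g (s (c v))) \<in> ?N" using H[OF gH] by simp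
      show "\<forall>v\<in>E. g (s (c (s (c v)))) = g v" using scsc by simp
    qed
  qed
  ultimately show ?thesis unfolding P by simp
qed

lemma eig_nonzero:
  assumes C: "cfam m {()} S d (\<lambda>_. s)" and ss: "\<And>v. v \<in> S \<Longrightarrow> s (s v) = v" and nz: "v0 \<in> S" "v0 \<noteq> 0"
  shows "\<exists>u\<in>eig m S d. u \<noteq> 0 \<and> (s u = u \<or> s u = - u)"
  using C
proof (induction m)
  case 0
  note sub = cfam_subspace[OF C] and sl = lin_rules[OF cfam_x(1)[OF C] cfam_subspace[OF C]]
  note sS = cfam_x(2)[OF C, OF singletonI]
  show ?case
  proof (cases "v0 + s v0 = 0")
    case True
    then have "s v0 = - v0" by (simp add: add_eq_0_iff)
    then show ?thesis using nz by auto
  next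
    case False
    have "s (v0 + s v0) = v0 + s v0"
      using sl(1)[OF _ nz(1) sS[OF nz(1)]] ss[OF nz(1)] by (simp add: add.commute)
    then show ?thesis using False cfun.subspace_add[OF sub nz(1) sS[OF nz(1)]] by auto
  qed
next
  case (Suc k)
  note C = Suc.prems
  obtain u where u: "u \<in> eig k S d" "u \<noteq> 0" "s u = u \<or> s u = - u"
    using Suc.IH[OF cfam_mono[OF C le_SucI[OF order_refl]]] by blast
  have uS: "u \<in> S" using u eig_sub by blast
  note sx = cfam_x[OF C, OF singletonI]
  have ky: "prA k d (s u) = s (prA k d u)" "prB k d (s u) = - s (prB k d u)"
    using kap_y(2,3)[where y=s, OF C sx(1) _ _ _ uS] sx(2,3) by auto
  note pl = lin_rules[OF prAB_lin(1)[OF C] cfam_subspace[OF C]] lin_rules[OF prAB_lin(2)[OF C] cfam_subspace[OF C]]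
  show ?case
  proof (cases "prA k d u = 0")
    case False
    have "s (prA k d u) = prA k d u \<or> s (prA k d u) = - prA k d u"
      using ky(1) u(3) pl(4)[OF uS] by metis
    then show ?thesis using False prAB_in(1)[OF C u(1)] by blast
  next
    case True
    have "prB k d u \<noteq> 0"
    proof
      assume "prB k d u = 0"
      then have "u = 0 + d (2 * k + 1) 0" using prAB_sum[OF C uS] True by simp
      moreover have "d (2 * k + 1) 0 = 0"
        by (rule lin_on_zero[OF cfam_d(1)[OF C] cfam_subspace[OF C]]) auto
      ultimately show False using u(2) by simp
    qed
    moreover have "s (prB k d u) = - prB k d (s u)" using ky(2) by simp
    then have "s (prB k d u) = prB k d u \<or> s (prB k d u) = - prB k d u"
      using u(3) pl(8)[OF uS] by auto
    ultimately show ?thesis using prAB_in(2)[OF C u(1)] by blast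
  qed
qed

section \<open>Modules over the Hecke--Clifford algebra\<close>

subsection \<open>Generation of the symmetric group by simple transpositions\<close>

lemma Sn_id: "id \<in> Sn n" by (simp add: Sn_def permutes_id)

lemma Sn_comp: "u \<in> Sn n \<Longrightarrow> v \<in> Sn n \<Longrightarrow> u \<circ> v \<in> Sn n"
  by (simp add: Sn_def permutes_compose)

lemma Sn_inv: "w \<in> Sn n \<Longrightarrow> inv w \<in> Sn n" by (simp add: Sn_def permutes_inv)

lemma Sn_transpose: "1 \<le> a \<Longrightarrow> a \<le> n \<Longrightarrow> 1 \<le> b \<Longrightarrow> b \<le> n \<Longrightarrow> transpose a b \<in> Sn n"
  by (simp add: Sn_def permutes_swap_id)

lemma Sn_simple: "j \<in> {1..<n} \<Longrightarrow> transpose j (Suc j) \<in> Sn n"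
  by (rule Sn_transpose) auto

lemma Sn_app: "w \<in> Sn n \<Longrightarrow> i \<in> {1..n} \<Longrightarrow> w i \<in> {1..n}"
  using permutes_in_image[of w "{1..n}" i] unfolding Sn_def by simp

lemma Sn_finite: "finite (Sn n)"
  by (simp add: Sn_def finite_permutations)

lemma Sn_inv_comp: assumes "w \<in> Sn n" shows "w \<circ> inv w = id" "inv w \<circ> w = id"
  using assms permutes_inv_o unfolding Sn_def by blast+

lemma Sn_generated:
  assumes w: "w \<in> Sn n" and Qid: "Q id" and Qs: "\<And>i. i \<in> {1..<n} \<Longrightarrow> Q (transpose i (Suc i))"
    and Qc: "\<And>u v. u \<in> Sn n \<Longrightarrow> v \<in> Sn n \<Longrightarrow> Q u \<Longrightarrow> Q v \<Longrightarrow> Q (u \<circ> v)"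
  shows "Q w"
proof -
  have lt: "Q (transpose a (Suc (a + k)))" if "1 \<le> a" "Suc (a + k) \<le> n" for a k
    using that(2)
  proof (induction k)
    case 0 then show ?case using Qs[of a] that(1) by simp
  next
    case (Suc k)
    let ?b = "Suc (a + k)"
    have e: "transpose a (Suc ?b) = transpose ?b (Suc ?b) \<circ> (transpose a ?b \<circ> transpose ?b (Suc ?b))"
      by (auto simp: fun_eq_iff transpose_def)
    have b: "?b \<in> {1..<n}" using Suc.prems by simp
    have t: "transpose a ?b \<in> Sn n" by (rule Sn_transpose) (use that(1) Suc.prems in auto)
    have "Q (transpose a ?b \<circ> transpose ?b (Suc ?b))"
      by (rule Qc[OF t Sn_simple[OF b] Suc.IH Qs[OF b]]) (use Suc.prems in simp)
    then have "Q (transpose ?b (Suc ?b) \<circ> (transpose a ?b \<circ> transpose ?b (Suc ?b)))"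
      by (rule Qc[OF Sn_simple[OF b] Sn_comp[OF t Sn_simple[OF b]] Qs[OF b]])
    then show ?case unfolding e[symmetric] by simp
  qed
  have tr: "Q (transpose a b)" if "a \<in> {1..n}" "b \<in> {1..n}" for a b
  proof -
    consider "a = b" | "a < b" | "b < a" by linarith
    then show ?thesis
    proof cases
      case 1 then show ?thesis using Qid by simp
    next
      case 2
      then have "b = Suc (a + (b - a - 1))" by simp
      then show ?thesis using lt[of a "b - a - 1"] that by simp
    next
      case 3
      then have "a = Suc (b + (a - b - 1))" by simp
      then show ?thesis using lt[of b "a - b - 1"] that transpose_commute[of a b] by simp
    qed
  qed
  have "w permutes {1..n}" using w by (simp add: Sn_def)
  from this finite_atLeastAtMost have "w \<in> Sn n \<and> Q w"
  proof (induction rule: permutes_induct)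
    case id
    show ?case by (intro conjI Sn_id Qid)
  next
    case (swap a b p)
    have t: "transpose a b \<in> Sn n" by (rule Sn_transpose) (use swap in auto)
    show ?case by (intro conjI Sn_comp[OF t] Qc[OF t _ tr]) (use swap in blast)+
  qed
  then show ?thesis by simp
qed

subsection \<open>Operators on a module\<close>

lemma hc_alg_simps [simp]: "gpar (hc_alg n) (Cl i) = 1" "gpar (hc_alg n) (Sy w) = 0"
  "Cl i \<in> gens (hc_alg n) \<longleftrightarrow> i \<in> {1..n}" "Sy w \<in> gens (hc_alg n) \<longleftrightarrow> w \<in> Sn n"
  by (auto simp: hc_alg_def)

lemma hc_gens_cases:
  assumes "g \<in> gens (hc_alg n)"
  obtains i where "g = Cl i" "i \<in> {1..n}" | w where "g = Sy w" "w \<in> Sn n"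
  using assms by (auto simp: hc_alg_def)

text \<open>The twisted Clifford operators, with square \<open>-1\<close>, and the twisted operators of the
  generators $t_j$.\<close>

definition dop :: "(hcgen, 'x) smod \<Rightarrow> nat \<Rightarrow> 'x vec \<Rightarrow> 'x vec" where
  "dop V i v = act V (Cl i) (sg V v)"

definition Top :: "(hcgen, 'x) smod \<Rightarrow> nat \<Rightarrow> 'x vec \<Rightarrow> 'x vec" where
  "Top V j v = (1 / csqrt (-2)) *c act V (Sy (transpose j (Suc j))) (dop V j v - dop V (Suc j) v)"

lemma tact_hc: "tact (hc_alg n) V (Cl i) = dop V i" "tact (hc_alg n) V (Sy w) = act V (Sy w)"
  by (auto simp: tact_def dop_def fun_eq_iff)

lemma csqrt_m2: "csqrt (-2) \<noteq> 0" "cnj (1 / csqrt (-2)) = - (1 / csqrt (-2))"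
proof -
  have "csqrt (-2) = \<i> * csqrt 2" using csqrt_minus[of 2] by simp
  moreover have "csqrt 2 = of_real (sqrt 2)" using csqrt_of_real_nonneg[of 2] by simp
  ultimately show "csqrt (-2) \<noteq> 0" "cnj (1 / csqrt (-2)) = - (1 / csqrt (-2))" by simp_all
qed

context
  fixes n :: nat and V :: "(hcgen, 'x) smod"
  assumes V: "hc_module n V"
begin

lemma hc_smodule: "smodule (hc_alg n) V" using V by (simp add: hc_module_def)

private lemmas gm = smoduleD(1)[OF hc_smodule]
private lemmas S = smoduleD(3)[OF hc_smodule]
private lemmas gr = gmod_graded[OF gm]

lemma hc_c:
  assumes "i \<in> {1..n}"
  shows "lin_on (carr V) (act V (Cl i))" "v \<in> carr V \<Longrightarrow> act V (Cl i) v \<in> carr V"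
    "v \<in> carr V \<Longrightarrow> act V (Cl i) (act V (Cl i) v) = v"
    "v \<in> carr V \<Longrightarrow> sg V (act V (Cl i) v) = - act V (Cl i) (sg V v)"
    "j \<in> {1..n} \<Longrightarrow> i \<noteq> j \<Longrightarrow> v \<in> carr V \<Longrightarrow> act V (Cl i) (act V (Cl j) v) = - act V (Cl j) (act V (Cl i) v)"
proof -
  have g: "Cl i \<in> gens (hc_alg n)" using assms by simp
  show "lin_on (carr V) (act V (Cl i))" by (rule act_lin[OF gm g])
  show "act V (Cl i) v \<in> carr V" "sg V (act V (Cl i) v) = - act V (Cl i) (sg V v)" if "v \<in> carr V"
    using act_carr[OF gm g that] sg_act[OF gm g that] by simp_all
  show "act V (Cl i) (act V (Cl i) v) = v" if "v \<in> carr V"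
    using V assms that unfolding hc_module_def by blast
  show "act V (Cl i) (act V (Cl j) v) = - act V (Cl j) (act V (Cl i) v)" if "j \<in> {1..n}" "i \<noteq> j" "v \<in> carr V"
    using V assms that unfolding hc_module_def by blast
qed

lemma hc_s:
  assumes "w \<in> Sn n"
  shows "lin_on (carr V) (act V (Sy w))" "v \<in> carr V \<Longrightarrow> act V (Sy w) v \<in> carr V"
    "v \<in> carr V \<Longrightarrow> sg V (act V (Sy w) v) = act V (Sy w) (sg V v)"
    "w' \<in> Sn n \<Longrightarrow> v \<in> carr V \<Longrightarrow> act V (Sy (w \<circ> w')) v = act V (Sy w) (act V (Sy w') v)"
proof -
  have g: "Sy w \<in> gens (hc_alg n)" using assms by simp
  show "lin_on (carr V) (act V (Sy w))" by (rule act_lin[OF gm g])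
  show "act V (Sy w) v \<in> carr V" "sg V (act V (Sy w) v) = act V (Sy w) (sg V v)" if "v \<in> carr V"
    using act_carr[OF gm g that] sg_act[OF gm g that] by simp_all
  show "act V (Sy (w \<circ> w')) v = act V (Sy w) (act V (Sy w') v)" if "w' \<in> Sn n" "v \<in> carr V"
    using V assms that unfolding hc_module_def by blast
qed

lemma hc_id: "v \<in> carr V \<Longrightarrow> act V (Sy id) v = v"
  using V unfolding hc_module_def by blast

lemma hc_s_inv: assumes "w \<in> Sn n" "v \<in> carr V"
  shows "act V (Sy w) (act V (Sy (inv w)) v) = v" "act V (Sy (inv w)) (act V (Sy w) v) = v"
  using hc_s(4)[OF assms(1) Sn_inv[OF assms(1)] assms(2)] hc_s(4)[OF Sn_inv[OF assms(1)] assms]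
    Sn_inv_comp[OF assms(1)] hc_id[OF assms(2)] by simp_all

text \<open>
  The relations are given for simple transpositions only and extend along products.
\<close>

lemma hc_sc:
  assumes "w \<in> Sn n"
  shows "\<forall>i\<in>{1..n}. \<forall>v\<in>carr V. act V (Sy w) (act V (Cl i) v) = act V (Cl (w i)) (act V (Sy w) v)"
  using assms
proof (rule Sn_generated)
  show "\<forall>i\<in>{1..n}. \<forall>v\<in>carr V. act V (Sy id) (act V (Cl i) v) = act V (Cl (id i)) (act V (Sy id) v)"
    using hc_id hc_c(2) by simp
  fix u w assume uw: "u \<in> Sn n" "w \<in> Sn n"
    "\<forall>i\<in>{1..n}. \<forall>v\<in>carr V. act V (Sy u) (act V (Cl i) v) = act V (Cl (u i)) (act V (Sy u) v)"
    "\<forall>i\<in>{1..n}. \<forall>v\<in>carr V. act V (Sy w) (act V (Cl i) v) = act V (Cl (w i)) (act V (Sy w) v)"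
  show "\<forall>i\<in>{1..n}. \<forall>v\<in>carr V. act V (Sy (u \<circ> w)) (act V (Cl i) v) = act V (Cl ((u \<circ> w) i)) (act V (Sy (u \<circ> w)) v)"
  proof (intro ballI)
    fix i v assume i: "i \<in> {1..n}" and v: "v \<in> carr V"
    have "act V (Sy (u \<circ> w)) (act V (Cl i) v) = act V (Sy u) (act V (Sy w) (act V (Cl i) v))"
      by (rule hc_s(4)[OF uw(1,2) hc_c(2)[OF i v]])
    also have "act V (Sy w) (act V (Cl i) v) = act V (Cl (w i)) (act V (Sy w) v)" using uw(4) i v by blast
    also have "act V (Sy u) (act V (Cl (w i)) (act V (Sy w) v)) = act V (Cl (u (w i))) (act V (Sy u) (act V (Sy w) v))"
      using uw(3) Sn_app[OF uw(2) i] hc_s(2)[OF uw(2) v] by blast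
    also have "act V (Sy u) (act V (Sy w) v) = act V (Sy (u \<circ> w)) v" by (rule hc_s(4)[OF uw(1,2) v, symmetric])
    finally show "act V (Sy (u \<circ> w)) (act V (Cl i) v) = act V (Cl ((u \<circ> w) i)) (act V (Sy (u \<circ> w)) v)"
      unfolding o_apply[of u w i] .
  qed
next
  fix j assume j: "j \<in> {1..<n}"
  let ?s = "transpose j (Suc j)"
  note s = Sn_simple[OF j]
  have jn: "j \<in> {1..n}" "Suc j \<in> {1..n}" using j by auto
  have ss: "act V (Sy ?s) (act V (Sy ?s) v) = v" if "v \<in> carr V" for v
    using hc_s(4)[OF s s that] hc_id[OF that] by simp
  have a: "act V (Sy ?s) (act V (Cl j) v) = act V (Cl (Suc j)) (act V (Sy ?s) v)" if "v \<in> carr V" for v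
    using V j that unfolding hc_module_def by blast
  show "\<forall>i\<in>{1..n}. \<forall>v\<in>carr V. act V (Sy ?s) (act V (Cl i) v) = act V (Cl (?s i)) (act V (Sy ?s) v)"
  proof (intro ballI)
    fix i v assume i: "i \<in> {1..n}" and v: "v \<in> carr V"
    consider "i = j" | "i = Suc j" | "i \<in> {1..n} - {j, Suc j}" using i by blast
    then show "act V (Sy ?s) (act V (Cl i) v) = act V (Cl (?s i)) (act V (Sy ?s) v)"
    proof cases
      case 1 then show ?thesis using a[OF v] by simp
    next
      case 2
      note sv = hc_s(2)[OF s v]
      have "act V (Sy ?s) (act V (Sy ?s) (act V (Cl j) (act V (Sy ?s) v))) = act V (Sy ?s) (act V (Cl (Suc j)) v)"
        using a[OF sv] ss[OF v] by simp
      then have "act V (Cl j) (act V (Sy ?s) v) = act V (Sy ?s) (act V (Cl (Suc j)) v)"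
        using ss[OF hc_c(2)[OF jn(1) sv]] by simp
      then show ?thesis using 2 by simp
    next
      case 3
      then have "?s i = i" by (auto simp: transpose_def)
      then show ?thesis using V j 3 v unfolding hc_module_def by auto
    qed
  qed
qed

lemma hc_d:
  assumes i: "i \<in> {1..n}"
  shows "lin_on (carr V) (dop V i)" "v \<in> carr V \<Longrightarrow> dop V i v \<in> carr V"
    "v \<in> carr V \<Longrightarrow> dop V i (dop V i v) = - v"
    "v \<in> carr V \<Longrightarrow> sg V (dop V i v) = - dop V i (sg V v)"
    "j \<in> {1..n} \<Longrightarrow> i \<noteq> j \<Longrightarrow> v \<in> carr V \<Longrightarrow> dop V i (dop V j v) = - dop V j (dop V i v)"
    "w \<in> Sn n \<Longrightarrow> v \<in> carr V \<Longrightarrow> act V (Sy w) (dop V i v) = dop V (w i) (act V (Sy w) v)"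
proof -
  show "lin_on (carr V) (dop V i)" using tact_lin[OF gm, of "Cl i"] i by (simp add: tact_hc)
  show "dop V i v \<in> carr V" if "v \<in> carr V" using tact_carr[OF gm, of "Cl i"] i that by (simp add: tact_hc)
  have dd: "dop V i (dop V j v) = - act V (Cl i) (act V (Cl j) v)" if "i \<in> {1..n}" "j \<in> {1..n}" "v \<in> carr V" for i j v
  proof -
    note sv = sg_carr[OF gr that(3)]
    have "sg V (dop V j v) = - act V (Cl j) v" unfolding dop_def hc_c(4)[OF that(2) sv] sg_sg[OF gr that(3)] ..
    then show ?thesis unfolding dop_def[of V i] using lin_on_uminus[OF hc_c(1)[OF that(1)] hc_c(2)[OF that(2,3)]] by simp
  qed
  show "dop V i (dop V i v) = - v" if "v \<in> carr V" using dd[OF i i that] hc_c(3)[OF i that] by simp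
  show "dop V i (dop V j v) = - dop V j (dop V i v)" if "j \<in> {1..n}" "i \<noteq> j" "v \<in> carr V"
    using dd[OF i that(1,3)] dd[OF that(1) i that(3)] hc_c(5)[OF i that] by simp
  show "sg V (dop V i v) = - dop V i (sg V v)" if "v \<in> carr V"
    unfolding dop_def by (rule hc_c(4)[OF i sg_carr[OF gr that]])
  show "act V (Sy w) (dop V i v) = dop V (w i) (act V (Sy w) v)" if "w \<in> Sn n" "v \<in> carr V"
    unfolding dop_def hc_s(3)[OF that] using hc_sc[OF that(1)] i sg_carr[OF gr that(2)] by blast
qed

lemma hc_T:
  assumes j: "j \<in> {1..<n}"
  shows "lin_on (carr V) (Top V j)" "v \<in> carr V \<Longrightarrow> Top V j v \<in> carr V"
    "i \<in> {1..n} \<Longrightarrow> v \<in> carr V \<Longrightarrow> Top V j (dop V i v) = - dop V i (Top V j v)"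
    "v \<in> carr V \<Longrightarrow> sg V (Top V j v) = - Top V j (sg V v)"
    "v \<in> carr V \<Longrightarrow> Top V j (dop V j v - dop V (Suc j) v) =
       (- 2 / csqrt (-2)) *c act V (Sy (transpose j (Suc j))) v"
proof -
  let ?s = "transpose j (Suc j)" and ?k = "1 / csqrt (-2)"
  note s = Sn_simple[OF j]
  have jn: "j \<in> {1..n}" "Suc j \<in> {1..n}" and ne: "j \<noteq> Suc j" using j by auto
  note sl = lin_rules[OF hc_s(1)[OF s] S]
  note dj = hc_d[OF jn(1)] and dk = hc_d[OF jn(2)]
  note cl = cfun.subspace_add[OF S] cfun.subspace_diff[OF S] cfun.subspace_scale[OF S] cfun.subspace_neg[OF S]
  have dif: "lin_on (carr V) (\<lambda>v. dop V j v - dop V (Suc j) v)" by (rule lin_on_diff_fun[OF dj(1) dk(1)])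
  have difS: "dop V j v - dop V (Suc j) v \<in> carr V" if "v \<in> carr V" for v by (intro cl dj(2) dk(2) that)
  show "lin_on (carr V) (Top V j)"
    unfolding Top_def by (rule lin_on_scale_fun, rule lin_on_comp[OF dif _ hc_s(1)[OF s]]) (use difS in blast)
  show TS: "Top V j v \<in> carr V" if "v \<in> carr V" for v
    unfolding Top_def by (intro cl(3) hc_s(2)[OF s] difS that)
  have key: "act V (Sy ?s) (dop V j (dop V i v) - dop V (Suc j) (dop V i v)) =
      - dop V i (act V (Sy ?s) (dop V j v - dop V (Suc j) v))" if i: "i \<in> {1..n}" and v: "v \<in> carr V" for i v
  proof -
    note di = hc_d[OF i] note dil = lin_rules[OF di(1) S] note djl = lin_rules[OF dj(1) S] and dkl = lin_rules[OF dk(1) S]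
    have si: "?s i \<in> {1..n}" by (rule Sn_app[OF s i])
    have ssi: "?s (?s i) = i" by simp
    have "dop V i (act V (Sy ?s) (dop V j v - dop V (Suc j) v)) =
        act V (Sy ?s) (dop V (?s i) (dop V j v - dop V (Suc j) v))"
      using hc_d(6)[OF si s difS[OF v]] ssi by simp
    moreover have "dop V j (dop V i v) - dop V (Suc j) (dop V i v) = - dop V (?s i) (dop V j v - dop V (Suc j) v)"
    proof -
      consider "i = j" | "i = Suc j" | "i \<noteq> j" "i \<noteq> Suc j" by blast
      then show ?thesis
      proof cases
        case 1
        have "dop V (Suc j) (dop V j v - dop V (Suc j) v) = dop V (Suc j) (dop V j v) + v"
          unfolding dkl(2)[OF dj(2)[OF v] dk(2)[OF v]] dk(3)[OF v] by simp
        then show ?thesis using 1 dj(3)[OF v] by simp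
      next
        case 2
        have "dop V j (dop V j v - dop V (Suc j) v) = - v - dop V j (dop V (Suc j) v)"
          unfolding djl(2)[OF dj(2)[OF v] dk(2)[OF v]] dj(3)[OF v] ..
        then show ?thesis using 2 dk(3)[OF v] by simp
      next
        case 3
        then have "?s i = i" by (auto simp: transpose_def)
        moreover have "dop V j (dop V i v) = - dop V i (dop V j v)" "dop V (Suc j) (dop V i v) = - dop V i (dop V (Suc j) v)"
          using dj(5)[OF i _ v] dk(5)[OF i _ v] 3 by auto
        ultimately show ?thesis using dil(2)[OF dj(2)[OF v] dk(2)[OF v]] by simp
      qed
    qed
    moreover have "dop V (?s i) (dop V j v - dop V (Suc j) v) \<in> carr V" by (rule hc_d(2)[OF si difS[OF v]])
    ultimately show ?thesis using sl(4) by metis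
  qed
  show "Top V j (dop V i v) = - dop V i (Top V j v)" if i: "i \<in> {1..n}" and v: "v \<in> carr V" for i
    unfolding Top_def key[OF i v] lin_on_scale[OF hc_d(1)[OF i] hc_s(2)[OF s difS[OF v]]] by simp
  show "sg V (Top V j v) = - Top V j (sg V v)" if v: "v \<in> carr V"
  proof -
    have "sg V (dop V j v - dop V (Suc j) v) = - (dop V j (sg V v) - dop V (Suc j) (sg V v))"
      unfolding lin_on_diff[OF sg_lin[OF gr] S dj(2)[OF v] dk(2)[OF v]] dj(4)[OF v] dk(4)[OF v] by simp
    then have "sg V (act V (Sy ?s) (dop V j v - dop V (Suc j) v)) =
        - act V (Sy ?s) (dop V j (sg V v) - dop V (Suc j) (sg V v))"
      using hc_s(3)[OF s difS[OF v]] sl(4)[OF difS[OF sg_carr[OF gr v]]] by simp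
    then show ?thesis unfolding Top_def lin_on_scale[OF sg_lin[OF gr] hc_s(2)[OF s difS[OF v]]] by simp
  qed
  show "Top V j (dop V j v - dop V (Suc j) v) = (- 2 / csqrt (-2)) *c act V (Sy ?s) v" if v: "v \<in> carr V"
  proof -
    note djl = lin_rules[OF dj(1) S] and dkl = lin_rules[OF dk(1) S]
    have e: "dop V j (dop V j v - dop V (Suc j) v) - dop V (Suc j) (dop V j v - dop V (Suc j) v) = (- 2) *c v"
      unfolding djl(2)[OF dj(2)[OF v] dk(2)[OF v]] dkl(2)[OF dj(2)[OF v] dk(2)[OF v]] dj(3)[OF v] dk(3)[OF v]
        dk(5)[OF jn(1) ne[symmetric] v] by (simp add: fun_eq_iff pointwise)
    show ?thesis unfolding Top_def e sl(3)[OF v] by (simp add: cscale_def fun_eq_iff)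
  qed
qed

lemma hc_cfam: assumes "2 * m \<le> n"
  shows "cfam m {1..<n} (carr V) (dop V) (Top V)" "cfam m {()} (carr V) (dop V) (\<lambda>_. sg V)"
    "odd n \<Longrightarrow> m = n div 2 \<Longrightarrow> cfam m (insert None (Some ` {1..<n})) (carr V) (dop V) (case_option (dop V n) (Top V))"
proof -
  have r: "j \<in> {1..n}" if "j \<in> {1..2*m}" for j using that assms by auto
  have d: "\<forall>j\<in>{1..2*m}. lin_on (carr V) (dop V j) \<and> (\<forall>v\<in>carr V. dop V j v \<in> carr V \<and> dop V j (dop V j v) = - v)"
    "\<forall>j\<in>{1..2*m}. \<forall>k\<in>{1..2*m}. j \<noteq> k \<longrightarrow> (\<forall>v\<in>carr V. dop V j (dop V k v) = - dop V k (dop V j v))"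
    by (intro ballI conjI; simp add: hc_d(1,2,3)[OF r]) (intro ballI impI, rule hc_d(5)[OF r r])
  have T: "\<forall>i\<in>{1..<n}. lin_on (carr V) (Top V i) \<and> (\<forall>v\<in>carr V. Top V i v \<in> carr V) \<and>
      (\<forall>j\<in>{1..2*m}. \<forall>v\<in>carr V. Top V i (dop V j v) = - dop V j (Top V i v))"
    by (intro ballI conjI; simp add: hc_T(1,2) hc_T(3)[OF _ r])
  show "cfam m {1..<n} (carr V) (dop V) (Top V)" unfolding cfam_def by (rule conjI[OF S conjI[OF d(1) conjI[OF d(2) T]]])
  show "cfam m {()} (carr V) (dop V) (\<lambda>_. sg V)"
    unfolding cfam_def
    by (rule conjI[OF S conjI[OF d(1) conjI[OF d(2)]]]) (simp add: sg_lin[OF gr] sg_carr[OF gr] hc_d(4)[OF r])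
  assume n: "odd n" "m = n div 2"
  then have nn: "n \<in> {1..n}" "\<And>j. j \<in> {1..2*m} \<Longrightarrow> n \<noteq> j" by (auto elim: oddE)
  have N: "lin_on (carr V) (dop V n) \<and> (\<forall>v\<in>carr V. dop V n v \<in> carr V) \<and>
      (\<forall>j\<in>{1..2*m}. \<forall>v\<in>carr V. dop V n (dop V j v) = - dop V j (dop V n v))"
    by (intro ballI conjI) (simp_all add: hc_d(1,2)[OF nn(1)] hc_d(5)[OF nn(1) r nn(2)])
  have "\<forall>i\<in>insert None (Some ` {1..<n}). lin_on (carr V) (case_option (dop V n) (Top V) i) \<and>
      (\<forall>v\<in>carr V. case_option (dop V n) (Top V) i v \<in> carr V) \<and>
      (\<forall>j\<in>{1..2*m}. \<forall>v\<in>carr V. case_option (dop V n) (Top V) i (dop V j v) = - dop V j (case_option (dop V n) (Top V) i v))"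
    using N T by simp
  then show "cfam m (insert None (Some ` {1..<n})) (carr V) (dop V) (case_option (dop V n) (Top V))"
    unfolding cfam_def by (rule conjI[OF S conjI[OF d(1) conjI[OF d(2)]]])
qed

end

text \<open>The space $e V$ for the primitive idempotent $e$ of the Clifford algebra that belongs to the
  joint eigenspace.\<close>

definition eD :: "nat \<Rightarrow> (hcgen, 'x) smod \<Rightarrow> 'x vec set" where
  "eD n V = eig (n div 2) (carr V) (dop V)"

lemma eD:
  assumes V: "hc_module n V"
  shows "fd (eD n V)" "eD n V \<subseteq> carr V" "j \<in> {1..<n} \<Longrightarrow> v \<in> eD n V \<Longrightarrow> Top V j v \<in> eD n V"
    "v \<in> eD n V \<Longrightarrow> sg V v \<in> eD n V" "odd n \<Longrightarrow> v \<in> eD n V \<Longrightarrow> dop V n v \<in> eD n V"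
proof -
  have m: "2 * (n div 2) \<le> n" by simp
  note C = hc_cfam(1)[OF V m] and C' = hc_cfam(2)[OF V m]
  show sub: "eD n V \<subseteq> carr V" unfolding eD_def by (rule eig_sub)
  show "fd (eD n V)"
    by (rule fd_mono[OF smoduleD(2)[OF hc_smodule[OF V]] sub]) (simp add: eD_def eig_subspace[OF C])
  show "Top V j v \<in> eD n V" if j: "j \<in> {1..<n}" and v: "v \<in> eD n V"
    unfolding eD_def
    by (rule eig_stable[where y="Top V j", OF C order_refl hc_T(1)[OF V j] _ _ v[unfolded eD_def]])
      (use hc_T(2,3)[OF V j] in auto)
  show "sg V v \<in> eD n V" if v: "v \<in> eD n V"
    unfolding eD_def
    by (rule eig_stable[where y="sg V", OF C order_refl cfam_x(1)[OF C' singletonI] _ _ v[unfolded eD_def]])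
      (use cfam_x(2,3)[OF C' singletonI] in auto)
  show "dop V n v \<in> eD n V" if n: "odd n" and v: "v \<in> eD n V"
  proof -
    have nn: "n \<in> {1..n}" "\<And>j. j \<le> 2 * (n div 2) \<Longrightarrow> n \<noteq> j" using n by (auto elim: oddE)
    show ?thesis unfolding eD_def
      by (rule eig_stable[where y="dop V n", OF C order_refl hc_d(1)[OF V nn(1)] _ _ v[unfolded eD_def]])
        (use hc_d(2,5)[OF V nn(1)] nn(2) in auto)
  qed
qed

text \<open>Intertwiners for the generators $c_i, s_w$ are the intertwiners for $c_i, t_j$.\<close>

lemma hc_shoms:
  assumes V: "hc_module n V" and W: "hc_module n W"
  shows "shoms (hc_alg n) V W =
    homs (Inl ` {1..n} \<union> Inr ` {1..<n}) (carr V) (case_sum (dop V) (Top V)) (carr W) (case_sum (dop W) (Top W))"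
    (is "?A = ?B")
proof (intro subset_antisym subsetI)
  note SV = smoduleD(3)[OF hc_smodule[OF V]] and SW = smoduleD(3)[OF hc_smodule[OF W]]
  have df: "f (dop V j v - dop V (Suc j) v) = dop W j (f v) - dop W (Suc j) (f v)"
    if "lin_on (carr V) f" "\<forall>i\<in>{1..n}. \<forall>v\<in>carr V. f (dop V i v) = dop W i (f v)"
      "j \<in> {1..<n}" "v \<in> carr V" for f j v
  proof -
    have jn: "j \<in> {1..n}" "Suc j \<in> {1..n}" using that(3) by auto
    show ?thesis
      unfolding lin_on_diff[OF that(1) SV hc_d(2)[OF V jn(1) that(4)] hc_d(2)[OF V jn(2) that(4)]]
        bspec[OF bspec[OF that(2) jn(1)] that(4)] bspec[OF bspec[OF that(2) jn(2)] that(4)] ..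
  qed
  have difS: "dop V j v - dop V (Suc j) v \<in> carr V" if "j \<in> {1..<n}" "v \<in> carr V" for j v
    using cfun.subspace_diff[OF SV] hc_d(2)[OF V _ that(2)] that(1) by auto
  {
    fix f assume f: "f \<in> ?A"
    note fD = homsD[OF f]
    have fd: "f (dop V i v) = dop W i (f v)" if "i \<in> {1..n}" "v \<in> carr V" for i v
      using fD(3)[of "Cl i" v] that by (simp add: tact_hc)
    have fd': "\<forall>i\<in>{1..n}. \<forall>v\<in>carr V. f (dop V i v) = dop W i (f v)" using fd by blast
    have fs: "f (act V (Sy w) v) = act W (Sy w) (f v)" if "w \<in> Sn n" "v \<in> carr V" for w v
      using fD(3)[of "Sy w" v] that by (simp add: tact_hc)
    show "f \<in> ?B"
    proof (rule homsI[OF fD(1,2)])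
      fix i v assume "i \<in> Inl ` {1..n} \<union> Inr ` {1..<n}" and v: "v \<in> carr V"
      then consider j where "i = Inl j" "j \<in> {1..n}" | j where "i = Inr j" "j \<in> {1..<n}" by blast
      then show "f (case_sum (dop V) (Top V) i v) = case_sum (dop W) (Top W) i (f v)"
      proof cases
        case (1 j) then show ?thesis using fd v by simp
      next
        case (2 j)
        note s = Sn_simple[OF 2(2)]
        have "f (Top V j v) = Top W j (f v)"
          unfolding Top_def lin_on_scale[OF fD(1) hc_s(2)[OF V s difS[OF 2(2) v]]]
            fs[OF s difS[OF 2(2) v]] df[OF fD(1) fd' 2(2) v] ..
        then show ?thesis using 2 by simp
      qed
    qed
  }
  {
    fix f assume f: "f \<in> ?B"
    note fD = homsD[OF f]
    have fd: "f (dop V i v) = dop W i (f v)" if "i \<in> {1..n}" "v \<in> carr V" for i v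
      using fD(3)[of "Inl i" v] that by auto
    have fd': "\<forall>i\<in>{1..n}. \<forall>v\<in>carr V. f (dop V i v) = dop W i (f v)" using fd by blast
    have fT: "f (Top V i v) = Top W i (f v)" if "i \<in> {1..<n}" "v \<in> carr V" for i v
      using fD(3)[of "Inr i" v] that by auto
    have fs: "\<forall>v\<in>carr V. f (act V (Sy w) v) = act W (Sy w) (f v)" if "w \<in> Sn n" for w
      using that
    proof (rule Sn_generated)
      show "\<forall>v\<in>carr V. f (act V (Sy id) v) = act W (Sy id) (f v)"
        using hc_id[OF V] hc_id[OF W] fD(2) by simp
      show "\<forall>v\<in>carr V. f (act V (Sy (u \<circ> w)) v) = act W (Sy (u \<circ> w)) (f v)"
        if "u \<in> Sn n" "w \<in> Sn n" "\<forall>v\<in>carr V. f (act V (Sy u) v) = act W (Sy u) (f v)"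
          "\<forall>v\<in>carr V. f (act V (Sy w) v) = act W (Sy w) (f v)" for u w
        using hc_s(4)[OF V that(1,2)] hc_s(4)[OF W that(1,2)] that(3,4) hc_s(2)[OF V that(2)] fD(2) by simp
      fix j assume j: "j \<in> {1..<n}"
      note s = Sn_simple[OF j]
      show "\<forall>v\<in>carr V. f (act V (Sy (transpose j (Suc j))) v) = act W (Sy (transpose j (Suc j))) (f v)"
      proof
        fix v assume v: "v \<in> carr V"
        have "(- 2 / csqrt (-2)) *c f (act V (Sy (transpose j (Suc j))) v) = f (Top V j (dop V j v - dop V (Suc j) v))"
          unfolding hc_T(5)[OF V j v] lin_on_scale[OF fD(1) hc_s(2)[OF V s v]] ..
        also have "\<dots> = (- 2 / csqrt (-2)) *c act W (Sy (transpose j (Suc j))) (f v)"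
          unfolding fT[OF j difS[OF j v]] df[OF fD(1) fd' j v] hc_T(5)[OF W j fD(2)[OF v]] ..
        finally show "f (act V (Sy (transpose j (Suc j))) v) = act W (Sy (transpose j (Suc j))) (f v)"
          using csqrt_m2(1) by simp
      qed
    qed
    show "f \<in> ?A"
    proof (rule homsI[OF fD(1,2)])
      fix g v assume "g \<in> gens (hc_alg n)" and v: "v \<in> carr V"
      then show "f (tact (hc_alg n) V g v) = tact (hc_alg n) W g (f v)"
        by (cases rule: hc_gens_cases) (use fd fs v in "auto simp: tact_hc")
    qed
  }
qed

text \<open>The functor \<open>V \<mapsto> eV\<close> multiplies the dimensions of homomorphism spaces by the dimension of the
  endomorphism algebra of the irreducible Clifford module: \<open>1\<close> for even \<open>n\<close>, \<open>2\<close> for odd \<open>n\<close>.\<close>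

lemma hdim_eD:
  assumes V: "hc_module n V" and W: "hc_module n W"
  shows "hdim {1..<n} (eD n V) (Top V) (eD n W) (Top W) = (if even n then 1 else 2) * shdim (hc_alg n) V W"
proof (cases "even n")
  case True
  then have n: "2 * (n div 2) = n" by simp
  then have m: "2 * (n div 2) \<le> n" by simp
  from hdim_eig[OF hc_cfam(1)[OF V m] hc_cfam(1)[OF W m]] show ?thesis
    unfolding hc_shoms[OF V W] n eD_def using True by simp
next
  case False
  then have n: "2 * (n div 2) + 1 = n" by simp
  then have m: "2 * (n div 2) \<le> n" by simp
  have nn: "n \<in> {1..n}" using n by simp
  let ?O = "insert None (Some ` {1..<n})"
  have e: "homs (Inl ` {1..n} \<union> Inr ` {1..<n}) (carr V) (case_sum (dop V) (Top V)) (carr W) (case_sum (dop W) (Top W)) =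
      homs (Inl ` {1..2 * (n div 2)} \<union> Inr ` ?O) (carr V) (case_sum (dop V) (case_option (dop V n) (Top V)))
        (carr W) (case_sum (dop W) (case_option (dop W n) (Top W)))"
  proof -
    have "{1..n} = insert n {1..2 * (n div 2)}" using n nn by (auto simp: atLeastAtMost_iff)
    then show ?thesis unfolding homs_def by (auto simp: ball_Un)
  qed
  have "shdim (hc_alg n) V W = hdim ?O (eD n V) (case_option (dop V n) (Top V)) (eD n W) (case_option (dop W n) (Top W))"
    unfolding hc_shoms[OF V W] e eD_def
    by (rule hdim_eig[OF hc_cfam(3)[OF V m False refl] hc_cfam(3)[OF W m False refl]])
  moreover have "hdim {1..<n} (eD n V) (Top V) (eD n W) (Top W) =
      2 * hdim ?O (eD n V) (case_option (dop V n) (Top V)) (eD n W) (case_option (dop W n) (Top W))"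
  proof (rule hdim_double[where s="sg V", OF eD(1)[OF V] eD(1)[OF W]])
    note sV = subsetD[OF eD(2)[OF V]] and sW = subsetD[OF eD(2)[OF W]]
    note gV = gmod_graded[OF smoduleD(1)[OF hc_smodule[OF V]]]
    show "lin_on (eD n V) (Top V j)" "lin_on (eD n W) (Top W j)" if "j \<in> {1..<n}" for j
      using lin_on_subset[OF hc_T(1)[OF V that] eD(2)[OF V]] lin_on_subset[OF hc_T(1)[OF W that] eD(2)[OF W]] .
    show "lin_on (eD n V) (dop V n)" "lin_on (eD n W) (dop W n)"
      using lin_on_subset[OF hc_d(1)[OF V nn] eD(2)[OF V]] lin_on_subset[OF hc_d(1)[OF W nn] eD(2)[OF W]] .
    show "lin_on (eD n V) (sg V)" by (rule lin_on_subset[OF sg_lin[OF gV] eD(2)[OF V]])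
    show "Top V j v \<in> eD n V" "dop V n (Top V j v) = - Top V j (dop V n v)" "sg V (Top V j v) = - Top V j (sg V v)"
      if "j \<in> {1..<n}" "v \<in> eD n V" for j v
      using eD(3)[OF V that] hc_T(3)[OF V that(1) nn sV[OF that(2)]] hc_T(4)[OF V that(1) sV[OF that(2)]] by simp_all
    show "Top W j v \<in> eD n W" "dop W n (Top W j v) = - Top W j (dop W n v)"
      if "j \<in> {1..<n}" "v \<in> eD n W" for j v
      using eD(3)[OF W that] hc_T(3)[OF W that(1) nn sW[OF that(2)]] by simp_all
    show "dop V n v \<in> eD n V" "dop V n (dop V n v) = - v" "sg V v \<in> eD n V" "sg V (sg V v) = v"
      "sg V (dop V n v) = - dop V n (sg V v)" if "v \<in> eD n V" for v
      using eD(5)[OF V False that] hc_d(3,4)[OF V nn sV[OF that]] eD(4)[OF V that] sg_sg[OF gV sV[OF that]] by simp_all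
    show "dop W n v \<in> eD n W" "dop W n (dop W n v) = - v" if "v \<in> eD n W" for v
      using eD(5)[OF W False that] hc_d(3)[OF W nn sW[OF that]] by simp_all
  qed
  ultimately show ?thesis using False by simp
qed

subsection \<open>Invariant Hermitian forms\<close>

lemma herm_exists:
  assumes "fd S" shows "\<exists>h. herm_form S h"
proof -
  obtain B where B: "finite B" "B \<subseteq> S" "cfun.independent B" "cfun.span B = S" using fd_basis[OF assms] .
  let ?r = "cfun.representation B"
  define h where "h u v = (\<Sum>b\<in>B. ?r u b * cnj (?r v b))" for u v
  have "herm_form S h"
    unfolding herm_form_def
  proof (intro conjI ballI allI impI)
    fix u w assume u: "u \<in> S" and w: "w \<in> S"
    show "h (u + v) w = h u w + h v w" if "v \<in> S" for v
      unfolding h_def using cfun.representation_add[OF B(3), of v u] u that B(4)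
      by (simp add: sum.distrib distrib_right)
    show "h (a *c u) w = a * h u w" for a
      unfolding h_def using cfun.representation_scale[OF B(3), of u a] u B(4)
      by (simp add: sum_distrib_left mult.assoc)
    show "h w u = cnj (h u w)" unfolding h_def by (simp add: mult.commute)
    assume "u \<noteq> 0"
    have "\<exists>b\<in>B. ?r u b \<noteq> 0"
    proof (rule ccontr)
      assume "\<not> ?thesis"
      then have "(\<Sum>b\<in>B. ?r u b *c b) = 0" by simp
      then show False using cfun.sum_representation_eq[OF B(3) _ B(1) order_refl, of u] u B(4) \<open>u \<noteq> 0\<close> by simp
    qed
    then obtain b where b: "b \<in> B" "?r u b \<noteq> 0" by blast
    have "Re (h u u) = (\<Sum>b\<in>B. (cmod (?r u b))\<^sup>2)"
      unfolding h_def Re_sum by (rule sum.cong[OF refl]) (simp add: complex_mult_cnj cmod_power2)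
    also have "\<dots> > 0" by (rule sum_pos2[OF B(1) b(1)]) (use b(2) in auto)
    finally show "0 < Re (h u u)" .
  qed
  then show ?thesis by blast
qed

text \<open>Sums of pullbacks of a Hermitian form along injective maps.\<close>

lemma herm_sum:
  assumes h: "herm_form S2 h" and S2: "cfun.subspace S2" and S: "cfun.subspace S" and A: "finite A" "a0 \<in> A"
    and L: "\<And>a. a \<in> A \<Longrightarrow> lin_on S (L a)" "\<And>a v. a \<in> A \<Longrightarrow> v \<in> S \<Longrightarrow> L a v \<in> S2"
      "\<And>a v. a \<in> A \<Longrightarrow> v \<in> S \<Longrightarrow> L a v = 0 \<Longrightarrow> v = 0"
  shows "herm_form S (\<lambda>u v. \<Sum>a\<in>A. h (L a u) (L a v))"
  unfolding herm_form_def
proof (intro conjI ballI allI impI)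
  fix u w assume u: "u \<in> S" and w: "w \<in> S"
  show "(\<Sum>a\<in>A. h (L a (u + v)) (L a w)) = (\<Sum>a\<in>A. h (L a u) (L a w)) + (\<Sum>a\<in>A. h (L a v) (L a w))" if v: "v \<in> S" for v
    unfolding sum.distrib[symmetric]
    by (rule sum.cong[OF refl])
      (simp add: lin_on_add[OF L(1) u v] herm_add[OF h S2 L(2)[OF _ u] L(2)[OF _ v] L(2)[OF _ w]])
  show "(\<Sum>a\<in>A. h (L a (c *c u)) (L a w)) = c * (\<Sum>a\<in>A. h (L a u) (L a w))" for c
    unfolding sum_distrib_left
    by (rule sum.cong[OF refl]) (simp add: lin_on_scale[OF L(1) u] herm_scale[OF h S2 L(2)[OF _ u] L(2)[OF _ w]])
  show "(\<Sum>a\<in>A. h (L a w) (L a u)) = cnj (\<Sum>a\<in>A. h (L a u) (L a w))"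
    unfolding cnj_sum by (rule sum.cong[OF refl]) (rule herm_cnj[OF h S2 L(2)[OF _ u] L(2)[OF _ w]])
  assume nz: "u \<noteq> 0"
  have pos: "0 < Re (h (L a u) (L a u))" if "a \<in> A" for a
    by (rule herm_pos[OF h S2 L(2)[OF that u]]) (use L(3)[OF that u] nz in blast)
  show "0 < Re (\<Sum>a\<in>A. h (L a u) (L a u))"
    unfolding Re_sum
    by (rule sum_pos2[where f="\<lambda>a. Re (h (L a u) (L a u))" and i=a0, OF A pos[OF A(2)]])
      (use pos in "auto intro: less_imp_le")
qed

lemma herm_uminus:
  assumes "herm_form S h" "cfun.subspace S" "u \<in> S" "v \<in> S"
  shows "h (- u) v = - h u v" "h u (- v) = - h u v"
  using herm_scale[OF assms, of "-1"] herm_scale_right[OF assms(1,2,4,3), of "-1"] by simp_all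

text \<open>Averaging over the group generated by anticommuting involutions, one involution at a time.\<close>

lemma herm_involutions:
  fixes k :: nat and y :: "nat \<Rightarrow> 'x vec \<Rightarrow> 'x vec"
  assumes S: "fd S" and y: "\<And>i. i < k \<Longrightarrow> lin_on S (y i)" "\<And>i v. i < k \<Longrightarrow> v \<in> S \<Longrightarrow> y i v \<in> S"
    "\<And>i v. i < k \<Longrightarrow> v \<in> S \<Longrightarrow> y i (y i v) = v"
    "\<And>i j v. i < k \<Longrightarrow> j < k \<Longrightarrow> i \<noteq> j \<Longrightarrow> v \<in> S \<Longrightarrow> y i (y j v) = - y j (y i v)"
  shows "\<exists>h. herm_form S h \<and> (\<forall>i<k. \<forall>u\<in>S. \<forall>v\<in>S. h (y i u) (y i v) = h u v)"
  using y
proof (induction k)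
  case 0 show ?case using herm_exists[OF S] by simp
next
  case (Suc k)
  note sub = fd_subspace[OF S]
  have "\<exists>h. herm_form S h \<and> (\<forall>i<k. \<forall>u\<in>S. \<forall>v\<in>S. h (y i u) (y i v) = h u v)"
  proof (rule Suc.IH)
    show "lin_on S (y i)" if "i < k" for i by (rule Suc.prems(1)[OF less_SucI[OF that]])
    show "y i v \<in> S" "y i (y i v) = v" if "i < k" "v \<in> S" for i v
      by (rule Suc.prems(2)[OF less_SucI[OF that(1)] that(2)], rule Suc.prems(3)[OF less_SucI[OF that(1)] that(2)])
    show "y i (y j v) = - y j (y i v)" if "i < k" "j < k" "i \<noteq> j" "v \<in> S" for i j v
      by (rule Suc.prems(4)[OF less_SucI[OF that(1)] less_SucI[OF that(2)] that(3,4)])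
  qed
  then obtain h where h: "herm_form S h" "\<forall>i<k. \<forall>u\<in>S. \<forall>v\<in>S. h (y i u) (y i v) = h u v" by blast
  note yk = Suc.prems(1)[OF lessI] Suc.prems(2)[OF lessI] Suc.prems(3)[OF lessI]
  define L where "L b = (if b then y k else (\<lambda>v. v))" for b
  define h' where "h' u v = (\<Sum>b\<in>(UNIV::bool set). h (L b u) (L b v))" for u v
  have h'e: "h' u v = h u v + h (y k u) (y k v)" for u v
    unfolding h'_def by (simp add: UNIV_bool L_def add.commute)
  have yk0: "v = 0" if "v \<in> S" "y k v = 0" for v
    using yk(3)[OF that(1)] that(2) lin_on_zero[OF yk(1) sub] by simp
  have "herm_form S h'"
    unfolding h'_def
    by (rule herm_sum[OF h(1) sub sub finite_UNIV, of True])
      (auto simp: L_def intro: lin_on_id yk(1,2) yk0 split: if_splits)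
  moreover have "h' (y i u) (y i v) = h' u v" if i: "i < Suc k" and u: "u \<in> S" and v: "v \<in> S" for i u v
  proof (cases "i = k")
    case True
    then show ?thesis unfolding h'e using yk(3)[OF u] yk(3)[OF v] by simp
  next
    case False
    then have ik: "i < k" using i by simp
    have a: "y k (y i w) = - y i (y k w)" if "w \<in> S" for w
      by (rule Suc.prems(4)[OF lessI i _ that]) (use False in simp)
    note m = Suc.prems(2)[OF i yk(2)[OF u]] Suc.prems(2)[OF i yk(2)[OF v]]
    have "h (y k (y i u)) (y k (y i v)) = h (y i (y k u)) (y i (y k v))"
      unfolding a[OF u] a[OF v] herm_uminus(1)[OF h(1) sub m(1) cfun.subspace_neg[OF sub m(2)]]
        herm_uminus(2)[OF h(1) sub m] by simp
    then show ?thesis unfolding h'e using h(2) ik u v yk(2) by simp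
  qed
  ultimately show ?case by blast
qed

text \<open>
  Any Hermitian form is averaged over the group generated by the parity involution, the Clifford
  generators and $S_n$: first over the anticommuting involutions, then over $S_n$, which permutes
  the Clifford generators and therefore does not destroy the invariance already reached.
\<close>

lemma hc_form:
  assumes V: "hc_module n V"
  shows "\<exists>h. herm_form (carr V) h \<and>
    (\<forall>u\<in>carr V. \<forall>v\<in>carr V. h (sg V u) v = h u (sg V v)) \<and>
    (\<forall>i\<in>{1..n}. \<forall>u\<in>carr V. \<forall>v\<in>carr V. h (dop V i u) v = - h u (dop V i v)) \<and>
    (\<forall>w\<in>Sn n. \<forall>u\<in>carr V. \<forall>v\<in>carr V. h (act V (Sy w) u) v = h u (act V (Sy (inv w)) v))"
proof -
  let ?S = "carr V"
  note sm = hc_smodule[OF V] note sub = smoduleD(3)[OF sm] note gr = gmod_graded[OF smoduleD(1)[OF sm]]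
  define y where "y i = (if i = 0 then sg V else act V (Cl i))" for i
  have yc: "y i = act V (Cl i)" "i \<in> {1..n}" if "i < Suc n" "i \<noteq> 0" for i using that by (auto simp: y_def)
  have y0: "y 0 = sg V" by (simp add: y_def)
  have "\<exists>h. herm_form ?S h \<and> (\<forall>i<Suc n. \<forall>u\<in>?S. \<forall>v\<in>?S. h (y i u) (y i v) = h u v)"
  proof (rule herm_involutions[OF smoduleD(2)[OF sm]])
    show "lin_on ?S (y i)" if "i < Suc n" for i
      using sg_lin[OF gr] hc_c(1)[OF V yc(2)[OF that]] yc(1)[OF that] y0 by (cases "i = 0") simp_all
    show "y i v \<in> ?S" "y i (y i v) = v" if "i < Suc n" "v \<in> ?S" for i v
      using sg_carr[OF gr that(2)] sg_sg[OF gr that(2)] hc_c(2,3)[OF V yc(2)[OF that(1)] that(2)] yc(1)[OF that(1)] y0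
      by (cases "i = 0"; simp)+
    show "y i (y j v) = - y j (y i v)" if ij: "i < Suc n" "j < Suc n" "i \<noteq> j" "v \<in> ?S" for i j v
    proof -
      note that = ij
      consider "i = 0" "j \<noteq> 0" | "j = 0" "i \<noteq> 0" | "i \<noteq> 0" "j \<noteq> 0" using ij(3) by fastforce
      then show ?thesis
      proof cases
        case 1 then show ?thesis using hc_c(4)[OF V yc(2)[OF that(2) 1(2)] that(4)] yc(1)[OF that(2) 1(2)] y0 by simp
      next
        case 2 then show ?thesis using hc_c(4)[OF V yc(2)[OF that(1) 2(2)] that(4)] yc(1)[OF that(1) 2(2)] y0 by simp
      next
        case 3
        then show ?thesis
          using hc_c(5)[OF V yc(2)[OF that(1) 3(1)] yc(2)[OF that(2) 3(2)] that(3,4)] yc(1)[OF that(1) 3(1)] yc(1)[OF that(2) 3(2)]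
          by simp
      qed
    qed
  qed
  then obtain h0 where h0: "herm_form ?S h0"
    and inv0: "\<And>i u v. i < Suc n \<Longrightarrow> u \<in> ?S \<Longrightarrow> v \<in> ?S \<Longrightarrow> h0 (y i u) (y i v) = h0 u v" by blast
  define h where "h u v = (\<Sum>w\<in>Sn n. h0 (act V (Sy w) u) (act V (Sy w) v))" for u v
  have h: "herm_form ?S h"
    unfolding h_def
  proof (rule herm_sum[OF h0 sub sub Sn_finite Sn_id])
    fix w assume w: "w \<in> Sn n"
    show "lin_on ?S (act V (Sy w))" by (rule hc_s(1)[OF V w])
    fix v assume v: "v \<in> ?S"
    show "act V (Sy w) v \<in> ?S" by (rule hc_s(2)[OF V w v])
    assume "act V (Sy w) v = 0"
    then show "v = 0" using hc_s_inv(2)[OF V w v] lin_on_zero[OF hc_s(1)[OF V Sn_inv[OF w]] sub] by simp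
  qed
  have hsg: "h (sg V u) (sg V v) = h u v" if "u \<in> ?S" "v \<in> ?S" for u v
    unfolding h_def
  proof (rule sum.cong[OF refl])
    fix w assume w: "w \<in> Sn n"
    show "h0 (act V (Sy w) (sg V u)) (act V (Sy w) (sg V v)) = h0 (act V (Sy w) u) (act V (Sy w) v)"
      unfolding hc_s(3)[OF V w that(1), symmetric] hc_s(3)[OF V w that(2), symmetric]
      using inv0[of 0] hc_s(2)[OF V w] that y0 by simp
  qed
  have hc: "h (act V (Cl i) u) (act V (Cl i) v) = h u v" if i: "i \<in> {1..n}" and uv: "u \<in> ?S" "v \<in> ?S" for i u v
    unfolding h_def
  proof (rule sum.cong[OF refl])
    fix w assume w: "w \<in> Sn n"
    have wi: "w i < Suc n" "w i \<noteq> 0" using Sn_app[OF w i] by auto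
    have "act V (Sy w) (act V (Cl i) x) = y (w i) (act V (Sy w) x)" if "x \<in> ?S" for x
      using hc_sc[OF V w] i that yc(1)[OF wi] by simp
    then show "h0 (act V (Sy w) (act V (Cl i) u)) (act V (Sy w) (act V (Cl i) v)) = h0 (act V (Sy w) u) (act V (Sy w) v)"
      using inv0[OF wi(1)] hc_s(2)[OF V w] uv by simp
  qed
  have hw: "h (act V (Sy w) u) (act V (Sy w) v) = h u v" if w: "w \<in> Sn n" and uv: "u \<in> ?S" "v \<in> ?S" for w u v
  proof -
    have bij: "bij_betw (\<lambda>x. x \<circ> w) (Sn n) (Sn n)"
      by (rule bij_betw_byWitness[where f'="\<lambda>x. x \<circ> inv w"])
        (use Sn_inv_comp[OF w] Sn_comp[OF _ w] Sn_comp[OF _ Sn_inv[OF w]] in "auto simp: o_assoc[symmetric]")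
    have "h (act V (Sy w) u) (act V (Sy w) v) = (\<Sum>x\<in>Sn n. h0 (act V (Sy (x \<circ> w)) u) (act V (Sy (x \<circ> w)) v))"
      unfolding h_def by (rule sum.cong[OF refl]) (simp only: hc_s(4)[OF V _ w uv(1)] hc_s(4)[OF V _ w uv(2)])
    also have "\<dots> = h u v"
      unfolding h_def
      by (rule sum.reindex_bij_betw[OF bij, of "\<lambda>x. h0 (act V (Sy x) u) (act V (Sy x) v)"])
    finally show ?thesis .
  qed
  show ?thesis
  proof (intro exI[of _ h] conjI h ballI)
    show s: "h (sg V u) v = h u (sg V v)" if "u \<in> ?S" "v \<in> ?S" for u v
      using hsg[OF that(1) sg_carr[OF gr that(2)]] sg_sg[OF gr that(2)] by simp
    show "h (dop V i u) v = - h u (dop V i v)" if i: "i \<in> {1..n}" and uv: "u \<in> ?S" "v \<in> ?S" for i u v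
    proof -
      note cv = hc_c(2)[OF V i uv(2)] note su = sg_carr[OF gr uv(1)] note sv = sg_carr[OF gr uv(2)]
      have "h (dop V i u) v = h (sg V u) (act V (Cl i) v)"
        unfolding dop_def using hc[OF i su cv] hc_c(3)[OF V i uv(2)] by simp
      also have "\<dots> = h u (- act V (Cl i) (sg V v))" unfolding s[OF uv(1) cv] hc_c(4)[OF V i uv(2)] ..
      also have "\<dots> = - h u (dop V i v)" unfolding dop_def by (rule herm_uminus(2)[OF h sub uv(1) hc_c(2)[OF V i sv]])
      finally show ?thesis .
    qed
    show "h (act V (Sy w) u) v = h u (act V (Sy (inv w)) v)" if w: "w \<in> Sn n" and uv: "u \<in> ?S" "v \<in> ?S" for w u v
      using hw[OF w uv(1) hc_s(2)[OF V Sn_inv[OF w] uv(2)]] hc_s_inv(1)[OF V w uv(2)] by simp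
  qed
qed

lemma hc_unitarizable:
  assumes V: "hc_module n V" shows "unitarizable (hc_alg n) V"
proof -
  obtain h where h: "herm_form (carr V) h"
    "\<And>u v. u \<in> carr V \<Longrightarrow> v \<in> carr V \<Longrightarrow> h (sg V u) v = h u (sg V v)"
    "\<And>i u v. i \<in> {1..n} \<Longrightarrow> u \<in> carr V \<Longrightarrow> v \<in> carr V \<Longrightarrow> h (dop V i u) v = - h u (dop V i v)"
    "\<And>w u v. w \<in> Sn n \<Longrightarrow> u \<in> carr V \<Longrightarrow> v \<in> carr V \<Longrightarrow> h (act V (Sy w) u) v = h u (act V (Sy (inv w)) v)"
    using hc_form[OF V] by (elim exE conjE) blast
  show ?thesis
    unfolding unitarizable_def
  proof (intro exI[of _ h] conjI ballI)
    fix g assume "g \<in> gens (hc_alg n)"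
    then show "\<exists>g'\<in>gens (hc_alg n). \<exists>a. \<forall>u\<in>carr V. \<forall>v\<in>carr V.
        h (tact (hc_alg n) V g u) v = a * h u (tact (hc_alg n) V g' v)"
    proof (cases rule: hc_gens_cases)
      case (1 i)
      then show ?thesis using h(3)[OF 1(2)] by (intro bexI[of _ "Cl i"] exI[of _ "-1"]) (auto simp: tact_hc)
    next
      case (2 w)
      then show ?thesis using h(4)[OF 2(2)] Sn_inv[OF 2(2)]
        by (intro bexI[of _ "Sy (inv w)"] exI[of _ 1]) (auto simp: tact_hc)
    qed
  qed (use h in auto)
qed

text \<open>The operators of the $t_j$ are skew-adjoint, so that an invariant form pulls back along
  embeddings of spin modules.\<close>

lemma spin_alg_simps [simp]: "gens (spin_alg n) = {1..<n}" "gpar (spin_alg n) j = 1"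
  by (simp_all add: spin_alg_def)

lemma spin_unitarizable:
  assumes V: "hc_module n V" and W: "gmod (spin_alg n) W"
    and P: "P \<in> homs {1..<n} (carr W) (tact (spin_alg n) W) (carr V) (Top V)" and inj: "inj_on P (carr W)"
  shows "unitarizable (spin_alg n) W"
proof -
  note sub = smoduleD(3)[OF hc_smodule[OF V]]
  obtain h where h: "herm_form (carr V) h"
    and hd: "\<And>i u v. i \<in> {1..n} \<Longrightarrow> u \<in> carr V \<Longrightarrow> v \<in> carr V \<Longrightarrow> h (dop V i u) v = - h u (dop V i v)"
    and hw: "\<And>w u v. w \<in> Sn n \<Longrightarrow> u \<in> carr V \<Longrightarrow> v \<in> carr V \<Longrightarrow> h (act V (Sy w) u) v = h u (act V (Sy (inv w)) v)"
    using hc_form[OF V] by (elim exE conjE) blast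
  have hT: "h (Top V j u) v = - h u (Top V j v)" if j: "j \<in> {1..<n}" and u: "u \<in> carr V" and v: "v \<in> carr V" for j u v
  proof -
    let ?s = "transpose j (Suc j)"
    note s = Sn_simple[OF j]
    have jn: "j \<in> {1..n}" "Suc j \<in> {1..n}" using j by auto
    note du = hc_d(2)[OF V jn(1) u] hc_d(2)[OF V jn(2) u] and dv = hc_d(2)[OF V jn(1) v] hc_d(2)[OF V jn(2) v]
    note sv = hc_s(2)[OF V s v]
    have invs: "inv ?s = ?s" by simp
    have sS: "act V (Sy ?s) (dop V j v - dop V (Suc j) v) = dop V (Suc j) (act V (Sy ?s) v) - dop V j (act V (Sy ?s) v)"
      unfolding lin_on_diff[OF hc_s(1)[OF V s] sub dv] using hc_d(6)[OF V jn(1) s v] hc_d(6)[OF V jn(2) s v] by simp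
    have a: "h u (dop V (Suc j) (act V (Sy ?s) v) - dop V j (act V (Sy ?s) v)) =
        h u (dop V (Suc j) (act V (Sy ?s) v)) - h u (dop V j (act V (Sy ?s) v))"
      using herm_add_right[OF h sub hc_d(2)[OF V jn(2) sv] cfun.subspace_neg[OF sub hc_d(2)[OF V jn(1) sv]] u]
        herm_uminus(2)[OF h sub u hc_d(2)[OF V jn(1) sv]] by simp
    have "h (Top V j u) v = (1 / csqrt (-2)) * h (dop V j u - dop V (Suc j) u) (act V (Sy ?s) v)"
      unfolding Top_def herm_scale[OF h sub hc_s(2)[OF V s cfun.subspace_diff[OF sub du]] v]
        hw[OF s cfun.subspace_diff[OF sub du] v] invs ..
    also have "h (dop V j u - dop V (Suc j) u) (act V (Sy ?s) v) =
        h u (dop V (Suc j) (act V (Sy ?s) v)) - h u (dop V j (act V (Sy ?s) v))"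
      unfolding herm_diff[OF h sub du sv] hd[OF jn(1) u sv] hd[OF jn(2) u sv] by simp
    also have "\<dots> = h u (act V (Sy ?s) (dop V j v - dop V (Suc j) v))" unfolding sS a ..
    finally have 1: "h (Top V j u) v = (1 / csqrt (-2)) * h u (act V (Sy ?s) (dop V j v - dop V (Suc j) v))" .
    have "h u (Top V j v) = cnj (1 / csqrt (-2)) * h u (act V (Sy ?s) (dop V j v - dop V (Suc j) v))"
      unfolding Top_def by (rule herm_scale_right[OF h sub hc_s(2)[OF V s cfun.subspace_diff[OF sub dv]] u])
    then show ?thesis unfolding 1 csqrt_m2(2) by simp
  qed
  let ?S = "carr W"
  note gr = gmod_graded[OF W] note subW = gmod_carr_subspace[OF W] note PD = homsD[OF P]
  define L where "L b = (if b then (\<lambda>v. P (sg W v)) else P)" for b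
  define k where "k u v = (\<Sum>b\<in>(UNIV::bool set). h (L b u) (L b v))" for u v
  have ke: "k u v = h (P u) (P v) + h (P (sg W u)) (P (sg W v))" for u v
    unfolding k_def by (simp add: UNIV_bool L_def add.commute)
  have P0: "v = 0" if "v \<in> ?S" "P v = 0" for v
    using inj that unfolding lin_on_inj_iff[OF PD(1) subW] by blast
  have Ps0: "v = 0" if "v \<in> ?S" "P (sg W v) = 0" for v
    using P0[OF sg_carr[OF gr that(1)] that(2)] sg_sg[OF gr that(1)] lin_on_zero[OF sg_lin[OF gr] subW] by simp
  have linPs: "lin_on ?S (\<lambda>v. P (sg W v))" by (rule lin_on_comp[OF sg_lin[OF gr] _ PD(1)]) (use sg_carr[OF gr] in blast)
  have "herm_form ?S k"
    unfolding k_def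
  proof (rule herm_sum[OF h sub subW finite_UNIV, of True])
    show "lin_on ?S (L b)" for b using linPs PD(1) by (simp add: L_def)
    show "L b v \<in> carr V" if "v \<in> ?S" for b v using PD(2) sg_carr[OF gr] that by (simp add: L_def)
    show "v = 0" if "v \<in> ?S" "L b v = 0" for b v using P0 Ps0 that by (cases b) (simp_all add: L_def)
  qed simp
  moreover have "k (sg W u) v = k u (sg W v)" if "u \<in> ?S" "v \<in> ?S" for u v
    unfolding ke sg_sg[OF gr that(1)] sg_sg[OF gr that(2)] by simp
  moreover have "k (tact (spin_alg n) W j u) v = - 1 * k u (tact (spin_alg n) W j v)"
    if j: "j \<in> {1..<n}" and u: "u \<in> ?S" and v: "v \<in> ?S" for j u v
  proof -
    have jg: "j \<in> gens (spin_alg n)" using j by simp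
    have Pt: "P (tact (spin_alg n) W j x) = Top V j (P x)" if "x \<in> ?S" for x by (rule PD(3)[OF j that])
    have Pst: "P (sg W (tact (spin_alg n) W j x)) = - Top V j (P (sg W x))" if x: "x \<in> ?S" for x
    proof -
      note sx = sg_carr[OF gr x]
      have "sg W (tact (spin_alg n) W j x) = - tact (spin_alg n) W j (sg W x)" using sg_tact[OF W jg x] by simp
      then show ?thesis using lin_on_uminus[OF PD(1) tact_carr[OF W jg sx]] Pt[OF sx] by simp
    qed
    note su = sg_carr[OF gr u] and sv = sg_carr[OF gr v]
    note T = hc_T(2)[OF V j]
    show ?thesis
      unfolding ke Pt[OF u] Pt[OF v] Pst[OF u] Pst[OF v] hT[OF j PD(2)[OF u] PD(2)[OF v]]
        herm_uminus(1)[OF h sub T[OF PD(2)[OF su]] PD(2)[OF sv]] hT[OF j PD(2)[OF su] PD(2)[OF sv]]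
        herm_uminus(2)[OF h sub PD(2)[OF su] T[OF PD(2)[OF sv]]] by simp
  qed
  ultimately show ?thesis unfolding unitarizable_def spin_alg_simps by blast
qed

subsection \<open>Tensoring with a module over the symmetric group\<close>

lemma sym_module_facts:
  assumes M: "sym_module n M"
  shows "fd (carr M)" "w \<in> Sn n \<Longrightarrow> lin_on (carr M) (act M w)" "w \<in> Sn n \<Longrightarrow> x \<in> carr M \<Longrightarrow> act M w x \<in> carr M"
    "x \<in> carr M \<Longrightarrow> act M id x = x"
    "w \<in> Sn n \<Longrightarrow> w' \<in> Sn n \<Longrightarrow> x \<in> carr M \<Longrightarrow> act M (w \<circ> w') x = act M w (act M w' x)"
proof -
  have sm: "smodule (sym_alg n) M" using M by (simp add: sym_module_def)
  note gm = smoduleD(1)[OF sm]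
  show "fd (carr M)" by (rule smoduleD(2)[OF sm])
  show "lin_on (carr M) (act M w)" if "w \<in> Sn n" using act_lin[OF gm, of w] that by (simp add: sym_alg_def)
  show "act M w x \<in> carr M" if "w \<in> Sn n" "x \<in> carr M" using act_carr[OF gm, of w] that by (simp add: sym_alg_def)
  show "act M id x = x" if "x \<in> carr M" using M that unfolding sym_module_def by blast
  show "act M (w \<circ> w') x = act M w (act M w' x)" if "w \<in> Sn n" "w' \<in> Sn n" "x \<in> carr M"
    using M that unfolding sym_module_def by blast
qed

lemma tmap_uminus: "tmap (\<lambda>v. - F v) G z = - tmap F G z"
  by (simp add: tmap_def fun_eq_iff uminus_apply)

abbreviation hcm :: "(nat \<Rightarrow> nat, 'y) smod \<Rightarrow> hcgen \<Rightarrow> 'y vec \<Rightarrow> 'y vec" where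
  "hcm M \<equiv> (\<lambda>g. case g of Cl i \<Rightarrow> (\<lambda>x. x) | Sy w \<Rightarrow> act M w)"

context
  fixes n :: nat and V :: "(hcgen, 'x) smod" and M :: "(nat \<Rightarrow> nat, 'y) smod"
  assumes V: "hc_module n V" and M: "sym_module n M"
begin

private lemmas gm8 = smoduleD(1)[OF hc_smodule[OF V]]
private lemmas S8 = smoduleD(3)[OF hc_smodule[OF V]]
private lemmas T = fd_subspace[OF sym_module_facts(1)[OF M]]
private lemma hcm: "g \<in> gens (hc_alg n) \<Longrightarrow> lin_on (carr M) (hcm M g)"
  "g \<in> gens (hc_alg n) \<Longrightarrow> x \<in> carr M \<Longrightarrow> hcm M g x \<in> carr M"
  by (auto elim!: hc_gens_cases intro: lin_on_id sym_module_facts(2,3)[OF M])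

private lemma tm: "carr (hc_tensor V M) = tens_space (carr V) (carr M)"
  "g \<in> gens (hc_alg n) \<Longrightarrow> z \<in> tens_space (carr V) (carr M) \<Longrightarrow>
    act (hc_tensor V M) g z = tmap (act V g) (hcm M g) z"
  "g \<in> gens (hc_alg n) \<Longrightarrow> z \<in> tens_space (carr V) (carr M) \<Longrightarrow>
    tact (hc_alg n) (hc_tensor V M) g z = tmap (tact (hc_alg n) V g) (hcm M g) z"
  "smodule (hc_alg n) (hc_tensor V M)"
proof -
  note t = tens_mod[of "hc_alg n" V "carr M" "hcm M", OF gm8 T, folded hc_tensor_tens_mod]
  show "carr (hc_tensor V M) = tens_space (carr V) (carr M)" by (rule t(1)) (use hcm in blast)+
  show "act (hc_tensor V M) g z = tmap (act V g) (hcm M g) z"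
    "tact (hc_alg n) (hc_tensor V M) g z = tmap (tact (hc_alg n) V g) (hcm M g) z"
    if "g \<in> gens (hc_alg n)" "z \<in> tens_space (carr V) (carr M)"
    using t(4,5)[OF _ _ that] hcm by blast+
  show "smodule (hc_alg n) (hc_tensor V M)"
    unfolding hc_tensor_tens_mod
    by (rule tens_mod_smodule[OF hc_smodule[OF V] sym_module_facts(1)[OF M]]) (use hcm in blast)+
qed

lemma hc_tensor_carr: "carr (hc_tensor V M) = tens_space (carr V) (carr M)"
  by (rule tm(1))

lemma hc_tensor_act:
  assumes "z \<in> tens_space (carr V) (carr M)"
  shows "i \<in> {1..n} \<Longrightarrow> act (hc_tensor V M) (Cl i) z = tmap (act V (Cl i)) (\<lambda>x. x) z"
    "w \<in> Sn n \<Longrightarrow> act (hc_tensor V M) (Sy w) z = tmap (act V (Sy w)) (act M w) z"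
    "i \<in> {1..n} \<Longrightarrow> dop (hc_tensor V M) i z = tmap (dop V i) (\<lambda>x. x) z"
  using tm(2)[of "Cl i" z] tm(2)[of "Sy w" z] tm(3)[of "Cl i" z] assms by (simp_all add: tact_hc)

lemma hc_tensor_module: "hc_module n (hc_tensor V M)"
proof -
  let ?Z = "tens_space (carr V) (carr M)"
  note c = hc_c[OF V] and s = hc_s[OF V] and mM = sym_module_facts[OF M]
  note zin = tmap_in[OF S8 T]
  have cin: "tmap (act V (Cl i)) (\<lambda>x. x) z \<in> ?Z" if "i \<in> {1..n}" "z \<in> ?Z" for i z
    by (rule zin[OF c(1)[OF that(1)] lin_on_id c(2)[OF that(1)] _ that(2)])
  have sin: "tmap (act V (Sy w)) (act M w) z \<in> ?Z" if "w \<in> Sn n" "z \<in> ?Z" for w z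
    by (rule zin[OF s(1)[OF that(1)] mM(2)[OF that(1)] s(2)[OF that(1)] mM(3)[OF that(1)] that(2)])
  have cc: "tmap (act V (Cl i)) (\<lambda>x. x) (tmap (act V (Cl j)) (\<lambda>x. x) z) = tmap (\<lambda>v. act V (Cl i) (act V (Cl j) v)) (\<lambda>x. x) z"
    if "i \<in> {1..n}" "j \<in> {1..n}" "z \<in> ?Z" for i j z
    by (rule tmap_comp[OF S8 T c(1)[OF that(2)] lin_on_id S8 c(1)[OF that(1)] lin_on_id c(2)[OF that(2)] _ that(3)])
  have lcc: "lin_on (carr V) (\<lambda>v. act V (Cl i) (act V (Cl j) v))" if "i \<in> {1..n}" "j \<in> {1..n}" for i j
    by (rule lin_on_comp[OF c(1)[OF that(2)] _ c(1)[OF that(1)]]) (use c(2)[OF that(2)] in blast)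
  have ss: "tmap (act V (Sy w)) (act M w) (tmap (act V (Sy u)) (act M u) z) =
      tmap (\<lambda>v. act V (Sy w) (act V (Sy u) v)) (\<lambda>x. act M w (act M u x)) z"
    if "w \<in> Sn n" "u \<in> Sn n" "z \<in> ?Z" for w u z
    by (rule tmap_comp[OF S8 T s(1)[OF that(2)] mM(2)[OF that(2)] S8 s(1)[OF that(1)] mM(2)[OF that(1)] s(2)[OF that(2)] mM(3)[OF that(2)] that(3)])
  have sc: "tmap (act V (Sy w)) (act M w) (tmap (act V (Cl i)) (\<lambda>x. x) z) =
      tmap (act V (Cl (w i))) (\<lambda>x. x) (tmap (act V (Sy w)) (act M w) z)"
    if w: "w \<in> Sn n" and i: "i \<in> {1..n}" and z: "z \<in> ?Z" for w i z
  proof -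
    note wi = Sn_app[OF w i]
    have "tmap (act V (Sy w)) (act M w) (tmap (act V (Cl i)) (\<lambda>x. x) z) =
        tmap (\<lambda>v. act V (Sy w) (act V (Cl i) v)) (\<lambda>x. act M w x) z"
      by (rule tmap_comp[OF S8 T c(1)[OF i] lin_on_id S8 s(1)[OF w] mM(2)[OF w] c(2)[OF i] _ z])
    also have "\<dots> = tmap (\<lambda>v. act V (Cl (w i)) (act V (Sy w) v)) (\<lambda>x. act M w x) z"
    proof (rule tmap_cong[OF S8 T _ mM(2)[OF w] _ mM(2)[OF w] _ refl z])
      show "lin_on (carr V) (\<lambda>v. act V (Sy w) (act V (Cl i) v))"
        by (rule lin_on_comp[OF c(1)[OF i] _ s(1)[OF w]]) (use c(2)[OF i] in blast)
      show "lin_on (carr V) (\<lambda>v. act V (Cl (w i)) (act V (Sy w) v))"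
        by (rule lin_on_comp[OF s(1)[OF w] _ c(1)[OF wi]]) (use s(2)[OF w] in blast)
      show "act V (Sy w) (act V (Cl i) v) = act V (Cl (w i)) (act V (Sy w) v)" if "v \<in> carr V" for v
        using hc_sc[OF V w] i that by blast
    qed
    also have "\<dots> = tmap (act V (Cl (w i))) (\<lambda>x. x) (tmap (act V (Sy w)) (act M w) z)"
      by (rule tmap_comp[OF S8 T s(1)[OF w] mM(2)[OF w] S8 c(1)[OF wi] lin_on_id s(2)[OF w] mM(3)[OF w] z, symmetric])
    finally show ?thesis .
  qed
  note ac = hc_tensor_act
  show ?thesis
    unfolding hc_module_def hc_tensor_carr
  proof (intro conjI ballI impI)
    show "smodule (hc_alg n) (hc_tensor V M)"
      by (rule tm(4))
    fix z assume z: "z \<in> ?Z"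
    show "act (hc_tensor V M) (Cl i) (act (hc_tensor V M) (Cl i) z) = z" if i: "i \<in> {1..n}" for i
    proof -
      have "tmap (\<lambda>v. act V (Cl i) (act V (Cl i) v)) (\<lambda>x. x) z = tmap (\<lambda>v. v) (\<lambda>x. x) z"
        by (rule tmap_cong[OF S8 T lcc[OF i i] lin_on_id lin_on_id lin_on_id c(3)[OF i] refl z])
      then show ?thesis unfolding ac(1)[OF z i] ac(1)[OF cin[OF i z] i] cc[OF i i z] tmap_id .
    qed
    show "act (hc_tensor V M) (Cl i) (act (hc_tensor V M) (Cl j) z) = - act (hc_tensor V M) (Cl j) (act (hc_tensor V M) (Cl i) z)"
      if i: "i \<in> {1..n}" and j: "j \<in> {1..n}" and ij: "i \<noteq> j" for i j
    proof -
      have l: "lin_on (carr V) (\<lambda>v. - act V (Cl j) (act V (Cl i) v))"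
        using lin_on_scale_fun[OF lcc[OF j i], of "-1"] by simp
      have "tmap (\<lambda>v. act V (Cl i) (act V (Cl j) v)) (\<lambda>x. x) z = tmap (\<lambda>v. - act V (Cl j) (act V (Cl i) v)) (\<lambda>x. x) z"
        by (rule tmap_cong[OF S8 T lcc[OF i j] lin_on_id l lin_on_id c(5)[OF i j ij] refl z])
      then show ?thesis
        unfolding ac(1)[OF z i] ac(1)[OF z j] ac(1)[OF cin[OF j z] i] ac(1)[OF cin[OF i z] j] cc[OF i j z] cc[OF j i z] tmap_uminus .
    qed
    show "act (hc_tensor V M) (Sy id) z = z"
    proof -
      have "tmap (act V (Sy id)) (act M id) z = tmap (\<lambda>v. v) (\<lambda>x. x) z"
        by (rule tmap_cong[OF S8 T s(1)[OF Sn_id] mM(2)[OF Sn_id] lin_on_id lin_on_id hc_id[OF V] mM(4) z])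
      then show ?thesis unfolding ac(2)[OF z Sn_id] tmap_id .
    qed
    show "act (hc_tensor V M) (Sy (w \<circ> u)) z = act (hc_tensor V M) (Sy w) (act (hc_tensor V M) (Sy u) z)"
      if w: "w \<in> Sn n" and u: "u \<in> Sn n" for w u
    proof -
      have "tmap (act V (Sy (w \<circ> u))) (act M (w \<circ> u)) z = tmap (\<lambda>v. act V (Sy w) (act V (Sy u) v)) (\<lambda>x. act M w (act M u x)) z"
      proof (rule tmap_cong[OF S8 T s(1)[OF Sn_comp[OF w u]] mM(2)[OF Sn_comp[OF w u]] _ _ s(4)[OF w u] mM(5)[OF w u] z])
        show "lin_on (carr V) (\<lambda>v. act V (Sy w) (act V (Sy u) v))"
          by (rule lin_on_comp[OF s(1)[OF u] _ s(1)[OF w]]) (use s(2)[OF u] in blast)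
        show "lin_on (carr M) (\<lambda>x. act M w (act M u x))"
          by (rule lin_on_comp[OF mM(2)[OF u] _ mM(2)[OF w]]) (use mM(3)[OF u] in blast)
      qed
      then show ?thesis unfolding ac(2)[OF z Sn_comp[OF w u]] ac(2)[OF z u] ac(2)[OF sin[OF u z] w] ss[OF w u z] .
    qed
    show "act (hc_tensor V M) (Sy (transpose i (Suc i))) (act (hc_tensor V M) (Cl i) z) =
        act (hc_tensor V M) (Cl (Suc i)) (act (hc_tensor V M) (Sy (transpose i (Suc i))) z)" if "i \<in> {1..<n}" for i
    proof -
      have i: "i \<in> {1..n}" "Suc i \<in> {1..n}" using that by auto
      note t = Sn_simple[OF that]
      show ?thesis unfolding ac(1)[OF z i(1)] ac(2)[OF cin[OF i(1) z] t] ac(2)[OF z t] ac(1)[OF sin[OF t z] i(2)] sc[OF t i(1) z] by simp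
    qed
    show "act (hc_tensor V M) (Sy (transpose i (Suc i))) (act (hc_tensor V M) (Cl j) z) =
        act (hc_tensor V M) (Cl j) (act (hc_tensor V M) (Sy (transpose i (Suc i))) z)"
      if ii: "i \<in> {1..<n}" and jj: "j \<in> {1..n} - {i, Suc i}" for i j
    proof -
      have j: "j \<in> {1..n}" and tj: "transpose i (Suc i) j = j" using jj by (auto simp: transpose_def)
      note t = Sn_simple[OF ii]
      show ?thesis unfolding ac(1)[OF z j] ac(2)[OF cin[OF j z] t] ac(2)[OF z t] ac(1)[OF sin[OF t z] j] sc[OF t j z] tj ..
    qed
  qed
qed

lemma Top_tensor:
  assumes j: "j \<in> {1..<n}" and z: "z \<in> tens_space (carr V) (carr M)"
  shows "Top (hc_tensor V M) j z = tmap (Top V j) (act M (transpose j (Suc j))) z"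
proof (rule lin_eq_on_tens[OF _ _ _ z])
  let ?s = "transpose j (Suc j)"
  note s = Sn_simple[OF j]
  have jn: "j \<in> {1..n}" "Suc j \<in> {1..n}" using j by auto
  note mM = sym_module_facts[OF M]
  show "lin_on (tens_space (carr V) (carr M)) (Top (hc_tensor V M) j)"
    using hc_T(1)[OF hc_tensor_module j] unfolding hc_tensor_carr .
  show "lin_on (tens_space (carr V) (carr M)) (tmap (Top V j) (act M ?s))"
    by (rule tmap_lin[OF S8 T hc_T(1)[OF V j] mM(2)[OF s]])
  fix u x assume u: "u \<in> carr V" and x: "x \<in> carr M"
  have d: "dop (hc_tensor V M) i (tens u x) = tens (dop V i u) x" if i: "i \<in> {1..n}" for i
    unfolding hc_tensor_act(3)[OF tens_in[OF u x] i] by (rule tmap_tens[OF S8 T hc_d(1)[OF V i] lin_on_id u x])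
  note du = cfun.subspace_diff[OF S8 hc_d(2)[OF V jn(1) u] hc_d(2)[OF V jn(2) u]]
  have "dop (hc_tensor V M) j (tens u x) - dop (hc_tensor V M) (Suc j) (tens u x) = tens (dop V j u - dop V (Suc j) u) x"
    unfolding d[OF jn(1)] d[OF jn(2)] by (simp add: tens_def fun_eq_iff pointwise left_diff_distrib)
  then have "Top (hc_tensor V M) j (tens u x) = (1 / csqrt (-2)) *c tens (act V (Sy ?s) (dop V j u - dop V (Suc j) u)) (act M ?s x)"
    unfolding Top_def using hc_tensor_act(2)[OF tens_in[OF du x] s] tmap_tens[OF S8 T hc_s(1)[OF V s] mM(2)[OF s] du x] by simp
  also have "\<dots> = tens (Top V j u) (act M ?s x)" unfolding Top_def tens_bilinear(2) ..
  also have "\<dots> = tmap (Top V j) (act M ?s) (tens u x)" by (rule tmap_tens[OF S8 T hc_T(1)[OF V j] mM(2)[OF s] u x, symmetric])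
  finally show "Top (hc_tensor V M) j (tens u x) = tmap (Top V j) (act M ?s) (tens u x)" .
qed

text \<open>
  The Clifford generators act on the first factor only, so a tensor lies in the eigenspace if and
  only if all its slices do.
\<close>

lemma eD_tensor: "eD n (hc_tensor V M) = tens_space (eD n V) (carr M)"
proof -
  note subE = fd_subspace[OF eD(1)[OF V]]
  let ?Z = "tens_space (carr V) (carr M)"
  have r: "2 * j - 1 \<in> {1..n}" "2 * j \<in> {1..n}" if "j \<in> {1..n div 2}" for j using that by auto
  have dz: "dop (hc_tensor V M) (2 * j - 1) (dop (hc_tensor V M) (2 * j) z) = tmap (\<lambda>v. dop V (2 * j - 1) (dop V (2 * j) v)) (\<lambda>x. x) z"
    if j: "j \<in> {1..n div 2}" and z: "z \<in> ?Z" for j z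
  proof -
    note d = hc_d[OF V r(1)[OF j]] and d' = hc_d[OF V r(2)[OF j]]
    have "tmap (dop V (2 * j)) (\<lambda>x. x) z \<in> ?Z" by (rule tmap_in[OF S8 T d'(1) lin_on_id d'(2) _ z])
    then show ?thesis
      unfolding hc_tensor_act(3)[OF z r(2)[OF j]]
      using hc_tensor_act(3)[OF _ r(1)[OF j]] tmap_comp[OF S8 T d'(1) lin_on_id S8 d(1) lin_on_id d'(2) _ z] by simp
  qed
  show ?thesis
  proof (intro subset_antisym subsetI)
    fix z assume z: "z \<in> eD n (hc_tensor V M)"
    then have zZ: "z \<in> ?Z" using eD(2)[OF hc_tensor_module] hc_tensor_carr by blast
    show "z \<in> tens_space (eD n V) (carr M)"
    proof (rule tens_retract[OF S8 T subE zZ])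
      fix b
      have "dop V (2 * j - 1) (dop V (2 * j) (\<lambda>a. z (a, b))) = \<i> *c (\<lambda>a. z (a, b))" if j: "j \<in> {1..n div 2}" for j
      proof -
        have e: "tmap (\<lambda>v. dop V (2 * j - 1) (dop V (2 * j) v)) (\<lambda>x. x) z = \<i> *c z"
          using z j unfolding eD_def eig_def dz[OF j zZ, symmetric] by blast
        have "(\<lambda>a. tmap (\<lambda>v. dop V (2 * j - 1) (dop V (2 * j) v)) (\<lambda>x. x) z (a, b)) = \<i> *c (\<lambda>a. z (a, b))"
          unfolding e by (simp add: cscale_def)
        then show ?thesis unfolding tmap_slice .
      qed
      then show "(\<lambda>a. z (a, b)) \<in> eD n V" unfolding eD_def eig_def using tens_slice_left[OF zZ S8] by blast
    qed
  next
    fix z assume z: "z \<in> tens_space (eD n V) (carr M)"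
    have zZ: "z \<in> ?Z" using z tens_space_mono[OF eD(2)[OF V]] by blast
    have "dop (hc_tensor V M) (2 * j - 1) (dop (hc_tensor V M) (2 * j) z) = \<i> *c z" if j: "j \<in> {1..n div 2}" for j
    proof -
      have sl: "(\<lambda>a. z (a, b)) \<in> eD n V" for b by (rule tens_slice_left[OF z subE])
      have "tmap (\<lambda>v. dop V (2 * j - 1) (dop V (2 * j) v)) (\<lambda>x. x) z (a, b) = (\<i> *c z) (a, b)" for a b
      proof -
        have "dop V (2 * j - 1) (dop V (2 * j) (\<lambda>a. z (a, b))) = \<i> *c (\<lambda>a. z (a, b))"
          using sl[of b] j unfolding eD_def eig_def by blast
        then have "(\<lambda>a. tmap (\<lambda>v. dop V (2 * j - 1) (dop V (2 * j) v)) (\<lambda>x. x) z (a, b)) = \<i> *c (\<lambda>a. z (a, b))"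
          unfolding tmap_slice .
        from fun_cong[OF this, of a] show ?thesis by (simp add: cscale_def)
      qed
      then show ?thesis unfolding dz[OF j zZ] by (simp add: fun_eq_iff)
    qed
    then show "z \<in> eD n (hc_tensor V M)" unfolding eD_def eig_def hc_tensor_carr using zZ by blast
  qed
qed

end

section \<open>The functor to spin modules\<close>

lemma cliff_alg_simps [simp]: "gens (cliff_alg n) = {1..n}" "gpar (cliff_alg n) j = 1"
  by (simp_all add: cliff_alg_def)

lemma tact_cliff: "tact (cliff_alg n) U i v = act U i (sg U v)"
  by (simp add: tact_def)

context
  fixes n :: nat and U :: "(nat, 'u) smod"
  assumes U: "cliff_module n U"
begin

lemma cliff_smodule: "smodule (cliff_alg n) U" using U by (simp add: cliff_module_def)

private lemmas gm9 = smoduleD(1)[OF cliff_smodule]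
private lemmas S9 = smoduleD(3)[OF cliff_smodule]
private lemmas gr9 = gmod_graded[OF gm9]
private abbreviation "d \<equiv> tact (cliff_alg n) U"

lemma cliff_d:
  assumes i: "i \<in> {1..n}"
  shows "lin_on (carr U) (d i)" "v \<in> carr U \<Longrightarrow> d i v \<in> carr U"
    "v \<in> carr U \<Longrightarrow> d i (d i v) = - v" "v \<in> carr U \<Longrightarrow> sg U (d i v) = - d i (sg U v)"
    "j \<in> {1..n} \<Longrightarrow> i \<noteq> j \<Longrightarrow> v \<in> carr U \<Longrightarrow> d i (d j v) = - d j (d i v)"
proof -
  have g: "k \<in> gens (cliff_alg n)" if "k \<in> {1..n}" for k using that by simp
  show "lin_on (carr U) (d i)" by (rule tact_lin[OF gm9 g[OF i]])
  show "d i v \<in> carr U" if "v \<in> carr U" by (rule tact_carr[OF gm9 g[OF i] that])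
  have dd: "d k (d j v) = - act U k (act U j v)" if "k \<in> {1..n}" "j \<in> {1..n}" "v \<in> carr U" for k j v
  proof -
    note sv = sg_carr[OF gr9 that(3)]
    have "sg U (d j v) = - act U j v"
      unfolding tact_cliff using sg_act[OF gm9 g[OF that(2)] sv] sg_sg[OF gr9 that(3)] by simp
    then show ?thesis
      unfolding tact_cliff[of n U k] using lin_on_uminus[OF act_lin[OF gm9 g[OF that(1)]] act_carr[OF gm9 g[OF that(2)] that(3)]] by simp
  qed
  have c2: "act U i (act U i v) = v" if "v \<in> carr U" using U i that unfolding cliff_module_def by blast
  have cc: "act U i (act U j v) = - act U j (act U i v)" if "j \<in> {1..n}" "i \<noteq> j" "v \<in> carr U"
    using U i that unfolding cliff_module_def by blast
  show "d i (d i v) = - v" if "v \<in> carr U" using dd[OF i i that] c2[OF that] by simp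
  show "sg U (d i v) = - d i (sg U v)" if "v \<in> carr U" using sg_tact[OF gm9 g[OF i] that] by simp
  show "d i (d j v) = - d j (d i v)" if "j \<in> {1..n}" "i \<noteq> j" "v \<in> carr U"
    using dd[OF i that(1,3)] dd[OF that(1) i that(3)] cc[OF that] by simp
qed

lemma cliff_cfam:
  assumes m: "2 * m \<le> n" and x: "\<And>i. i \<in> I \<Longrightarrow> lin_on (carr U) (x i)" "\<And>i v. i \<in> I \<Longrightarrow> v \<in> carr U \<Longrightarrow> x i v \<in> carr U"
    "\<And>i j v. i \<in> I \<Longrightarrow> j \<in> {1..2*m} \<Longrightarrow> v \<in> carr U \<Longrightarrow> x i (d j v) = - d j (x i v)"
  shows "cfam m I (carr U) d x"
proof -
  have r: "j \<in> {1..n}" if "j \<in> {1..2*m}" for j using that m by auto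
  have d: "\<forall>j\<in>{1..2*m}. lin_on (carr U) (d j) \<and> (\<forall>v\<in>carr U. d j v \<in> carr U \<and> d j (d j v) = - v)"
    "\<forall>j\<in>{1..2*m}. \<forall>k\<in>{1..2*m}. j \<noteq> k \<longrightarrow> (\<forall>v\<in>carr U. d j (d k v) = - d k (d j v))"
    by (intro ballI conjI; simp add: cliff_d(1,2,3)[OF r]) (intro ballI impI, rule cliff_d(5)[OF r r])
  show ?thesis
    unfolding cfam_def by (rule conjI[OF S9 conjI[OF d(1) conjI[OF d(2)]]]) (intro ballI conjI x)
qed

end

lemma res_cliff_simps [simp]: "hpart (res_cliff V) = hpart V" "carr (res_cliff V) = carr V" "sg (res_cliff V) = sg V"
  "act (res_cliff V) i = act V (Cl i)"
  by (simp_all add: res_cliff_def carr_def sg_def fun_eq_iff)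

lemma tact_res: "tact (cliff_alg n) (res_cliff V) = dop V"
  by (simp add: fun_eq_iff tact_cliff dop_def)

lemma res_cliff_module:
  assumes V: "hc_module n V" shows "cliff_module n (res_cliff V)"
proof -
  note sm = hc_smodule[OF V] note gm = smoduleD(1)[OF sm]
  have "gmod (cliff_alg n) (res_cliff V)"
    unfolding gmod_def
  proof (intro conjI ballI allI)
    show "graded (res_cliff V)" using gmod_graded[OF gm] by simp
    fix i assume "i \<in> gens (cliff_alg n)"
    then have i: "i \<in> {1..n}" and g: "Cl i \<in> gens (hc_alg n)" by auto
    show "lin_on (carr (res_cliff V)) (act (res_cliff V) i)" using hc_c(1)[OF V i] by simp
    show "act (res_cliff V) i ` hpart (res_cliff V) p \<subseteq> hpart (res_cliff V) (p + gpar (cliff_alg n) i)" for p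
      using act_hpart[OF gm g, of _ p] unfolding res_cliff_simps cliff_alg_simps hc_alg_simps by blast
  qed
  then have "smodule (cliff_alg n) (res_cliff V)" using smoduleD(2)[OF sm] by (simp add: smodule_iff)
  then have sm: "smodule (cliff_alg n) (res_cliff V)" .
  show ?thesis unfolding cliff_module_def res_cliff_simps
  proof (intro conjI ballI impI)
    show "smodule (cliff_alg n) (res_cliff V)" by (rule sm)
    show "act V (Cl i) (act V (Cl i) v) = v" if "i \<in> {1..n}" "v \<in> carr V" for i v by (rule hc_c(3)[OF V that])
    show "act V (Cl i) (act V (Cl j) v) = - act V (Cl j) (act V (Cl i) v)"
      if "i \<in> {1..n}" "j \<in> {1..n}" "i \<noteq> j" "v \<in> carr V" for i j v by (rule hc_c(5)[OF V that])
  qed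
qed

context
  fixes n :: nat and U :: "(nat, 'u) smod" and V :: "(hcgen, 'x) smod"
  assumes U: "cliff_module n U" and irr: "sirreducible (cliff_alg n) U" and V: "hc_module n V"
begin

private abbreviation "G \<equiv> G_functor n U V"
private abbreviation "H \<equiv> homs {1..n} (carr U) (tact (cliff_alg n) U) (carr V) (dop V)"

private lemmas gU = smoduleD(1)[OF cliff_smodule[OF U]]
private lemmas grU = gmod_graded[OF gU]
private lemmas SU = smoduleD(3)[OF cliff_smodule[OF U]]
private lemmas gR = smoduleD(1)[OF cliff_smodule[OF res_cliff_module[OF V]]]
private lemmas gV = smoduleD(1)[OF hc_smodule[OF V]]
private lemmas grV = gmod_graded[OF gV]
private lemmas SV = smoduleD(3)[OF hc_smodule[OF V]]

private lemma shom_G: "shom (cliff_alg n) p U (res_cliff V) f \<longleftrightarrow>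
    f \<in> H \<and> (\<forall>v\<in>carr U. f (sg U v) = ssign 1 p *c sg V (f v))"
  using shom_iff[OF gU gR, of p f] unfolding tact_res cliff_alg_simps res_cliff_simps .

private lemma G_hpart: "hpart G p = enc (carr U) ` {f \<in> H. \<forall>v\<in>carr U. f (sg U v) = ssign 1 p *c sg V (f v)}"
  unfolding G_functor_def by (auto simp: shom_G enc_def)

private lemma spH: "fspace H"
  by (rule homs_fspace[OF SV]) (use hc_d(1)[OF V] in auto)

private lemma G_carr: "carr G = enc (carr U) ` H"
proof (intro subset_antisym subsetI)
  fix F assume "F \<in> carr G"
  then obtain F0 F1 where F: "F0 \<in> hpart G 0" "F1 \<in> hpart G 1" "F = F0 + F1" unfolding carr_def by blast
  then obtain f0 f1 where f: "f0 \<in> H" "F0 = enc (carr U) f0" "f1 \<in> H" "F1 = enc (carr U) f1" unfolding G_hpart by auto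
  have "F = enc (carr U) (\<lambda>v. f0 v + f1 v)" unfolding F(3) f(2,4) enc_add ..
  then show "F \<in> enc (carr U) ` H" using fspace_add[OF spH f(1,3)] by blast
next
  fix F assume "F \<in> enc (carr U) ` H"
  then obtain f where f: "f \<in> H" "F = enc (carr U) f" by blast
  have f': "f \<in> shoms (cliff_alg n) U (res_cliff V)" using f(1) unfolding tact_res cliff_alg_simps res_cliff_simps .
  let ?f = "\<lambda>p. hcomp U (res_cliff V) p f"
  have p: "enc (carr U) (?f p) \<in> hpart G p" for p
    using hcomp_shom[OF gU gR f', of p] unfolding shom_G G_hpart by blast
  have "F = enc (carr U) (?f 0) + enc (carr U) (?f 1)"
    unfolding f(2) enc_add[symmetric] enc_eq_iff using hcomp_sum[of f _ U "res_cliff V"] by blast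
  then show "F \<in> carr G" using p unfolding carr_def by blast
qed

private lemma G_graded: "graded G"
proof -
  have sub: "cfun.subspace (hpart G p)" for p
    unfolding G_hpart
  proof (rule fspace_subspace)
    have z: "sg V 0 = 0" by (rule lin_on_zero[OF sg_lin[OF grV] SV])
    note sl = lin_rules[OF sg_lin[OF grV] SV]
    have HE: "f v \<in> carr V" if "f \<in> H" "v \<in> carr U" for f v by (rule homsD(2)[OF that])
    show "fspace {f \<in> H. \<forall>v\<in>carr U. f (sg U v) = ssign 1 p *c sg V (f v)}"
      unfolding fspace_def
      using fspace_add[OF spH] fspace_scale[OF spH] spH z sl(1,3) HE
      by (auto simp: fspace_def cfun.scale_right_distrib mult.commute)
  qed
  have "F = 0" if FF: "F \<in> hpart G 0" "F \<in> hpart G 1" for F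
  proof -
    obtain f0 f1 where f: "f0 \<in> H" "\<forall>v\<in>carr U. f0 (sg U v) = sg V (f0 v)" "F = enc (carr U) f0"
      "f1 \<in> H" "\<forall>v\<in>carr U. f1 (sg U v) = - sg V (f1 v)" "F = enc (carr U) f1" using FF unfolding G_hpart by auto
    have e: "f0 v = f1 v" if "v \<in> carr U" for v using f(3,6) that enc_eq_iff[of "carr U" f0 f1] by auto
    have "f0 v = 0" if v: "v \<in> carr U" for v
    proof -
      have "sg V (f0 v) = - sg V (f0 v)" using f(2,5) e[OF v] e[OF sg_carr[OF grU v]] v by auto
      then have "2 *c sg V (f0 v) = 0" by (simp add: fun_eq_iff pointwise)
      then have "sg V (f0 v) = 0" by simp
      then show ?thesis
        using sg_sg[OF grV homsD(2)[OF f(1) v]] lin_on_zero[OF sg_lin[OF grV] SV] by simp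
    qed
    then show "F = 0" unfolding f(3) enc_eq_0_iff by blast
  qed
  then have "hpart G 0 \<inter> hpart G 1 = {0}" using cfun.subspace_0[OF sub] by blast
  then show ?thesis unfolding splits_def using sub by (simp add: carr_def)
qed

private lemma G_sg: assumes f: "f \<in> H" shows "sg G (enc (carr U) f) = enc (carr U) (\<lambda>v. sg V (f (sg U v)))"
proof -
  have f': "f \<in> shoms (cliff_alg n) U (res_cliff V)" using f unfolding tact_res cliff_alg_simps res_cliff_simps .
  let ?f = "\<lambda>p. hcomp U (res_cliff V) p f"
  have p: "enc (carr U) (?f p) \<in> hpart G p" for p
    using hcomp_shom[OF gU gR f', of p] unfolding shom_G G_hpart by blast
  have e: "enc (carr U) f = enc (carr U) (?f 0) + enc (carr U) (?f 1)"
    unfolding enc_add[symmetric] enc_eq_iff using hcomp_sum[of f _ U "res_cliff V"] by blast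
  have "enc (carr U) (\<lambda>v. sg V (f (sg U v))) + enc (carr U) (?f 1) = enc (carr U) (?f 0)"
  proof -
    have "y + (1/2) *c (x + (-1) *c y) = (1/2) *c (x + 1 *c y)" for x y :: "'x vec"
      by (rule ext) (simp add: pointwise field_simps)
    then show ?thesis unfolding enc_add[symmetric] enc_eq_iff hcomp_def ssign_simps res_cliff_simps by blast
  qed
  then have "enc (carr U) (?f 0) - enc (carr U) (?f 1) = enc (carr U) (\<lambda>v. sg V (f (sg U v)))"
    by (simp add: algebra_simps)
  then show ?thesis unfolding e using sg_add_parts[OF G_graded p p] by simp
qed

private lemma Ts_H: assumes j: "j \<in> {1..<n}" and f: "f \<in> H" shows "(\<lambda>v. Top V j (sg V (f v))) \<in> H"
proof (rule homsI)
  note fD = homsD[OF f] note T = hc_T[OF V j] note sV = sg_carr[OF grV]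
  show "lin_on (carr U) (\<lambda>v. Top V j (sg V (f v)))"
    by (rule lin_on_comp[OF lin_on_comp[OF fD(1) _ sg_lin[OF grV]] _ T(1)]) (use fD(2) sV in blast)+
  show "Top V j (sg V (f v)) \<in> carr V" if "v \<in> carr U" for v by (intro T(2) sV fD(2) that)
  fix i v assume i: "i \<in> {1..n}" and v: "v \<in> carr U"
  note fv = fD(2)[OF v]
  have "sg V (f (tact (cliff_alg n) U i v)) = - dop V i (sg V (f v))"
    unfolding fD(3)[OF i v] by (rule hc_d(4)[OF V i fv])
  then show "Top V j (sg V (f (tact (cliff_alg n) U i v))) = dop V i (Top V j (sg V (f v)))"
    using lin_on_uminus[OF T(1) hc_d(2)[OF V i sV[OF fv]]] T(3)[OF i sV[OF fv]] by simp
qed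

private lemma G_act: assumes j: "j \<in> {1..<n}" and f: "f \<in> H"
  shows "act G j (enc (carr U) f) = enc (carr U) (\<lambda>v. Top V j (sg V (f v)))"
proof -
  let ?s = "transpose j (Suc j)"
  have jn: "j \<in> {1..n}" "Suc j \<in> {1..n}" using j by auto
  note s = Sn_simple[OF j]
  have zero: "act V (Sy ?s) (act V (Cl j) 0 - act V (Cl (Suc j)) 0) = 0"
    using lin_on_zero[OF hc_c(1)[OF V jn(1)] SV] lin_on_zero[OF hc_c(1)[OF V jn(2)] SV] lin_on_zero[OF hc_s(1)[OF V s] SV] by simp
  have out: "(\<lambda>y. enc (carr U) f (u, y)) = (if u \<in> carr U then f u else 0)" for u
    by (simp add: enc_def fun_eq_iff zero_fun_apply)
  have T: "Top V j (sg V (f u)) = (1 / csqrt (-2)) *c act V (Sy ?s) (act V (Cl j) (f u) - act V (Cl (Suc j)) (f u))"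
    if "u \<in> carr U" for u
    unfolding Top_def dop_def sg_sg[OF grV homsD(2)[OF f that]] ..
  show ?thesis
  proof (rule ext, clarify)
    fix u y
    have "act G j (enc (carr U) f) (u, y) =
        1 / csqrt (-2) * act V (Sy ?s) (act V (Cl j) (if u \<in> carr U then f u else 0) - act V (Cl (Suc j)) (if u \<in> carr U then f u else 0)) y"
      unfolding G_functor_def by (simp only: smod.simps Let_def prod.case out)
    also have "\<dots> = enc (carr U) (\<lambda>v. Top V j (sg V (f v))) (u, y)"
      using zero T[of u] by (cases "u \<in> carr U") (simp_all add: enc_def cscale_def zero_fun_apply)
    finally show "act G j (enc (carr U) f) (u, y) = enc (carr U) (\<lambda>v. Top V j (sg V (f v))) (u, y)" .
  qed
qed

lemma G_gmod: "gmod (spin_alg n) G"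
  unfolding gmod_def
proof (intro conjI ballI allI)
  show "graded G" by (rule G_graded)
  fix j assume "j \<in> gens (spin_alg n)"
  then have j: "j \<in> {1..<n}" by simp
  note T = hc_T[OF V j] note sV = sg_carr[OF grV] note sl = lin_rules[OF sg_lin[OF grV] SV] and Tl = lin_rules[OF T(1) SV]
  show "lin_on (carr G) (act G j)"
    unfolding lin_on_def
  proof (intro conjI ballI allI)
    fix F a assume "F \<in> carr G"
    then obtain f where f: "f \<in> H" "F = enc (carr U) f" unfolding G_carr by blast
    show "act G j (a *c F) = a *c act G j F"
      unfolding f(2) enc_scale[symmetric] G_act[OF j f(1)] G_act[OF j fspace_scale[OF spH f(1)]] enc_eq_iff
      using sl(3) Tl(3) homsD(2)[OF f(1)] sV by simp
    fix F' assume "F' \<in> carr G"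
    then obtain f' where f': "f' \<in> H" "F' = enc (carr U) f'" unfolding G_carr by blast
    show "act G j (F + F') = act G j F + act G j F'"
      unfolding f(2) f'(2) enc_add[symmetric] G_act[OF j f(1)] G_act[OF j f'(1)] G_act[OF j fspace_add[OF spH f(1) f'(1)]] enc_eq_iff
      using sl(1) Tl(1) homsD(2)[OF f(1)] homsD(2)[OF f'(1)] sV by simp
  qed
  fix p
  show "act G j ` hpart G p \<subseteq> hpart G (p + gpar (spin_alg n) j)"
  proof (rule image_subsetI)
    fix F assume "F \<in> hpart G p"
    then obtain f where f: "f \<in> H" "\<forall>v\<in>carr U. f (sg U v) = ssign 1 p *c sg V (f v)" "F = enc (carr U) f"
      unfolding G_hpart by blast
    have "Top V j (sg V (f (sg U v))) = ssign 1 (p + 1) *c sg V (Top V j (sg V (f v)))" if v: "v \<in> carr U" for v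
    proof -
      note fv = homsD(2)[OF f(1) v]
      have "Top V j (sg V (f (sg U v))) = ssign 1 p *c Top V j (f v)"
        using f(2) v sl(3)[OF sV[OF fv]] Tl(3)[OF fv] sg_sg[OF grV fv] by simp
      moreover have "sg V (Top V j (sg V (f v))) = - Top V j (f v)" using T(4)[OF sV[OF fv]] sg_sg[OF grV fv] by simp
      ultimately show ?thesis unfolding ssign_add by simp
    qed
    then show "act G j F \<in> hpart G (p + gpar (spin_alg n) j)"
      unfolding f(3) G_act[OF j f(1)] G_hpart spin_alg_simps using Ts_H[OF j f(1)] by blast
  qed
qed

private lemma G_tact: assumes j: "j \<in> {1..<n}" and f: "f \<in> H"
  shows "tact (spin_alg n) G j (enc (carr U) f) = enc (carr U) (\<lambda>v. Top V j (f (sg U v)))"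
proof -
  have fs: "(\<lambda>v. sg V (f (sg U v))) \<in> H"
  proof (rule homsI)
    note fD = homsD[OF f] note sV = sg_carr[OF grV] note sU = sg_carr[OF grU]
    show "lin_on (carr U) (\<lambda>v. sg V (f (sg U v)))"
      by (rule lin_on_comp[OF lin_on_comp[OF sg_lin[OF grU] _ fD(1)] _ sg_lin[OF grV]]) (use fD(2) sU in blast)+
    show "sg V (f (sg U v)) \<in> carr V" if "v \<in> carr U" for v by (intro sV fD(2) sU that)
    fix i v assume i: "i \<in> {1..n}" and v: "v \<in> carr U"
    have "f (sg U (tact (cliff_alg n) U i v)) = - dop V i (f (sg U v))"
      unfolding cliff_d(4)[OF U i v] lin_on_uminus[OF fD(1) cliff_d(2)[OF U i sU[OF v]]] fD(3)[OF i sU[OF v]] ..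
    then show "sg V (f (sg U (tact (cliff_alg n) U i v))) = dop V i (sg V (f (sg U v)))"
      using lin_on_uminus[OF sg_lin[OF grV] hc_d(2)[OF V i fD(2)[OF sU[OF v]]]] hc_d(4)[OF V i fD(2)[OF sU[OF v]]] by simp
  qed
  have "tact (spin_alg n) G j (enc (carr U) f) = act G j (sg G (enc (carr U) f))" by (simp add: tact_def)
  also have "\<dots> = enc (carr U) (\<lambda>v. Top V j (sg V (sg V (f (sg U v)))))" unfolding G_sg[OF f] by (rule G_act[OF j fs])
  also have "\<dots> = enc (carr U) (\<lambda>v. Top V j (f (sg U v)))"
    unfolding enc_eq_iff using sg_sg[OF grV homsD(2)[OF f sg_carr[OF grU]]] by simp
  finally show ?thesis .
qed

text \<open>A Clifford homomorphism out of the irreducible module \<open>U\<close> is determined by its value at a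
  homogeneous vector of the joint eigenspace, and every vector of \<open>eV\<close> is such a value. So
  $\mathfrak{G}_n(V)$ is \<open>eV\<close> with the operators of the $t_j$.\<close>

lemma G_iso:
  "\<exists>P \<in> homs {1..<n} (carr G) (tact (spin_alg n) G) (eD n V) (Top V). bij_betw P (carr G) (eD n V)"
proof -
  let ?m = "n div 2" let ?d = "tact (cliff_alg n) U"
  have m: "2 * ?m \<le> n" by simp
  have r: "j \<in> {1..n}" if "j \<in> {1..2*?m}" for j using that m by auto
  have Cs: "cfam ?m {()} (carr U) ?d (\<lambda>_. sg U)"
    by (rule cliff_cfam[OF U m]) (use sg_lin[OF grU] sg_carr[OF grU] cliff_d(4)[OF U r] in auto)
  obtain v0 where "v0 \<in> carr U" "v0 \<noteq> 0"
    using irr cfun.subspace_0[OF SU] unfolding sirreducible_def by blast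
  from eig_nonzero[OF Cs sg_sg[OF grU] this]
  obtain u where u: "u \<in> eig ?m (carr U) ?d" "u \<noteq> 0" "sg U u = u \<or> sg U u = - u" by blast
  have uU: "u \<in> carr U" using u(1) eig_sub by blast
  define e where "e = (if sg U u = u then 1 else - 1 :: complex)"
  have e: "sg U u = e *c u" "e * e = 1" "e = 1 \<or> e = - 1" using u(3) by (auto simp: e_def)
  define rho where "rho = (if e = 1 then (\<lambda>v. v) else sg V)"
  have rho_lin: "lin_on (carr V) rho" using sg_lin[OF grV] by (simp add: rho_def lin_on_id)
  have rho_in: "rho v \<in> carr V" if "v \<in> carr V" for v using sg_carr[OF grV that] that by (simp add: rho_def)
  have rho_eD: "rho v \<in> eD n V" if "v \<in> eD n V" for v using eD(4)[OF V that] that by (simp add: rho_def)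
  have rho2: "rho (rho v) = v" if "v \<in> carr V" for v using sg_sg[OF grV that] by (simp add: rho_def)
  have rhoT: "rho (Top V j (e *c v)) = Top V j (rho v)" if j: "j \<in> {1..<n}" and v: "v \<in> carr V" for j v
    using e(3)
  proof
    assume "e = 1" then show ?thesis by (simp add: rho_def)
  next
    assume e1: "e = - 1"
    have "Top V j (e *c v) = - Top V j v" using e1 lin_on_uminus[OF hc_T(1)[OF V j] v] by simp
    then show ?thesis
      using e1 hc_T(4)[OF V j v] lin_on_uminus[OF sg_lin[OF grV] hc_T(2)[OF V j v]] by (simp add: rho_def)
  qed
  define P where "P F = rho (\<lambda>y. F (u, y))" for F :: "'u vec \<times> 'x \<Rightarrow> complex"
  have Pe: "P (enc (carr U) f) = rho (f u)" for f
    using uU by (simp add: P_def enc_def)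
  have fu: "f u \<in> eD n V" if f: "f \<in> H" for f
  proof -
    note fD = homsD[OF f]
    have "dop V (2 * j - 1) (dop V (2 * j) (f u)) = \<i> *c f u" if j: "j \<in> {1..?m}" for j
    proof -
      have jr: "2 * j - 1 \<in> {1..n}" "2 * j \<in> {1..n}" using j by auto
      have "dop V (2 * j - 1) (dop V (2 * j) (f u)) = f (?d (2 * j - 1) (?d (2 * j) u))"
        unfolding fD(3)[OF jr(1) cliff_d(2)[OF U jr(2) uU]] fD(3)[OF jr(2) uU] ..
      also have "?d (2 * j - 1) (?d (2 * j) u) = \<i> *c u" using u(1) j unfolding eig_def by blast
      finally show ?thesis using lin_on_scale[OF fD(1) uU] by simp
    qed
    then show ?thesis unfolding eD_def eig_def using fD(2)[OF uU] by blast
  qed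
  have Pin: "P \<in> homs {1..<n} (carr G) (tact (spin_alg n) G) (eD n V) (Top V)"
  proof (rule homsI)
    show "lin_on (carr G) P"
      unfolding lin_on_def
    proof (intro conjI ballI allI)
      fix F a assume "F \<in> carr G"
      then obtain f where f: "f \<in> H" "F = enc (carr U) f" unfolding G_carr by blast
      note fc = homsD(2)[OF f(1) uU]
      show "P (a *c F) = a *c P F" unfolding f(2) enc_scale[symmetric] Pe by (rule lin_on_scale[OF rho_lin fc])
      fix F' assume "F' \<in> carr G"
      then obtain f' where f': "f' \<in> H" "F' = enc (carr U) f'" unfolding G_carr by blast
      show "P (F + F') = P F + P F'"
        unfolding f(2) f'(2) enc_add[symmetric] Pe by (rule lin_on_add[OF rho_lin fc homsD(2)[OF f'(1) uU]])
    qed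
    fix F assume "F \<in> carr G"
    then obtain f where f: "f \<in> H" "F = enc (carr U) f" unfolding G_carr by blast
    note fc = homsD(2)[OF f(1) uU]
    show "P F \<in> eD n V" unfolding f(2) Pe by (rule rho_eD[OF fu[OF f(1)]])
    fix j assume j: "j \<in> {1..<n}"
    have "f (sg U u) = e *c f u" unfolding e(1) by (rule lin_on_scale[OF homsD(1)[OF f(1)] uU])
    then show "P (tact (spin_alg n) G j F) = Top V j (P F)"
      unfolding f(2) G_tact[OF j f(1)] Pe using rhoT[OF j fc] by simp
  qed
  moreover have "inj_on P (carr G)"
    unfolding lin_on_inj_iff[OF homsD(1)[OF Pin] carr_subspace[OF G_graded]]
  proof (intro ballI impI)
    fix F assume "F \<in> carr G" and PF: "P F = 0"
    then obtain f where f: "f \<in> H" "F = enc (carr U) f" unfolding G_carr by blast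
    have f': "f \<in> shoms (cliff_alg n) U (res_cliff V)" using f(1) unfolding tact_res cliff_alg_simps res_cliff_simps .
    have "rho (f u) = 0" using PF unfolding f(2) Pe .
    then have fu0: "f u = 0" using rho2[OF homsD(2)[OF f(1) uU]] lin_on_zero[OF rho_lin SV] by simp
    have "hcomp U (res_cliff V) p f v = 0" if v: "v \<in> carr U" for p v
    proof (rule ccontr)
      assume nz: "hcomp U (res_cliff V) p f v \<noteq> 0"
      let ?h = "hcomp U (res_cliff V) p f"
      note sh = hcomp_shom[OF gU gR f', of p]
      have inj: "inj_on ?h (carr U)" by (rule schur_inj[where f="?h" and v=v, OF gU gR sh irr v nz])
      have "f (sg U u) = 0" unfolding e(1) lin_on_scale[OF homsD(1)[OF f(1)] uU] fu0 by simp
      then have "?h u = 0" unfolding hcomp_def fu0 using lin_on_zero[OF sg_lin[OF grV] SV] by simp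
      moreover have "lin_on (carr U) ?h" using sh unfolding shom_def by blast
      ultimately show False using inj uU u(2) lin_on_inj_iff[OF _ SU] by blast
    qed
    then have "f v = 0" if "v \<in> carr U" for v using hcomp_sum[of f v U "res_cliff V"] that by simp
    then show "F = 0" unfolding f(2) enc_eq_0_iff by blast
  qed
  moreover have "eD n V \<subseteq> P ` carr G"
  proof
    fix y assume y: "y \<in> eD n V"
    define x where "x = rho y"
    have x: "x \<in> eD n V" unfolding x_def by (rule rho_eD[OF y])
    have xV: "x \<in> carr V" using x eD(2)[OF V] by blast
    have subE: "cfun.subspace (eD n V)" by (rule fd_subspace[OF eD(1)[OF V]])
    have "cfun.independent {u}" using u(2) by simp
    from cpair.linear_independent_extend_subspace[OF this, of "\<lambda>_. x"]
    obtain xi :: "'u vec \<Rightarrow> 'x vec" where xi: "clinear xi" "xi u = x" "range xi = cfun.span {x}"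
      by auto
    have xiE: "xi v \<in> eD n V" for v
      using xi(3) cfun.span_minimal[of "{x}", OF _ subE] x by auto
    have "\<exists>f\<in>H. f u = x"
    proof (cases "even n")
      case True
      then have n: "2 * ?m = n" by simp
      have C: "cfam ?m {} (carr U) ?d (\<lambda>_::unit. sg U)" by (rule cliff_cfam[OF U m]) auto
      have C': "cfam ?m {} (carr V) (dop V) (\<lambda>_::unit. sg V)"
        using cliff_cfam[OF res_cliff_module[OF V] m, of "{}" "\<lambda>_::unit. sg V"] unfolding tact_res by simp
      have xh: "xi \<in> homs {} (eig ?m (carr U) ?d) (\<lambda>_::unit. sg U) (eig ?m (carr V) (dop V)) (\<lambda>_::unit. sg V)"
        by (rule homsI) (use clinear_lin_on[OF xi(1)] xiE in "auto simp: eD_def")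
      obtain F where F: "F \<in> homs (Inl ` {1..2*?m} \<union> Inr ` {}) (carr U) (case_sum ?d (\<lambda>_::unit. sg U)) (carr V) (case_sum (dop V) (\<lambda>_::unit. sg V))"
        "\<forall>v\<in>eig ?m (carr U) ?d. F v = xi v" using eig_extend[OF C C' xh] by blast
      have "F \<in> H"
        by (rule homsI[OF homsD(1,2)[OF F(1)]]) (use homsD(3)[OF F(1), of "Inl i" for i] n in auto)
      then show ?thesis using F(2) u(1) xi(2) by (intro bexI[of _ F]) auto
    next
      case False
      then have n: "2 * ?m + 1 = n" by simp
      have nn: "n \<in> {1..n}" "\<And>j. j \<in> {1..2*?m} \<Longrightarrow> n \<noteq> j" using n by auto
      have C: "cfam ?m {()} (carr U) ?d (\<lambda>_. ?d n)"
        by (rule cliff_cfam[OF U m]) (use cliff_d(1,2)[OF U nn(1)] cliff_d(5)[OF U nn(1) r nn(2)] in auto)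
      have C': "cfam ?m {()} (carr V) (dop V) (\<lambda>_. dop V n)"
        using cliff_cfam[OF res_cliff_module[OF V] m, of "{()}" "\<lambda>_. dop V n"]
          hc_d(1,2)[OF V nn(1)] hc_d(5)[OF V nn(1) r nn(2)] unfolding tact_res by simp
      note dn = cliff_d[OF U nn(1)] and dnV = hc_d[OF V nn(1)]
      note xl = lin_rules[OF clinear_lin_on[OF xi(1), of UNIV] cfun.subspace_UNIV, OF UNIV_I]
      define eta where "eta v = xi ((1/2) *c (v + e *c sg U v))" for v
      have eta_lin: "lin_on (carr U) eta"
        unfolding eta_def
        by (rule lin_on_comp[OF lin_on_scale_fun[OF lin_on_add_fun[OF lin_on_id lin_on_scale_fun[OF sg_lin[OF grU]]]]
              subset_UNIV clinear_lin_on[OF xi(1)]])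
      have eta_u: "eta u = x" "eta (?d n u) = 0"
      proof -
        have "u + e *c sg U u = u + u" unfolding e(1) using e(2) by simp
        then have 1: "(1/2) *c (u + e *c sg U u) = u" by (simp only: half_double)
        show "eta u = x" unfolding eta_def 1 by (rule xi(2))
        have "sg U (?d n u) = - (e *c ?d n u)" unfolding dn(4)[OF uU] e(1) lin_on_scale[OF dn(1) uU] ..
        then have 2: "?d n u + e *c sg U (?d n u) = 0" using e(2) by simp
        show "eta (?d n u) = 0" unfolding eta_def 2 using lin_on_zero[OF clinear_lin_on[OF xi(1), of UNIV] cfun.subspace_UNIV] by simp
      qed
      have eta_E: "eta v \<in> eD n V" for v unfolding eta_def by (rule xiE)
      have eta_V: "eta v \<in> carr V" for v using eta_E eD(2)[OF V] by blast
      define psi where "psi v = eta v - dop V n (eta (?d n v))" for v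
      have dn_E: "?d n v \<in> eig ?m (carr U) ?d" if "v \<in> eig ?m (carr U) ?d" for v
        by (rule eig_stable[where y="?d n", OF C order_refl dn(1) _ _ that])
          (use dn(2) cliff_d(5)[OF U nn(1) r nn(2)] in auto)
      have EU: "v \<in> carr U" if "v \<in> eig ?m (carr U) ?d" for v using that eig_sub by blast
      have "psi \<in> homs {()} (eig ?m (carr U) ?d) (\<lambda>_. ?d n) (eig ?m (carr V) (dop V)) (\<lambda>_. dop V n)"
      proof (rule homsI)
        have l2: "lin_on (carr U) (\<lambda>v. eta (?d n v))" by (rule lin_on_comp[OF dn(1) _ eta_lin]) (use dn(2) in blast)
        have "lin_on (carr U) (\<lambda>v. dop V n (eta (?d n v)))" by (rule lin_on_comp[OF l2 _ dnV(1)]) (use eta_V in blast)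
        then have "lin_on (carr U) psi" unfolding psi_def by (rule lin_on_diff_fun[OF eta_lin])
        then show "lin_on (eig ?m (carr U) ?d) psi" by (rule lin_on_subset[OF _ eig_sub])
        show "psi v \<in> eig ?m (carr V) (dop V)" for v
          unfolding psi_def eD_def[symmetric]
          by (intro cfun.subspace_diff[OF subE] eta_E eD(5)[OF V False])
        show "psi (?d n v) = dop V n (psi v)" if "v \<in> eig ?m (carr U) ?d" for v
        proof -
          note vU = EU[OF that]
          have "eta (?d n (?d n v)) = - eta v" unfolding dn(3)[OF vU] by (rule lin_on_uminus[OF eta_lin vU])
          then have "psi (?d n v) = eta (?d n v) + dop V n (eta v)"
            unfolding psi_def using lin_on_uminus[OF dnV(1) eta_V] by simp
          moreover have "dop V n (psi v) = dop V n (eta v) + eta (?d n v)"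
            unfolding psi_def lin_on_diff[OF dnV(1) SV eta_V dnV(2)[OF eta_V]] dnV(3)[OF eta_V] by simp
          ultimately show ?thesis by (simp add: add.commute)
        qed
      qed
      from eig_extend[OF C C' this]
      obtain F where F: "F \<in> homs (Inl ` {1..2*?m} \<union> Inr ` {()}) (carr U) (case_sum ?d (\<lambda>_. ?d n)) (carr V) (case_sum (dop V) (\<lambda>_. dop V n))"
        "\<forall>v\<in>eig ?m (carr U) ?d. F v = psi v" by blast
      have "F \<in> H"
      proof (rule homsI[OF homsD(1,2)[OF F(1)]])
        fix i v assume i: "i \<in> {1..n}" and v: "v \<in> carr U"
        show "F (?d i v) = dop V i (F v)"
        proof (cases "i = n")
          case True then show ?thesis using homsD(3)[OF F(1), of "Inr ()" v] v by simp
        next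
          case False
          then have "i \<in> {1..2*?m}" using i n by auto
          then show ?thesis using homsD(3)[OF F(1), of "Inl i" v] v by simp
        qed
      qed
      moreover have "F u = x"
        using F(2) u(1) lin_on_zero[OF dnV(1) SV] by (simp add: psi_def eta_u)
      ultimately show ?thesis by blast
    qed
    then obtain f where f: "f \<in> H" "f u = x" by blast
    have "P (enc (carr U) f) = y"
      unfolding Pe f(2) x_def by (rule rho2) (use y eD(2)[OF V] in blast)
    then show "y \<in> P ` carr G" unfolding G_carr using f(1) by blast
  qed
  moreover have "P ` carr G \<subseteq> eD n V" using homsD(2)[OF Pin] by blast
  ultimately show ?thesis unfolding bij_betw_def by blast
qed

end

section \<open>The Clifford module \<open>cliff_hc\<close>\<close>

text \<open>The signs in $c_i c_A = \pm c_{A \triangle \{i\}}$ and $w c_A = \pm c_{w(A)}$.\<close>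

definition ks :: "nat \<Rightarrow> nat set \<Rightarrow> complex" where
  "ks i A = (-1) ^ card {a \<in> A. a < i}"

definition sgw :: "(nat \<Rightarrow> nat) \<Rightarrow> nat set \<Rightarrow> complex" where
  "sgw w A = (-1) ^ inversions_on w A"

lemma ks_sq [simp]: "ks i A * ks i A = 1"
  by (simp add: ks_def flip: power_add mult_2)

lemma ks_sq' [simp]: "ks i A * (ks i A * x) = x"
  by (simp flip: mult.assoc)

lemma ks_insert: "b \<notin> A \<Longrightarrow> ks i (insert b A) = (if b < i then - ks i A else ks i A)"
proof -
  assume b: "b \<notin> A"
  have f: "finite {a \<in> A. a < i}" by (rule finite_subset[of _ "{..<i}"]) auto
  show ?thesis
  proof (cases "b < i")
    case True
    then have "{a \<in> insert b A. a < i} = insert b {a \<in> A. a < i}" by auto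
    then show ?thesis using True b f by (simp add: ks_def)
  next
    case False
    then have "{a \<in> insert b A. a < i} = {a \<in> A. a < i}" by auto
    then show ?thesis using False by (simp add: ks_def)
  qed
qed

lemma ks_sym_diff: "ks j (sym_diff A {i}) = (if i < j then - ks j A else ks j A)"
proof (cases "i \<in> A")
  case True
  then have e: "sym_diff A {i} = A - {i}" and "A = insert i (A - {i})" by auto
  then have "ks j A = (if i < j then - ks j (A - {i}) else ks j (A - {i}))"
    using ks_insert[of i "A - {i}" j] by simp
  then show ?thesis unfolding e by simp
next
  case False
  then have "sym_diff A {i} = insert i A" by auto
  then show ?thesis using ks_insert[OF False] by simp
qed

text \<open>
  Both sides compare $w(c_ic_A)$ with $c_{w(i)}w(c_A)$: the inversions that involve \<open>i\<close> are
  counted, modulo $2$, by the elements of \<open>A\<close> below \<open>i\<close> and the elements of \<open>w ` A\<close> below \<open>w i\<close>,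
  since those below both are counted twice.
\<close>

lemma sgw_insert:
  assumes A: "finite A" and i: "i \<notin> A" and w: "inj w"
  shows "sgw w (insert i A) = sgw w A * ks i A * ks (w i) (w ` A)"
proof -
  let ?P = "{a \<in> A. i < a \<and> w a < w i}" and ?Q = "{a \<in> A. a < i \<and> w i < w a}" and ?R = "{a \<in> A. a < i \<and> w a < w i}"
  let ?I = "\<lambda>A. {(a, b). a \<in> A \<and> b \<in> A \<and> a < b \<and> w b < w a}"
  have ne: "a \<noteq> i" "w a \<noteq> w i" if "a \<in> A" for a using that i w by (auto dest: injD)
  have fin: "finite (?I A)" by (rule finite_subset[of _ "A \<times> A"]) (use A in auto)
  have "?I (insert i A) = ?I A \<union> (\<lambda>b. (i, b)) ` ?P \<union> (\<lambda>a. (a, i)) ` ?Q" using ne by auto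
  moreover have "card (?I A \<union> (\<lambda>b. (i, b)) ` ?P \<union> (\<lambda>a. (a, i)) ` ?Q) = card (?I A) + card ?P + card ?Q"
  proof -
    have f: "finite ((\<lambda>b. (i, b)) ` ?P)" "finite ((\<lambda>a. (a, i)) ` ?Q)" using A by auto
    have d: "?I A \<inter> (\<lambda>b. (i, b)) ` ?P = {}" "(?I A \<union> (\<lambda>b. (i, b)) ` ?P) \<inter> (\<lambda>a. (a, i)) ` ?Q = {}"
      using i by blast+
    have c: "card ((\<lambda>b. (i, b)) ` ?P) = card ?P" "card ((\<lambda>a. (a, i)) ` ?Q) = card ?Q"
      by (rule card_image, simp add: inj_on_def)+
    show ?thesis
      unfolding card_Un_disjoint[OF finite_UnI[OF fin f(1)] f(2) d(2)] card_Un_disjoint[OF fin f(1) d(1)] c ..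
  qed
  ultimately have 1: "inversions_on w (insert i A) = inversions_on w A + card ?P + card ?Q"
    unfolding inversions_on_def by simp
  have tri: "w a < w i \<or> w i < w a" if "a \<in> A" for a using ne(2)[OF that] by linarith
  have tri': "a < i \<or> i < a" if "a \<in> A" for a using ne(1)[OF that] by linarith
  have "{a \<in> A. a < i} = ?Q \<union> ?R" using tri by blast
  moreover have "card (?Q \<union> ?R) = card ?Q + card ?R" by (rule card_Un_disjoint) (use A in auto)
  ultimately have 2: "card {a \<in> A. a < i} = card ?Q + card ?R" by simp
  have "{a \<in> w ` A. a < w i} = w ` (?P \<union> ?R)" using tri' by blast
  moreover have "card (w ` (?P \<union> ?R)) = card (?P \<union> ?R)" using w by (simp add: card_image inj_on_subset[OF w])
  moreover have "card (?P \<union> ?R) = card ?P + card ?R" by (rule card_Un_disjoint) (use A in auto)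
  ultimately have 3: "card {a \<in> w ` A. a < w i} = card ?P + card ?R" by simp
  have "(-1::complex) ^ card ?R * (-1) ^ card ?R = 1" by (simp flip: power_add mult_2)
  then show ?thesis unfolding sgw_def ks_def 1 2 3 power_add by (simp add: mult_ac)
qed

lemma sgw_empty [simp]: "sgw w {} = 1" by (simp add: sgw_def inversions_on_def)

lemma sgw_comp:
  assumes "finite A" "inj u" "inj w" shows "sgw (u \<circ> w) A = sgw u (w ` A) * sgw w A"
  using assms(1)
proof (induction A rule: finite_induct)
  case empty then show ?case by simp
next
  case (insert i A)
  have "w i \<notin> w ` A" using insert(2) assms(3) by (auto dest: injD)
  then have "sgw u (w ` insert i A) = sgw u (w ` A) * ks (w i) (w ` A) * ks (u (w i)) (u ` w ` A)"
    using sgw_insert[of "w ` A" "w i" u] insert(1) assms(2) by simp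
  moreover have "sgw (u \<circ> w) (insert i A) = sgw u (w ` A) * sgw w A * ks i A * ks (u (w i)) (u ` w ` A)"
    using sgw_insert[OF insert(1,2) inj_compose[OF assms(2,3)]] unfolding insert.IH image_comp[symmetric] comp_apply .
  ultimately show ?case
    unfolding sgw_insert[OF insert(1,2) assms(3)] by (simp only: mult_ac ks_sq')
qed

lemma sgw_id: "sgw id A = 1"
proof -
  have e: "{(a, b). a \<in> A \<and> b \<in> A \<and> a < b \<and> id b < id a} = {}" by auto
  show ?thesis unfolding sgw_def inversions_on_def e by simp
qed

lemma sgw_sym_diff:
  assumes "finite A" "inj w"
  shows "sgw w (sym_diff A {i}) = sgw w A * ks i A * ks (w i) (w ` A)"
proof (cases "i \<in> A")
  case True
  let ?B = "A - {i}"
  have A: "A = insert i ?B" and e: "sym_diff A {i} = ?B" using True by auto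
  have wB: "w i \<notin> w ` ?B" using assms(2) by (auto dest: injD)
  have k1: "ks i A = ks i ?B" using ks_insert[of i ?B i] A by simp
  have k2: "ks (w i) (w ` A) = ks (w i) (w ` ?B)" using ks_insert[OF wB, of "w i"] A by (metis image_insert less_irrefl)
  have "sgw w A = sgw w ?B * ks i ?B * ks (w i) (w ` ?B)"
    using sgw_insert[of ?B i w] assms A by simp
  then show ?thesis unfolding e k1 k2 by (simp add: mult_ac)
next
  case False
  then have "sym_diff A {i} = insert i A" by auto
  then show ?thesis using sgw_insert[OF assms(1) False assms(2)] by simp
qed

lemma cliff_act:
  "act (cliff_hc n) (Cl i) f B = ks i B * f (sym_diff B {i})"
  "act (cliff_hc n) (Sy w) f B = sgw w (w -` B) * f (w -` B)"
  by (simp_all add: cliff_hc_def ks_def sgw_def)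

lemma cliff_hpart: "f \<in> hpart (cliff_hc n) p \<longleftrightarrow> (\<forall>A. f A \<noteq> 0 \<longrightarrow> A \<subseteq> {1..n} \<and> of_nat (card A) = p)"
  by (simp add: cliff_hc_def)

lemma cliff_carr: "f \<in> carr (cliff_hc n) \<longleftrightarrow> (\<forall>A. f A \<noteq> 0 \<longrightarrow> A \<subseteq> {1..n})"
proof
  assume "f \<in> carr (cliff_hc n)"
  then obtain u v where uv: "u \<in> hpart (cliff_hc n) 0" "v \<in> hpart (cliff_hc n) 1" "f = u + v"
    unfolding carr_def by blast
  show "\<forall>A. f A \<noteq> 0 \<longrightarrow> A \<subseteq> {1..n}"
  proof (intro allI impI)
    fix A assume "f A \<noteq> 0"
    then have "u A \<noteq> 0 \<or> v A \<noteq> 0" unfolding uv(3) plus_fun_apply by auto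
    then show "A \<subseteq> {1..n}" using uv(1,2) unfolding cliff_hpart by blast
  qed
next
  assume f: "\<forall>A. f A \<noteq> 0 \<longrightarrow> A \<subseteq> {1..n}"
  let ?u = "\<lambda>p A. if of_nat (card A) = (p::bit) then f A else 0"
  have "?u p \<in> hpart (cliff_hc n) p" for p unfolding cliff_hpart using f by simp
  moreover have "f = ?u 0 + ?u 1"
    by (rule ext) (use bit_01 in "auto simp: plus_fun_apply")
  ultimately show "f \<in> carr (cliff_hc n)" unfolding carr_def by blast
qed

lemma delta_carr: "A \<subseteq> {1..n} \<Longrightarrow> delta A \<in> hpart (cliff_hc n) (of_nat (card A))"
  unfolding cliff_hpart by (simp add: delta_def)

lemma cliff_expand:
  assumes "f \<in> carr (cliff_hc n)" shows "f = (\<Sum>A\<in>Pow {1..n}. f A *c delta A)"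
proof (rule ext)
  fix B
  have sum_app: "(\<Sum>A\<in>K. g A) B = (\<Sum>A\<in>K. g A B)" if "finite K" for K :: "nat set set" and g :: "nat set \<Rightarrow> nat set \<Rightarrow> complex"
    using that by (induction K rule: finite_induct) (simp_all add: pointwise)
  have "(\<Sum>A\<in>Pow {1..n}. f A *c delta A) B = (\<Sum>A\<in>Pow {1..n}. if A = B then f B else 0)"
    unfolding sum_app[OF finite_Pow_iff[THEN iffD2, OF finite_atLeastAtMost]]
    by (rule sum.cong) (auto simp: cscale_def delta_def)
  also have "\<dots> = f B" using assms unfolding cliff_carr by (auto simp: sum.delta)
  finally show "f B = (\<Sum>A\<in>Pow {1..n}. f A *c delta A) B" by simp
qed

lemma vimage_perm: assumes "w \<in> Sn n" "B \<subseteq> {1..n}" shows "w -` B \<subseteq> {1..n}"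
proof
  fix x assume "x \<in> w -` B"
  then have "w x \<in> {1..n}" using assms(2) by auto
  then show "x \<in> {1..n}" using assms(1) permutes_in_image[of w "{1..n}" x] by (simp add: Sn_def)
qed

lemma Sn_bij: assumes "w \<in> Sn n" shows "inj w" "w ` (w -` B) = B" "w -` (w ` B) = B"
  using assms permutes_inj[of w "{1..n}"] permutes_surj[of w "{1..n}"]
  by (auto simp: Sn_def surj_image_vimage_eq inj_vimage_image_eq)

lemma cliff_bounds:
  assumes "w \<in> Sn n" "w -` B \<subseteq> {1..n}" shows "B \<subseteq> {1..n}" "card (w -` B) = card B"
proof -
  have "w ` (w -` B) \<subseteq> {1..n}" using assms(2) Sn_app[OF assms(1)] by blast
  then show "B \<subseteq> {1..n}" using Sn_bij(2)[OF assms(1)] by simp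
  show "card (w -` B) = card B"
    using card_image[OF inj_on_subset[OF Sn_bij(1)[OF assms(1)] subset_UNIV], of "w -` B"] Sn_bij(2)[OF assms(1)] by simp
qed

lemma card_sym_diff_bit:
  assumes "finite B" shows "(of_nat (card B) :: bit) = of_nat (card (sym_diff B {i})) + 1"
proof (cases "i \<in> B")
  case True
  then have "sym_diff B {i} = B - {i}" by auto
  moreover have "card B = Suc (card (B - {i}))" by (rule card.remove[OF assms True])
  ultimately show ?thesis by simp
next
  case False
  then have "sym_diff B {i} = insert i B" by auto
  then show ?thesis using False assms by simp
qed

lemma sym_diff_bounds: "i \<in> {1..n} \<Longrightarrow> sym_diff B {i} \<subseteq> {1..n} \<longleftrightarrow> B \<subseteq> {1..n}"
  by auto

lemma sym_diff_twice: "sym_diff (sym_diff B {i}) {i} = B" "sym_diff (sym_diff B {i}) {j} = sym_diff (sym_diff B {j}) {i}"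
  by auto

lemma cliff_hc_module: "hc_module n (cliff_hc n)"
proof -
  let ?C = "cliff_hc n"
  have sub: "cfun.subspace (hpart ?C p)" for p
  proof (rule cfun.subspaceI)
    show "0 \<in> hpart ?C p" unfolding cliff_hpart by (simp add: zero_fun_apply)
    show "x + y \<in> hpart ?C p" if "x \<in> hpart ?C p" "y \<in> hpart ?C p" for x y
      unfolding cliff_hpart
    proof (intro allI impI)
      fix A assume "(x + y) A \<noteq> 0"
      then have "x A \<noteq> 0 \<or> y A \<noteq> 0" by (auto simp: plus_fun_apply)
      then show "A \<subseteq> {1..n} \<and> of_nat (card A) = p" using that unfolding cliff_hpart by blast
    qed
    show "c *c x \<in> hpart ?C p" if "x \<in> hpart ?C p" for c x
      using that unfolding cliff_hpart by (simp add: cscale_def)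
  qed
  have "hpart ?C 0 \<inter> hpart ?C 1 = {0}"
  proof (intro subset_antisym subsetI)
    fix f assume f: "f \<in> hpart ?C 0 \<inter> hpart ?C 1"
    have "f A = 0" for A
    proof (rule ccontr)
      assume "f A \<noteq> 0"
      then have "(of_nat (card A) :: bit) = 0" "(of_nat (card A) :: bit) = 1"
        using IntD1[OF f] IntD2[OF f] unfolding cliff_hpart by blast+
      then show False using zero_neq_one by metis
    qed
    then show "f \<in> {0}" by (simp add: fun_eq_iff zero_fun_apply)
  qed (use cfun.subspace_0[OF sub] in auto)
  then have gr: "graded ?C" unfolding splits_def using sub by (simp add: carr_def)
  have lin: "lin_on (carr ?C) (act ?C g)" for g
    by (cases g) (auto simp: lin_on_def fun_eq_iff cliff_act pointwise algebra_simps)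
  have fd: "fd (carr ?C)"
  proof -
    have "carr ?C \<subseteq> cfun.span (delta ` Pow {1..n})"
    proof
      fix f assume "f \<in> carr ?C"
      from cliff_expand[OF this] show "f \<in> cfun.span (delta ` Pow {1..n})"
        by (metis (no_types, lifting) cfun.span_base cfun.span_scale cfun.span_sum imageI)
    qed
    moreover have "fd (cfun.span (delta ` Pow {1..n}))" unfolding fd_def by (intro exI[of _ "delta ` Pow {1..n}"]) simp
    ultimately show ?thesis using fd_mono carr_subspace[OF gr] by blast
  qed
  have par: "act ?C g f \<in> hpart ?C (p + gpar (hc_alg n) g)" if g: "g \<in> gens (hc_alg n)" and f: "f \<in> hpart ?C p" for g f p
    using g
  proof (cases rule: hc_gens_cases)
    case (1 i)
    show ?thesis unfolding 1(1) cliff_hpart cliff_act hc_alg_simps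
    proof (intro allI impI)
      fix B assume "ks i B * f (sym_diff B {i}) \<noteq> 0"
      then have "f (sym_diff B {i}) \<noteq> 0" by auto
      then have b: "sym_diff B {i} \<subseteq> {1..n}" "of_nat (card (sym_diff B {i})) = p" using f unfolding cliff_hpart by blast+
      have B: "B \<subseteq> {1..n}" using sym_diff_bounds[OF 1(2)] b(1) by blast
      then have "finite B" by (rule finite_subset) simp
      from card_sym_diff_bit[OF this, of i] show "B \<subseteq> {1..n} \<and> of_nat (card B) = p + 1" using B unfolding b(2) by blast
    qed
  next
    case (2 w)
    show ?thesis unfolding 2(1) cliff_hpart cliff_act hc_alg_simps
    proof (intro allI impI)
      fix B assume "sgw w (w -` B) * f (w -` B) \<noteq> 0"
      then have "f (w -` B) \<noteq> 0" by auto
      then have "w -` B \<subseteq> {1..n}" "of_nat (card (w -` B)) = p" using f unfolding cliff_hpart by blast+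
      then show "B \<subseteq> {1..n} \<and> of_nat (card B) = p + 0" using cliff_bounds[OF 2(2)] by simp
    qed
  qed
  have sm: "smodule (hc_alg n) ?C"
    unfolding smodule_iff gmod_def using gr lin par fd by blast
  have sc: "act ?C (Sy w) (act ?C (Cl i) f) = act ?C (Cl (w i)) (act ?C (Sy w) f)"
    if w: "w \<in> Sn n" and i: "i \<in> {1..n}" and f: "f \<in> carr ?C" for w i f
  proof (rule ext)
    fix B
    let ?A = "w -` B"
    note wb = Sn_bij[OF w]
    have v: "w -` (sym_diff B {w i}) = sym_diff ?A {i}" using wb(1) by (auto dest: injD)
    show "act ?C (Sy w) (act ?C (Cl i) f) B = act ?C (Cl (w i)) (act ?C (Sy w) f) B"
    proof (cases "?A \<subseteq> {1..n}")
      case True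
      then have fin: "finite ?A" by (rule finite_subset) simp
      have "sgw w (sym_diff ?A {i}) = sgw w ?A * ks i ?A * ks (w i) B"
        using sgw_sym_diff[OF fin wb(1), of i] wb(2) by simp
      then show ?thesis unfolding cliff_act v by (simp add: mult_ac)
    next
      case False
      then have "\<not> sym_diff ?A {i} \<subseteq> {1..n}" using sym_diff_bounds[OF i] by blast
      then have "f (sym_diff ?A {i}) = 0" using f unfolding cliff_carr by blast
      then show ?thesis unfolding cliff_act v by simp
    qed
  qed
  show ?thesis
    unfolding hc_module_def
  proof (intro conjI ballI impI)
    show "smodule (hc_alg n) ?C" by (rule sm)
    fix f assume f: "f \<in> carr ?C"
    show "act ?C (Cl i) (act ?C (Cl i) f) = f" for i
      by (rule ext) (simp only: cliff_act sym_diff_twice(1) ks_sym_diff, simp)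
    show "act ?C (Cl i) (act ?C (Cl j) f) = - act ?C (Cl j) (act ?C (Cl i) f)" if "i \<noteq> j" for i j
    proof (rule ext)
      fix B
      have "ks i B * ks j (sym_diff B {i}) = - (ks j B * ks i (sym_diff B {j}))"
        unfolding ks_sym_diff using that by auto
      then show "act ?C (Cl i) (act ?C (Cl j) f) B = (- act ?C (Cl j) (act ?C (Cl i) f)) B"
        unfolding uminus_apply cliff_act sym_diff_twice(2)[of B i j] by (simp flip: mult.assoc)
    qed
    show "act ?C (Sy id) f = f" by (rule ext) (simp add: cliff_act sgw_id)
    show "act ?C (Sy (w \<circ> u)) f = act ?C (Sy w) (act ?C (Sy u) f)" if w: "w \<in> Sn n" and u: "u \<in> Sn n" for w u
    proof (rule ext)
      fix B
      have v: "(w \<circ> u) -` B = u -` (w -` B)" by auto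
      show "act ?C (Sy (w \<circ> u)) f B = act ?C (Sy w) (act ?C (Sy u) f) B"
      proof (cases "u -` (w -` B) \<subseteq> {1..n}")
        case True
        then have fin: "finite (u -` (w -` B))" by (rule finite_subset) simp
        have "sgw (w \<circ> u) (u -` (w -` B)) = sgw w (w -` B) * sgw u (u -` (w -` B))"
          using sgw_comp[OF fin Sn_bij(1)[OF w] Sn_bij(1)[OF u]] Sn_bij(2)[OF u] by simp
        then show ?thesis unfolding cliff_act v by simp
      next
        case False
        then have "f (u -` (w -` B)) = 0" using f unfolding cliff_carr by blast
        then show ?thesis unfolding cliff_act v by simp
      qed
    qed
    show "act ?C (Sy (transpose i (Suc i))) (act ?C (Cl i) f) = act ?C (Cl (Suc i)) (act ?C (Sy (transpose i (Suc i))) f)"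
      if "i \<in> {1..<n}" for i
      using sc[OF Sn_simple[OF that] _ f, of i] that by simp
    show "act ?C (Sy (transpose i (Suc i))) (act ?C (Cl j) f) = act ?C (Cl j) (act ?C (Sy (transpose i (Suc i))) f)"
      if i: "i \<in> {1..<n}" and j: "j \<in> {1..n} - {i, Suc i}" for i j
    proof -
      have "j \<in> {1..n}" "transpose i (Suc i) j = j" using j by (auto simp: transpose_def)
      then show ?thesis using sc[OF Sn_simple[OF i] _ f, of j] by simp
    qed
  qed
qed

subsection \<open>The universal property\<close>

text \<open>$c_A x = c_{a_1} \cdots c_{a_k} x$ for $A = \{a_1 < \dots < a_k\}$.\<close>

definition cprod :: "(hcgen, 'x) smod \<Rightarrow> nat set \<Rightarrow> 'x vec \<Rightarrow> 'x vec" where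
  "cprod V A x = foldr (\<lambda>i. act V (Cl i)) (sorted_list_of_set A) x"

lemma cprod_empty [simp]: "cprod V {} x = x" by (simp add: cprod_def)

lemma cprod_insert_min:
  assumes "finite A" "\<forall>a\<in>A. b < a" shows "cprod V (insert b A) x = act V (Cl b) (cprod V A x)"
proof -
  have "b \<notin> A" using assms(2) by auto
  have "sorted_list_of_set (insert b A) = insort b (sorted_list_of_set A)"
    using assms(1) \<open>b \<notin> A\<close> by (rule sorted_list_of_set_insert)
  also have "\<dots> = b # sorted_list_of_set A" by (rule insort_is_Cons) (use assms in auto)
  finally show ?thesis by (simp add: cprod_def)
qed

lemma ks_min: "\<forall>a\<in>A. b < a \<Longrightarrow> ks b A = 1"
proof -
  assume "\<forall>a\<in>A. b < a"
  then have e: "{a \<in> A. a < b} = {}" by (auto dest: less_asym)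
  show ?thesis unfolding ks_def e by simp
qed

context
  fixes n :: nat and V :: "(hcgen, 'x) smod" and x
  assumes V: "hc_module n V" and x: "x \<in> hpart V 0"
begin

private lemmas gmX = smoduleD(1)[OF hc_smodule[OF V]]
private lemmas SX = smoduleD(3)[OF hc_smodule[OF V]]
private lemmas grX = gmod_graded[OF gmX]

lemma cprod_hpart:
  assumes "A \<subseteq> {1..n}" shows "cprod V A x \<in> hpart V (of_nat (card A))"
proof -
  have "finite A" using assms by (rule finite_subset) simp
  then show ?thesis using assms
  proof (induction A rule: finite_linorder_min_induct)
    case empty then show ?case using x by simp
  next
    case (insert b A)
    have "Cl b \<in> gens (hc_alg n)" using insert by simp
    then have "act V (Cl b) (cprod V A x) \<in> hpart V (of_nat (card A) + 1)"
      using act_hpart[OF gmX, of "Cl b"] insert by simp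
    moreover have bA: "b \<notin> A" using insert by auto
    ultimately show ?case
      unfolding cprod_insert_min[OF insert(1,2)] card_insert_disjoint[OF insert(1) bA] of_nat_Suc
      by (simp only: add.commute)
  qed
qed

lemma cprod_carr: "A \<subseteq> {1..n} \<Longrightarrow> cprod V A x \<in> carr V"
  using cprod_hpart hpart_in_carr[OF grX] by blast

lemma c_cprod:
  assumes "A \<subseteq> {1..n}" and i: "i \<in> {1..n}"
  shows "act V (Cl i) (cprod V A x) = ks i A *c cprod V (sym_diff A {i}) x"
proof -
  have "finite A" using assms by (meson finite_atLeastAtMost finite_subset)
  then show ?thesis using assms(1)
  proof (induction A rule: finite_linorder_min_induct)
    case empty
    show ?case using cprod_insert_min[of "{}" i V x] by (simp add: ks_def)
  next
    case (insert b A)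
    have bA: "b \<notin> A" and b: "b \<in> {1..n}" and A: "A \<subseteq> {1..n}" using insert by auto
    note cA = cprod_carr[OF A]
    note cb = cprod_insert_min[OF insert(1,2), of V x]
    consider "i < b" | "i = b" | "b < i" by linarith
    then show ?case
    proof cases
      case 1
      then have m: "\<forall>a\<in>insert b A. i < a" using insert(2) by auto
      then have "sym_diff (insert b A) {i} = insert i (insert b A)" by auto
      then show ?thesis using cprod_insert_min[OF _ m, of V x] insert(1) ks_min[OF m] by simp
    next
      case 2
      then have "sym_diff (insert b A) {i} = A" using bA by auto
      moreover have "ks i (insert b A) = 1" using 2 ks_insert[OF bA] ks_min[OF insert(2)] by simp
      ultimately show ?thesis using cb hc_c(3)[OF V b cA] 2 by simp
    next
      case 3
      then have s: "sym_diff (insert b A) {i} = insert b (sym_diff A {i})" using bA by auto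
      have m: "\<forall>a\<in>sym_diff A {i}. b < a" using insert(2) 3 by auto
      have fin: "finite (sym_diff A {i})" using insert(1) by simp
      have sA: "sym_diff A {i} \<subseteq> {1..n}" using A i by auto
      have "act V (Cl i) (act V (Cl b) (cprod V A x)) = - act V (Cl b) (act V (Cl i) (cprod V A x))"
        using hc_c(5)[OF V i b _ cA] 3 by simp
      also have "act V (Cl i) (cprod V A x) = ks i A *c cprod V (sym_diff A {i}) x" by (rule insert.IH[OF A])
      also have "act V (Cl b) (ks i A *c cprod V (sym_diff A {i}) x) = ks i A *c cprod V (insert b (sym_diff A {i})) x"
        unfolding cprod_insert_min[OF fin m] by (rule lin_on_scale[OF hc_c(1)[OF V b] cprod_carr[OF sA]])
      finally show ?thesis unfolding cb s using ks_insert[OF bA, of i] 3 by simp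
    qed
  qed
qed

lemma s_cprod:
  assumes "A \<subseteq> {1..n}" and w: "w \<in> Sn n" and inv: "\<And>w. w \<in> Sn n \<Longrightarrow> act V (Sy w) x = x"
  shows "act V (Sy w) (cprod V A x) = sgw w A *c cprod V (w ` A) x"
proof -
  have "finite A" using assms(1) by (rule finite_subset) simp
  then show ?thesis using assms(1)
  proof (induction A rule: finite_linorder_min_induct)
    case empty show ?case using inv[OF w] by simp
  next
    case (insert b A)
    have bA: "b \<notin> A" and b: "b \<in> {1..n}" and A: "A \<subseteq> {1..n}" using insert by auto
    note wi = Sn_bij[OF w]
    have wA: "w ` A \<subseteq> {1..n}" using A Sn_app[OF w] by blast
    have wb: "w b \<in> {1..n}" by (rule Sn_app[OF w b])
    have "w b \<notin> w ` A" using bA wi(1) by (auto dest: injD)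
    then have sd: "sym_diff (w ` A) {w b} = w ` insert b A" by auto
    have "act V (Sy w) (cprod V (insert b A) x) = act V (Cl (w b)) (act V (Sy w) (cprod V A x))"
      unfolding cprod_insert_min[OF insert(1,2)] using hc_sc[OF V w] b cprod_carr[OF A] by blast
    also have "\<dots> = sgw w A *c act V (Cl (w b)) (cprod V (w ` A) x)"
      unfolding insert.IH[OF A] by (rule lin_on_scale[OF hc_c(1)[OF V wb] cprod_carr[OF wA]])
    also have "\<dots> = (sgw w A * ks (w b) (w ` A)) *c cprod V (w ` insert b A) x"
      unfolding c_cprod[OF wA wb] sd by simp
    also have "sgw w A * ks (w b) (w ` A) = sgw w (insert b A)"
      using sgw_insert[OF insert(1) bA wi(1)] ks_min[OF insert(2)] by simp
    finally show ?case .
  qed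
qed

end

lemma cliff_c_delta: "act (cliff_hc n) (Cl i) (delta A) = ks i A *c delta (sym_diff A {i})"
proof (rule ext)
  fix B
  have "sym_diff B {i} = A \<longleftrightarrow> B = sym_diff A {i}" by auto
  then show "act (cliff_hc n) (Cl i) (delta A) B = (ks i A *c delta (sym_diff A {i})) B"
    unfolding cliff_act by (auto simp: delta_def cscale_def ks_sym_diff)
qed

lemma cprod_delta:
  assumes "A \<subseteq> {1..n}" shows "cprod (cliff_hc n) A (delta {}) = delta A"
proof -
  have "finite A" using assms by (rule finite_subset) simp
  then show ?thesis using assms
  proof (induction A rule: finite_linorder_min_induct)
    case empty then show ?case by simp
  next
    case (insert b A)
    have "b \<notin> A" using insert(2) by auto
    then have "sym_diff A {b} = insert b A" by auto
    then show ?case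
      unfolding cprod_insert_min[OF insert(1,2)] using insert cliff_c_delta[of n b A] ks_min[OF insert(2)] by simp
  qed
qed

lemma cliff_s_delta: "w \<in> Sn n \<Longrightarrow> act (cliff_hc n) (Sy w) (delta {}) = delta {}"
proof (rule ext)
  fix B assume w: "w \<in> Sn n"
  have "w -` B = {} \<longleftrightarrow> B = {}" using Sn_bij(2)[OF w, of B] by (metis image_empty vimage_empty)
  then show "act (cliff_hc n) (Sy w) (delta {}) B = delta {} B"
    unfolding cliff_act by (auto simp: delta_def)
qed

text \<open>
  The basis vector $c_A$ is obtained from \<open>delta {}\<close> by Clifford generators, so its image must be
  $c_A x$; the signs computed above show that this assignment is a homomorphism.
\<close>

lemma cliff_universal:
  fixes N :: "(hcgen, 'x) smod"
  assumes N: "hc_module n N" and x: "x \<in> hpart N 0" and inv: "\<And>w. w \<in> Sn n \<Longrightarrow> act N (Sy w) x = x"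
  shows "\<exists>f. shom (hc_alg n) 0 (cliff_hc n) N f \<and> f (delta {}) = x \<and>
     (\<forall>g. shom (hc_alg n) 0 (cliff_hc n) N g \<and> g (delta {}) = x \<longrightarrow> (\<forall>v\<in>carr (cliff_hc n). g v = f v))"
proof -
  let ?C = "cliff_hc n" let ?P = "Pow {1..n}"
  note C = cliff_hc_module[of n]
  note gC = smoduleD(1)[OF hc_smodule[OF C]] and gN = smoduleD(1)[OF hc_smodule[OF N]]
  note SN = smoduleD(3)[OF hc_smodule[OF N]] and SC = smoduleD(3)[OF hc_smodule[OF C]]
  note grN = gmod_graded[OF gN] and grC = gmod_graded[OF gC]
  note cc = cprod_carr[OF N x]
  define f where "f g = (\<Sum>A\<in>?P. g A *c cprod N A x)" for g
  have lin: "lin_on (carr ?C) f"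
    unfolding lin_on_def f_def
    by (simp add: pointwise cfun.scale_left_distrib sum.distrib cfun.scale_sum_right flip: cscale_def)
      (simp add: cscale_def cfun.scale_sum_right)?
  have comm: "f (act ?C g v) = act N g (f v)" if g: "g \<in> gens (hc_alg n)" and v: "v \<in> carr ?C" for g v
    using g
  proof (cases rule: hc_gens_cases)
    case (1 i)
    note l = hc_c(1)[OF N 1(2)]
    have "act N (Cl i) (f v) = (\<Sum>A\<in>?P. act N (Cl i) (v A *c cprod N A x))"
      unfolding f_def by (rule lin_on_sum[OF l SN]) (use cc cfun.subspace_scale[OF SN] in auto)
    also have "\<dots> = (\<Sum>A\<in>?P. (v A * ks i A) *c cprod N (sym_diff A {i}) x)"
    proof (rule sum.cong[OF refl])
      fix A assume "A \<in> ?P"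
      then have A: "A \<subseteq> {1..n}" by simp
      show "act N (Cl i) (v A *c cprod N A x) = (v A * ks i A) *c cprod N (sym_diff A {i}) x"
        unfolding lin_on_scale[OF l cc[OF A]] c_cprod[OF N x A 1(2)] by simp
    qed
    also have "\<dots> = (\<Sum>B\<in>?P. (ks i B * v (sym_diff B {i})) *c cprod N B x)"
    proof (rule sum.reindex_bij_witness[of _ "\<lambda>B. sym_diff B {i}" "\<lambda>A. sym_diff A {i}"])
      fix A
      show "sym_diff (sym_diff A {i}) {i} = A" by (rule sym_diff_twice)
      then show "sym_diff (sym_diff A {i}) {i} = A" .
      show "sym_diff A {i} \<in> ?P" if "A \<in> ?P" using that 1(2) by auto
      then show "sym_diff A {i} \<in> ?P" if "A \<in> ?P" using that .
      show "(ks i (sym_diff A {i}) * v (sym_diff (sym_diff A {i}) {i})) *c cprod N (sym_diff A {i}) x =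
          (v A * ks i A) *c cprod N (sym_diff A {i}) x"
        unfolding sym_diff_twice(1) ks_sym_diff by (simp add: mult.commute)
    qed
    finally show ?thesis unfolding 1(1) f_def cliff_act ..
  next
    case (2 w)
    note l = hc_s(1)[OF N 2(2)] note wb = Sn_bij[OF 2(2)]
    have "act N (Sy w) (f v) = (\<Sum>A\<in>?P. act N (Sy w) (v A *c cprod N A x))"
      unfolding f_def by (rule lin_on_sum[OF l SN]) (use cc cfun.subspace_scale[OF SN] in auto)
    also have "\<dots> = (\<Sum>A\<in>?P. (v A * sgw w A) *c cprod N (w ` A) x)"
    proof (rule sum.cong[OF refl])
      fix A assume "A \<in> ?P"
      then have A: "A \<subseteq> {1..n}" by simp
      show "act N (Sy w) (v A *c cprod N A x) = (v A * sgw w A) *c cprod N (w ` A) x"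
        unfolding lin_on_scale[OF l cc[OF A]] s_cprod[where w = w, OF N x A 2(2) inv, simplified] by simp
    qed
    also have "\<dots> = (\<Sum>B\<in>?P. (sgw w (w -` B) * v (w -` B)) *c cprod N B x)"
    proof (rule sum.reindex_bij_witness[of _ "\<lambda>B. w -` B" "\<lambda>A. w ` A"])
      show "w -` (w ` A) = A" "w ` (w -` A) = A" for A by (fact wb)+
      show "w ` A \<in> ?P" if "A \<in> ?P" for A using that Sn_app[OF 2(2)] by blast
      show "w -` A \<in> ?P" if "A \<in> ?P" for A using that vimage_perm[OF 2(2)] by blast
      show "(sgw w (w -` (w ` A)) * v (w -` (w ` A))) *c cprod N (w ` A) x = (v A * sgw w A) *c cprod N (w ` A) x" for A
        unfolding wb(3) by (simp add: mult.commute)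
    qed
    finally show ?thesis unfolding 2(1) f_def cliff_act ..
  qed
  have fsh: "shom (hc_alg n) 0 ?C N f"
    unfolding shom_def
  proof (intro conjI allI ballI)
    show "lin_on (carr ?C) f" by (rule lin)
    show "f ` hpart ?C q \<subseteq> hpart N (q + 0)" for q
    proof (rule image_subsetI)
      fix v assume v: "v \<in> hpart ?C q"
      have "v A *c cprod N A x \<in> hpart N q" if "A \<in> ?P" for A
      proof (cases "v A = 0")
        case True then show ?thesis using cfun.subspace_0[OF hpart_subspace[OF grN]] by simp
      next
        case False
        then have "of_nat (card A) = q" using v unfolding cliff_hpart by blast
        then show ?thesis using cprod_hpart[OF N x, of A] that cfun.subspace_scale[OF hpart_subspace[OF grN]] by blast
      qed
      then show "f v \<in> hpart N (q + 0)"
        unfolding f_def add_0_right by (rule cfun.subspace_sum[OF hpart_subspace[OF grN]])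
    qed
    show "f (act ?C g v) = ssign 0 (gpar (hc_alg n) g) *c act N g (f v)" if "g \<in> gens (hc_alg n)" "v \<in> carr ?C" for g v
      using comm[OF that] by simp
  qed
  moreover have f0: "f (delta {}) = x"
  proof -
    have "f (delta {}) = (\<Sum>A\<in>?P. if A = {} then x else 0)"
      unfolding f_def by (rule sum.cong[OF refl]) (simp add: delta_def)
    then show ?thesis by (simp add: sum.delta)
  qed
  moreover have "g v = f v" if g: "shom (hc_alg n) 0 ?C N g" "g (delta {}) = x" and v: "v \<in> carr ?C" for g v
  proof -
    have glin: "lin_on (carr ?C) g" and gc: "\<And>i v. i \<in> {1..n} \<Longrightarrow> v \<in> carr ?C \<Longrightarrow> g (act ?C (Cl i) v) = act N (Cl i) (g v)"
      using g(1) unfolding shom_def by auto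
    have d0: "delta {} \<in> hpart ?C 0" using delta_carr[of "{}" n] by simp
    have dc: "delta A \<in> carr ?C" if "A \<subseteq> {1..n}" for A using delta_carr[OF that] hpart_in_carr[OF grC] by blast
    have gd: "g (delta A) = cprod N A x" if A: "A \<subseteq> {1..n}" for A
    proof -
      have "finite A" using A by (rule finite_subset) simp
      then have "g (cprod ?C A (delta {})) = cprod N A x" using A
      proof (induction A rule: finite_linorder_min_induct)
        case empty then show ?case using g(2) by simp
      next
        case (insert b A)
        have b: "b \<in> {1..n}" and A: "A \<subseteq> {1..n}" using insert by auto
        show ?case
          unfolding cprod_insert_min[OF insert(1,2)] gc[OF b cprod_carr[OF C d0 A]] insert.IH[OF A] ..
      qed
      then show ?thesis unfolding cprod_delta[OF A] .
    qed
    have "g v = g (\<Sum>A\<in>?P. v A *c delta A)" using cliff_expand[OF v] by simp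
    also have "\<dots> = (\<Sum>A\<in>?P. g (v A *c delta A))"
      by (rule lin_on_sum[OF glin SC]) (use dc cfun.subspace_scale[OF SC] in auto)
    also have "\<dots> = f v"
      unfolding f_def by (rule sum.cong[OF refl]) (simp add: lin_on_scale[OF glin dc] gd)
    finally show ?thesis .
  qed
  ultimately show ?thesis by blast
qed

text \<open>The same module on a subspace of \<^typ>\<open>nat \<Rightarrow> complex\<close>, through the binary coding of finite sets.\<close>

definition trans_mod :: "('x vec \<Rightarrow> 'y vec) \<Rightarrow> ('g, 'x) smod \<Rightarrow> ('g, 'y) smod" where
  "trans_mod t V = \<lparr>hpart = \<lambda>p. t ` hpart V p, act = \<lambda>g F. t (act V g (inv_into (carr V) t F))\<rparr>"

context
  fixes n :: nat and V :: "(hcgen, 'x) smod" and t :: "'x vec \<Rightarrow> 'y vec"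
  assumes V: "hc_module n V" and t: "lin_on (carr V) t" "inj_on t (carr V)"
begin

private lemmas smT = hc_smodule[OF V]
private lemmas gmT = smoduleD(1)[OF smT]
private lemmas grT = gmod_graded[OF gmT]
private lemmas ST = smoduleD(3)[OF smT]

lemma trans_act: "v \<in> carr V \<Longrightarrow> act (trans_mod t V) g (t v) = t (act V g v)"
  using t(2) by (simp add: trans_mod_def)

lemma trans_carr: "carr (trans_mod t V) = t ` carr V"
proof -
  have "t (u + v) = t u + t v" if "u \<in> hpart V 0" "v \<in> hpart V 1" for u v
    using lin_on_add[OF t(1)] that hpart_in_carr[OF grT] by blast
  then show ?thesis
    unfolding carr_def trans_mod_def by (auto simp: image_iff) metis+
qed

lemma trans_hpart: "hpart (trans_mod t V) p = t ` hpart V p"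
  by (simp add: trans_mod_def)

lemma trans_hc_module: "hc_module n (trans_mod t V)"
proof -
  let ?W = "trans_mod t V"
  have hc: "v \<in> hpart V p \<Longrightarrow> v \<in> carr V" for v p by (rule hpart_in_carr[OF grT])
  have sub: "cfun.subspace (t ` hpart V p)" for p
    by (rule subspace_lin_image[OF hpart_subspace[OF grT] lin_on_subset[OF t(1) hpart_carr[OF grT]]])
  have "t ` hpart V 0 \<inter> t ` hpart V 1 = t ` (hpart V 0 \<inter> hpart V 1)"
    by (rule inj_on_image_Int[OF t(2) hpart_carr[OF grT] hpart_carr[OF grT], symmetric])
  also have "\<dots> = {0}" using grT lin_on_zero[OF t(1) ST] unfolding splits_def by simp
  finally have "t ` hpart V 0 \<inter> t ` hpart V 1 = {0}" .
  then have grW: "graded ?W" unfolding splits_def trans_hpart using sub by (simp add: carr_def trans_hpart)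
  have "smodule (hc_alg n) ?W"
    unfolding smodule_iff gmod_def
  proof (intro conjI ballI allI)
    show "graded ?W" by (rule grW)
    show "fd (carr ?W)" unfolding trans_carr by (rule fd_lin_image[OF smoduleD(2)[OF smT] t(1)])
    fix g assume g: "g \<in> gens (hc_alg n)"
    note al = act_lin[OF gmT g] and ac = act_carr[OF gmT g]
    show "lin_on (carr ?W) (act ?W g)"
      unfolding lin_on_def trans_carr
    proof (intro conjI ballI allI)
      fix F a assume "F \<in> t ` carr V"
      then obtain u where u: "u \<in> carr V" "F = t u" by blast
      show "act ?W g (a *c F) = a *c act ?W g F"
        unfolding u(2) lin_on_scale[OF t(1) u(1), symmetric] trans_act[OF cfun.subspace_scale[OF ST u(1)]] trans_act[OF u(1)]
          lin_on_scale[OF al u(1)] by (rule lin_on_scale[OF t(1) ac[OF u(1)]])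
      fix F' assume "F' \<in> t ` carr V"
      then obtain v where v: "v \<in> carr V" "F' = t v" by blast
      show "act ?W g (F + F') = act ?W g F + act ?W g F'"
        unfolding u(2) v(2) lin_on_add[OF t(1) u(1) v(1), symmetric] trans_act[OF cfun.subspace_add[OF ST u(1) v(1)]]
          trans_act[OF u(1)] trans_act[OF v(1)] lin_on_add[OF al u(1) v(1)]
        by (rule lin_on_add[OF t(1) ac[OF u(1)] ac[OF v(1)]])
    qed
    show "act ?W g ` hpart ?W p \<subseteq> hpart ?W (p + gpar (hc_alg n) g)" for p
      unfolding trans_hpart using act_hpart[OF gmT g, of _ p] trans_act hc by (auto simp del: hc_alg_simps)
  qed
  note sW = this
  show ?thesis
    unfolding hc_module_def
  proof (intro conjI ballI impI)
    show "smodule (hc_alg n) ?W" by (rule sW)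
    fix F assume "F \<in> carr ?W"
    then obtain v where v: "v \<in> carr V" and F: "F = t v" unfolding trans_carr by blast
    note a = trans_act and c = hc_c[OF V] and s = hc_s[OF V]
    show "act ?W (Cl i) (act ?W (Cl i) F) = F" if "i \<in> {1..n}" for i
      unfolding F a[OF v] a[OF c(2)[OF that v]] c(3)[OF that v] ..
    show "act ?W (Cl i) (act ?W (Cl j) F) = - act ?W (Cl j) (act ?W (Cl i) F)"
      if i: "i \<in> {1..n}" and j: "j \<in> {1..n}" and ij: "i \<noteq> j" for i j
      unfolding F a[OF v] a[OF c(2)[OF j v]] a[OF c(2)[OF i v]] c(5)[OF i j ij v]
      by (rule lin_on_uminus[OF t(1) c(2)[OF j c(2)[OF i v]]])
    show "act ?W (Sy id) F = F" unfolding F a[OF v] hc_id[OF V v] ..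
    show "act ?W (Sy (w \<circ> u)) F = act ?W (Sy w) (act ?W (Sy u) F)" if w: "w \<in> Sn n" and u: "u \<in> Sn n" for w u
      unfolding F a[OF v] a[OF s(2)[OF u v]] s(4)[OF w u v] ..
    show "act ?W (Sy (transpose i (Suc i))) (act ?W (Cl i) F) = act ?W (Cl (Suc i)) (act ?W (Sy (transpose i (Suc i))) F)"
      if "i \<in> {1..<n}" for i
    proof -
      have i: "i \<in> {1..n}" using that by auto
      note t = Sn_simple[OF that]
      show ?thesis unfolding F a[OF v] a[OF c(2)[OF i v]] a[OF s(2)[OF t v]] using hc_sc[OF V t] i v by simp
    qed
    show "act ?W (Sy (transpose i (Suc i))) (act ?W (Cl j) F) = act ?W (Cl j) (act ?W (Sy (transpose i (Suc i))) F)"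
      if ii: "i \<in> {1..<n}" and jj: "j \<in> {1..n} - {i, Suc i}" for i j
    proof -
      have j: "j \<in> {1..n}" "transpose i (Suc i) j = j" using jj by (auto simp: transpose_def)
      note t = Sn_simple[OF ii]
      show ?thesis unfolding F a[OF v] a[OF c(2)[OF j(1) v]] a[OF s(2)[OF t v]] using bspec[OF bspec[OF hc_sc[OF V t] j(1)] v] j(2) by simp
    qed
  qed
qed

lemma trans_shom: "shom (hc_alg n) 0 V (trans_mod t V) t" "bij_betw t (carr V) (carr (trans_mod t V))"
proof -
  show "shom (hc_alg n) 0 V (trans_mod t V) t"
    unfolding shom_def trans_hpart using t(1) trans_act by auto
  show "bij_betw t (carr V) (carr (trans_mod t V))" unfolding trans_carr using t(2) by (simp add: bij_betw_def)
qed

lemma trans_inv_shom: "shom (hc_alg n) 0 (trans_mod t V) V (inv_into (carr V) t)"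
proof -
  let ?W = "trans_mod t V" and ?k = "inv_into (carr V) t"
  have k: "?k (t v) = v" if "v \<in> carr V" for v using t(2) that by simp
  show ?thesis
    unfolding shom_def trans_hpart trans_carr
  proof (intro conjI allI ballI)
    show "lin_on (t ` carr V) ?k"
      unfolding lin_on_def
      using k lin_on_add[OF t(1), symmetric] lin_on_scale[OF t(1), symmetric] cfun.subspace_add[OF ST] cfun.subspace_scale[OF ST]
      by auto
    show "?k ` t ` hpart V q \<subseteq> hpart V (q + 0)" for q using k hpart_in_carr[OF grT] by auto
    show "?k (act ?W g F) = ssign 0 (gpar (hc_alg n) g) *c act V g (?k F)" if "g \<in> gens (hc_alg n)" "F \<in> t ` carr V" for g F
      using that k act_carr[OF gmT that(1)] trans_act by auto
  qed
qed

end

definition cliff_nat :: "nat \<Rightarrow> hcmod" where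
  "cliff_nat n = trans_mod (\<lambda>f k. f (set_decode k)) (cliff_hc n)"

lemma cliff_code: "lin_on (carr (cliff_hc n)) (\<lambda>f k. f (set_decode k))" "inj_on (\<lambda>f k. f (set_decode k)) (carr (cliff_hc n))"
proof -
  show "lin_on (carr (cliff_hc n)) (\<lambda>f k. f (set_decode k))"
    by (auto simp: lin_on_def fun_eq_iff pointwise)
  show "inj_on (\<lambda>f k. f (set_decode k)) (carr (cliff_hc n))"
  proof (rule inj_onI, rule ext)
    fix f g A assume f: "f \<in> carr (cliff_hc n)" and g: "g \<in> carr (cliff_hc n)"
      and e: "(\<lambda>k. f (set_decode k)) = (\<lambda>k. g (set_decode k))"
    show "f A = g A"
    proof (cases "finite A")
      case True then show ?thesis using fun_cong[OF e, of "set_encode A"] by simp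
    next
      case False
      then have "\<not> A \<subseteq> {1..n}" using finite_subset by blast
      then show ?thesis using f g unfolding cliff_carr by metis
    qed
  qed
qed

lemma shom_comp:
  assumes "shom A 0 V W f" "shom A 0 W X g" "\<And>v. v \<in> carr V \<Longrightarrow> f v \<in> carr W"
  shows "shom A 0 V X (\<lambda>v. g (f v))"
proof -
  have f: "lin_on (carr V) f" "\<And>q. f ` hpart V q \<subseteq> hpart W q" "\<And>h v. h \<in> gens A \<Longrightarrow> v \<in> carr V \<Longrightarrow> f (act V h v) = act W h (f v)"
    using assms(1) unfolding shom_def add_0_right by auto
  have g: "lin_on (carr W) g" "\<And>q. g ` hpart W q \<subseteq> hpart X q" "\<And>h v. h \<in> gens A \<Longrightarrow> v \<in> carr W \<Longrightarrow> g (act W h v) = act X h (g v)"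
    using assms(2) unfolding shom_def add_0_right by auto
  have fi: "f ` carr V \<subseteq> carr W" using assms(3) by blast
  have "(\<lambda>v. g (f v)) ` hpart V q \<subseteq> hpart X q" for q using f(2)[of q] g(2)[of q] by auto
  then show ?thesis
    unfolding shom_def using lin_on_comp[OF f(1) fi g(1)] f(3) g(3) assms(3) by simp
qed

lemma young_single: "young n [n] = Sn n"
proof -
  have s: "{0<..n} = {1..n}" by auto
  have "w ` {1..n} = {1..n}" if "w \<in> Sn n" for w using that permutes_image by (auto simp: Sn_def)
  then show ?thesis unfolding young_def by (auto simp: s simp del: atLeastAtMost_iff)
qed

lemma cliff_nat_induced: "is_induced_triv n [n] (cliff_nat n)"
proof -
  let ?t = "\<lambda>f k. f (set_decode k) :: complex" and ?C = "cliff_hc n"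
  note C = cliff_hc_module[of n]
  note tc = cliff_code[of n]
  note gC = gmod_graded[OF smoduleD(1)[OF hc_smodule[OF C]]]
  have d0: "delta {} \<in> hpart ?C 0" using delta_carr[of "{}" n] by simp
  have dc: "delta {} \<in> carr ?C" using hpart_in_carr[OF gC d0] .
  let ?k = "inv_into (carr ?C) ?t"
  have k0: "?k (?t (delta {})) = delta {}" by (rule inv_into_f_f[OF tc(2) dc])
  have tin: "?t v \<in> carr (cliff_nat n)" if "v \<in> carr ?C" for v
    unfolding cliff_nat_def trans_carr[OF C tc] using that by blast
  have kin: "?k v \<in> carr ?C" "?t (?k v) = v" if v: "v \<in> carr (cliff_nat n)" for v
    using v f_inv_into_f[of v ?t "carr ?C"] inv_into_into[of v ?t "carr ?C"]
    unfolding cliff_nat_def trans_carr[OF C tc] by blast+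
  show ?thesis
    unfolding is_induced_triv_def young_single
  proof (intro conjI bexI[of _ "?t (delta {})"] ballI allI impI)
    show "hc_module n (cliff_nat n)" unfolding cliff_nat_def by (rule trans_hc_module[OF C tc])
    show "?t (delta {}) \<in> hpart (cliff_nat n) 0" unfolding cliff_nat_def trans_hpart[OF C tc] using d0 by blast
    show "act (cliff_nat n) (Sy w) (?t (delta {})) = ?t (delta {})" if "w \<in> Sn n" for w
      unfolding cliff_nat_def trans_act[OF C tc dc] cliff_s_delta[OF that] ..
    fix N :: hcmod and x assume N: "hc_module n N" and x: "x \<in> hpart N 0" and inv: "\<forall>w\<in>Sn n. act N (Sy w) x = x"
    obtain f where f: "shom (hc_alg n) 0 ?C N f" "f (delta {}) = x"
      "\<And>g v. shom (hc_alg n) 0 ?C N g \<Longrightarrow> g (delta {}) = x \<Longrightarrow> v \<in> carr ?C \<Longrightarrow> g v = f v"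
      using cliff_universal[OF N x] inv by blast
    have F: "shom (hc_alg n) 0 (cliff_nat n) N (\<lambda>v. f (?k v))"
      by (rule shom_comp[OF trans_inv_shom[OF C tc, folded cliff_nat_def] f(1) kin(1)])
    show "\<exists>f. shom (hc_alg n) 0 (cliff_nat n) N f \<and> f (?t (delta {})) = x \<and>
        (\<forall>g. shom (hc_alg n) 0 (cliff_nat n) N g \<and> g (?t (delta {})) = x \<longrightarrow> (\<forall>v\<in>carr (cliff_nat n). g v = f v))"
    proof (intro exI[of _ "\<lambda>v. f (?k v)"] conjI allI impI ballI)
      show "shom (hc_alg n) 0 (cliff_nat n) N (\<lambda>v. f (?k v))" by (rule F)
      show "f (?k (?t (delta {}))) = x" unfolding k0 by (rule f(2))
      fix g v assume g: "shom (hc_alg n) 0 (cliff_nat n) N g \<and> g (?t (delta {})) = x" and v: "v \<in> carr (cliff_nat n)"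
      have "shom (hc_alg n) 0 ?C N (\<lambda>v. g (?t v))"
        by (rule shom_comp[OF trans_shom(1)[OF C tc, folded cliff_nat_def] conjunct1[OF g] tin])
      from f(3)[OF this conjunct2[OF g] kin(1)[OF v]] show "g v = f (?k v)" unfolding kin(2)[OF v] .
    qed
  qed
qed

section \<open>The function \<open>Q\<^sub>(\<^sub>n\<^sub>)\<close>\<close>

lemma inverse_linear_fps: "inverse (1 - fps_const (a::complex) * fps_X) = Abs_fps (\<lambda>k. a ^ k)"
proof -
  have "(1 - fps_const a * fps_X) * Abs_fps (\<lambda>k. a ^ k) = 1"
  proof (rule fps_ext)
    fix k show "fps_nth ((1 - fps_const a * fps_X) * Abs_fps (\<lambda>k. a ^ k)) k = fps_nth 1 k"
      by (cases k) (simp_all add: algebra_simps)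
  qed
  then show ?thesis by (rule fps_inverse_unique)
qed

lemma divide_linear_fps: "F / (1 - fps_const (a::complex) * fps_X) = F * Abs_fps (\<lambda>k. a ^ k)"
  unfolding inverse_linear_fps[symmetric] by (rule fps_divide_unit) simp

text \<open>The residue of $\prod_i \frac{1+z_iu}{1-z_iu}$ at $u = 1/z_i$, up to normalization.\<close>

definition pf_coeff :: "(nat \<Rightarrow> complex) \<Rightarrow> nat set \<Rightarrow> nat \<Rightarrow> complex" where
  "pf_coeff z I i = (\<Prod>j\<in>I - {i}. (z i + z j) / (z i - z j))"

text \<open>Partial fractions. Both sides have degree at most \<open>card I\<close>, and agree at $0$ and at all $1/z_k$.\<close>

lemma partial_fractions:
  assumes I: "finite I" "inj_on z I" "\<And>i. i \<in> I \<Longrightarrow> z i \<noteq> 0"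
  shows "(\<Prod>i\<in>I. [:1, z i:]) =
    (\<Prod>i\<in>I. [:1, - z i:]) + (\<Sum>i\<in>I. Polynomial.smult (2 * pf_coeff z I i * z i) ([:0, 1:] * (\<Prod>j\<in>I - {i}. [:1, - z j:])))"
proof (rule poly_eqI_degree[of "insert 0 ((\<lambda>i. inverse (z i)) ` I)"])
  have "inj_on (\<lambda>i. inverse (z i)) I" using I(2) by (simp add: inj_on_def)
  moreover have "0 \<notin> (\<lambda>i. inverse (z i)) ` I" using I(3) by auto
  ultimately have c: "card (insert 0 ((\<lambda>i. inverse (z i)) ` I)) = Suc (card I)"
    using I(1) by (simp add: card_image)
  have dp: "degree (\<Prod>i\<in>J. [:1, h i:]) \<le> card J" if "finite J" for J and h :: "nat \<Rightarrow> complex"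
  proof -
    have "degree (\<Prod>i\<in>J. [:1, h i:]) \<le> sum (degree \<circ> (\<lambda>i. [:1, h i:])) J" by (rule degree_prod_sum_le[OF that])
    also have "\<dots> \<le> (\<Sum>i\<in>J. 1)" by (rule sum_mono) simp
    finally show ?thesis by simp
  qed
  show "degree (\<Prod>i\<in>I. [:1, z i:]) < card (insert 0 ((\<lambda>i. inverse (z i)) ` I))"
    unfolding c using dp[OF I(1), of z] by simp
  have "degree (Polynomial.smult (2 * pf_coeff z I i * z i) ([:0, 1:] * (\<Prod>j\<in>I - {i}. [:1, - z j:]))) \<le> card I" if "i \<in> I" for i
  proof -
    have "degree ([:0, 1:] * (\<Prod>j\<in>I - {i}. [:1, - z j:])) \<le> degree [:0, 1::complex:] + degree (\<Prod>j\<in>I - {i}. [:1, - z j:])"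
      by (rule degree_mult_le)
    also have "\<dots> \<le> 1 + card (I - {i})" using dp[of "I - {i}" "\<lambda>j. - z j"] I(1) by simp
    also have "\<dots> = card I" using card.remove[OF I(1) that] by simp
    finally show ?thesis using degree_smult_le order_trans by blast
  qed
  then have "degree (\<Sum>i\<in>I. Polynomial.smult (2 * pf_coeff z I i * z i) ([:0, 1:] * (\<Prod>j\<in>I - {i}. [:1, - z j:]))) \<le> card I"
    by (rule degree_sum_le[OF I(1)])
  then show "degree ((\<Prod>i\<in>I. [:1, - z i:]) + (\<Sum>i\<in>I. Polynomial.smult (2 * pf_coeff z I i * z i) ([:0, 1:] * (\<Prod>j\<in>I - {i}. [:1, - z j:]))))
      < card (insert 0 ((\<lambda>i. inverse (z i)) ` I))"
    unfolding c using degree_add_le[OF dp[OF I(1), of "\<lambda>j. - z j"]] by (simp add: less_Suc_eq_le)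
  fix x assume "x \<in> insert 0 ((\<lambda>i. inverse (z i)) ` I)"
  then consider "x = 0" | k where "k \<in> I" "x = inverse (z k)" by blast
  then show "poly (\<Prod>i\<in>I. [:1, z i:]) x =
      poly ((\<Prod>i\<in>I. [:1, - z i:]) + (\<Sum>i\<in>I. Polynomial.smult (2 * pf_coeff z I i * z i) ([:0, 1:] * (\<Prod>j\<in>I - {i}. [:1, - z j:])))) x"
  proof cases
    case 1
    then show ?thesis by (simp add: poly_prod poly_sum)
  next
    case (2 k)
    let ?t = "\<lambda>i. 2 * pf_coeff z I i * z i * (x * (\<Prod>j\<in>I - {i}. 1 - x * z j))"
    have xk: "x * z k = 1" using 2 I(3) by simp
    have z0: "(\<Prod>i\<in>I. 1 - x * z i) = 0" using 2(1) xk I(1) by (auto intro!: prod_zero)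
    have "?t i = 0" if "i \<in> I - {k}" for i
    proof -
      have "(\<Prod>j\<in>I - {i}. 1 - x * z j) = 0" using 2(1) xk I(1) that by (intro prod_zero) auto
      then show ?thesis by simp
    qed
    then have "(\<Sum>i\<in>I - {k}. ?t i) = 0" by (intro sum.neutral ballI)
    then have "(\<Sum>i\<in>I. ?t i) = ?t k" unfolding sum.remove[OF I(1) 2(1), of ?t] by (simp only: add_0_right)
    also have "\<dots> = 2 * ((\<Prod>j\<in>I - {k}. (z k + z j) / (z k - z j)) * (\<Prod>j\<in>I - {k}. 1 - x * z j)) * (x * z k)"
      by (simp add: pf_coeff_def)
    also have "\<dots> = 2 * (\<Prod>j\<in>I - {k}. (z k + z j) / (z k - z j) * (1 - x * z j))"
      unfolding xk prod.distrib by (simp only: mult_1_right)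
    also have "(\<Prod>j\<in>I - {k}. (z k + z j) / (z k - z j) * (1 - x * z j)) = (\<Prod>j\<in>I - {k}. 1 + x * z j)"
    proof (rule prod.cong[OF refl])
      fix j assume j: "j \<in> I - {k}"
      then have "z k - z j \<noteq> 0" "z k \<noteq> 0" using I(2,3) 2(1) by (auto dest: inj_onD)
      then show "(z k + z j) / (z k - z j) * (1 - x * z j) = 1 + x * z j" unfolding 2(2) by (simp add: field_simps)
    qed
    also have "2 * (\<Prod>j\<in>I - {k}. 1 + x * z j) = (\<Prod>j\<in>I. 1 + x * z j)"
      using prod.remove[OF I(1) 2(1), of "\<lambda>j. 1 + x * z j"] xk by simp
    finally have "(\<Sum>i\<in>I. ?t i) = (\<Prod>j\<in>I. 1 + x * z j)" .
    moreover have "poly (\<Sum>i\<in>I. Polynomial.smult (2 * pf_coeff z I i * z i) ([:0, 1:] * (\<Prod>j\<in>I - {i}. [:1, - z j:]))) x = (\<Sum>i\<in>I. ?t i)"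
      unfolding poly_sum by (rule sum.cong[OF refl]) (simp add: poly_prod)
    ultimately show ?thesis using z0 unfolding poly_add by (simp add: poly_prod)
  qed
qed

text \<open>
  The partial fraction identity, divided by $\prod_i (1 - z_iu)$ and expanded in geometric
  series.
\<close>

lemma q_coefficients:
  assumes I: "finite I" "inj_on z I" "\<And>i. i \<in> I \<Longrightarrow> z i \<noteq> 0" and r: "r \<ge> 1"
  shows "fps_nth (\<Prod>i\<in>I. (1 + fps_const (z i) * fps_X) / (1 - fps_const (z i) * fps_X)) r =
    (\<Sum>i\<in>I. 2 * pf_coeff z I i * z i ^ r)"
proof -
  let ?f = "\<lambda>i. 1 + fps_const (z i) * fps_X" and ?g = "\<lambda>i. 1 - fps_const (z i) * fps_X"
    and ?k = "\<lambda>i. Abs_fps (\<lambda>k. z i ^ k)" and ?c = "\<lambda>i. 2 * pf_coeff z I i * z i"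
  have gk: "?g i * ?k i = 1" for i
    unfolding inverse_linear_fps[symmetric] by (simp add: inverse_mult_eq_1')
  have "fps_of_poly [:1, - z i:] = ?g i" "fps_of_poly [:1, z i:] = ?f i" for i
    by (simp_all add: fps_of_poly_linear' flip: fps_const_neg)
  moreover have "fps_of_poly [:0, 1::complex:] = fps_X" by (simp add: fps_of_poly_linear)
  ultimately have "(\<Prod>i\<in>I. ?f i) = (\<Prod>i\<in>I. ?g i) + (\<Sum>i\<in>I. fps_const (?c i) * (fps_X * (\<Prod>j\<in>I - {i}. ?g j)))"
    using arg_cong[OF partial_fractions[OF I], of fps_of_poly]
    by (simp only: fps_of_poly_add fps_of_poly_sum fps_of_poly_prod fps_of_poly_smult fps_of_poly_mult)
  then have "(\<Prod>i\<in>I. ?f i) * (\<Prod>i\<in>I. ?k i) =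
      (\<Prod>i\<in>I. ?g i) * (\<Prod>i\<in>I. ?k i) + (\<Sum>i\<in>I. fps_const (?c i) * (fps_X * (\<Prod>j\<in>I - {i}. ?g j)) * (\<Prod>i\<in>I. ?k i))"
    by (simp only: distrib_right sum_distrib_right)
  also have "(\<Prod>i\<in>I. ?g i) * (\<Prod>i\<in>I. ?k i) = 1" unfolding prod.distrib[symmetric] gk by simp
  also have "(\<Sum>i\<in>I. fps_const (?c i) * (fps_X * (\<Prod>j\<in>I - {i}. ?g j)) * (\<Prod>i\<in>I. ?k i)) = (\<Sum>i\<in>I. fps_const (?c i) * (fps_X * ?k i))"
  proof (rule sum.cong[OF refl])
    fix i assume i: "i \<in> I"
    have "(\<Prod>j\<in>I - {i}. ?g j) * (\<Prod>i\<in>I. ?k i) = (\<Prod>j\<in>I - {i}. ?g j * ?k j) * ?k i"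
      unfolding prod.remove[OF I(1) i, of ?k] prod.distrib by (simp only: mult_ac)
    then have e: "(\<Prod>j\<in>I - {i}. ?g j) * (\<Prod>i\<in>I. ?k i) = ?k i" unfolding gk by simp
    show "fps_const (?c i) * (fps_X * (\<Prod>j\<in>I - {i}. ?g j)) * (\<Prod>i\<in>I. ?k i) = fps_const (?c i) * (fps_X * ?k i)"
      unfolding mult.assoc e ..
  qed
  also have "(\<Prod>i\<in>I. ?f i) * (\<Prod>i\<in>I. ?k i) = (\<Prod>i\<in>I. ?f i / ?g i)"
    unfolding divide_linear_fps prod.distrib ..
  finally have "(\<Prod>i\<in>I. ?f i / ?g i) = 1 + (\<Sum>i\<in>I. fps_const (?c i) * (fps_X * ?k i))" .
  moreover have "fps_nth (1 + (\<Sum>i\<in>I. fps_const (?c i) * (fps_X * ?k i))) r = (\<Sum>i\<in>I. ?c i * z i ^ (r - 1))"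
    using r by (simp add: fps_sum_nth)
  moreover have "?c i * z i ^ (r - 1) = 2 * pf_coeff z I i * z i ^ r" for i
    using r by (cases r) simp_all
  ultimately show ?thesis by (simp only:)
qed

abbreviation "coord \<equiv> Poly_Mapping.lookup"
abbreviation "supp \<equiv> Poly_Mapping.keys"

lemma q_fun_eq:
  assumes z: "supp z \<subseteq> {..<m}" "inj_on (coord z) {..<m}" and r: "r \<ge> 1"
  shows "q_fun r z = (\<Sum>i<m. 2 * pf_coeff (coord z) {..<m} i * coord z i ^ r)"
proof -
  let ?z = "coord z" and ?I = "supp z"
  have nz: "?z i \<noteq> 0 \<longleftrightarrow> i \<in> ?I" for i by (simp add: in_keys_iff)
  have "q_fun r z = (\<Sum>i\<in>?I. 2 * pf_coeff ?z ?I i * ?z i ^ r)"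
    unfolding q_fun_def by (rule q_coefficients) (use z nz r in "auto intro: inj_on_subset")
  also have "\<dots> = (\<Sum>i\<in>?I. 2 * pf_coeff ?z {..<m} i * ?z i ^ r)"
  proof (rule sum.cong[OF refl])
    fix i assume i: "i \<in> ?I"
    have "pf_coeff ?z ?I i = pf_coeff ?z {..<m} i"
      unfolding pf_coeff_def
    proof (rule prod.mono_neutral_left)
      show "\<forall>j\<in>{..<m} - {i} - (?I - {i}). (?z i + ?z j) / (?z i - ?z j) = 1"
      proof
        fix j assume "j \<in> {..<m} - {i} - (?I - {i})"
        then have "?z j = 0" using nz by blast
        then show "(?z i + ?z j) / (?z i - ?z j) = 1" using nz i by simp
      qed
    qed (use z in auto)
    then show "2 * pf_coeff ?z ?I i * ?z i ^ r = 2 * pf_coeff ?z {..<m} i * ?z i ^ r" by simp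
  qed
  also have "\<dots> = (\<Sum>i<m. 2 * pf_coeff ?z {..<m} i * ?z i ^ r)"
    by (rule sum.mono_neutral_left) (use z nz r in auto)
  finally show ?thesis .
qed

text \<open>The permutation of \<open>{..<m}\<close> that is increasing outside $0$ and sends $0$ to \<open>i\<close>.\<close>

lemma shuffle_bij:
  fixes m :: nat
  assumes m: "m \<ge> 1"
  shows "bij_betw (\<lambda>w. w 0) {w. w permutes {..<m} \<and> strict_mono_on {1..<m} w} {..<m}"
  unfolding bij_betw_def
proof (intro conjI subset_antisym)
  let ?S = "{w. w permutes {..<m} \<and> strict_mono_on {1..<m} w}"
  have im: "w ` {1..<m} = {..<m} - {w 0}" if "w permutes {..<m}" for w
  proof -
    have "{1..<m} = {..<m} - {0::nat}" by (auto simp: Suc_le_eq)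
    then have "w ` {1..<m} = w ` {..<m} - {w 0}" using permutes_inj[OF that] by (simp add: image_set_diff)
    then show ?thesis using permutes_image[OF that] by simp
  qed
  show "inj_on (\<lambda>w. w 0) ?S"
  proof (rule inj_onI)
    fix u w assume u: "u \<in> ?S" and w: "w \<in> ?S" and e: "u 0 = w 0"
    have sd: "sorted_wrt (<) (map v [1..<m])" if "v \<in> ?S" for v
      unfolding sorted_wrt_iff_nth_less
    proof (intro allI impI)
      fix i j assume ij: "i < j" "j < length (map v [1..<m])"
      have sm: "strict_mono_on {1..<m} v" using that by simp
      show "map v [1..<m] ! i < map v [1..<m] ! j"
        using strict_mono_onD[OF sm, of "1 + i" "1 + j"] ij by simp
    qed
    have "set (map u [1..<m]) = set (map w [1..<m])"
      using im[of u] im[of w] u w e by simp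
    then have l: "map u [1..<m] = map w [1..<m]"
      using sd[OF u] sd[OF w] strict_sorted_equal by blast
    show "u = w"
    proof (rule ext)
      fix k
      consider "k = 0" | "k \<in> {1..<m}" | "k \<notin> {..<m}" by (cases "k = 0") auto
      then show "u k = w k"
      proof cases
        case 2 then show ?thesis using l by simp
      next
        case 3 then show ?thesis using u w permutes_not_in[of u "{..<m}" k] permutes_not_in[of w "{..<m}" k] by simp
      qed (use e in simp)
    qed
  qed
  show "(\<lambda>w. w 0) ` ?S \<subseteq> {..<m}" using m permutes_in_image by fastforce
  show "{..<m} \<subseteq> (\<lambda>w. w 0) ` ?S"
  proof
    fix i assume i: "i \<in> {..<m}"
    define w where "w k = (if k = 0 then i else if k \<le> i then k - 1 else k)" for k
    have "w permutes {..<m}"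
    proof (rule bij_imp_permutes)
      have "inj_on w {..<m}" by (rule inj_onI) (auto simp: w_def split: if_splits)
      moreover have "w ` {..<m} \<subseteq> {..<m}" using i by (auto simp: w_def)
      ultimately show "bij_betw w {..<m} {..<m}"
        by (simp add: bij_betw_def endo_inj_surj)
      show "w k = k" if "k \<notin> {..<m}" for k using that i by (auto simp: w_def)
    qed
    moreover have "strict_mono_on {1..<m} w" by (rule strict_mono_onI) (auto simp: w_def)
    moreover have "w 0 = i" by (simp add: w_def)
    ultimately show "i \<in> (\<lambda>w. w 0) ` ?S" by blast
  qed
qed

text \<open>
  The coset representative \<open>w\<close> enters only through \<open>w 0\<close>, and summing over it gives the residues
  of the generating function of the $q_r$.
\<close>

lemma schurQ_vars_single:
  assumes m: "m \<ge> 1"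
  shows "schurQ_vars [r] m z = (\<Sum>i<m. 2 * pf_coeff z {..<m} i * z i ^ r)"
proof -
  let ?S = "{w. w permutes {..<m} \<and> strict_mono_on {1..<m} w}"
  have "schurQ_vars [r] m z = (\<Sum>w\<in>?S. 2 * (z (w 0) ^ r * (\<Prod>j\<in>{0<..<m}. (z (w 0) + z (w j)) / (z (w 0) - z (w j)))))"
    unfolding schurQ_vars_def by (simp add: sum_distrib_left)
  also have "\<dots> = (\<Sum>w\<in>?S. 2 * pf_coeff z {..<m} (w 0) * z (w 0) ^ r)"
  proof (rule sum.cong[OF refl])
    fix w assume "w \<in> ?S"
    then have w: "w permutes {..<m}" by simp
    have "{0<..<m} = {..<m} - {0}" by auto
    then have "w ` {0<..<m} = {..<m} - {w 0}"
      using permutes_inj[OF w] permutes_image[OF w] by (simp add: image_set_diff)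
    then have "bij_betw w {0<..<m} ({..<m} - {w 0})"
      unfolding bij_betw_def using inj_on_subset[OF permutes_inj[OF w] subset_UNIV] by simp
    from prod.reindex_bij_betw[OF this, of "\<lambda>j. (z (w 0) + z j) / (z (w 0) - z j)"]
    show "2 * (z (w 0) ^ r * (\<Prod>j\<in>{0<..<m}. (z (w 0) + z (w j)) / (z (w 0) - z (w j)))) = 2 * pf_coeff z {..<m} (w 0) * z (w 0) ^ r"
      unfolding pf_coeff_def by simp
  qed
  also have "\<dots> = (\<Sum>i<m. 2 * pf_coeff z {..<m} i * z i ^ r)"
    by (rule sum.reindex_bij_betw[OF shuffle_bij[OF m], of "\<lambda>i. 2 * pf_coeff z {..<m} i * z i ^ r"])
  finally show ?thesis .
qed

text \<open>
  An element of $\Gamma$ is determined by its values at points with distinct coordinates, because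
  on the line through any point \<open>z\<close> in direction $(0, 1, 2, \dots)$ it is a polynomial in the
  parameter, and almost all points of this line have distinct coordinates.
\<close>

definition line :: "(nat \<Rightarrow>\<^sub>0 complex) \<Rightarrow> nat \<Rightarrow> complex \<Rightarrow> nat \<Rightarrow>\<^sub>0 complex" where
  "line z m t = Abs_poly_mapping (\<lambda>i. if i < m then coord z i + t * of_nat i else 0)"

lemma lookup_line: "coord (line z m t) i = (if i < m then coord z i + t * of_nat i else 0)"
proof -
  have "finite {i. (if i < m then coord z i + t * of_nat i else 0) \<noteq> 0}"
    by (rule finite_subset[of _ "{..<m}"]) auto
  then show ?thesis unfolding line_def by (simp add: Abs_poly_mapping_inverse)
qed

lemma keys_line: "supp (line z m t) \<subseteq> {..<m}"
  by (auto simp: in_keys_iff lookup_line split: if_splits)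

lemma q_factor_nth:
  "fps_nth ((1 + fps_const a * fps_X) / (1 - fps_const (a::complex) * fps_X)) k = (if k = 0 then 1 else 2 * a ^ k)"
  unfolding divide_linear_fps by (cases k) (simp_all add: algebra_simps)

lemma q_fun_line:
  "\<exists>P. \<forall>t. q_fun r (line z m t) = poly P t"
proof -
  let ?a = "\<lambda>t i. coord z i + t * of_nat i"
  let ?F = "\<lambda>t i. (1 + fps_const (?a t i) * fps_X) / (1 - fps_const (?a t i) * fps_X)"
  have "\<exists>P. \<forall>t. fps_nth (\<Prod>i<k. ?F t i) r = poly P t" for k r
  proof (induction k arbitrary: r)
    case 0
    show ?case by (rule exI[of _ "[:fps_nth 1 r:]"]) simp
  next
    case (Suc k)
    then obtain P where P: "fps_nth (\<Prod>i<k. ?F t i) r = poly (P r) t" for r t by metis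
    define R where "R j = (if j = 0 then 1 else Polynomial.smult 2 ([:coord z k, of_nat k:] ^ j))" for j
    have R: "fps_nth (?F t k) j = poly (R j) t" for j t
      unfolding q_factor_nth R_def by (simp add: poly_power)
    show ?case
      by (rule exI[of _ "\<Sum>j=0..r. P j * R (r - j)"]) (simp only: prod.lessThan_Suc fps_mult_nth P R poly_sum poly_mult simp_thms)
  qed
  then obtain P where P: "\<And>t. fps_nth (\<Prod>i<m. ?F t i) r = poly P t" by blast
  have "q_fun r (line z m t) = poly P t" for t
  proof -
    have "(\<Prod>i\<in>supp (line z m t). (1 + fps_const (coord (line z m t) i) * fps_X) /
        (1 - fps_const (coord (line z m t) i) * fps_X)) = (\<Prod>i<m. ?F t i)"
      by (rule prod.mono_neutral_cong_left) (use keys_line in "auto simp: in_keys_iff lookup_line split: if_splits")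
    then show ?thesis unfolding q_fun_def P[symmetric] by simp
  qed
  then show ?thesis by blast
qed

lemma Gamma_line: "f \<in> Gamma \<Longrightarrow> \<exists>P. \<forall>t. f (line z m t) = poly P t"
proof (induction rule: Gamma.induct)
  case (const a) then show ?case by (intro exI[of _ "[:a:]"]) simp
next
  case (q r) then show ?case using q_fun_line by blast
next
  case (add f g)
  then obtain P R where "\<forall>t. f (line z m t) = poly P t" "\<forall>t. g (line z m t) = poly R t" by blast
  then show ?case by (intro exI[of _ "P + R"]) (simp add: plus_fun_apply)
next
  case (mult f g)
  then obtain P R where "\<forall>t. f (line z m t) = poly P t" "\<forall>t. g (line z m t) = poly R t" by blast
  then show ?case by (intro exI[of _ "P * R"]) (simp add: times_fun_apply)
qed

lemma line_distinct: "finite {t. \<not> inj_on (coord (line z m t)) {..<m}}"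
proof -
  let ?z = "coord z"
  have "{t. \<not> inj_on (coord (line z m t)) {..<m}} \<subseteq>
    (\<lambda>(i, j). (?z i - ?z j) / (of_nat j - of_nat i)) ` ({..<m} \<times> {..<m})"
  proof
    fix t assume "t \<in> {t. \<not> inj_on (coord (line z m t)) {..<m}}"
    then obtain i j where ij: "i < m" "j < m" "i \<noteq> j" "?z i + t * of_nat i = ?z j + t * of_nat j"
      unfolding inj_on_def by (auto simp: lookup_line)
    have "(of_nat j :: complex) - of_nat i \<noteq> 0" using ij(3) by simp
    moreover have "t * (of_nat j - of_nat i) = ?z i - ?z j" using ij(4) by (simp add: algebra_simps)
    ultimately have "t = (?z i - ?z j) / (of_nat j - of_nat i)" by (simp add: eq_divide_eq)
    then show "t \<in> (\<lambda>(i, j). (?z i - ?z j) / (of_nat j - of_nat i)) ` ({..<m} \<times> {..<m})" using ij by force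
  qed
  then show ?thesis by (rule finite_subset) simp
qed

lemma Gamma_unique:
  assumes f: "f \<in> Gamma" and g: "g \<in> Gamma"
    and e: "\<And>m z. m \<ge> 1 \<Longrightarrow> supp z \<subseteq> {..<m} \<Longrightarrow> inj_on (coord z) {..<m} \<Longrightarrow> f z = g z"
  shows "f = g"
proof (rule ext)
  fix z :: "nat \<Rightarrow>\<^sub>0 complex"
  obtain m where m: "m \<ge> 1" "supp z \<subseteq> {..<m}"
  proof -
    obtain k where "supp z \<subseteq> {..<k}" using finite_nat_iff_bounded[of "supp z"] by auto
    then show ?thesis using that[of "Suc k"] by fastforce
  qed
  obtain P R where P: "\<And>t. f (line z m t) = poly P t" and R: "\<And>t. g (line z m t) = poly R t"
    using Gamma_line[OF f] Gamma_line[OF g] by metis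
  have "P - R = 0"
  proof (rule ccontr)
    assume "P - R \<noteq> 0"
    then have "finite {t. poly (P - R) t = 0}" by (rule poly_roots_finite)
    moreover have "UNIV \<subseteq> {t. poly (P - R) t = 0} \<union> {t. \<not> inj_on (coord (line z m t)) {..<m}}"
    proof
      fix t
      show "t \<in> {t. poly (P - R) t = 0} \<union> {t. \<not> inj_on (coord (line z m t)) {..<m}}"
      proof (cases "inj_on (coord (line z m t)) {..<m}")
        case True
        from e[OF m(1) keys_line True] have "poly P t = poly R t" unfolding P R .
        then show ?thesis by simp
      qed simp
    qed
    ultimately have "finite (UNIV :: complex set)" using line_distinct finite_subset by blast
    then show False using infinite_UNIV_char_0 by blast
  qed
  then have "f (line z m 0) = g (line z m 0)" using P R by simp
  moreover have "line z m 0 = z"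
    by (rule poly_mapping_eqI) (use m(2) in "auto simp: lookup_line in_keys_iff")
  ultimately show "f z = g z" by simp
qed

theorem schurQ_single:
  assumes n: "n \<ge> 1" shows "schurQ [n] = q_comp [n]"
proof -
  have q: "q_fun n \<in> Gamma" using n by (rule Gamma.q)
  have val: "q_fun n z = schurQ_vars [n] m (coord z)"
    if "m \<ge> 1" "supp z \<subseteq> {..<m}" "inj_on (coord z) {..<m}" for m z
    unfolding schurQ_vars_single[OF that(1)] by (rule q_fun_eq[OF that(2,3) n])
  have "schurQ [n] = q_fun n"
    unfolding schurQ_def
  proof (rule the_equality)
    show "q_fun n \<in> Gamma \<and> (\<forall>m\<ge>length [n]. \<forall>z. supp z \<subseteq> {..<m} \<and> inj_on (coord z) {..<m} \<longrightarrow>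
           q_fun n z = schurQ_vars [n] m (coord z))"
      using q val by simp
    fix f assume f: "f \<in> Gamma \<and> (\<forall>m\<ge>length [n]. \<forall>z. supp z \<subseteq> {..<m} \<and> inj_on (coord z) {..<m} \<longrightarrow>
           f z = schurQ_vars [n] m (coord z))"
    show "f = q_fun n" by (rule Gamma_unique) (use f q val in auto)
  qed
  then show ?thesis by (simp add: q_comp_def)
qed

section \<open>Modules with the same characteristic\<close>

lemma homs_cong_right:
  assumes "\<And>i v. i \<in> I \<Longrightarrow> v \<in> T \<Longrightarrow> b i v = b' i v"
  shows "homs I S a T b = homs I S a T b'"
  unfolding homs_def using assms by (auto simp: image_subset_iff)

lemma Pi_smod:
  assumes V: "gmod A V"
  shows "carr (Pi_smod A V) = carr V" and "gmod A (Pi_smod A V)"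
    and "g \<in> gens A \<Longrightarrow> v \<in> carr V \<Longrightarrow> tact A (Pi_smod A V) g v = tact A V g v"
proof -
  let ?P = "Pi_smod A V"
  note gr = gmod_graded[OF V]
  have h: "hpart ?P 0 = hpart V 1" "hpart ?P 1 = hpart V 0" by (simp_all add: Pi_smod_def)
  show c: "carr ?P = carr V"
    unfolding carr_def h by (auto simp: add.commute) (metis add.commute)+
  have grP: "graded ?P" unfolding c h by (rule splits_swap[OF gr])
  show "gmod A ?P"
    unfolding gmod_def
  proof (intro conjI ballI allI)
    show "graded ?P" by (rule grP)
    fix g assume g: "g \<in> gens A"
    show "lin_on (carr ?P) (act ?P g)"
      unfolding c using lin_on_scale_fun[OF act_lin[OF V g]] by (simp add: Pi_smod_def)
    show "act ?P g ` hpart ?P p \<subseteq> hpart ?P (p + gpar A g)" for p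
    proof (rule image_subsetI)
      fix v assume "v \<in> hpart ?P p"
      then have "v \<in> hpart V (p + 1)" by (simp only: Pi_smod_def smod.simps)
      from act_hpart[OF V g this] have "ssign 1 (gpar A g) *c act V g v \<in> hpart V (p + 1 + gpar A g)"
        by (rule cfun.subspace_scale[OF hpart_subspace[OF gr]])
      moreover have "p + 1 + gpar A g = p + gpar A g + 1" by (simp only: add_ac)
      ultimately show "act ?P g v \<in> hpart ?P (p + gpar A g)" by (simp only: Pi_smod_def smod.simps)
    qed
  qed
  show "tact A ?P g v = tact A V g v" if g: "g \<in> gens A" and v: "v \<in> carr V"
  proof -
    obtain v0 v1 where vv: "v0 \<in> hpart V 0" "v1 \<in> hpart V 1" "v = v0 + v1" using carr_cases[OF gr v] .
    have s: "sg ?P v = - sg V v"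
      using sg_add_parts[OF gr vv(1,2)] sg_add_parts[OF grP, of v1 v0] vv unfolding h by (simp add: add.commute)
    show ?thesis
    proof (cases "gpar A g = 0")
      case True then show ?thesis by (simp add: tact_def Pi_smod_def)
    next
      case False
      then have "gpar A g = 1" using bit_01 by metis
      have "act V g (- sg V v) = - act V g (sg V v)" by (rule lin_on_uminus[OF act_lin[OF V g] sg_carr[OF gr v]])
      then show ?thesis unfolding tact_def s using \<open>gpar A g = 1\<close>
        by (simp add: Pi_smod_def cscale_def fun_eq_iff uminus_apply)
    qed
  qed
qed

text \<open>
  By semisimplicity the middle term is the direct sum of copies of the outer ones.
\<close>

lemma short_exact_splits:
  assumes "smodule A V1" "smodule A V2" "smodule A V3" and uni: "unitarizable A V2" and s: "short_exact A V1 V2 V3"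
  obtains K X f g where "splits (carr V2) K X" "ssubmodule A V2 K" "ssubmodule A V2 X"
    "f \<in> homs (gens A) (carr V1) (tact A V1) K (tact A V2)" "bij_betw f (carr V1) K"
    "g \<in> homs (gens A) X (tact A V2) (carr V3) (tact A V3)" "bij_betw g X (carr V3)"
proof -
  note G = smoduleD(1)[OF assms(1)] smoduleD(1)[OF assms(2)] smoduleD(1)[OF assms(3)]
  obtain f g where f: "shom A 0 V1 V2 f" and g: "shom A 0 V2 V3 g" and inj: "inj_on f (carr V1)"
    and im: "f ` carr V1 = {v \<in> carr V2. g v = 0}" and sur: "g ` carr V2 = carr V3"
    using s unfolding short_exact_def by blast
  define K where "K = {v \<in> carr V2. g v = 0}"
  have K: "ssubmodule A V2 K" unfolding K_def by (rule shom_kernel[OF G(2,3) g])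
  obtain X where X: "ssubmodule A V2 X" "splits (carr V2) K X"
    by (rule invariant_complement[OF assms(2) uni K ssubmodule_carr[OF G(2)]]) (auto simp: K_def)
  note fs = shom_iff[OF G(1,2), THEN iffD1, OF f, THEN conjunct1]
  note gs = shom_iff[OF G(2,3), THEN iffD1, OF g, THEN conjunct1]
  have XV: "X \<subseteq> carr V2" and KX: "K \<inter> X = {0}" and SX: "cfun.subspace X" using X(2) splits_sub unfolding splits_def by blast+
  show ?thesis
  proof (rule that[OF X(2) K X(1)])
    show "f \<in> homs (gens A) (carr V1) (tact A V1) K (tact A V2)"
    proof (rule homsI)
      show "f v \<in> K" if "v \<in> carr V1" for v using im that unfolding K_def by blast
    qed (use homsD[OF fs] in auto)
    show "bij_betw f (carr V1) K" unfolding bij_betw_def K_def using inj im by blast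
    show "g \<in> homs (gens A) X (tact A V2) (carr V3) (tact A V3)"
    proof (rule homsI)
      show "lin_on X g" by (rule lin_on_subset[OF homsD(1)[OF gs] XV])
    qed (use homsD(2,3)[OF gs] XV in blast)+
    have "inj_on g X"
      unfolding lin_on_inj_iff[OF lin_on_subset[OF homsD(1)[OF gs] XV] SX] using XV KX unfolding K_def by blast
    moreover have "g ` X = carr V3"
    proof
      show "g ` X \<subseteq> carr V3" using sur XV by blast
      show "carr V3 \<subseteq> g ` X"
      proof
        fix w assume "w \<in> carr V3"
        then obtain v where v: "v \<in> carr V2" "w = g v" using sur by blast
        then obtain k x where kx: "k \<in> K" "x \<in> X" "v = k + x" using X(2) unfolding splits_def by blast
        have "g v = g k + g x" unfolding kx(3) by (rule lin_on_add[OF homsD(1)[OF gs]]) (use kx XV K_def in auto)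
        moreover have "g k = 0" using kx(1) unfolding K_def by blast
        ultimately show "w \<in> g ` X" using v(2) kx(2) by simp
      qed
    qed
    ultimately show "bij_betw g X (carr V3)" by (simp add: bij_betw_def)
  qed
qed

lemma shdim_short_exact:
  assumes D: "hc_module n D" and V: "hc_module n V1" "hc_module n V2" "hc_module n V3"
    and s: "short_exact (hc_alg n) V1 V2 V3"
  shows "shdim (hc_alg n) D V2 = shdim (hc_alg n) D V1 + shdim (hc_alg n) D V3"
proof -
  let ?A = "hc_alg n" let ?I = "gens ?A"
  note smD = hc_smodule[OF D] and sm = hc_smodule[OF V(1)] hc_smodule[OF V(2)] hc_smodule[OF V(3)]
  note gD = smoduleD(1)[OF smD] and G = sm[THEN smoduleD(1)]
  obtain K X f g where KX: "splits (carr V2) K X" "ssubmodule ?A V2 K" "ssubmodule ?A V2 X"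
    and f: "f \<in> homs ?I (carr V1) (tact ?A V1) K (tact ?A V2)" "bij_betw f (carr V1) K"
    and g: "g \<in> homs ?I X (tact ?A V2) (carr V3) (tact ?A V3)" "bij_betw g X (carr V3)"
    by (rule short_exact_splits[OF sm hc_unitarizable[OF V(2)] s])
  note st = KX(2,3)[unfolded ssubmodule_iff[OF G(2)]]
  have XV: "X \<subseteq> carr V2" and SX: "cfun.subspace X" using st(2) by blast+
  have "hdim ?I (carr D) (tact ?A D) (carr V2) (tact ?A V2) =
      hdim ?I (carr D) (tact ?A D) K (tact ?A V2) + hdim ?I (carr D) (tact ?A D) X (tact ?A V2)"
    by (rule hdim_sum_right[OF KX(1) smoduleD(2)[OF smD] smoduleD(2)[OF sm(2)] tact_lin[OF G(2)]])
      (use st tact_carr[OF gD] in blast)+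
  also have "hdim ?I (carr D) (tact ?A D) K (tact ?A V2) = shdim ?A D V1"
    by (rule hdim_iso_right[OF smoduleD(3)[OF sm(1)] tact_lin[OF G(1)] tact_carr[OF G(1)] f smoduleD(3)[OF smD] tact_carr[OF gD],
          symmetric])
  also have "hdim ?I (carr D) (tact ?A D) X (tact ?A V2) = shdim ?A D V3"
    by (rule hdim_iso_right[OF SX _ _ g smoduleD(3)[OF smD] tact_carr[OF gD]])
      (use st lin_on_subset[OF tact_lin[OF G(2)] XV] in blast)+
  finally show ?thesis .
qed

lemma dim_short_exact:
  assumes V: "hc_module n V1" "hc_module n V2" "hc_module n V3"
    and s: "short_exact (hc_alg n) V1 V2 V3"
  shows "cfun.dim (carr V2) = cfun.dim (carr V1) + cfun.dim (carr V3)"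
proof -
  let ?A = "hc_alg n" let ?I = "gens ?A"
  note sm = hc_smodule[OF V(1)] hc_smodule[OF V(2)] hc_smodule[OF V(3)]
  obtain K X f g where KX: "splits (carr V2) K X"
    and f: "f \<in> homs ?I (carr V1) (tact ?A V1) K (tact ?A V2)" "bij_betw f (carr V1) K"
    and g: "g \<in> homs ?I X (tact ?A V2) (carr V3) (tact ?A V3)" "bij_betw g X (carr V3)"
    by (rule short_exact_splits[OF sm hc_unitarizable[OF V(2)] s])
  have "cfun.dim K = cfun.dim (carr V1)"
    using dim_lin_image[OF smoduleD(3)[OF sm(1)] homsD(1)[OF f(1)]] f(2) unfolding bij_betw_def by simp
  moreover have "cfun.dim (carr V3) = cfun.dim X"
    using dim_lin_image[OF _ homsD(1)[OF g(1)]] g(2) KX unfolding bij_betw_def splits_def by simp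
  ultimately show ?thesis using dim_splits[OF KX smoduleD(2)[OF sm(2)]] by simp
qed

text \<open>
  A function on modules that is additive on short exact sequences factors through the
  Grothendieck group, so by injectivity of the characteristic map it depends only on the
  characteristic.
\<close>

lemma additive_eq_if_ch_eq:
  fixes hd :: "hcmod \<Rightarrow> nat"
  assumes ch: "characteristic_map ch" and V: "hc_module n V" and W: "hc_module n W" and eq: "ch n V = ch n W"
    and add: "\<And>V1 V2 V3. hc_module n V1 \<Longrightarrow> hc_module n V2 \<Longrightarrow> hc_module n V3 \<Longrightarrow>
      short_exact (hc_alg n) V1 V2 V3 \<Longrightarrow> hd V2 = hd V1 + hd V3"
    and Pi: "\<And>V. hc_module n V \<Longrightarrow> hd (Pi_smod (hc_alg n) V) = hd V"
  shows "hd V = hd W"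
proof (cases "V = W")
  case False
  define c :: "nat \<times> hcmod \<Rightarrow> complex" where "c y = (if fst y = n then of_nat (hd (snd y)) else 0)" for y
  define \<phi> where "\<phi> x = (\<Sum>y | x y \<noteq> 0. x y * c y)" for x :: "nat \<times> hcmod \<Rightarrow> complex"
  let ?fin = "\<lambda>x :: nat \<times> hcmod \<Rightarrow> complex. finite {y. x y \<noteq> 0}"
  have phi: "\<phi> x = (\<Sum>y\<in>K. x y * c y)" if "finite K" "{y. x y \<noteq> 0} \<subseteq> K" for x K
    unfolding \<phi>_def by (rule sum.mono_neutral_left) (use that in auto)
  have phi_add: "?fin (u + v) \<and> \<phi> (u + v) = \<phi> u + \<phi> v" if "?fin u" "?fin v" for u v
  proof -
    let ?K = "{y. u y \<noteq> 0} \<union> {y. v y \<noteq> 0}"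
    have K: "finite ?K" "{y. (u + v) y \<noteq> 0} \<subseteq> ?K" using that by (auto simp: plus_fun_apply)
    have "\<phi> (u + v) = \<phi> u + \<phi> v"
      unfolding phi[OF K] phi[of ?K u, OF K(1) Un_upper1] phi[of ?K v, OF K(1) Un_upper2]
      by (simp add: plus_fun_apply distrib_right sum.distrib)
    then show ?thesis using finite_subset[OF K(2,1)] by blast
  qed
  have phi_scale: "?fin (a *c u) \<and> \<phi> (a *c u) = a * \<phi> u" if "?fin u" for a u
  proof -
    have K: "{y. (a *c u) y \<noteq> 0} \<subseteq> {y. u y \<noteq> 0}" by (auto simp: cscale_def)
    have "\<phi> (a *c u) = a * \<phi> u"
      unfolding phi[OF that K] by (simp add: \<phi>_def cscale_def sum_distrib_left mult.assoc)
    then show ?thesis using finite_subset[OF K that] by blast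
  qed
  have phi_delta: "?fin (delta y) \<and> \<phi> (delta y) = c y" for y
  proof -
    have "{y'. delta y y' \<noteq> 0} = {y}" by (auto simp: delta_def)
    then show ?thesis by (simp add: \<phi>_def delta_def)
  qed
  have phi_diff: "?fin (u - v) \<and> \<phi> (u - v) = \<phi> u - \<phi> v" if "?fin u" "?fin v" for u v
  proof -
    have e: "u - v = u + (- 1) *c v" by (simp add: fun_eq_iff pointwise cscale_def)
    note s = phi_scale[OF that(2), of "- 1"]
    note a = phi_add[OF that(1) conjunct1[OF s]]
    show ?thesis
    proof
      show "?fin (u - v)" unfolding e by (rule conjunct1[OF a])
      show "\<phi> (u - v) = \<phi> u - \<phi> v" unfolding e conjunct2[OF a] conjunct2[OF s] by simp
    qed
  qed
  let ?P = "{x. ?fin x \<and> \<phi> x = 0}"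
  have sub: "cfun.subspace ?P"
  proof (rule cfun.subspaceI)
    show "0 \<in> ?P" by (simp add: \<phi>_def zero_fun_apply)
    show "x + y \<in> ?P" if "x \<in> ?P" "y \<in> ?P" for x y using that phi_add[of x y] by simp
    show "a *c x \<in> ?P" if "x \<in> ?P" for a x using that phi_scale[of x a] by simp
  qed
  have d: "?fin (delta y - delta y') \<and> \<phi> (delta y - delta y') = \<phi> (delta y) - \<phi> (delta y')" for y y'
    by (rule phi_diff[OF conjunct1[OF phi_delta] conjunct1[OF phi_delta]])
  have dd: "?fin (delta y - delta y' - delta y'') \<and> \<phi> (delta y - delta y' - delta y'') = \<phi> (delta y - delta y') - \<phi> (delta y'')" for y y' y''
    by (rule phi_diff[OF conjunct1[OF d] conjunct1[OF phi_delta]])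
  have "K_rel \<subseteq> ?P"
    unfolding K_rel_def
  proof (rule cfun.span_minimal[OF _ sub], rule Un_least; rule subsetI)
    {
      fix x :: "nat \<times> hcmod \<Rightarrow> complex"
      assume "x \<in> {delta (n, V2) - delta (n, V1) - delta (n, V3) | n V1 V2 V3.
         hc_module n V1 \<and> hc_module n V2 \<and> hc_module n V3 \<and> short_exact (hc_alg n) V1 V2 V3}"
      then obtain k V1 V2 V3 where 1: "x = delta (k, V2) - delta (k, V1) - delta (k, V3)"
        "hc_module k V1" "hc_module k V2" "hc_module k V3" "short_exact (hc_alg k) V1 V2 V3" by blast
      have "c (k, V2) = c (k, V1) + c (k, V3)" using add[of V1 V2 V3] 1 by (auto simp: c_def)
      then have z: "\<phi> x = 0" unfolding 1(1) conjunct2[OF dd] conjunct2[OF d] conjunct2[OF phi_delta] by simp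
      have "?fin x" unfolding 1(1) by (rule conjunct1[OF dd])
      then show "x \<in> ?P" using z by (intro CollectI conjI)
    next
      fix x :: "nat \<times> hcmod \<Rightarrow> complex"
      assume "x \<in> {delta (n, Pi_smod (hc_alg n) V) - delta (n, V) | n V. hc_module n V}"
      then obtain k V where 2: "x = delta (k, Pi_smod (hc_alg k) V) - delta (k, V)" "hc_module k V" by blast
      have "c (k, Pi_smod (hc_alg k) V) = c (k, V)" using Pi[of V] 2 by (auto simp: c_def)
      then have z: "\<phi> x = 0" unfolding 2(1) conjunct2[OF d] conjunct2[OF phi_delta] by simp
      have "?fin x" unfolding 2(1) by (rule conjunct1[OF d])
      then show "x \<in> ?P" using z by (intro CollectI conjI)
    }
  qed
  moreover have "delta (n, V) - delta (n, W) \<in> K_rel"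
  proof -
    let ?x = "delta (n, V) - delta (n, W)"
    have K: "?x \<in> K_free"
      unfolding K_free_def using V W by (intro cfun.span_diff cfun.span_base) blast+
    have s: "{y. ?x y \<noteq> 0} = {(n, V), (n, W)}" using False by (auto simp: delta_def minus_apply)
    have "ch_ext ch ?x = (1 *c ch n V) + (- 1) *c ch n W"
      unfolding ch_ext_def s using False by (simp add: delta_def minus_apply)
    also have "\<dots> = 0" unfolding eq by (simp add: fun_eq_iff cscale_def pointwise)
    finally show ?thesis using ch K unfolding characteristic_map_def by blast
  qed
  ultimately have "\<phi> (delta (n, V) - delta (n, W)) = 0" by blast
  then have "c (n, V) = c (n, W)" unfolding conjunct2[OF d] conjunct2[OF phi_delta] by simp
  then show ?thesis by (simp add: c_def)
qed simp

lemma shdim_eq_if_ch_eq: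
  assumes ch: "characteristic_map ch" and D: "hc_module n D" and V: "hc_module n V" and W: "hc_module n W"
    and eq: "ch n V = ch n W"
  shows "shdim (hc_alg n) D V = shdim (hc_alg n) D W"
proof (rule additive_eq_if_ch_eq[where hd = "\<lambda>V. shdim (hc_alg n) D V", OF ch V W eq shdim_short_exact[OF D]])
  fix V :: hcmod assume "hc_module n V"
  then have g: "gmod (hc_alg n) V" by (rule smoduleD(1)[OF hc_smodule])
  show "shdim (hc_alg n) D (Pi_smod (hc_alg n) V) = shdim (hc_alg n) D V"
  proof -
    have "shoms (hc_alg n) D (Pi_smod (hc_alg n) V) = shoms (hc_alg n) D V"
      unfolding Pi_smod(1)[OF g] by (rule homs_cong_right) (rule Pi_smod(3)[OF g])
    then show ?thesis by (simp only:)
  qed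
qed

lemma dim_eq_if_ch_eq:
  assumes ch: "characteristic_map ch" and V: "hc_module n V" and W: "hc_module n W"
    and eq: "ch n V = ch n W"
  shows "cfun.dim (carr V) = cfun.dim (carr W)"
proof (rule additive_eq_if_ch_eq[where hd = "\<lambda>V. cfun.dim (carr V)", OF ch V W eq dim_short_exact])
  fix V :: hcmod assume "hc_module n V"
  then have g: "gmod (hc_alg n) V" by (rule smoduleD(1)[OF hc_smodule])
  show "cfun.dim (carr (Pi_smod (hc_alg n) V)) = cfun.dim (carr V)" unfolding Pi_smod(1)[OF g] ..
qed

text \<open>
  $\mathrm{Hom}(D, D)$ contains the identity, and $\mathrm{Hom}(D, V)$ has the same dimension.
\<close>

lemma nonzero_hom_if_ch_eq:
  assumes ch: "characteristic_map ch" and D: "hc_module n D" "sirreducible (hc_alg n) D" and V: "hc_module n V"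
    and eq: "ch n D = ch n V"
  obtains f v where "f \<in> shoms (hc_alg n) D V" "v \<in> carr D" "f v \<noteq> 0"
proof -
  have "shdim (hc_alg n) D D = shdim (hc_alg n) D V" by (rule shdim_eq_if_ch_eq[OF ch D(1) D(1) V eq])
  moreover have "0 < shdim (hc_alg n) D D"
    by (rule shdim_pos[OF hc_smodule[OF D(1)]]) (use D(2) in "simp add: sirreducible_def")
  ultimately show ?thesis
    using hdim_eq_0[of "gens (hc_alg n)" "carr D" "tact (hc_alg n) D" "carr V" "tact (hc_alg n) V"] that
    by (metis less_irrefl)
qed

lemma is_D_unique:
  assumes ch: "characteristic_map ch" and D: "is_D ch n lam D" and D': "is_D ch n lam D'"
  shows "\<exists>h\<in>shoms (hc_alg n) D D'. bij_betw h (carr D) (carr D')"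
proof -
  note d = D[unfolded is_D_def] and d' = D'[unfolded is_D_def]
  have m: "hc_module n D" "sirreducible (hc_alg n) D" "hc_module n D'" "sirreducible (hc_alg n) D'"
    using d d' by blast+
  have eq: "ch n D = ch n D'" using d d' by simp
  obtain f v where f: "f \<in> shoms (hc_alg n) D D'" "v \<in> carr D" "f v \<noteq> 0"
    by (rule nonzero_hom_if_ch_eq[OF ch m(1-3) eq])
  obtain h p where "shom (hc_alg n) p D D' h" "h \<in> shoms (hc_alg n) D D'" "bij_betw h (carr D) (carr D')"
    by (rule schur_iso[OF smoduleD(1)[OF hc_smodule[OF m(1)]] smoduleD(1)[OF hc_smodule[OF m(3)]] f(1) m(2,4) f(2,3)])
  then show ?thesis by blast
qed

text \<open>
  A nonzero homomorphism from the irreducible module to $\mathcal{C}_n$ is injective, and the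
  dimensions agree because the characteristics do.
\<close>

lemma is_D_single:
  assumes n: "n \<ge> 1" and ch: "characteristic_map ch" and D: "is_D ch n [n] D"
  shows "\<exists>h\<in>shoms (hc_alg n) D (cliff_hc n). bij_betw h (carr D) (carr (cliff_hc n))"
proof -
  let ?A = "hc_alg n" let ?N = "cliff_nat n"
  have m: "hc_module n D" "sirreducible ?A D" and chD: "ch n D = q_comp [n]"
    using D unfolding is_D_def schurQ_single[OF n] delta_len_def by (simp_all add: cscale_def)
  have N: "hc_module n ?N" using cliff_nat_induced unfolding is_induced_triv_def by blast
  have "composition_of n [n]" using n by (simp add: composition_of_def)
  then have eq: "ch n D = ch n ?N" using ch cliff_nat_induced[of n] chD unfolding characteristic_map_def by metis
  note gD = smoduleD(1)[OF hc_smodule[OF m(1)]] and gN = smoduleD(1)[OF hc_smodule[OF N]]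
    and gC = smoduleD(1)[OF hc_smodule[OF cliff_hc_module]]
  obtain f v where f: "f \<in> shoms ?A D ?N" "v \<in> carr D" "f v \<noteq> 0"
    by (rule nonzero_hom_if_ch_eq[OF ch m N eq])
  have "\<exists>p. hcomp D ?N p f v \<noteq> 0"
  proof (rule ccontr)
    assume "\<not> (\<exists>p. hcomp D ?N p f v \<noteq> 0)"
    then have z: "hcomp D ?N p f v = 0" for p by blast
    have "f v = 0 + 0" using hcomp_sum[of f v D ?N] unfolding z .
    then show False using f(3) by simp
  qed
  then obtain p where p: "hcomp D ?N p f v \<noteq> 0" by (rule exE)
  let ?h = "hcomp D ?N p f"
  have h: "shom ?A p D ?N ?h" by (rule hcomp_shom[OF gD gN f(1)])
  have inj: "inj_on ?h (carr D)" by (rule schur_inj[where f = "?h" and v = v, OF gD gN h m(2) f(2) p])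
  have hs: "?h \<in> shoms ?A D ?N" using h shom_iff[OF gD gN] by blast
  have im: "?h ` carr D = carr ?N"
  proof (rule fd_dim_eq[OF smoduleD(2)[OF hc_smodule[OF N]]])
    show "?h ` carr D \<subseteq> carr ?N" using homsD(2)[OF hs] by blast
    show "cfun.subspace (?h ` carr D)" by (rule subspace_lin_image[OF gmod_carr_subspace[OF gD] homsD(1)[OF hs]])
    show "cfun.dim (?h ` carr D) = cfun.dim (carr ?N)"
      unfolding dim_lin_image[OF gmod_carr_subspace[OF gD] homsD(1)[OF hs] inj] by (rule dim_eq_if_ch_eq[OF ch m(1) N eq])
  qed
  define k where "k = inv_into (carr (cliff_hc n)) (\<lambda>f k. f (set_decode k) :: complex)"
  have "shom ?A 0 ?N (cliff_hc n) k"
    unfolding k_def cliff_nat_def by (rule trans_inv_shom[OF cliff_hc_module cliff_code])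
  then have ks: "k \<in> shoms ?A ?N (cliff_hc n)" using shom_iff[OF gN gC] by blast
  have kb: "bij_betw k (carr ?N) (carr (cliff_hc n))"
    unfolding k_def cliff_nat_def by (rule bij_betw_inv_into[OF trans_shom(2)[OF cliff_hc_module cliff_code]])
  have "bij_betw (\<lambda>v. k (?h v)) (carr D) (carr (cliff_hc n))"
    using bij_betw_trans[OF bij_betw_imageI[OF inj im] kb] unfolding comp_def .
  then show ?thesis by (rule bexI[OF _ homs_comp[OF hs ks]])
qed

section \<open>One or two copies of a spin module\<close>

lemma case_sum_linear:
  "case_sum u v + case_sum u' v' = case_sum (u + u') (v + v')"
  "c *c case_sum u v = case_sum (c *c u) (c *c v)"
  "- case_sum u v = case_sum (- u) (- v)"
  "case_sum u v = 0 \<longleftrightarrow> u = 0 \<and> v = 0"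
  by (auto simp: fun_eq_iff pointwise cscale_def zero_fun_apply split: sum.splits)

lemma case_sum_parts: "case_sum u v \<circ> Inl = u" "case_sum u v \<circ> Inr = v"
  by (simp_all add: fun_eq_iff)

lemma case_sum_eq: "case_sum u v = case_sum u' v' \<longleftrightarrow> u = u' \<and> v = v'"
  by (metis case_sum_parts)

context
  fixes A :: "'g sgens" and V :: "('g, 'x) smod" and W :: "('g, 'y) smod"
  assumes V: "gmod A V" and W: "gmod A W"
begin

private lemmas rV = gmod_graded[OF V]
private lemmas rW = gmod_graded[OF W]

lemma dsum_hpart: "hpart (dsum_smod V W) p = {case_sum u v | u v. u \<in> hpart V p \<and> v \<in> hpart W p}"
  by (simp add: dsum_smod_def)

lemma dsum_act: "act (dsum_smod V W) g (case_sum u v) = case_sum (act V g u) (act W g v)"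
  by (simp add: dsum_smod_def case_sum_parts)

lemma dsum_carr: "carr (dsum_smod V W) = {case_sum u v | u v. u \<in> carr V \<and> v \<in> carr W}"
proof (intro subset_antisym subsetI)
  fix z assume "z \<in> carr (dsum_smod V W)"
  then obtain u v u' v' where uv: "u \<in> hpart V 0" "v \<in> hpart W 0" "u' \<in> hpart V 1" "v' \<in> hpart W 1"
    and z: "z = case_sum u v + case_sum u' v'"
    unfolding carr_def dsum_hpart by blast
  have "u + u' \<in> carr V" "v + v' \<in> carr W" unfolding carr_def using uv by blast+
  then show "z \<in> {case_sum u v | u v. u \<in> carr V \<and> v \<in> carr W}" unfolding z case_sum_linear by blast
next
  fix z assume "z \<in> {case_sum u v | u v. u \<in> carr V \<and> v \<in> carr W}"
  then obtain u v where uv: "u \<in> carr V" "v \<in> carr W" and z: "z = case_sum u v" by blast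
  obtain u0 u1 where u: "u0 \<in> hpart V 0" "u1 \<in> hpart V 1" "u = u0 + u1" using carr_cases[OF rV uv(1)] .
  obtain v0 v1 where v: "v0 \<in> hpart W 0" "v1 \<in> hpart W 1" "v = v0 + v1" using carr_cases[OF rW uv(2)] .
  have "z = case_sum u0 v0 + case_sum u1 v1" unfolding z u v case_sum_linear ..
  then show "z \<in> carr (dsum_smod V W)" unfolding carr_def dsum_hpart using u v by blast
qed

lemma dsum_gmod: "gmod A (dsum_smod V W)"
  unfolding gmod_def
proof (intro conjI ballI allI)
  have sub: "cfun.subspace {case_sum u v | u v. u \<in> S \<and> v \<in> T}" if S: "cfun.subspace S" and T: "cfun.subspace T"
    for S :: "'x vec set" and T :: "'y vec set"
  proof (rule cfun.subspaceI)
    have "(0 :: 'x + 'y \<Rightarrow> complex) = case_sum 0 0" using case_sum_linear(4) by metis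
    then show "0 \<in> {case_sum u v | u v. u \<in> S \<and> v \<in> T}" using cfun.subspace_0[OF S] cfun.subspace_0[OF T] by blast
    show "x + y \<in> {case_sum u v | u v. u \<in> S \<and> v \<in> T}"
      if x: "x \<in> {case_sum u v | u v. u \<in> S \<and> v \<in> T}" and y: "y \<in> {case_sum u v | u v. u \<in> S \<and> v \<in> T}" for x y
    proof -
      obtain u v u' v' where e: "x = case_sum u v" "y = case_sum u' v'" "u \<in> S" "v \<in> T" "u' \<in> S" "v' \<in> T" using x y by blast
      have "u + u' \<in> S" "v + v' \<in> T" using e cfun.subspace_add[OF S] cfun.subspace_add[OF T] by blast+
      then show ?thesis unfolding e(1,2) case_sum_linear by blast
    qed
    show "c *c x \<in> {case_sum u v | u v. u \<in> S \<and> v \<in> T}" if x: "x \<in> {case_sum u v | u v. u \<in> S \<and> v \<in> T}" for c x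
    proof -
      obtain u v where e: "x = case_sum u v" "u \<in> S" "v \<in> T" using x by blast
      have "c *c u \<in> S" "c *c v \<in> T" using e cfun.subspace_scale[OF S] cfun.subspace_scale[OF T] by blast+
      then show ?thesis unfolding e(1) case_sum_linear by blast
    qed
  qed
  have "hpart (dsum_smod V W) 0 \<inter> hpart (dsum_smod V W) 1 = {0}"
  proof (intro subset_antisym subsetI)
    fix z assume "z \<in> hpart (dsum_smod V W) 0 \<inter> hpart (dsum_smod V W) 1"
    then have "z \<in> hpart (dsum_smod V W) 0" "z \<in> hpart (dsum_smod V W) 1" by simp_all
    then obtain u v u' v' where e: "z = case_sum u v" "u \<in> hpart V 0" "v \<in> hpart W 0"
      and e': "z = case_sum u' v'" "u' \<in> hpart V 1" "v' \<in> hpart W 1" unfolding dsum_hpart by blast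
    have "u' = u" "v' = v" using e(1) e'(1) case_sum_eq by metis+
    then have "u \<in> hpart V 0 \<inter> hpart V 1" "v \<in> hpart W 0 \<inter> hpart W 1" using e e' by blast+
    then have "u = 0" "v = 0" using rV rW unfolding splits_def by blast+
    then show "z \<in> {0}" using e(1) case_sum_linear(4) by blast
  next
    fix z :: "'x + 'y \<Rightarrow> complex" assume "z \<in> {0}"
    then show "z \<in> hpart (dsum_smod V W) 0 \<inter> hpart (dsum_smod V W) 1"
      unfolding dsum_hpart using cfun.subspace_0[OF sub[OF hpart_subspace[OF rV] hpart_subspace[OF rW]]] by blast
  qed
  then show "graded (dsum_smod V W)"
    unfolding splits_def dsum_hpart using sub hpart_subspace[OF rV] hpart_subspace[OF rW] by (simp add: carr_def dsum_hpart)
  fix g assume g: "g \<in> gens A"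
  show "lin_on (carr (dsum_smod V W)) (act (dsum_smod V W) g)"
    unfolding lin_on_def
  proof (intro conjI ballI allI)
    fix x assume "x \<in> carr (dsum_smod V W)"
    then obtain u v where x: "x = case_sum u v" "u \<in> carr V" "v \<in> carr W" unfolding dsum_carr by blast
    show "act (dsum_smod V W) g (c *c x) = c *c act (dsum_smod V W) g x" for c
      unfolding x(1) case_sum_linear dsum_act lin_on_scale[OF act_lin[OF V g] x(2)] lin_on_scale[OF act_lin[OF W g] x(3)] ..
    fix y assume "y \<in> carr (dsum_smod V W)"
    then obtain u' v' where y: "y = case_sum u' v'" "u' \<in> carr V" "v' \<in> carr W" unfolding dsum_carr by blast
    show "act (dsum_smod V W) g (x + y) = act (dsum_smod V W) g x + act (dsum_smod V W) g y"
      unfolding x(1) y(1) case_sum_linear dsum_act lin_on_add[OF act_lin[OF V g] x(2) y(2)] lin_on_add[OF act_lin[OF W g] x(3) y(3)] ..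
  qed
  show "act (dsum_smod V W) g ` hpart (dsum_smod V W) p \<subseteq> hpart (dsum_smod V W) (p + gpar A g)" for p
  proof (rule image_subsetI)
    fix z assume "z \<in> hpart (dsum_smod V W) p"
    then obtain u v where z: "z = case_sum u v" "u \<in> hpart V p" "v \<in> hpart W p" unfolding dsum_hpart by blast
    show "act (dsum_smod V W) g z \<in> hpart (dsum_smod V W) (p + gpar A g)"
      unfolding z(1) dsum_act unfolding dsum_hpart using act_hpart[OF V g z(2)] act_hpart[OF W g z(3)] by blast
  qed
qed

lemma dsum_tact:
  assumes "u \<in> carr V" "v \<in> carr W"
  shows "tact A (dsum_smod V W) g (case_sum u v) = case_sum (tact A V g u) (tact A W g v)"
proof -
  obtain u0 u1 where u: "u0 \<in> hpart V 0" "u1 \<in> hpart V 1" "u = u0 + u1" using carr_cases[OF rV assms(1)] .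
  obtain v0 v1 where v: "v0 \<in> hpart W 0" "v1 \<in> hpart W 1" "v = v0 + v1" using carr_cases[OF rW assms(2)] .
  have "sg (dsum_smod V W) (case_sum u0 v0 + case_sum u1 v1) = case_sum u0 v0 - case_sum u1 v1"
    by (rule sg_add_parts[OF gmod_graded[OF dsum_gmod]]) (use u v dsum_hpart in blast)+
  also have "\<dots> = case_sum (u0 - u1) (v0 - v1)" by (simp add: fun_eq_iff pointwise split: sum.splits)
  finally have "sg (dsum_smod V W) (case_sum u v) = case_sum (sg V u) (sg W v)"
    unfolding u(3) v(3) case_sum_linear sg_add_parts[OF rV u(1,2)] sg_add_parts[OF rW v(1,2)] .
  then show ?thesis unfolding tact_def by (simp add: dsum_act)
qed

lemma dsum_splits:
  "splits (carr (dsum_smod V W)) ((\<lambda>u. case_sum u 0) ` carr V) ((\<lambda>v. case_sum 0 v) ` carr W)"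
  unfolding splits_def
proof (intro conjI)
  note SV = gmod_carr_subspace[OF V] and SW = gmod_carr_subspace[OF W]
  show "cfun.subspace ((\<lambda>u. case_sum u (0 :: 'y vec)) ` carr V)"
    by (rule subspace_lin_image[OF SV]) (simp add: lin_on_def case_sum_linear)
  show "cfun.subspace ((\<lambda>v. case_sum (0 :: 'x vec) v) ` carr W)"
    by (rule subspace_lin_image[OF SW]) (simp add: lin_on_def case_sum_linear)
  show "(\<lambda>u. case_sum u (0 :: 'y vec)) ` carr V \<inter> (\<lambda>v. case_sum 0 v) ` carr W = {0}"
  proof (intro subset_antisym subsetI)
    fix z assume "z \<in> (\<lambda>u. case_sum u (0 :: 'y vec)) ` carr V \<inter> (\<lambda>v. case_sum 0 v) ` carr W"
    then obtain u v where e: "z = case_sum u 0" "z = case_sum 0 v" by blast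
    then have "u = 0" using case_sum_eq by metis
    then show "z \<in> {0}" using e(1) case_sum_linear(4) by blast
  next
    fix z :: "'x + 'y \<Rightarrow> complex" assume "z \<in> {0}"
    moreover have "(0 :: 'x + 'y \<Rightarrow> complex) = case_sum 0 0" using case_sum_linear(4) by metis
    ultimately have "z = case_sum 0 0" by blast
    then show "z \<in> (\<lambda>u. case_sum u (0 :: 'y vec)) ` carr V \<inter> (\<lambda>v. case_sum 0 v) ` carr W"
      using cfun.subspace_0[OF SV] cfun.subspace_0[OF SW] by blast
  qed
  show "carr (dsum_smod V W) =
    {x + y | x y. x \<in> (\<lambda>u. case_sum u 0) ` carr V \<and> y \<in> (\<lambda>v. case_sum 0 v) ` carr W}"
    unfolding dsum_carr
  proof (intro subset_antisym subsetI)
    fix z assume "z \<in> {case_sum u v | u v. u \<in> carr V \<and> v \<in> carr W}"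
    then obtain u v where uv: "u \<in> carr V" "v \<in> carr W" "z = case_sum u v" by blast
    have "z = case_sum u 0 + case_sum 0 v" unfolding uv case_sum_linear by simp
    then show "z \<in> {x + y | x y. x \<in> (\<lambda>u. case_sum u 0) ` carr V \<and> y \<in> (\<lambda>v. case_sum 0 v) ` carr W}" using uv by blast
  next
    fix z assume "z \<in> {x + y | x y. x \<in> (\<lambda>u. case_sum u 0) ` carr V \<and> y \<in> (\<lambda>v. case_sum 0 v) ` carr W}"
    then obtain u v where uv: "u \<in> carr V" "v \<in> carr W" and z: "z = case_sum u 0 + case_sum 0 v" by blast
    have "z = case_sum u v" unfolding z case_sum_linear by simp
    then show "z \<in> {case_sum u v | u v. u \<in> carr V \<and> v \<in> carr W}" using uv by blast
  qed
qed

end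

lemma splits_image:
  assumes s: "splits S X Y" and f: "lin_on S f" "inj_on f S"
  shows "splits (f ` S) (f ` X) (f ` Y)"
  unfolding splits_def
proof (intro conjI)
  note XY = splits_sub[OF s] and S = splits_subspace[OF s]
  have sX: "cfun.subspace X" and sY: "cfun.subspace Y" and i: "X \<inter> Y = {0}" using s unfolding splits_def by blast+
  show "cfun.subspace (f ` X)" "cfun.subspace (f ` Y)"
    using subspace_lin_image[OF sX] subspace_lin_image[OF sY] lin_on_subset[OF f(1)] XY by blast+
  have "f ` X \<inter> f ` Y = f ` (X \<inter> Y)" using inj_on_image_Int[OF f(2), of X Y] XY by simp
  then show "f ` X \<inter> f ` Y = {0}" unfolding i using lin_on_zero[OF f(1) S] by simp
  have a: "f (x + y) = f x + f y" if "x \<in> X" "y \<in> Y" for x y using lin_on_add[OF f(1)] that XY by blast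
  show "f ` S = {x + y | x y. x \<in> f ` X \<and> y \<in> f ` Y}"
  proof (intro subset_antisym subsetI)
    fix z assume "z \<in> f ` S"
    then obtain x y where "x \<in> X" "y \<in> Y" "z = f (x + y)" using s unfolding splits_def by blast
    then show "z \<in> {x + y | x y. x \<in> f ` X \<and> y \<in> f ` Y}" using a by blast
  next
    fix z assume "z \<in> {x + y | x y. x \<in> f ` X \<and> y \<in> f ` Y}"
    then obtain x y where xy: "x \<in> X" "y \<in> Y" "z = f x + f y" by blast
    then have "x + y \<in> S" using s unfolding splits_def by blast
    then show "z \<in> f ` S" using a[OF xy(1,2)] xy(3) by (metis imageI)
  qed
qed

text \<open>The space \<open>S\<close> with operators \<open>a\<close> is a direct sum of $k \in \{1, 2\}$ copies of \<open>E\<close> with operators \<open>e\<close>.\<close>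

definition ncopies ::
  "nat \<Rightarrow> 'i set \<Rightarrow> 'x vec set \<Rightarrow> ('i \<Rightarrow> 'x vec \<Rightarrow> 'x vec) \<Rightarrow>
   'y vec set \<Rightarrow> ('i \<Rightarrow> 'y vec \<Rightarrow> 'y vec) \<Rightarrow> bool" where
  "ncopies k I S a E e \<longleftrightarrow>
     k = 1 \<and> (\<exists>f\<in>homs I E e S a. bij_betw f E S) \<or>
     k = 2 \<and> (\<exists>X Y. splits S X Y \<and> (\<exists>f\<in>homs I E e X a. bij_betw f E X) \<and> (\<exists>f\<in>homs I E e Y a. bij_betw f E Y))"

lemma iso_image_stable:
  assumes "f \<in> homs I E e X a" "bij_betw f E X" "\<And>i v. i \<in> I \<Longrightarrow> v \<in> E \<Longrightarrow> e i v \<in> E" "i \<in> I" "x \<in> X"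
  shows "a i x \<in> X"
proof -
  obtain v where v: "v \<in> E" "x = f v" using assms(2,5) unfolding bij_betw_def by blast
  have "a i x = f (e i v)" unfolding v(2) using homsD(3)[OF assms(1,4) v(1)] by simp
  then show ?thesis using homsD(2)[OF assms(1) assms(3)[OF assms(4) v(1)]] by simp
qed

lemma homs_widen: "f \<in> homs I E e X a \<Longrightarrow> X \<subseteq> S \<Longrightarrow> f \<in> homs I E e S a"
  unfolding homs_def by blast

context
  fixes k :: nat and I :: "'i set" and S :: "'x vec set" and a
    and E :: "'y vec set" and e
  assumes N: "ncopies k I S a E e"
    and S: "fd S" "\<And>i. i \<in> I \<Longrightarrow> lin_on S (a i)"
    and E: "fd E" "\<And>i. i \<in> I \<Longrightarrow> lin_on E (e i)" "\<And>i v. i \<in> I \<Longrightarrow> v \<in> E \<Longrightarrow> e i v \<in> E"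
begin

private lemmas sE = fd_subspace[OF E(1)]

lemma ncopies_cases:
  obtains (one) f where "k = 1" "f \<in> homs I E e S a" "bij_betw f E S"
  | (two) X Y f g where "k = 2" "splits S X Y" "f \<in> homs I E e X a" "bij_betw f E X" "g \<in> homs I E e Y a" "bij_betw g E Y"
  using N unfolding ncopies_def by blast

lemma ncopies_embedding: "\<exists>f\<in>homs I E e S a. inj_on f E"
proof (cases rule: ncopies_cases)
  case one then show ?thesis by (auto simp: bij_betw_def)
next
  case (two X Y f g)
  have "f \<in> homs I E e S a" using homs_widen[OF two(3)] splits_sub[OF two(2)] by blast
  then show ?thesis using two(4) unfolding bij_betw_def by blast
qed

lemma ncopies_hdim_left:
  assumes T: "fd T" "\<And>i. i \<in> I \<Longrightarrow> lin_on T (b i)"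
  shows "hdim I S a T b = k * hdim I E e T b"
proof (cases rule: ncopies_cases)
  case (one f)
  show ?thesis using hdim_iso_left[OF one(2,3) sE E(3) fd_subspace[OF T(1)] T(2)] one(1) by simp
next
  case (two X Y f g)
  have "hdim I S a T b = hdim I X a T b + hdim I Y a T b"
    by (rule hdim_sum_left[OF two(2) S(1) T S(2)])
      (use iso_image_stable[OF two(3,4) E(3)] iso_image_stable[OF two(5,6) E(3)] in auto)
  then show ?thesis
    using hdim_iso_left[OF two(3,4) sE E(3) fd_subspace[OF T(1)] T(2)] hdim_iso_left[OF two(5,6) sE E(3) fd_subspace[OF T(1)] T(2)] two(1)
    by simp
qed

lemma ncopies_hdim_right:
  assumes R: "fd R" "\<And>i v. i \<in> I \<Longrightarrow> v \<in> R \<Longrightarrow> c i v \<in> R"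
  shows "hdim I R c S a = k * hdim I R c E e"
proof (cases rule: ncopies_cases)
  case (one f)
  show ?thesis using hdim_iso_right[OF sE E(2,3) one(2,3) fd_subspace[OF R(1)] R(2)] one(1) by simp
next
  case (two X Y f g)
  have "hdim I R c S a = hdim I R c X a + hdim I R c Y a"
    by (rule hdim_sum_right[OF two(2) R(1) S])
      (use iso_image_stable[OF two(3,4) E(3)] iso_image_stable[OF two(5,6) E(3)] R(2) in auto)
  then show ?thesis
    using hdim_iso_right[OF sE E(2,3) two(3,4) fd_subspace[OF R(1)] R(2)] hdim_iso_right[OF sE E(2,3) two(5,6) fd_subspace[OF R(1)] R(2)] two(1)
    by simp
qed

lemma ncopies_tens:
  assumes T: "fd T" and m: "\<And>i. i \<in> I \<Longrightarrow> lin_on T (m i)" "\<And>i x. i \<in> I \<Longrightarrow> x \<in> T \<Longrightarrow> m i x \<in> T"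
  shows "ncopies k I (tens_space S T) (\<lambda>i. tmap (a i) (m i)) (tens_space E T) (\<lambda>i. tmap (e i) (m i))"
proof -
  note sT = fd_subspace[OF T]
  have t: "\<exists>f\<in>homs I (tens_space E T) (\<lambda>i. tmap (e i) (m i)) (tens_space X T) (\<lambda>i. tmap (a i) (m i)).
      bij_betw f (tens_space E T) (tens_space X T)"
    if f: "f \<in> homs I E e X a" "bij_betw f E X" and X: "cfun.subspace X" "X \<subseteq> S" for X f
  proof (rule bexI)
    show "bij_betw (tmap f (\<lambda>x. x)) (tens_space E T) (tens_space X T)"
      by (rule tmap_bij[OF sE sT homsD(1)[OF f(1)] f(2)])
    show "tmap f (\<lambda>x. x) \<in> homs I (tens_space E T) (\<lambda>i. tmap (e i) (m i)) (tens_space X T) (\<lambda>i. tmap (a i) (m i))"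
      by (rule tmap_homs[OF sE sT X(1) f(1) E(2,3) lin_on_subset[OF S(2) X(2)] m])
  qed
  show ?thesis
  proof (cases rule: ncopies_cases)
    case (one f)
    then show ?thesis unfolding ncopies_def using t[OF one(2,3) fd_subspace[OF S(1)] subset_refl] by blast
  next
    case (two X Y f g)
    have XY: "cfun.subspace X" "cfun.subspace Y" "X \<subseteq> S" "Y \<subseteq> S" using two(2) splits_sub[OF two(2)] unfolding splits_def by blast+
    show ?thesis
      unfolding ncopies_def
      using two(1) tens_splits[OF two(2) sT] t[OF two(3,4) XY(1,3)] t[OF two(5,6) XY(2,4)] by blast
  qed
qed

end

text \<open>
  $\mathfrak{G}_n(D^\lambda)$ is \<open>eD n D\<close>, the joint eigenspace of commuting operators that are
  quadratic in the Clifford generators, so the definition of $D^\lambda_-$ says that this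
  eigenspace consists of one or two copies of $D^\lambda_-$. Here $D^\lambda_-$ and its parity
  shift have the same twisted operators and hence are the same.
\<close>

lemma is_D_spin_copies:
  fixes E :: "(nat, 'e) smod"
  assumes E: "is_D_spin ch n lam E"
  shows "\<exists>D. is_D ch n lam D \<and>
    ncopies (if even n \<or> even (length lam) then 1 else 2) {1..<n} (eD n D) (Top D) (carr E) (tact (spin_alg n) E)"
proof -
  let ?A = "spin_alg n" let ?I = "{1..<n}"
  obtain U :: "(nat, nat) smod" and D where U: "cliff_module n U" "sirreducible (cliff_alg n) U" and D: "is_D ch n lam D"
    and iso: "if even n \<or> even (length lam) then iso_smod ?A (G_functor n U D) E
      else iso_smod ?A (G_functor n U D) (dsum_smod E (Pi_smod ?A E))"
    using E unfolding is_D_spin_def by blast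
  have V: "hc_module n D" using D unfolding is_D_def by blast
  have gE: "gmod ?A E" using E smoduleD(1) unfolding is_D_spin_def spin_module_def by blast
  note gG = G_gmod[OF U V]
  obtain P where P: "P \<in> homs ?I (carr (G_functor n U D)) (tact ?A (G_functor n U D)) (eD n D) (Top D)"
    "bij_betw P (carr (G_functor n U D)) (eD n D)"
    using G_iso[OF U V] by blast
  have tr: "\<exists>f\<in>homs ?I (carr X) (tact ?A X) (eD n D) (Top D). bij_betw f (carr X) (eD n D)"
    if X: "gmod ?A X" "iso_smod ?A (G_functor n U D) X" for X :: "(nat, 'z) smod"
  proof -
    obtain f where f: "hom_smod ?A (G_functor n U D) X f" "bij_betw f (carr (G_functor n U D)) (carr X)"
      using X(2) unfolding iso_smod_def by blast
    have fs: "f \<in> homs ?I (carr (G_functor n U D)) (tact ?A (G_functor n U D)) (carr X) (tact ?A X)"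
      using f(1) unfolding hom_smod_iff[OF gG X(1)] spin_alg_simps .
    have st: "tact ?A (G_functor n U D) i v \<in> carr (G_functor n U D)" if "i \<in> ?I" "v \<in> carr (G_functor n U D)" for i v
      using tact_carr[OF gG] that unfolding spin_alg_simps by blast
    note k = homs_inverse[OF fs f(2) gmod_carr_subspace[OF gG] st]
    show ?thesis
    proof (rule bexI)
      show "bij_betw (\<lambda>v. P (inv_into (carr (G_functor n U D)) f v)) (carr X) (eD n D)"
        using bij_betw_trans[OF k(2) P(2)] unfolding comp_def .
      show "(\<lambda>v. P (inv_into (carr (G_functor n U D)) f v)) \<in> homs ?I (carr X) (tact ?A X) (eD n D) (Top D)"
        by (rule homs_comp[OF k(1) P(1)])
    qed
  qed
  have "ncopies (if even n \<or> even (length lam) then 1 else 2) ?I (eD n D) (Top D) (carr E) (tact ?A E)"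
  proof (cases "even n \<or> even (length lam)")
    case True
    then have "iso_smod ?A (G_functor n U D) E" using iso by (simp only: if_True)
    from tr[OF gE this] show ?thesis unfolding ncopies_def using True by simp
  next
    case False
    let ?P = "Pi_smod ?A E" let ?S = "dsum_smod E ?P"
    note Pi = Pi_smod[OF gE]
    have "iso_smod ?A (G_functor n U D) ?S" using iso False by (simp only: if_False)
    from tr[OF dsum_gmod[OF gE Pi(2)] this] obtain f
      where f: "f \<in> homs ?I (carr ?S) (tact ?A ?S) (eD n D) (Top D)" "bij_betw f (carr ?S) (eD n D)" by blast
    have im: "f ` carr ?S = eD n D" and inj: "inj_on f (carr ?S)" using f(2) unfolding bij_betw_def by blast+
    have sE0: "0 \<in> carr E" by (rule cfun.subspace_0[OF gmod_carr_subspace[OF gE]])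
    let ?l = "\<lambda>u. case_sum u (0 :: 'e vec)" and ?r = "\<lambda>u. case_sum (0 :: 'e vec) u"
    have z: "tact ?A E i 0 = 0" "tact ?A ?P i 0 = 0" if "i \<in> ?I" for i
      using lin_on_zero[OF tact_lin[OF gE]] gmod_carr_subspace[OF gE] Pi(3)[OF _ sE0] that by simp_all
    have cS: "?l u \<in> carr ?S" "?r u \<in> carr ?S" if "u \<in> carr E" for u
      unfolding dsum_carr[OF gE Pi(2)] Pi(1) using that sE0 by blast+
    have tl: "tact ?A ?S i (?l u) = ?l (tact ?A E i u)" "tact ?A ?S i (?r u) = ?r (tact ?A E i u)"
      if "i \<in> ?I" "u \<in> carr E" for i u
      using dsum_tact[OF gE Pi(2), of u 0 i] dsum_tact[OF gE Pi(2), of 0 u i] Pi(1) Pi(3)[of i u] that sE0 z by simp_all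
    have ll: "lin_on (carr E) ?l" "lin_on (carr E) ?r" by (simp_all add: lin_on_def case_sum_linear)
    have part: "\<exists>h\<in>homs ?I (carr E) (tact ?A E) (f ` t ` carr E) (Top D). bij_betw h (carr E) (f ` t ` carr E)"
      if t: "lin_on (carr E) t" "\<And>u. u \<in> carr E \<Longrightarrow> t u \<in> carr ?S" "inj_on t (carr E)"
        "\<And>i u. i \<in> ?I \<Longrightarrow> u \<in> carr E \<Longrightarrow> tact ?A ?S i (t u) = t (tact ?A E i u)"
      for t :: "'e vec \<Rightarrow> 'e + 'e \<Rightarrow> complex"
    proof (rule bexI)
      have tc: "t ` carr E \<subseteq> carr ?S" using t(2) by blast
      have "inj_on (\<lambda>u. f (t u)) (carr E)" using comp_inj_on[OF t(3) inj_on_subset[OF inj tc]] unfolding comp_def .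
      then show "bij_betw (\<lambda>u. f (t u)) (carr E) (f ` t ` carr E)" by (rule bij_betw_imageI) (simp add: image_image)
      show "(\<lambda>u. f (t u)) \<in> homs ?I (carr E) (tact ?A E) (f ` t ` carr E) (Top D)"
      proof (rule homsI)
        show "lin_on (carr E) (\<lambda>u. f (t u))" by (rule lin_on_comp[OF t(1) tc homsD(1)[OF f(1)]])
        show "f (t (tact ?A E i u)) = Top D i (f (t u))" if "i \<in> ?I" "u \<in> carr E" for i u
          using homsD(3)[OF f(1) that(1) t(2)[OF that(2)]] t(4)[OF that] by simp
      qed blast
    qed
    have "splits (eD n D) (f ` ?l ` carr E) (f ` ?r ` carr E)"
      using splits_image[OF dsum_splits[OF gE Pi(2)] homsD(1)[OF f(1)] inj] unfolding im Pi(1) .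
    moreover have "inj_on ?l (carr E)" "inj_on ?r (carr E)" by (simp_all add: inj_on_def case_sum_eq)
    ultimately show ?thesis
      unfolding ncopies_def using False part[OF ll(1) cS(1) _ tl(1)] part[OF ll(2) cS(2) _ tl(2)] by (simp only: if_False) blast
  qed
  then show ?thesis using D by blast
qed

section \<open>Comparison of the multiplicities\<close>

text \<open>The two dimension formulas are \<open>hdim_eD\<close> for \<open>D1\<close> against \<open>hc_tensor D2 M\<close> and against itself,
  with the copies of \<open>E\<close> and \<open>B\<close> in the eigenspaces counted.\<close>

context
  fixes n a b :: nat and M :: "(nat \<Rightarrow> nat, 'm) smod" and D1 :: "(hcgen, 'x) smod" and D2 :: "(hcgen, 'y) smod"
    and E :: "(nat, 'e) smod" and B :: "(nat, 'b) smod"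
  assumes M: "sym_module n M" and D1: "hc_module n D1" and D2: "hc_module n D2"
    and E: "smodule (spin_alg n) E" and B: "smodule (spin_alg n) B"
    and NE: "ncopies a {1..<n} (eD n D1) (Top D1) (carr E) (tact (spin_alg n) E)"
    and NB: "ncopies b {1..<n} (eD n D2) (Top D2) (carr B) (tact (spin_alg n) B)"
begin

private abbreviation "eps \<equiv> (if even n then 1 else 2 :: nat)"
private abbreviation "sm j \<equiv> act M (transpose j (Suc j))"
private abbreviation "BT \<equiv> tens_space (carr B) (carr M)"
private abbreviation "DT \<equiv> tens_space (eD n D2) (carr M)"

private lemma spin_ops:
  assumes W: "smodule (spin_alg n) W"
  shows "i \<in> {1..<n} \<Longrightarrow> lin_on (carr W) (tact (spin_alg n) W i)"
    "i \<in> {1..<n} \<Longrightarrow> v \<in> carr W \<Longrightarrow> tact (spin_alg n) W i v \<in> carr W"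
  using tact_lin[OF smoduleD(1)[OF W]] tact_carr[OF smoduleD(1)[OF W]] unfolding spin_alg_simps by blast+

private lemma sm: "i \<in> {1..<n} \<Longrightarrow> lin_on (carr M) (sm i)" "i \<in> {1..<n} \<Longrightarrow> x \<in> carr M \<Longrightarrow> sm i x \<in> carr M"
  using sym_module_facts(2,3)[OF M Sn_simple] by blast+

private lemma Top_eD:
  assumes V: "hc_module n V" and i: "i \<in> {1..<n}"
  shows "lin_on (eD n V) (Top V i)"
  by (rule lin_on_subset[OF hc_T(1)[OF V i] eD(2)[OF V]])

private lemma spin_tensor_facts:
  "carr (spin_tensor B M) = BT" "smodule (spin_alg n) (spin_tensor B M)"
  "i \<in> {1..<n} \<Longrightarrow> z \<in> BT \<Longrightarrow> tact (spin_alg n) (spin_tensor B M) i z = tmap (tact (spin_alg n) B i) (sm i) z"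
proof -
  note g = smoduleD(1)[OF B] and T = sym_module_facts(1)[OF M]
  have m: "lin_on (carr M) (sm i)" "x \<in> carr M \<Longrightarrow> sm i x \<in> carr M" if "i \<in> gens (spin_alg n)" for i x
    using sm that unfolding spin_alg_simps by blast+
  show "carr (spin_tensor B M) = BT"
    unfolding spin_tensor_tens_mod by (rule tens_mod(1)[OF g fd_subspace[OF T] m])
  show "smodule (spin_alg n) (spin_tensor B M)"
    unfolding spin_tensor_tens_mod by (rule tens_mod_smodule[OF B T m])
  show "tact (spin_alg n) (spin_tensor B M) i z = tmap (tact (spin_alg n) B i) (sm i) z" if "i \<in> {1..<n}" "z \<in> BT"
    unfolding spin_tensor_tens_mod
    by (rule tens_mod(5)[OF g fd_subspace[OF T] m _ that(2)]) (use that(1) in simp_all)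
qed

private lemma NBM: "ncopies b {1..<n} DT (\<lambda>i. tmap (Top D2 i) (sm i)) BT (\<lambda>i. tmap (tact (spin_alg n) B i) (sm i))"
  by (rule ncopies_tens[OF NB eD(1)[OF D2] Top_eD[OF D2] smoduleD(2)[OF B] spin_ops[OF B] sym_module_facts(1)[OF M] sm])

private lemma BT_ops:
  assumes i: "i \<in> {1..<n}"
  shows "lin_on BT (\<lambda>z. tmap (tact (spin_alg n) B i) (sm i) z)" "z \<in> BT \<Longrightarrow> tmap (tact (spin_alg n) B i) (sm i) z \<in> BT"
    "lin_on DT (\<lambda>z. tmap (Top D2 i) (sm i) z)"
proof -
  note sB = smoduleD(3)[OF B] and sM = fd_subspace[OF sym_module_facts(1)[OF M]] and sD = fd_subspace[OF eD(1)[OF D2]]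
  show "lin_on BT (\<lambda>z. tmap (tact (spin_alg n) B i) (sm i) z)"
    by (rule tmap_lin[OF sB sM spin_ops(1)[OF B i] sm(1)[OF i]])
  show "tmap (tact (spin_alg n) B i) (sm i) z \<in> BT" if "z \<in> BT"
    by (rule tmap_in[OF sB sM spin_ops(1)[OF B i] sm(1)[OF i] spin_ops(2)[OF B i] sm(2)[OF i] that])
  show "lin_on DT (\<lambda>z. tmap (Top D2 i) (sm i) z)"
    by (rule tmap_lin[OF sD sM Top_eD[OF D2 i] sm(1)[OF i]])
qed

lemma spin_tensor_unitarizable: "unitarizable (spin_alg n) (spin_tensor B M)"
proof -
  note H = hc_tensor_module[OF D2 M] and sM = sym_module_facts(1)[OF M]
  have DTc: "DT \<subseteq> tens_space (carr D2) (carr M)" by (rule tens_space_mono[OF eD(2)[OF D2]])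
  obtain P where P: "P \<in> homs {1..<n} BT (\<lambda>i. tmap (tact (spin_alg n) B i) (sm i)) DT (\<lambda>i. tmap (Top D2 i) (sm i))" "inj_on P BT"
    using ncopies_embedding[OF NBM fd_tens[OF eD(1)[OF D2] sM] BT_ops(3) fd_tens[OF smoduleD(2)[OF B] sM] BT_ops(1,2)] by blast
  have "P \<in> homs {1..<n} (carr (spin_tensor B M)) (tact (spin_alg n) (spin_tensor B M)) (carr (hc_tensor D2 M)) (Top (hc_tensor D2 M))"
    unfolding spin_tensor_facts(1) hc_tensor_carr[OF D2 M]
  proof (rule homsI)
    show "lin_on BT P" by (rule homsD(1)[OF P(1)])
    show "P v \<in> tens_space (carr D2) (carr M)" if "v \<in> BT" for v using homsD(2)[OF P(1) that] DTc by blast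
    show "P (tact (spin_alg n) (spin_tensor B M) i v) = Top (hc_tensor D2 M) i (P v)" if i: "i \<in> {1..<n}" and v: "v \<in> BT" for i v
      unfolding spin_tensor_facts(3)[OF i v] Top_tensor[OF D2 M i subsetD[OF DTc homsD(2)[OF P(1) v]]] by (rule homsD(3)[OF P(1) i v])
  qed
  then show ?thesis
    by (rule spin_unitarizable[OF H smoduleD(1)[OF spin_tensor_facts(2)]]) (use P(2) in "simp only: spin_tensor_facts(1)")
qed

lemma hdim_spin_tensor:
  "a * b * shdim (spin_alg n) E (spin_tensor B M) = eps * shdim (hc_alg n) D1 (hc_tensor D2 M)"
proof -
  let ?H = "hc_tensor D2 M" and ?I = "{1..<n}"
  note H = hc_tensor_module[OF D2 M] and sM = sym_module_facts(1)[OF M]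
  note eH = eD_tensor[OF D2 M]
  have DTc: "DT \<subseteq> tens_space (carr D2) (carr M)" by (rule tens_space_mono[OF eD(2)[OF D2]])
  have "shdim (spin_alg n) E (spin_tensor B M) =
      hdim ?I (carr E) (tact (spin_alg n) E) BT (\<lambda>i. tmap (tact (spin_alg n) B i) (sm i))"
  proof -
    have "homs ?I (carr E) (tact (spin_alg n) E) BT (tact (spin_alg n) (spin_tensor B M)) =
        homs ?I (carr E) (tact (spin_alg n) E) BT (\<lambda>i. tmap (tact (spin_alg n) B i) (sm i))"
      by (rule homs_cong_right) (rule spin_tensor_facts(3))
    then show ?thesis unfolding spin_tensor_facts(1) spin_alg_simps by (simp only:)
  qed
  then have "b * shdim (spin_alg n) E (spin_tensor B M) =
      hdim ?I (carr E) (tact (spin_alg n) E) DT (\<lambda>i. tmap (Top D2 i) (sm i))"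
    using ncopies_hdim_right[OF NBM fd_tens[OF eD(1)[OF D2] sM] BT_ops(3) fd_tens[OF smoduleD(2)[OF B] sM] BT_ops(1,2)
        smoduleD(2)[OF E] spin_ops(2)[OF E]] by (simp only:)
  also have "\<dots> = hdim ?I (carr E) (tact (spin_alg n) E) (eD n ?H) (Top ?H)"
  proof -
    have "homs ?I (carr E) (tact (spin_alg n) E) DT (\<lambda>i. tmap (Top D2 i) (sm i)) =
        homs ?I (carr E) (tact (spin_alg n) E) DT (Top ?H)"
      by (rule homs_cong_right) (use Top_tensor[OF D2 M] DTc in "auto simp del: atLeastLessThan_iff")
    then show ?thesis unfolding eH by (simp only:)
  qed
  finally have "a * b * shdim (spin_alg n) E (spin_tensor B M) = a * hdim ?I (carr E) (tact (spin_alg n) E) (eD n ?H) (Top ?H)"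
    by (simp only: mult.assoc)
  also have "\<dots> = hdim ?I (eD n D1) (Top D1) (eD n ?H) (Top ?H)"
    by (rule ncopies_hdim_left[OF NE eD(1)[OF D1] Top_eD[OF D1] smoduleD(2)[OF E] spin_ops[OF E] eD(1)[OF H] Top_eD[OF H], symmetric])
  also have "\<dots> = eps * shdim (hc_alg n) D1 ?H" by (rule hdim_eD[OF D1 H])
  finally show ?thesis .
qed

lemma hdim_spin_self: "a * a * shdim (spin_alg n) E E = eps * shdim (hc_alg n) D1 D1"
proof -
  let ?I = "{1..<n}"
  have "a * (a * hdim ?I (carr E) (tact (spin_alg n) E) (carr E) (tact (spin_alg n) E)) =
      a * hdim ?I (carr E) (tact (spin_alg n) E) (eD n D1) (Top D1)"
    using ncopies_hdim_right[OF NE eD(1)[OF D1] Top_eD[OF D1] smoduleD(2)[OF E] spin_ops[OF E] smoduleD(2)[OF E] spin_ops(2)[OF E]]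
    by (simp only:)
  also have "\<dots> = hdim ?I (eD n D1) (Top D1) (eD n D1) (Top D1)"
    by (rule ncopies_hdim_left[OF NE eD(1)[OF D1] Top_eD[OF D1] smoduleD(2)[OF E] spin_ops[OF E] eD(1)[OF D1] Top_eD[OF D1], symmetric])
  also have "\<dots> = eps * shdim (hc_alg n) D1 D1" by (rule hdim_eD[OF D1 D1])
  finally show ?thesis unfolding spin_alg_simps by (simp only: mult.assoc)
qed

end

lemma shdim_iso_left:
  assumes V: "smodule A V" and W: "smodule A W" and X: "smodule A X"
    and h: "h \<in> shoms A V W" "bij_betw h (carr V) (carr W)"
  shows "shdim A V X = shdim A W X"
  by (rule hdim_iso_left[OF h smoduleD(3)[OF V] tact_carr[OF smoduleD(1)[OF V]] smoduleD(3)[OF X] tact_lin[OF smoduleD(1)[OF X]]])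

lemma shdim_iso_right:
  assumes V: "smodule A V" and W: "smodule A W" and X: "smodule A X"
    and h: "h \<in> shoms A V W" "bij_betw h (carr V) (carr W)"
  shows "shdim A X V = shdim A X W"
  by (rule hdim_iso_right[OF smoduleD(3)[OF V] tact_lin[OF smoduleD(1)[OF V]] tact_carr[OF smoduleD(1)[OF V]] h
      smoduleD(3)[OF X] tact_carr[OF smoduleD(1)[OF X]]])

lemma hc_tensor_iso:
  assumes V: "hc_module n V" and W: "hc_module n W" and M: "sym_module n M"
    and h: "h \<in> shoms (hc_alg n) V W" "bij_betw h (carr V) (carr W)"
  shows "\<exists>k\<in>shoms (hc_alg n) (hc_tensor V M) (hc_tensor W M). bij_betw k (carr (hc_tensor V M)) (carr (hc_tensor W M))"
proof -
  let ?A = "hc_alg n" and ?T = "carr M"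
  note gV = smoduleD(1)[OF hc_smodule[OF V]] and gW = smoduleD(1)[OF hc_smodule[OF W]]
  note sV = gmod_carr_subspace[OF gV] and sW = gmod_carr_subspace[OF gW] and T = fd_subspace[OF sym_module_facts(1)[OF M]]
  have m: "lin_on ?T (hcm M g)" "x \<in> ?T \<Longrightarrow> hcm M g x \<in> ?T" if "g \<in> gens ?A" for g x
    using that sym_module_facts(2,3)[OF M] by (cases rule: hc_gens_cases; simp add: lin_on_id)+
  have t: "tact ?A (hc_tensor X M) g z = tmap (tact ?A X g) (hcm M g) z"
    if "gmod ?A X" "g \<in> gens ?A" "z \<in> tens_space (carr X) ?T" for X :: "(hcgen, 'z) smod" and g z
    unfolding hc_tensor_tens_mod by (rule tens_mod(5)[OF that(1) T m that(2,3)])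
  let ?k = "tmap h (\<lambda>x. x)"
  have k: "?k \<in> homs (gens ?A) (tens_space (carr V) ?T) (\<lambda>g. tmap (tact ?A V g) (hcm M g)) (tens_space (carr W) ?T) (\<lambda>g. tmap (tact ?A W g) (hcm M g))"
    by (rule tmap_homs[OF sV T sW h(1) tact_lin[OF gV] tact_carr[OF gV] tact_lin[OF gW] m])
  have "?k \<in> shoms ?A (hc_tensor V M) (hc_tensor W M)"
    unfolding hc_tensor_carr[OF V M] hc_tensor_carr[OF W M]
  proof (rule homsI)
    show "lin_on (tens_space (carr V) ?T) ?k" by (rule homsD(1)[OF k])
    show "?k v \<in> tens_space (carr W) ?T" if "v \<in> tens_space (carr V) ?T" for v by (rule homsD(2)[OF k that])
    show "?k (tact ?A (hc_tensor V M) g v) = tact ?A (hc_tensor W M) g (?k v)"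
      if g: "g \<in> gens ?A" and v: "v \<in> tens_space (carr V) ?T" for g v
      unfolding t[OF gV g v] t[OF gW g homsD(2)[OF k v]] by (rule homsD(3)[OF k g v])
  qed
  moreover have "bij_betw ?k (carr (hc_tensor V M)) (carr (hc_tensor W M))"
    unfolding hc_tensor_carr[OF V M] hc_tensor_carr[OF W M] by (rule tmap_bij[OF sV T homsD(1)[OF h(1)] h(2)])
  ultimately show ?thesis by blast
qed

theorem proposition3p2:
  fixes n :: nat and lam :: "nat list"
    and M :: "(nat \<Rightarrow> nat, 'm) smod"
    and ch :: "nat \<Rightarrow> hcmod \<Rightarrow> symfun"
    and D :: hcmod and E :: "(nat, 'e) smod" and B :: "(nat, 'b) smod"
  assumes "n \<ge> 1"
    and "sym_module n M"
    and "strict_partition n lam"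
    and "characteristic_map ch"
    and "is_D ch n lam D"
    and "is_D_spin ch n lam E"
    and "is_D_spin ch n [n] B"
  shows "real (smult (spin_alg n) (spin_tensor B M) E) =
    (if even n then real (smult (hc_alg n) (hc_tensor (cliff_hc n) M) D)
     else if odd (length lam) then real (smult (hc_alg n) (hc_tensor (cliff_hc n) M) D)
     else 1 / 2 * real (smult (hc_alg n) (hc_tensor (cliff_hc n) M) D))"
proof -
  let ?A = "hc_alg n" and ?S = "spin_alg n" and ?C = "hc_tensor (cliff_hc n) M"
  define a b eps :: nat where "a = (if even n \<or> even (length lam) then 1 else 2)"
    and "b = (if even n then 1 else 2)" and "eps = (if even n then 1 else 2)"
  note M = assms(2) and ch = assms(4)
  obtain D1 where D1: "is_D ch n lam D1" and NE: "ncopies a {1..<n} (eD n D1) (Top D1) (carr E) (tact ?S E)"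
    using is_D_spin_copies[OF assms(6)] unfolding a_def by blast
  have be: "(if even n \<or> even (length [n]) then 1 else 2) = b" by (simp add: b_def)
  obtain D2 where D2: "is_D ch n [n] D2" and NB: "ncopies b {1..<n} (eD n D2) (Top D2) (carr B) (tact ?S B)"
    using is_D_spin_copies[OF assms(7)] unfolding be by blast
  have E: "smodule ?S E" "sirreducible ?S E" and B: "smodule ?S B"
    using assms(6,7) unfolding is_D_spin_def spin_module_def by blast+
  have m: "hc_module n D" "sirreducible ?A D" "hc_module n D1" "hc_module n D2"
    using assms(5) D1 D2 unfolding is_D_def by blast+
  note C = hc_tensor_module[OF cliff_hc_module M] and H = hc_tensor_module[OF m(4) M]
  note sm = hc_smodule[OF m(1)] hc_smodule[OF m(3)] hc_smodule[OF H] hc_smodule[OF C]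
  obtain h where h: "h \<in> shoms ?A D D1" "bij_betw h (carr D) (carr D1)"
    using is_D_unique[OF ch assms(5) D1] by blast
  obtain c where c: "c \<in> shoms ?A D2 (cliff_hc n)" "bij_betw c (carr D2) (carr (cliff_hc n))"
    using is_D_single[OF assms(1) ch D2] by blast
  obtain k where k: "k \<in> shoms ?A (hc_tensor D2 M) ?C" "bij_betw k (carr (hc_tensor D2 M)) (carr ?C)"
    using hc_tensor_iso[OF m(4) cliff_hc_module M c] by blast
  have dT: "shdim ?A D1 (hc_tensor D2 M) = shdim ?A D ?C"
    using shdim_iso_left[OF sm(1,2,3) h] shdim_iso_right[OF sm(3,4,1) k] by simp
  have dD: "shdim ?A D1 D1 = shdim ?A D D"
    using shdim_iso_left[OF sm(1,2,2) h] shdim_iso_right[OF sm(1,2,1) h] by simp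
  note ctx = M m(3,4) E(1) B NE NB
  have p: "smult ?S (spin_tensor B M) E * shdim ?S E E = shdim ?S E (spin_tensor B M)"
  proof (rule smult_hdim[OF _ spin_tensor_unitarizable[OF ctx] E])
    note T = sym_module_facts[OF M]
    show "smodule ?S (spin_tensor B M)"
      unfolding spin_tensor_tens_mod
      by (rule tens_mod_smodule[OF B T(1)]) (use T(2,3)[OF Sn_simple] in "auto simp del: atLeastLessThan_iff")
  qed
  have q: "smult ?A ?C D * shdim ?A D D = shdim ?A D ?C"
    by (rule smult_hdim[OF sm(4) hc_unitarizable[OF C] sm(1) m(2)])
  have pos: "0 < shdim ?S E E" by (rule shdim_pos[OF E(1)]) (use E(2) in "simp add: sirreducible_def")
  have 1: "a * b * (smult ?S (spin_tensor B M) E * shdim ?S E E) = eps * (smult ?A ?C D * shdim ?A D D)"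
    using hdim_spin_tensor[OF ctx] unfolding p q dT eps_def .
  have 2: "a * a * shdim ?S E E = eps * shdim ?A D D"
    using hdim_spin_self[OF ctx] unfolding dD eps_def .
  \<comment> \<open>Eliminating the dimension of \<open>End D\<close> from 1 and 2.\<close>
  have "(a * shdim ?S E E) * (b * smult ?S (spin_tensor B M) E) = (a * shdim ?S E E) * (a * smult ?A ?C D)"
  proof -
    have "(a * shdim ?S E E) * (b * smult ?S (spin_tensor B M) E) = a * b * (smult ?S (spin_tensor B M) E * shdim ?S E E)"
      by (simp only: mult_ac)
    also have "\<dots> = smult ?A ?C D * (eps * shdim ?A D D)" unfolding 1 by (simp only: mult_ac)
    also have "\<dots> = (a * shdim ?S E E) * (a * smult ?A ?C D)" unfolding 2[symmetric] by (simp only: mult_ac)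
    finally show ?thesis .
  qed
  moreover have "a > 0" by (simp add: a_def)
  ultimately have "b * smult ?S (spin_tensor B M) E = a * smult ?A ?C D" using pos by simp
  then have r: "real b * real (smult ?S (spin_tensor B M) E) = real a * real (smult ?A ?C D)"
    by (simp flip: of_nat_mult)
  show ?thesis
  proof (cases "even n")
    case True
    then show ?thesis using r by (simp add: a_def b_def)
  next
    case False
    then show ?thesis using r by (cases "even (length lam)") (simp_all add: a_def b_def)
  qed
qed

end
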